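(* Let $\mathcal V$ be a cartesian category, with tensor product given by the categorical product, and with small coproducts commuting with pullbacks. Let $P$ be a (classical, non-symmetric) operad in $\mathcal V$, and let $\Sigma P$ be its suspension, a $(\mathcal V\text{-}\mathbf{Gph},\mathbf{fc}_{\mathcal V})$-operad. Then a $(\mathcal V,P)$-category is an algebra for $\Sigma P$, and this extends to an equivalence of categories $$(\mathcal V,P)\text{-}\mathbf{Cat}\simeq \Sigma P\text{-}\mathrm{Alg}.$$
   Context: "Cartesian category" means a category with pullbacks; here it also has a terminal object $1$ (hence finite products). "Small coproducts commute with pullbacks" is in the sense that for set maps $I\to K\leftarrow J$ and compatible families $A_i\to C_k\leftarrow B_j$ in $\mathcal V$, the canonical map $\coprod_{(i,j)\in I\times_KJ}A_i\times_{C_k}B_j\to(\coprod_iA_i)\times_{\coprod_kC_k}(\coprod_jB_j)$ is an isomorphism. **Graphs and $(\mathcal V,P)$-categories.** A $\mathcal V$-graph $A$ is a set $A_0$ of objects with an object $A(a,a')\in\mathcal V$ for all $a,a'\in A_0$; a morphism $F:A\to B$ is a function $A_0\to B_0$ with morphisms $A(a,a')\to B(Fa,Fa')$ in $\mathcal V$. They form $\mathcal V\text{-}\mathbf{Gph}$. A $(\mathcal V,P)$-category is a $\mathcal V$-graph $A$ with, for all $k\ge0$ and $a_0,\dots,a_k\in A_0$, a morphism $\gamma: P(k)\times A(a_{k-1},a_k)\times\cdots\times A(a_0,a_1)\to A(a_0,a_k)$ (for $k=0$: $P(0)\to A(a,a)$), compatible with the operad structure: the unit of $P$ acts as the identity,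 and, for a composable string cut into $m$ consecutive blocks, applying $p_i\in P(k_i)$ to the $i$-th block along the string and then $p\in P(m)$ to the results agrees with applying the operadic composite $p(p_1,\dots,p_m)\in P(k_1+\cdots+k_m)$ to the whole string. Morphisms are $\mathcal V$-graph morphisms commuting with all $\gamma$; the category is $(\mathcal V,P)\text{-}\mathbf{Cat}$. **Free $\mathcal V$-category monad.** $\mathbf{fc}_{\mathcal V}$ is the monad on $\mathcal V\text{-}\mathbf{Gph}$ for free $\mathcal V$-categories, which is cartesian (functor part preserves pullbacks, unit and multiplication have pullback naturality squares): identity on objects, and $(\mathbf{fc}_{\mathcal V}A)(a,a')=\coprod_{k\ge0,\ a=a_0,\dots,a_k=a'}A(a_{k-1},a_k)\times\cdots\times A(a_0,a_1)$. In particular $\mathbf{fc}_{\mathcal V}1$ has one object and single hom-object $\coprod_{k\ge0}1$. **Generalised operads.** For a cartesian monad $T$ on a category $\mathcal E$ with pullbacks and a terminal object, $T$-collections are objects of $\mathcal E/T1$, a monoidal category: the tensor product of $\alpha:A\to T1$ and $\beta:B\to T1$ is the pullback $TA\times_{T1}B$ of $T!:TA\to T1$ and $\beta$, mapped to $T1$ via $TA\xrightarrow{T\alpha}T^21\xrightarrow{\mu_1}T1$; the unit is $\eta_1:1\to T1$. An $(\mathcal E,T)$-operad is a monoid $d:R\to T1$ in this monoidal category. Its associated monad $T_R$ on $\mathcal E$ is $T_RA=R\times_{T1}TA$ (pullback of $d$ and $T!$), with unit and multiplication induced by those of $R$ and $T$; an algebra for $R$ is an algebra for $T_R$. **Suspension.**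 $\Sigma P$ is the $(\mathcal V\text{-}\mathbf{Gph},\mathbf{fc}_{\mathcal V})$-operad whose underlying $\mathcal V$-graph has one object $*$ and $\Sigma P( *,* )=\coprod_{k\ge0}P(k)$; the map $\Sigma P\to\mathbf{fc}_{\mathcal V}1$ is, on hom-objects, $\coprod_kP(k)\to\coprod_k1$ (the coproduct of the maps $P(k)\to1$); unit and multiplication are those induced by the unit and composition of $P$. *)

theory Defs
  imports Main
begin

section \<open>Categories, functors, equivalences\<close>

record ('o, 'm) cat =
  Obj :: "'o set"
  Arr :: "'m set"
  Dom :: "'m \<Rightarrow> 'o"
  Cod :: "'m \<Rightarrow> 'o"
  Ident :: "'o \<Rightarrow> 'm"
  Comp :: "'m \<Rightarrow> 'm \<Rightarrow> 'm"  (infixr "\<cdot>\<index>" 70)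

definition hom :: "('o, 'm) cat \<Rightarrow> 'o \<Rightarrow> 'o \<Rightarrow> 'm set" where
  "hom C a b = {f \<in> Arr C. Dom C f = a \<and> Cod C f = b}"

locale category =
  fixes C :: "('o, 'm) cat"
  assumes dom_obj: "f \<in> Arr C \<Longrightarrow> Dom C f \<in> Obj C"
    and cod_obj: "f \<in> Arr C \<Longrightarrow> Cod C f \<in> Obj C"
    and ident_hom: "a \<in> Obj C \<Longrightarrow> Ident C a \<in> hom C a a"
    and comp_hom: "f \<in> hom C a b \<Longrightarrow> g \<in> hom C b c \<Longrightarrow> g \<cdot>\<^bsub>C\<^esub> f \<in> hom C a c"
    and ident_left: "f \<in> hom C a b \<Longrightarrow> Ident C b \<cdot>\<^bsub>C\<^esub> f = f"
    and ident_right: "f \<in> hom C a b \<Longrightarrow> f \<cdot>\<^bsub>C\<^esub> Ident C a = f"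
    and comp_assoc: "f \<in> hom C a b \<Longrightarrow> g \<in> hom C b c \<Longrightarrow> h \<in> hom C c d \<Longrightarrow>
          (h \<cdot>\<^bsub>C\<^esub> g) \<cdot>\<^bsub>C\<^esub> f = h \<cdot>\<^bsub>C\<^esub> (g \<cdot>\<^bsub>C\<^esub> f)"

definition is_iso :: "('o, 'm) cat \<Rightarrow> 'm \<Rightarrow> bool" where
  "is_iso C f \<longleftrightarrow> f \<in> Arr C \<and>
     (\<exists>g \<in> hom C (Cod C f) (Dom C f).
        g \<cdot>\<^bsub>C\<^esub> f = Ident C (Dom C f) \<and> f \<cdot>\<^bsub>C\<^esub> g = Ident C (Cod C f))"

record ('o1, 'm1, 'o2, 'm2) fctr =
  FOb :: "'o1 \<Rightarrow> 'o2"
  FAr :: "'m1 \<Rightarrow> 'm2"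

definition is_functor :: "('o1, 'm1) cat \<Rightarrow> ('o2, 'm2) cat \<Rightarrow> ('o1, 'm1, 'o2, 'm2) fctr \<Rightarrow> bool" where
  "is_functor C D F \<longleftrightarrow> category C \<and> category D \<and>
     (\<forall>a \<in> Obj C. FOb F a \<in> Obj D \<and> FAr F (Ident C a) = Ident D (FOb F a)) \<and>
     (\<forall>a b. \<forall>f \<in> hom C a b. FAr F f \<in> hom D (FOb F a) (FOb F b)) \<and>
     (\<forall>a b c. \<forall>f \<in> hom C a b. \<forall>g \<in> hom C b c.
        FAr F (g \<cdot>\<^bsub>C\<^esub> f) = FAr F g \<cdot>\<^bsub>D\<^esub> FAr F f)"

definition id_fctr :: "('o, 'm, 'o, 'm) fctr" where
  "id_fctr = \<lparr>FOb = \<lambda>a. a, FAr = \<lambda>f. f\<rparr>"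

definition comp_fctr ::
  "('o2, 'm2, 'o3, 'm3) fctr \<Rightarrow> ('o1, 'm1, 'o2, 'm2) fctr \<Rightarrow> ('o1, 'm1, 'o3, 'm3) fctr" where
  "comp_fctr G F = \<lparr>FOb = FOb G \<circ> FOb F, FAr = FAr G \<circ> FAr F\<rparr>"

definition is_natural_iso ::
  "('o1, 'm1) cat \<Rightarrow> ('o2, 'm2) cat \<Rightarrow> ('o1, 'm1, 'o2, 'm2) fctr \<Rightarrow>
   ('o1, 'm1, 'o2, 'm2) fctr \<Rightarrow> ('o1 \<Rightarrow> 'm2) \<Rightarrow> bool" where
  "is_natural_iso C D F G \<alpha> \<longleftrightarrow>
     (\<forall>a \<in> Obj C. \<alpha> a \<in> hom D (FOb F a) (FOb G a) \<and> is_iso D (\<alpha> a)) \<and>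
     (\<forall>a b. \<forall>f \<in> hom C a b. \<alpha> b \<cdot>\<^bsub>D\<^esub> FAr F f = FAr G f \<cdot>\<^bsub>D\<^esub> \<alpha> a)"

definition is_equivalence :: "('o1, 'm1) cat \<Rightarrow> ('o2, 'm2) cat \<Rightarrow> ('o1, 'm1, 'o2, 'm2) fctr \<Rightarrow> bool" where
  "is_equivalence C D F \<longleftrightarrow> is_functor C D F \<and>
     (\<exists>G. is_functor D C G \<and>
        (\<exists>\<alpha>. is_natural_iso C C id_fctr (comp_fctr G F) \<alpha>) \<and>
        (\<exists>\<beta>. is_natural_iso D D (comp_fctr F G) id_fctr \<beta>))"


section \<open>Chosen limits and coproducts\<close>

text \<open>Each construction is specified by its universal property; one instance is then chosen
  by Hilbert choice, and induced arrows are the unique ones with the required components.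
  None of these choices is meaningful unless the limit or colimit in question exists.\<close>

definition is_terminal :: "('o, 'm) cat \<Rightarrow> 'o \<Rightarrow> bool" where
  "is_terminal C t \<longleftrightarrow> t \<in> Obj C \<and> (\<forall>a \<in> Obj C. \<exists>!h. h \<in> hom C a t)"

definition trm :: "('o, 'm) cat \<Rightarrow> 'o" where
  "trm C = (SOME t. is_terminal C t)"

definition bang :: "('o, 'm) cat \<Rightarrow> 'o \<Rightarrow> 'm" where
  "bang C a = (THE h. h \<in> hom C a (trm C))"

text \<open>Pullbacks of a cospan \<open>f: a \<rightarrow> c \<leftarrow> b :g\<close>.\<close>

definition is_pullback :: "('o, 'm) cat \<Rightarrow> 'm \<Rightarrow> 'm \<Rightarrow> 'o \<Rightarrow> 'm \<Rightarrow> 'm \<Rightarrow> bool" where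
  "is_pullback C f g p \<pi>1 \<pi>2 \<longleftrightarrow>
     f \<in> Arr C \<and> g \<in> Arr C \<and> Cod C f = Cod C g \<and>
     p \<in> Obj C \<and> \<pi>1 \<in> hom C p (Dom C f) \<and> \<pi>2 \<in> hom C p (Dom C g) \<and>
     f \<cdot>\<^bsub>C\<^esub> \<pi>1 = g \<cdot>\<^bsub>C\<^esub> \<pi>2 \<and>
     (\<forall>z \<in> Obj C. \<forall>x \<in> hom C z (Dom C f). \<forall>y \<in> hom C z (Dom C g).
        f \<cdot>\<^bsub>C\<^esub> x = g \<cdot>\<^bsub>C\<^esub> y \<longrightarrow>
        (\<exists>!h. h \<in> hom C z p \<and> \<pi>1 \<cdot>\<^bsub>C\<^esub> h = x \<and> \<pi>2 \<cdot>\<^bsub>C\<^esub> h = y))"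

definition pb :: "('o, 'm) cat \<Rightarrow> 'm \<Rightarrow> 'm \<Rightarrow> 'o \<times> 'm \<times> 'm" where
  "pb C f g = (SOME (p, \<pi>1, \<pi>2). is_pullback C f g p \<pi>1 \<pi>2)"

definition pbo :: "('o, 'm) cat \<Rightarrow> 'm \<Rightarrow> 'm \<Rightarrow> 'o" where
  "pbo C f g = fst (pb C f g)"

definition pb1 :: "('o, 'm) cat \<Rightarrow> 'm \<Rightarrow> 'm \<Rightarrow> 'm" where
  "pb1 C f g = fst (snd (pb C f g))"

definition pb2 :: "('o, 'm) cat \<Rightarrow> 'm \<Rightarrow> 'm \<Rightarrow> 'm" where
  "pb2 C f g = snd (snd (pb C f g))"

definition pbtup :: "('o, 'm) cat \<Rightarrow> 'm \<Rightarrow> 'm \<Rightarrow> 'm \<Rightarrow> 'm \<Rightarrow> 'm" where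
  "pbtup C f g x y =
     (THE h. h \<in> hom C (Dom C x) (pbo C f g) \<and>
        pb1 C f g \<cdot>\<^bsub>C\<^esub> h = x \<and> pb2 C f g \<cdot>\<^bsub>C\<^esub> h = y)"

text \<open>Finite products of lists of objects. \<open>elems C z xs\<close> are the families of generalised
  elements, at stage \<open>z\<close>, of the objects in the list \<open>xs\<close>.\<close>

definition elems :: "('o, 'm) cat \<Rightarrow> 'o \<Rightarrow> 'o list \<Rightarrow> 'm list set" where
  "elems C z xs = {fs. list_all2 (\<lambda>x f. f \<in> hom C z x) xs fs}"

definition is_product :: "('o, 'm) cat \<Rightarrow> 'o list \<Rightarrow> 'o \<Rightarrow> 'm list \<Rightarrow> bool" where
  "is_product C xs p \<pi>s \<longleftrightarrow> set xs \<subseteq> Obj C \<and> p \<in> Obj C \<and> \<pi>s \<in> elems C p xs \<and>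
     (\<forall>z \<in> Obj C. \<forall>fs \<in> elems C z xs. \<exists>!h. h \<in> hom C z p \<and> map (\<lambda>\<pi>. \<pi> \<cdot>\<^bsub>C\<^esub> h) \<pi>s = fs)"

definition prd_cone :: "('o, 'm) cat \<Rightarrow> 'o list \<Rightarrow> 'o \<times> 'm list" where
  "prd_cone C xs = (SOME (p, \<pi>s). is_product C xs p \<pi>s)"

definition prd :: "('o, 'm) cat \<Rightarrow> 'o list \<Rightarrow> 'o" where
  "prd C xs = fst (prd_cone C xs)"

definition prjs :: "('o, 'm) cat \<Rightarrow> 'o list \<Rightarrow> 'm list" where
  "prjs C xs = snd (prd_cone C xs)"

definition tup :: "('o, 'm) cat \<Rightarrow> 'o \<Rightarrow> 'm list \<Rightarrow> 'm" where
  "tup C z fs = (let xs = map (Cod C) fs in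
     (THE h. h \<in> hom C z (prd C xs) \<and> map (\<lambda>\<pi>. \<pi> \<cdot>\<^bsub>C\<^esub> h) (prjs C xs) = fs))"

text \<open>Coproducts of families indexed by a set.\<close>

definition is_coproduct :: "('o, 'm) cat \<Rightarrow> 'i set \<Rightarrow> ('i \<Rightarrow> 'o) \<Rightarrow> 'o \<Rightarrow> ('i \<Rightarrow> 'm) \<Rightarrow> bool" where
  "is_coproduct C I X c \<iota> \<longleftrightarrow> X ` I \<subseteq> Obj C \<and> c \<in> Obj C \<and> (\<forall>i \<in> I. \<iota> i \<in> hom C (X i) c) \<and>
     (\<forall>z \<in> Obj C. \<forall>f. (\<forall>i \<in> I. f i \<in> hom C (X i) z) \<longrightarrow>
        (\<exists>!h. h \<in> hom C c z \<and> (\<forall>i \<in> I. h \<cdot>\<^bsub>C\<^esub> \<iota> i = f i)))"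

definition cpr_cocone :: "('o, 'm) cat \<Rightarrow> 'i set \<Rightarrow> ('i \<Rightarrow> 'o) \<Rightarrow> 'o \<times> ('i \<Rightarrow> 'm)" where
  "cpr_cocone C I X = (SOME (c, \<iota>). is_coproduct C I X c \<iota>)"

definition cpr :: "('o, 'm) cat \<Rightarrow> 'i set \<Rightarrow> ('i \<Rightarrow> 'o) \<Rightarrow> 'o" where
  "cpr C I X = fst (cpr_cocone C I X)"

definition inc :: "('o, 'm) cat \<Rightarrow> 'i set \<Rightarrow> ('i \<Rightarrow> 'o) \<Rightarrow> 'i \<Rightarrow> 'm" where
  "inc C I X = snd (cpr_cocone C I X)"

definition cotup :: "('o, 'm) cat \<Rightarrow> 'i set \<Rightarrow> ('i \<Rightarrow> 'o) \<Rightarrow> 'o \<Rightarrow> ('i \<Rightarrow> 'm) \<Rightarrow> 'm" where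
  "cotup C I X z f =
     (THE h. h \<in> hom C (cpr C I X) z \<and> (\<forall>i \<in> I. h \<cdot>\<^bsub>C\<^esub> inc C I X i = f i))"

definition has_terminal :: "('o, 'm) cat \<Rightarrow> bool" where
  "has_terminal C \<longleftrightarrow> (\<exists>t. is_terminal C t)"

definition has_pullbacks :: "('o, 'm) cat \<Rightarrow> bool" where
  "has_pullbacks C \<longleftrightarrow> (\<forall>f \<in> Arr C. \<forall>g \<in> Arr C. Cod C f = Cod C g \<longrightarrow>
     (\<exists>p \<pi>1 \<pi>2. is_pullback C f g p \<pi>1 \<pi>2))"

text \<open>``Small'' sets are the sets of elements of a fixed type \<open>'u\<close>, which is infinite wherever
  this is used. Sets of pairs, sets of lists and sets of naturals then also index coproducts,
  since \<open>'u \<times> 'u\<close>, \<open>'u list\<close> and \<open>nat\<close> inject into \<open>'u\<close>.\<close>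

definition has_small_coproducts :: "'u itself \<Rightarrow> ('o, 'm) cat \<Rightarrow> bool" where
  "has_small_coproducts (_ :: 'u itself) C \<longleftrightarrow>
     (\<forall>(I :: 'u set) X. X ` I \<subseteq> Obj C \<longrightarrow> (\<exists>c \<iota>. is_coproduct C I X c \<iota>))"

text \<open>For index maps \<open>r: I \<rightarrow> K \<leftarrow> J :s\<close> and arrows \<open>u i: A i \<rightarrow> C (r i)\<close>, \<open>v j: B j \<rightarrow> C (s j)\<close>, the
  canonical arrow from the coproduct of the pullbacks of \<open>u i\<close> and \<open>v j\<close> over all \<open>(i, j)\<close> with
  \<open>r i = s j\<close> to the pullback of the induced arrows between the coproducts is invertible.\<close>

definition small_coproducts_commute_with_pullbacks :: "'u itself \<Rightarrow> ('o, 'm) cat \<Rightarrow> bool" where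
  "small_coproducts_commute_with_pullbacks (_ :: 'u itself) V \<longleftrightarrow>
     (\<forall>(I :: 'u set) (J :: 'u set) (K :: 'u set) r s A B C u v.
        r ` I \<subseteq> K \<longrightarrow> s ` J \<subseteq> K \<longrightarrow>
        A ` I \<subseteq> Obj V \<longrightarrow> B ` J \<subseteq> Obj V \<longrightarrow> C ` K \<subseteq> Obj V \<longrightarrow>
        (\<forall>i \<in> I. u i \<in> hom V (A i) (C (r i))) \<longrightarrow> (\<forall>j \<in> J. v j \<in> hom V (B j) (C (s j))) \<longrightarrow>
        (let f = cotup V I A (cpr V K C) (\<lambda>i. inc V K C (r i) \<cdot>\<^bsub>V\<^esub> u i);
             g = cotup V J B (cpr V K C) (\<lambda>j. inc V K C (s j) \<cdot>\<^bsub>V\<^esub> v j)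
         in is_iso V (cotup V {(i, j). i \<in> I \<and> j \<in> J \<and> r i = s j} (\<lambda>(i, j). pbo V (u i) (v j))
              (pbo V f g)
              (\<lambda>(i, j). pbtup V f g (inc V I A i \<cdot>\<^bsub>V\<^esub> pb1 V (u i) (v j))
                                     (inc V J B j \<cdot>\<^bsub>V\<^esub> pb2 V (u i) (v j))))))"


section \<open>Classical operads\<close>

text \<open>\<open>OpComp P [k\<^sub>1, \<dots>, k\<^sub>m]\<close> is the composition
  \<open>P(m) \<times> P(k\<^sub>1) \<times> \<dots> \<times> P(k\<^sub>m) \<rightarrow> P(k\<^sub>1 + \<dots> + k\<^sub>m)\<close>. Here and below, commuting diagrams between
  products are expressed on generalised elements.\<close>

record ('o, 'm) ns_operad =
  OpOb :: "nat \<Rightarrow> 'o"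
  OpUnit :: 'm
  OpComp :: "nat list \<Rightarrow> 'm"

definition is_ns_operad :: "('o, 'm) cat \<Rightarrow> ('o, 'm) ns_operad \<Rightarrow> bool" where
  "is_ns_operad V P \<longleftrightarrow>
     (\<forall>k. OpOb P k \<in> Obj V) \<and>
     OpUnit P \<in> hom V (trm V) (OpOb P 1) \<and>
     (\<forall>ks. OpComp P ks \<in> hom V (prd V (OpOb P (length ks) # map (OpOb P) ks)) (OpOb P (sum_list ks))) \<and>
     (\<forall>k. \<forall>z \<in> Obj V. \<forall>p \<in> hom V z (OpOb P k).
        OpComp P [k] \<cdot>\<^bsub>V\<^esub> tup V z [OpUnit P \<cdot>\<^bsub>V\<^esub> bang V z, p] = p \<and>
        OpComp P (replicate k 1) \<cdot>\<^bsub>V\<^esub> tup V z (p # replicate k (OpUnit P \<cdot>\<^bsub>V\<^esub> bang V z)) = p) \<and>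
     (\<forall>lss. \<forall>z \<in> Obj V. \<forall>p \<in> hom V z (OpOb P (length lss)).
        \<forall>qs \<in> elems V z (map (\<lambda>ls. OpOb P (length ls)) lss).
        \<forall>rss. list_all2 (\<lambda>ls rs. rs \<in> elems V z (map (OpOb P) ls)) lss rss \<longrightarrow>
          OpComp P (concat lss) \<cdot>\<^bsub>V\<^esub>
            tup V z ((OpComp P (map length lss) \<cdot>\<^bsub>V\<^esub> tup V z (p # qs)) # concat rss)
          = OpComp P (map sum_list lss) \<cdot>\<^bsub>V\<^esub>
            tup V z (p # map (\<lambda>i. OpComp P (lss ! i) \<cdot>\<^bsub>V\<^esub> tup V z (qs ! i # rss ! i)) [0..<length lss]))"


section \<open>Enriched graphs\<close>

datatype ('u, 'o) vgraph =
  VGraph (Verts: "'u set") (Edge: "'u \<Rightarrow> 'u \<Rightarrow> 'o")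

datatype ('u, 'o, 'm) vgmor =
  VGMor (GDom: "('u, 'o) vgraph") (GCod: "('u, 'o) vgraph")
    (Vmap: "'u \<Rightarrow> 'u") (Emap: "'u \<Rightarrow> 'u \<Rightarrow> 'm")

text \<open>The functions in graphs and graph morphisms take the value \<open>undefined\<close> off the vertex set,
  so that equality is determined by the values on vertices.\<close>

definition mk_graph :: "'u set \<Rightarrow> ('u \<Rightarrow> 'u \<Rightarrow> 'o) \<Rightarrow> ('u, 'o) vgraph" where
  "mk_graph S E = VGraph S (\<lambda>a b. if a \<in> S \<and> b \<in> S then E a b else undefined)"

definition mk_vgmor ::
  "('u, 'o) vgraph \<Rightarrow> ('u, 'o) vgraph \<Rightarrow> ('u \<Rightarrow> 'u) \<Rightarrow> ('u \<Rightarrow> 'u \<Rightarrow> 'm) \<Rightarrow> ('u, 'o, 'm) vgmor" where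
  "mk_vgmor A B f e = VGMor A B
     (\<lambda>a. if a \<in> Verts A then f a else undefined)
     (\<lambda>a b. if a \<in> Verts A \<and> b \<in> Verts A then e a b else undefined)"

definition is_vgraph :: "('o, 'm) cat \<Rightarrow> ('u, 'o) vgraph \<Rightarrow> bool" where
  "is_vgraph V A \<longleftrightarrow> A = mk_graph (Verts A) (Edge A) \<and>
     (\<forall>a \<in> Verts A. \<forall>b \<in> Verts A. Edge A a b \<in> Obj V)"

definition is_vgmor :: "('o, 'm) cat \<Rightarrow> ('u, 'o, 'm) vgmor \<Rightarrow> bool" where
  "is_vgmor V f \<longleftrightarrow> is_vgraph V (GDom f) \<and> is_vgraph V (GCod f) \<and>
     f = mk_vgmor (GDom f) (GCod f) (Vmap f) (Emap f) \<and>
     (\<forall>a \<in> Verts (GDom f). Vmap f a \<in> Verts (GCod f)) \<and>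
     (\<forall>a \<in> Verts (GDom f). \<forall>b \<in> Verts (GDom f).
        Emap f a b \<in> hom V (Edge (GDom f) a b) (Edge (GCod f) (Vmap f a) (Vmap f b)))"

definition VGph :: "('o, 'm) cat \<Rightarrow> (('u, 'o) vgraph, ('u, 'o, 'm) vgmor) cat" where
  "VGph V = \<lparr>
     Obj = {A. is_vgraph V A},
     Arr = {f. is_vgmor V f},
     Dom = GDom,
     Cod = GCod,
     Ident = (\<lambda>A. mk_vgmor A A (\<lambda>a. a) (\<lambda>a b. Ident V (Edge A a b))),
     Comp = (\<lambda>g f. mk_vgmor (GDom f) (GCod g) (\<lambda>a. Vmap g (Vmap f a))
               (\<lambda>a b. Emap g (Vmap f a) (Vmap f b) \<cdot>\<^bsub>V\<^esub> Emap f a b))\<rparr>"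

text \<open>A path \<open>a\<^sub>0, \<dots>, a\<^sub>k\<close> is a nonempty list of vertices. Its edges are listed along the path,
  \<open>A(a\<^sub>0,a\<^sub>1), \<dots>, A(a\<^sub>k\<^sub>-\<^sub>1,a\<^sub>k)\<close>, whereas products are formed in composition order
  \<open>A(a\<^sub>k\<^sub>-\<^sub>1,a\<^sub>k) \<times> \<dots> \<times> A(a\<^sub>0,a\<^sub>1)\<close>, whence the occurrences of \<open>rev\<close>.\<close>

definition all_paths :: "('u, 'o) vgraph \<Rightarrow> 'u list set" where
  "all_paths A = {as. as \<noteq> [] \<and> set as \<subseteq> Verts A}"

definition paths :: "('u, 'o) vgraph \<Rightarrow> 'u \<Rightarrow> 'u \<Rightarrow> 'u list set" where
  "paths A a b = {as \<in> all_paths A. hd as = a \<and> last as = b}"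

definition plen :: "'u list \<Rightarrow> nat" where
  "plen as = length (tl as)"

definition edges :: "('u, 'o) vgraph \<Rightarrow> 'u list \<Rightarrow> 'o list" where
  "edges A as = map2 (Edge A) as (tl as)"

text \<open>A cutting of a path into consecutive blocks is given by the path \<open>as\<close> of cut points
  together with, for each step of \<open>as\<close>, a (possibly trivial) path between its endpoints.\<close>

definition blocks :: "('u, 'o) vgraph \<Rightarrow> 'u list \<Rightarrow> 'u list list set" where
  "blocks A as = {ps. list_all2 (\<lambda>(a, b) p. p \<in> paths A a b) (zip as (tl as)) ps}"

definition join :: "'u list \<Rightarrow> 'u list list \<Rightarrow> 'u list" where
  "join as ps = hd as # concat (map tl ps)"

text \<open>The action of a graph morphism on a string of generalised elements along a path.\<close>

definition map_string :: "('o, 'm) cat \<Rightarrow> ('u, 'o, 'm) vgmor \<Rightarrow> 'u list \<Rightarrow> 'm list \<Rightarrow> 'm list" where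
  "map_string V f as xs = map2 (\<lambda>e x. e \<cdot>\<^bsub>V\<^esub> x) (map2 (Emap f) as (tl as)) xs"


section \<open>Categories over an operad\<close>

text \<open>The second component assigns to each path \<open>a\<^sub>0, \<dots>, a\<^sub>k\<close> the arrow
  \<open>P(k) \<times> A(a\<^sub>k\<^sub>-\<^sub>1,a\<^sub>k) \<times> \<dots> \<times> A(a\<^sub>0,a\<^sub>1) \<rightarrow> A(a\<^sub>0,a\<^sub>k)\<close>.\<close>

type_synonym ('u, 'o, 'm) vpcat = "('u, 'o) vgraph \<times> ('u list \<Rightarrow> 'm)"

definition is_vpcat :: "('o, 'm) cat \<Rightarrow> ('o, 'm) ns_operad \<Rightarrow> ('u, 'o, 'm) vpcat \<Rightarrow> bool" where
  "is_vpcat V P X \<longleftrightarrow> (case X of (A, \<gamma>) \<Rightarrow>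
     is_vgraph V A \<and>
     (\<forall>as. as \<notin> all_paths A \<longrightarrow> \<gamma> as = undefined) \<and>
     (\<forall>as \<in> all_paths A.
        \<gamma> as \<in> hom V (prd V (OpOb P (plen as) # rev (edges A as))) (Edge A (hd as) (last as))) \<and>
     (\<forall>a \<in> Verts A. \<forall>b \<in> Verts A. \<forall>z \<in> Obj V. \<forall>x \<in> hom V z (Edge A a b).
        \<gamma> [a, b] \<cdot>\<^bsub>V\<^esub> tup V z [OpUnit P \<cdot>\<^bsub>V\<^esub> bang V z, x] = x) \<and>
     (\<forall>as \<in> all_paths A. \<forall>ps \<in> blocks A as. \<forall>z \<in> Obj V.
        \<forall>p \<in> hom V z (OpOb P (length ps)).
        \<forall>qs \<in> elems V z (map (\<lambda>bs. OpOb P (plen bs)) ps).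
        \<forall>xss. list_all2 (\<lambda>bs xs. xs \<in> elems V z (edges A bs)) ps xss \<longrightarrow>
          \<gamma> as \<cdot>\<^bsub>V\<^esub>
            tup V z (p # rev (map (\<lambda>i. \<gamma> (ps ! i) \<cdot>\<^bsub>V\<^esub> tup V z (qs ! i # rev (xss ! i))) [0..<length ps]))
          = \<gamma> (join as ps) \<cdot>\<^bsub>V\<^esub>
            tup V z ((OpComp P (map plen ps) \<cdot>\<^bsub>V\<^esub> tup V z (p # qs)) # rev (concat xss))))"

definition is_vpcat_mor :: "('o, 'm) cat \<Rightarrow> ('o, 'm) ns_operad \<Rightarrow>
    ('u, 'o, 'm) vpcat \<Rightarrow> ('u, 'o, 'm) vpcat \<Rightarrow> ('u, 'o, 'm) vgmor \<Rightarrow> bool" where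
  "is_vpcat_mor V P X Y f \<longleftrightarrow> f \<in> hom (VGph V) (fst X) (fst Y) \<and>
     (\<forall>as \<in> all_paths (fst X). \<forall>z \<in> Obj V. \<forall>p \<in> hom V z (OpOb P (plen as)).
        \<forall>xs \<in> elems V z (edges (fst X) as).
          Emap f (hd as) (last as) \<cdot>\<^bsub>V\<^esub> (snd X as \<cdot>\<^bsub>V\<^esub> tup V z (p # rev xs))
          = snd Y (map (Vmap f) as) \<cdot>\<^bsub>V\<^esub> tup V z (p # rev (map_string V f as xs)))"

definition VPCat :: "('o, 'm) cat \<Rightarrow> ('o, 'm) ns_operad \<Rightarrow>
    (('u, 'o, 'm) vpcat, ('u, 'o, 'm) vpcat \<times> ('u, 'o, 'm) vpcat \<times> ('u, 'o, 'm) vgmor) cat" where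
  "VPCat V P = \<lparr>
     Obj = {X. is_vpcat V P X},
     Arr = {(X, Y, f). is_vpcat V P X \<and> is_vpcat V P Y \<and> is_vpcat_mor V P X Y f},
     Dom = (\<lambda>(X, Y, f). X),
     Cod = (\<lambda>(X, Y, f). Y),
     Ident = (\<lambda>X. (X, X, Ident (VGph V) (fst X))),
     Comp = (\<lambda>(Y', Z, g) (X, Y, f). (X, Z, g \<cdot>\<^bsub>VGph V\<^esub> f))\<rparr>"


section \<open>Monads and their algebras\<close>

record ('o, 'm) monad =
  TOb :: "'o \<Rightarrow> 'o"
  TAr :: "'m \<Rightarrow> 'm"
  TEta :: "'o \<Rightarrow> 'm"
  TMu :: "'o \<Rightarrow> 'm"

definition is_algebra :: "('o, 'm) cat \<Rightarrow> ('o, 'm) monad \<Rightarrow> 'o \<times> 'm \<Rightarrow> bool" where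
  "is_algebra E T X \<longleftrightarrow> (case X of (A, \<theta>) \<Rightarrow>
     A \<in> Obj E \<and> \<theta> \<in> hom E (TOb T A) A \<and>
     \<theta> \<cdot>\<^bsub>E\<^esub> TEta T A = Ident E A \<and>
     \<theta> \<cdot>\<^bsub>E\<^esub> TAr T \<theta> = \<theta> \<cdot>\<^bsub>E\<^esub> TMu T A)"

definition is_algebra_mor :: "('o, 'm) cat \<Rightarrow> ('o, 'm) monad \<Rightarrow> 'o \<times> 'm \<Rightarrow> 'o \<times> 'm \<Rightarrow> 'm \<Rightarrow> bool" where
  "is_algebra_mor E T X Y f \<longleftrightarrow> f \<in> hom E (fst X) (fst Y) \<and>
     f \<cdot>\<^bsub>E\<^esub> snd X = snd Y \<cdot>\<^bsub>E\<^esub> TAr T f"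

definition Alg :: "('o, 'm) cat \<Rightarrow> ('o, 'm) monad \<Rightarrow>
    ('o \<times> 'm, ('o \<times> 'm) \<times> ('o \<times> 'm) \<times> 'm) cat" where
  "Alg E T = \<lparr>
     Obj = {X. is_algebra E T X},
     Arr = {(X, Y, f). is_algebra E T X \<and> is_algebra E T Y \<and> is_algebra_mor E T X Y f},
     Dom = (\<lambda>(X, Y, f). X),
     Cod = (\<lambda>(X, Y, f). Y),
     Ident = (\<lambda>X. (X, X, Ident E (fst X))),
     Comp = (\<lambda>(Y', Z, g) (X, Y, f). (X, Z, g \<cdot>\<^bsub>E\<^esub> f))\<rparr>"


section \<open>Generalised operads\<close>

text \<open>Collections are arrows \<open>\<alpha>: A \<rightarrow> T1\<close>, tensored by pulling \<open>T!: TA \<rightarrow> T1\<close> back along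
  \<open>\<beta>: B \<rightarrow> T1\<close>.\<close>

definition Tbang :: "('o, 'm) cat \<Rightarrow> ('o, 'm) monad \<Rightarrow> 'o \<Rightarrow> 'm" where
  "Tbang E T A = TAr T (bang E A)"

definition tens_ob :: "('o, 'm) cat \<Rightarrow> ('o, 'm) monad \<Rightarrow> 'm \<Rightarrow> 'm \<Rightarrow> 'o" where
  "tens_ob E T \<alpha> \<beta> = pbo E (Tbang E T (Dom E \<alpha>)) \<beta>"

definition tens1 :: "('o, 'm) cat \<Rightarrow> ('o, 'm) monad \<Rightarrow> 'm \<Rightarrow> 'm \<Rightarrow> 'm" where
  "tens1 E T \<alpha> \<beta> = pb1 E (Tbang E T (Dom E \<alpha>)) \<beta>"

definition tens2 :: "('o, 'm) cat \<Rightarrow> ('o, 'm) monad \<Rightarrow> 'm \<Rightarrow> 'm \<Rightarrow> 'm" where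
  "tens2 E T \<alpha> \<beta> = pb2 E (Tbang E T (Dom E \<alpha>)) \<beta>"

definition tens :: "('o, 'm) cat \<Rightarrow> ('o, 'm) monad \<Rightarrow> 'm \<Rightarrow> 'm \<Rightarrow> 'm" where
  "tens E T \<alpha> \<beta> = TMu T (trm E) \<cdot>\<^bsub>E\<^esub> (TAr T \<alpha> \<cdot>\<^bsub>E\<^esub> tens1 E T \<alpha> \<beta>)"

definition tens_tup :: "('o, 'm) cat \<Rightarrow> ('o, 'm) monad \<Rightarrow> 'm \<Rightarrow> 'm \<Rightarrow> 'm \<Rightarrow> 'm \<Rightarrow> 'm" where
  "tens_tup E T \<alpha> \<beta> x y = pbtup E (Tbang E T (Dom E \<alpha>)) \<beta> x y"

definition coll_unit :: "('o, 'm) cat \<Rightarrow> ('o, 'm) monad \<Rightarrow> 'm" where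
  "coll_unit E T = TEta T (trm E)"

definition is_coll_mor :: "('o, 'm) cat \<Rightarrow> 'm \<Rightarrow> 'm \<Rightarrow> 'm \<Rightarrow> bool" where
  "is_coll_mor E \<alpha> \<beta> f \<longleftrightarrow> f \<in> hom E (Dom E \<alpha>) (Dom E \<beta>) \<and> \<beta> \<cdot>\<^bsub>E\<^esub> f = \<alpha>"

text \<open>\<open>tens_ar E T \<alpha> \<beta> \<alpha>' \<beta>' f g\<close> is \<open>f \<otimes> g\<close> for \<open>f: \<alpha> \<rightarrow> \<alpha>'\<close> and \<open>g: \<beta> \<rightarrow> \<beta>'\<close>.\<close>

definition tens_ar ::
  "('o, 'm) cat \<Rightarrow> ('o, 'm) monad \<Rightarrow> 'm \<Rightarrow> 'm \<Rightarrow> 'm \<Rightarrow> 'm \<Rightarrow> 'm \<Rightarrow> 'm \<Rightarrow> 'm" where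
  "tens_ar E T \<alpha> \<beta> \<alpha>' \<beta>' f g =
     tens_tup E T \<alpha>' \<beta>' (TAr T f \<cdot>\<^bsub>E\<^esub> tens1 E T \<alpha> \<beta>) (g \<cdot>\<^bsub>E\<^esub> tens2 E T \<alpha> \<beta>)"

text \<open>The coherence isomorphisms: \<open>(\<alpha> \<otimes> \<beta>) \<otimes> \<delta> \<rightarrow> \<alpha> \<otimes> (\<beta> \<otimes> \<delta>)\<close>, \<open>I \<otimes> \<alpha> \<rightarrow> \<alpha>\<close> and \<open>\<alpha> \<rightarrow> \<alpha> \<otimes> I\<close>.\<close>

definition tens_assoc :: "('o, 'm) cat \<Rightarrow> ('o, 'm) monad \<Rightarrow> 'm \<Rightarrow> 'm \<Rightarrow> 'm \<Rightarrow> 'm" where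
  "tens_assoc E T \<alpha> \<beta> \<delta> = (let q = tens1 E T (tens E T \<alpha> \<beta>) \<delta> in
     tens_tup E T \<alpha> (tens E T \<beta> \<delta>)
       (TMu T (Dom E \<alpha>) \<cdot>\<^bsub>E\<^esub> (TAr T (tens1 E T \<alpha> \<beta>) \<cdot>\<^bsub>E\<^esub> q))
       (tens_tup E T \<beta> \<delta> (TAr T (tens2 E T \<alpha> \<beta>) \<cdot>\<^bsub>E\<^esub> q) (tens2 E T (tens E T \<alpha> \<beta>) \<delta>)))"

definition tens_lunit :: "('o, 'm) cat \<Rightarrow> ('o, 'm) monad \<Rightarrow> 'm \<Rightarrow> 'm" where
  "tens_lunit E T \<alpha> = tens2 E T (coll_unit E T) \<alpha>"

definition tens_runit_inv :: "('o, 'm) cat \<Rightarrow> ('o, 'm) monad \<Rightarrow> 'm \<Rightarrow> 'm" where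
  "tens_runit_inv E T \<alpha> = tens_tup E T \<alpha> (coll_unit E T) (TEta T (Dom E \<alpha>)) (bang E (Dom E \<alpha>))"

record 'm gen_operad =
  Rmap :: 'm
  Runit :: 'm
  Rmult :: 'm

text \<open>Monoids in the monoidal category of collections.\<close>

definition is_gen_operad :: "('o, 'm) cat \<Rightarrow> ('o, 'm) monad \<Rightarrow> 'm gen_operad \<Rightarrow> bool" where
  "is_gen_operad E T R \<longleftrightarrow> (let d = Rmap R; e = Runit R; m = Rmult R;
       I = coll_unit E T; i = Ident E (Dom E d); dd = tens E T d d in
     d \<in> Arr E \<and> Cod E d = TOb T (trm E) \<and>
     is_coll_mor E I d e \<and> is_coll_mor E dd d m \<and>
     m \<cdot>\<^bsub>E\<^esub> tens_ar E T I d d d e i = tens_lunit E T d \<and>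
     m \<cdot>\<^bsub>E\<^esub> (tens_ar E T d I d d i e \<cdot>\<^bsub>E\<^esub> tens_runit_inv E T d) = i \<and>
     m \<cdot>\<^bsub>E\<^esub> tens_ar E T dd d d d m i =
       m \<cdot>\<^bsub>E\<^esub> (tens_ar E T d dd d d i m \<cdot>\<^bsub>E\<^esub> tens_assoc E T d d d))"

text \<open>The induced monad \<open>T\<^sub>R A = R \<times>\<^bsub>T1\<^esub> TA\<close>. Its multiplication sends
  \<open>R \<times>\<^bsub>T1\<^esub> T(R \<times>\<^bsub>T1\<^esub> TA)\<close> to \<open>TR \<times>\<^bsub>T1\<^esub> R\<close> and to \<open>TTA\<close>, and there applies the
  multiplications of \<open>R\<close> and of \<open>T\<close>.\<close>

definition operad_monad :: "('o, 'm) cat \<Rightarrow> ('o, 'm) monad \<Rightarrow> 'm gen_operad \<Rightarrow> ('o, 'm) monad" where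
  "operad_monad E T R = (let d = Rmap R;
       TR = (\<lambda>A. pbo E d (Tbang E T A));
       p1 = (\<lambda>A. pb1 E d (Tbang E T A));
       p2 = (\<lambda>A. pb2 E d (Tbang E T A)) in \<lparr>
     TOb = TR,
     TAr = (\<lambda>f. pbtup E d (Tbang E T (Cod E f)) (p1 (Dom E f)) (TAr T f \<cdot>\<^bsub>E\<^esub> p2 (Dom E f))),
     TEta = (\<lambda>A. pbtup E d (Tbang E T A) (Runit R \<cdot>\<^bsub>E\<^esub> bang E A) (TEta T A)),
     TMu = (\<lambda>A. pbtup E d (Tbang E T A)
        (Rmult R \<cdot>\<^bsub>E\<^esub> tens_tup E T d d (TAr T (p1 A) \<cdot>\<^bsub>E\<^esub> p2 (TR A)) (p1 (TR A)))
        (TMu T A \<cdot>\<^bsub>E\<^esub> (TAr T (p2 A) \<cdot>\<^bsub>E\<^esub> p2 (TR A))))\<rparr>)"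

definition OperadAlg :: "('o, 'm) cat \<Rightarrow> ('o, 'm) monad \<Rightarrow> 'm gen_operad \<Rightarrow>
    ('o \<times> 'm, ('o \<times> 'm) \<times> ('o \<times> 'm) \<times> 'm) cat" where
  "OperadAlg E T R = Alg E (operad_monad E T R)"


section \<open>The free enriched category monad\<close>

definition fc_ob :: "('o, 'm) cat \<Rightarrow> ('u, 'o) vgraph \<Rightarrow> ('u, 'o) vgraph" where
  "fc_ob V A = mk_graph (Verts A)
     (\<lambda>a b. cpr V (paths A a b) (\<lambda>as. prd V (rev (edges A as))))"

definition path_inc :: "('o, 'm) cat \<Rightarrow> ('u, 'o) vgraph \<Rightarrow> 'u list \<Rightarrow> 'm" where
  "path_inc V A as = inc V (paths A (hd as) (last as)) (\<lambda>bs. prd V (rev (edges A bs))) as"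

definition fc_ar :: "('o, 'm) cat \<Rightarrow> ('u, 'o, 'm) vgmor \<Rightarrow> ('u, 'o, 'm) vgmor" where
  "fc_ar V f = (let A = GDom f; B = GCod f in mk_vgmor (fc_ob V A) (fc_ob V B) (Vmap f)
     (\<lambda>a b. cotup V (paths A a b) (\<lambda>as. prd V (rev (edges A as)))
        (Edge (fc_ob V B) (Vmap f a) (Vmap f b))
        (\<lambda>as. let xs = rev (prjs V (rev (edges A as))) in
           path_inc V B (map (Vmap f) as) \<cdot>\<^bsub>V\<^esub>
           tup V (prd V (rev (edges A as))) (rev (map_string V f as xs)))))"

definition fc_eta :: "('o, 'm) cat \<Rightarrow> ('u, 'o) vgraph \<Rightarrow> ('u, 'o, 'm) vgmor" where
  "fc_eta V A = mk_vgmor A (fc_ob V A) (\<lambda>a. a)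
     (\<lambda>a b. path_inc V A [a, b] \<cdot>\<^bsub>V\<^esub> tup V (Edge A a b) [Ident V (Edge A a b)])"

text \<open>The multiplication is concatenation of paths. As finite products distribute over small
  coproducts, it is determined by its effect on strings of strings of generalised elements.\<close>

definition fc_mu :: "('o, 'm) cat \<Rightarrow> ('u, 'o) vgraph \<Rightarrow> ('u, 'o, 'm) vgmor" where
  "fc_mu V A = mk_vgmor (fc_ob V (fc_ob V A)) (fc_ob V A) (\<lambda>a. a)
     (\<lambda>a b. THE h. h \<in> hom V (Edge (fc_ob V (fc_ob V A)) a b) (Edge (fc_ob V A) a b) \<and>
        (\<forall>as \<in> paths A a b. \<forall>ps \<in> blocks A as. \<forall>z \<in> Obj V.
           \<forall>xss. list_all2 (\<lambda>bs xs. xs \<in> elems V z (edges A bs)) ps xss \<longrightarrow>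
             h \<cdot>\<^bsub>V\<^esub> (path_inc V (fc_ob V A) as \<cdot>\<^bsub>V\<^esub>
               tup V z (rev (map2 (\<lambda>bs xs. path_inc V A bs \<cdot>\<^bsub>V\<^esub> tup V z (rev xs)) ps xss)))
             = path_inc V A (join as ps) \<cdot>\<^bsub>V\<^esub> tup V z (rev (concat xss))))"

definition fc :: "('o, 'm) cat \<Rightarrow> (('u, 'o) vgraph, ('u, 'o, 'm) vgmor) monad" where
  "fc V = \<lparr>TOb = fc_ob V, TAr = fc_ar V, TEta = fc_eta V, TMu = fc_mu V\<rparr>"


section \<open>Suspension\<close>

text \<open>The single object of the suspension is taken to be that of the chosen terminal graph.\<close>

definition susp_pt :: "('u, 'o, 'm) vgmor itself \<Rightarrow> ('o, 'm) cat \<Rightarrow> 'u" where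
  "susp_pt _ V = the_elem (Verts (trm (VGph V :: (('u, 'o) vgraph, ('u, 'o, 'm) vgmor) cat)))"

text \<open>The path of length \<open>k\<close> at the single object.\<close>

definition loop :: "('u, 'o, 'm) vgmor itself \<Rightarrow> ('o, 'm) cat \<Rightarrow> nat \<Rightarrow> 'u list" where
  "loop t V k = replicate (Suc k) (susp_pt t V)"

definition susp_inc :: "('o, 'm) cat \<Rightarrow> ('o, 'm) ns_operad \<Rightarrow> nat \<Rightarrow> 'm" where
  "susp_inc V P = inc V UNIV (OpOb P)"

definition susp_graph ::
  "('u, 'o, 'm) vgmor itself \<Rightarrow> ('o, 'm) cat \<Rightarrow> ('o, 'm) ns_operad \<Rightarrow> ('u, 'o) vgraph" where
  "susp_graph t V P = mk_graph {susp_pt t V} (\<lambda>_ _. cpr V UNIV (OpOb P))"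

text \<open>The \<open>k\<close>-th summand of the single hom-object of \<open>fc 1\<close> is the \<open>k\<close>-fold product of a
  terminal object, which is again terminal.\<close>

definition susp_map ::
  "('u, 'o, 'm) vgmor itself \<Rightarrow> ('o, 'm) cat \<Rightarrow> ('o, 'm) ns_operad \<Rightarrow> ('u, 'o, 'm) vgmor" where
  "susp_map t V P = (let one = trm (VGph V) :: ('u, 'o) vgraph; pt = susp_pt t V in
     mk_vgmor (susp_graph t V P) (fc_ob V one) (\<lambda>_. pt)
       (\<lambda>_ _. cotup V UNIV (OpOb P) (Edge (fc_ob V one) pt pt)
          (\<lambda>k. path_inc V one (loop t V k) \<cdot>\<^bsub>V\<^esub>
             (THE h. h \<in> hom V (OpOb P k) (prd V (rev (edges one (loop t V k))))))))"

definition susp_unit ::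
  "('u, 'o, 'm) vgmor itself \<Rightarrow> ('o, 'm) cat \<Rightarrow> ('o, 'm) ns_operad \<Rightarrow> ('u, 'o, 'm) vgmor" where
  "susp_unit t V P = (let one = trm (VGph V) :: ('u, 'o) vgraph in
     mk_vgmor one (susp_graph t V P) (\<lambda>_. susp_pt t V)
       (\<lambda>a b. susp_inc V P 1 \<cdot>\<^bsub>V\<^esub> (OpUnit P \<cdot>\<^bsub>V\<^esub> bang V (Edge one a b))))"

text \<open>An element of the hom-object of \<open>\<Sigma>P \<otimes> \<Sigma>P\<close> given by \<open>p \<in> P(m)\<close> and, along the loop of
  length \<open>m\<close>, by \<open>q\<^sub>1 \<in> P(k\<^sub>1), \<dots>, q\<^sub>m \<in> P(k\<^sub>m)\<close> is sent to \<open>p(q\<^sub>1, \<dots>, q\<^sub>m)\<close>. By commutation of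
  small coproducts with pullbacks this determines the multiplication.\<close>

definition susp_mult ::
  "('u, 'o, 'm) vgmor itself \<Rightarrow> ('o, 'm) cat \<Rightarrow> ('o, 'm) ns_operad \<Rightarrow> ('u, 'o, 'm) vgmor" where
  "susp_mult t V P = (let d = susp_map t V P; S = susp_graph t V P; pt = susp_pt t V;
       W = tens_ob (VGph V) (fc V) d d; w1 = tens1 (VGph V) (fc V) d d; w2 = tens2 (VGph V) (fc V) d d in
     mk_vgmor W S (\<lambda>_. pt)
       (\<lambda>x y. THE h. h \<in> hom V (Edge W x y) (Edge S pt pt) \<and>
          (\<forall>ks. \<forall>z \<in> Obj V. \<forall>p \<in> hom V z (OpOb P (length ks)). \<forall>qs \<in> elems V z (map (OpOb P) ks).
             \<forall>c \<in> hom V z (Edge W x y).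
               Emap w1 x y \<cdot>\<^bsub>V\<^esub> c =
                 path_inc V S (loop t V (length ks)) \<cdot>\<^bsub>V\<^esub>
                 tup V z (rev (map2 (\<lambda>k q. susp_inc V P k \<cdot>\<^bsub>V\<^esub> q) ks qs)) \<longrightarrow>
               Emap w2 x y \<cdot>\<^bsub>V\<^esub> c = susp_inc V P (length ks) \<cdot>\<^bsub>V\<^esub> p \<longrightarrow>
               h \<cdot>\<^bsub>V\<^esub> c = susp_inc V P (sum_list ks) \<cdot>\<^bsub>V\<^esub> (OpComp P ks \<cdot>\<^bsub>V\<^esub> tup V z (p # qs)))))"

definition susp ::
  "('u, 'o, 'm) vgmor itself \<Rightarrow> ('o, 'm) cat \<Rightarrow> ('o, 'm) ns_operad \<Rightarrow> ('u, 'o, 'm) vgmor gen_operad" where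
  "susp t V P = \<lparr>Rmap = susp_map t V P, Runit = susp_unit t V P, Rmult = susp_mult t V P\<rparr>"

abbreviation Susp ::
  "('o, 'm) cat \<Rightarrow> ('o, 'm) ns_operad \<Rightarrow> ('u, 'o, 'm) vgmor gen_operad"  ("\<Sigma>") where
  "\<Sigma> V P \<equiv> susp TYPE(('u, 'o, 'm) vgmor) V P"

text \<open>The algebra structure \<open>\<theta>: \<Sigma>P \<times>\<^bsub>fc 1\<^esub> fc A \<rightarrow> A\<close> restricts, on the summand belonging to
  a path, to the arrow that \<open>\<gamma>\<close> assigns to this path. The vertices \<open>x\<close>, \<open>y\<close> of the pullback
  graph lie over the endpoints of the path.\<close>

definition action_agrees ::
  "('o, 'm) cat \<Rightarrow> ('o, 'm) ns_operad \<Rightarrow> ('u, 'o) vgraph \<Rightarrow> ('u list \<Rightarrow> 'm) \<Rightarrow>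
   ('u, 'o, 'm) vgmor \<Rightarrow> bool" where
  "action_agrees V P A \<gamma> \<theta> \<longleftrightarrow>
     (let d = Rmap (\<Sigma> V P) :: ('u, 'o, 'm) vgmor; E = VGph V; W = pbo E d (Tbang E (fc V) A);
          w1 = pb1 E d (Tbang E (fc V) A); w2 = pb2 E d (Tbang E (fc V) A) in
     \<forall>x \<in> Verts W. \<forall>y \<in> Verts W. \<forall>as \<in> paths A (Vmap w2 x) (Vmap w2 y). \<forall>z \<in> Obj V.
       \<forall>p \<in> hom V z (OpOb P (plen as)). \<forall>xs \<in> elems V z (edges A as). \<forall>c \<in> hom V z (Edge W x y).
         Emap w1 x y \<cdot>\<^bsub>V\<^esub> c = susp_inc V P (plen as) \<cdot>\<^bsub>V\<^esub> p \<longrightarrow>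
         Emap w2 x y \<cdot>\<^bsub>V\<^esub> c = path_inc V A as \<cdot>\<^bsub>V\<^esub> tup V z (rev xs) \<longrightarrow>
         Emap \<theta> x y \<cdot>\<^bsub>V\<^esub> c = \<gamma> as \<cdot>\<^bsub>V\<^esub> tup V z (p # rev xs))"

end

theory Submission
  imports Defs
begin

text \<open>Finite products and small coproducts in \<open>V\<close> are handled through generalised elements. The
  hypothesis on coproducts says that they are disjoint and universal, so the summand inclusions cover a
  coproduct in the canonical topology: an element of a coproduct lies locally in a single summand, which
  is unique up to void stages, and arrows can be compared and glued locally. Hence an element of a
  hom-object of \<open>fc A\<close> is locally a path with a string of elements along it, an element of
  \<open>\<Sigma>P \<times>\<^bsub>fc 1\<^esub> fc A\<close> is locally an operation \<open>p \<in> P(k)\<close> with a string along a path of length \<open>k\<close>, and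
  all structure maps are computed on such elements. The operad laws of \<open>\<Sigma>P\<close> become those of \<open>P\<close>, and a
  morphism \<open>\<theta>: \<Sigma>P \<times>\<^bsub>fc 1\<^esub> fc A \<rightarrow> A\<close> over the identity on vertices amounts to a family \<open>\<gamma>\<close>, with the algebra
  laws for \<open>\<theta>\<close> corresponding to the axioms for \<open>\<gamma>\<close>. As the correspondence is bijective and respects morphisms,
  the equivalence is even an isomorphism of categories over \<open>V\<close>-graphs.\<close>

text \<open>The maps \<open>fc_mu\<close> and \<open>susp_mult\<close> are given by
  \<open>THE\<close> from their values on strings, so their existence has to be proved, not only
  equations between them. Distributing finite products over coproducts, and again over coproducts of
  coproducts, would bury this under indices. Covers avoid it: every representable is a sheaf for the
  canonical topology, so a rule on normal forms that respects restriction glues to an arrow into any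
  object, and since covers are stable under pullback and composition, factors can be decomposed one
  after the other. A second obstacle is that limits of graphs are chosen by universal property
  alone: the vertices of a pullback are not literally pairs, and the point of the terminal graph is
  unknown. Both are recovered by mapping in graphs with a single relevant edge. Strict bijectivity
  of the correspondence rests on the convention that functions are \<open>undefined\<close> off
  their proper domain.\<close>

section \<open>Categories of structured objects\<close>

text \<open>Both \<open>VPCat\<close> and \<open>Alg\<close> are of this form.\<close>

definition concrete_cat :: "('o, 'm) cat \<Rightarrow> ('o \<times> 's) set \<Rightarrow> ('o \<times> 's \<Rightarrow> 'o \<times> 's \<Rightarrow> 'm \<Rightarrow> bool) \<Rightarrow>
    ('o \<times> 's, ('o \<times> 's) \<times> ('o \<times> 's) \<times> 'm) cat" where
  "concrete_cat E Q M = \<lparr>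
     Obj = Q,
     Arr = {(X, Y, f). X \<in> Q \<and> Y \<in> Q \<and> M X Y f},
     Dom = (\<lambda>(X, Y, f). X),
     Cod = (\<lambda>(X, Y, f). Y),
     Ident = (\<lambda>X. (X, X, Ident E (fst X))),
     Comp = (\<lambda>(Y', Z, g) (X, Y, f). (X, Z, g \<cdot>\<^bsub>E\<^esub> f))\<rparr>"

lemma concrete_cat_hom: "t \<in> hom (concrete_cat E Q M) X Y \<longleftrightarrow> (\<exists>f. t = (X, Y, f) \<and> X \<in> Q \<and> Y \<in> Q \<and> M X Y f)"
  by (auto simp: concrete_cat_def hom_def)

lemma concrete_cat_simps [simp]:
  "Obj (concrete_cat E Q M) = Q" "Ident (concrete_cat E Q M) X = (X, X, Ident E (fst X))"
  "Dom (concrete_cat E Q M) (X, Y, f) = X" "Cod (concrete_cat E Q M) (X, Y, f) = Y"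
  "(X, Y, f) \<in> Arr (concrete_cat E Q M) \<longleftrightarrow> X \<in> Q \<and> Y \<in> Q \<and> M X Y f"
  "(Y', Z, g) \<cdot>\<^bsub>concrete_cat E Q M\<^esub> (X, Y, f) = (X, Z, g \<cdot>\<^bsub>E\<^esub> f)"
  by (auto simp: concrete_cat_def)

lemma concrete_cat_category:
  assumes "category E" and ty: "\<And>X Y f. M X Y f \<Longrightarrow> f \<in> hom E (fst X) (fst Y)"
    and id: "\<And>X. X \<in> Q \<Longrightarrow> M X X (Ident E (fst X))"
    and cmp: "\<And>X Y Z f g. X \<in> Q \<Longrightarrow> Y \<in> Q \<Longrightarrow> Z \<in> Q \<Longrightarrow> M X Y f \<Longrightarrow> M Y Z g \<Longrightarrow> M X Z (g \<cdot>\<^bsub>E\<^esub> f)"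
  shows "category (concrete_cat E Q M)"
proof -
  interpret category E by fact
  show ?thesis
  proof
    fix f assume "f \<in> Arr (concrete_cat E Q M)"
    then show "Dom (concrete_cat E Q M) f \<in> Obj (concrete_cat E Q M)" "Cod (concrete_cat E Q M) f \<in> Obj (concrete_cat E Q M)"
      by (cases f; simp)+
  next
    fix f g h X Y Z W
    assume "f \<in> hom (concrete_cat E Q M) X Y" "g \<in> hom (concrete_cat E Q M) Y Z" "h \<in> hom (concrete_cat E Q M) Z W"
    then obtain f' g' h' where "f = (X, Y, f')" "g = (Y, Z, g')" "h = (Z, W, h')" "M X Y f'" "M Y Z g'" "M Z W h'"
      unfolding concrete_cat_hom by blast
    then show "(h \<cdot>\<^bsub>concrete_cat E Q M\<^esub> g) \<cdot>\<^bsub>concrete_cat E Q M\<^esub> f = h \<cdot>\<^bsub>concrete_cat E Q M\<^esub> (g \<cdot>\<^bsub>concrete_cat E Q M\<^esub> f)"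
      using comp_assoc[of f' "fst X" "fst Y" g' "fst Z" h' "fst W"] ty by simp
  next
    fix f X Y assume "f \<in> hom (concrete_cat E Q M) X Y"
    then obtain f' where "f = (X, Y, f')" "M X Y f'" unfolding concrete_cat_hom by blast
    then show "Ident (concrete_cat E Q M) Y \<cdot>\<^bsub>concrete_cat E Q M\<^esub> f = f" "f \<cdot>\<^bsub>concrete_cat E Q M\<^esub> Ident (concrete_cat E Q M) X = f"
      using ident_left[OF ty] ident_right[OF ty] by simp_all
  qed (use id cmp in \<open>auto simp: concrete_cat_hom\<close>)
qed

text \<open>The bijection \<open>\<Phi>\<close> keeps underlying objects, and the two kinds of
  morphism are the same arrows of \<open>E\<close>. Hence both composites act as identity functors,
  and identities serve as the natural isomorphisms. Closure under identities and composition is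
  assumed for the target only; the source inherits it through \<open>MM\<close>.\<close>

lemma concrete_cat_equivalence:
  assumes E: "category E" and ty': "\<And>X Y f. M' X Y f \<Longrightarrow> f \<in> hom E (fst X) (fst Y)"
    and ty: "\<And>X Y f. M X Y f \<Longrightarrow> f \<in> hom E (fst X) (fst Y)"
    and id': "\<And>X. X \<in> Q' \<Longrightarrow> M' X X (Ident E (fst X))"
    and cmp': "\<And>X Y Z f g. X \<in> Q' \<Longrightarrow> Y \<in> Q' \<Longrightarrow> Z \<in> Q' \<Longrightarrow> M' X Y f \<Longrightarrow> M' Y Z g \<Longrightarrow> M' X Z (g \<cdot>\<^bsub>E\<^esub> f)"
    and \<Phi>: "\<And>X. X \<in> Q \<Longrightarrow> \<Phi> X \<in> Q' \<and> fst (\<Phi> X) = fst X \<and> \<Psi> (\<Phi> X) = X"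
    and \<Psi>: "\<And>Y. Y \<in> Q' \<Longrightarrow> \<Psi> Y \<in> Q \<and> \<Phi> (\<Psi> Y) = Y"
    and MM: "\<And>X Y f. X \<in> Q \<Longrightarrow> Y \<in> Q \<Longrightarrow> M X Y f \<longleftrightarrow> M' (\<Phi> X) (\<Phi> Y) f"
  shows "is_equivalence (concrete_cat E Q M) (concrete_cat E Q' M') \<lparr>FOb = \<Phi>, FAr = \<lambda>(X, Y, f). (\<Phi> X, \<Phi> Y, f)\<rparr>"
proof -
  have id: "M X X (Ident E (fst X))" if "X \<in> Q" for X using MM[OF that that] id'[of "\<Phi> X"] \<Phi>[OF that] by simp
  have cmp: "M X Z (g \<cdot>\<^bsub>E\<^esub> f)" if "X \<in> Q" "Y \<in> Q" "Z \<in> Q" "M X Y f" "M Y Z g" for X Y Z f g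
    using that MM cmp'[of "\<Phi> X" "\<Phi> Y" "\<Phi> Z"] \<Phi> by simp
  have cat: "category (concrete_cat E Q M)"
    by (rule concrete_cat_category[OF E], rule ty, assumption, rule id, assumption, rule cmp)
  have cat': "category (concrete_cat E Q' M')"
    by (rule concrete_cat_category[OF E], rule ty', assumption, rule id', assumption, rule cmp')
  have f\<Psi>: "fst (\<Psi> Y) = fst Y" if "Y \<in> Q'" for Y using \<Psi>[OF that] \<Phi>[of "\<Psi> Y"] by metis
  have MM': "M' X Y f \<longleftrightarrow> M (\<Psi> X) (\<Psi> Y) f" if "X \<in> Q'" "Y \<in> Q'" for X Y f
    using \<Psi>[OF that(1)] \<Psi>[OF that(2)] MM[of "\<Psi> X" "\<Psi> Y" f] by simp
  let ?F = "\<lparr>FOb = \<Phi>, FAr = \<lambda>(X, Y, f). (\<Phi> X, \<Phi> Y, f)\<rparr>"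
  let ?G = "\<lparr>FOb = \<Psi>, FAr = \<lambda>(X, Y, f). (\<Psi> X, \<Psi> Y, f)\<rparr>"
  have F: "is_functor (concrete_cat E Q M) (concrete_cat E Q' M') ?F"
    unfolding is_functor_def using cat cat' \<Phi> MM by (auto simp: concrete_cat_hom)
  have G: "is_functor (concrete_cat E Q' M') (concrete_cat E Q M) ?G"
    unfolding is_functor_def using cat cat' \<Psi> MM' f\<Psi> by (auto simp: concrete_cat_hom)
  have isoid: "is_iso D (Ident D a) \<and> Ident D a \<in> hom D a a" if "category D" "a \<in> Obj D" for D :: "('x, 'y) cat" and a
  proof -
    interpret category D by fact
    note i = ident_hom[OF that(2)]
    then show ?thesis using ident_left[OF i] by (auto simp: is_iso_def hom_def)
  qed
  have 1: "is_natural_iso (concrete_cat E Q M) (concrete_cat E Q M) id_fctr (comp_fctr ?G ?F) (Ident (concrete_cat E Q M))"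
    unfolding is_natural_iso_def
  proof (intro conjI ballI allI)
    fix X assume "X \<in> Obj (concrete_cat E Q M)"
    then show "Ident (concrete_cat E Q M) X \<in> hom (concrete_cat E Q M) (FOb id_fctr X) (FOb (comp_fctr ?G ?F) X)"
      "is_iso (concrete_cat E Q M) (Ident (concrete_cat E Q M) X)"
      using isoid[OF cat] \<Phi>[of X] by (auto simp: id_fctr_def comp_fctr_def)
  next
    fix X Y t assume t: "t \<in> hom (concrete_cat E Q M) X Y"
    have "FAr (comp_fctr ?G ?F) t = t"
      using t \<Phi>[of X] \<Phi>[of Y] by (auto simp: comp_fctr_def concrete_cat_hom)
    then show "Ident (concrete_cat E Q M) Y \<cdot>\<^bsub>concrete_cat E Q M\<^esub> FAr id_fctr t = FAr (comp_fctr ?G ?F) t \<cdot>\<^bsub>concrete_cat E Q M\<^esub> Ident (concrete_cat E Q M) X"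
      by (simp only: id_fctr_def fctr.simps category.ident_left[OF cat t] category.ident_right[OF cat t])
  qed
  have 2: "is_natural_iso (concrete_cat E Q' M') (concrete_cat E Q' M') (comp_fctr ?F ?G) id_fctr (Ident (concrete_cat E Q' M'))"
    unfolding is_natural_iso_def
  proof (intro conjI ballI allI)
    fix X assume "X \<in> Obj (concrete_cat E Q' M')"
    then show "Ident (concrete_cat E Q' M') X \<in> hom (concrete_cat E Q' M') (FOb (comp_fctr ?F ?G) X) (FOb id_fctr X)"
      "is_iso (concrete_cat E Q' M') (Ident (concrete_cat E Q' M') X)"
      using isoid[OF cat'] \<Psi>[of X] by (auto simp: id_fctr_def comp_fctr_def)
  next
    fix X Y t assume t: "t \<in> hom (concrete_cat E Q' M') X Y"
    have "FAr (comp_fctr ?F ?G) t = t"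
      using t \<Psi>[of X] \<Psi>[of Y] by (auto simp: comp_fctr_def concrete_cat_hom)
    then show "Ident (concrete_cat E Q' M') Y \<cdot>\<^bsub>concrete_cat E Q' M'\<^esub> FAr (comp_fctr ?F ?G) t = FAr id_fctr t \<cdot>\<^bsub>concrete_cat E Q' M'\<^esub> Ident (concrete_cat E Q' M') X"
      by (simp only: id_fctr_def fctr.simps category.ident_left[OF cat' t] category.ident_right[OF cat' t])
  qed
  show ?thesis unfolding is_equivalence_def using F G 1 2 by blast
qed

section \<open>Products and pullbacks\<close>

locale cart_cat = category C for C :: "('o, 'm) cat" (structure) +
  assumes has_pb: "has_pullbacks C"
    and has_trm: "has_terminal C"
begin

lemma hom_iff: "f \<in> hom C a b \<longleftrightarrow> f \<in> Arr C \<and> Dom C f = a \<and> Cod C f = b"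
  by (simp add: hom_def)

text \<open>Stated with \<open>Dom\<close> and \<open>Cod\<close> in place of \<open>hom\<close>,
  these let the simplifier discharge composability without guessing objects.\<close>

lemma arr_comp [simp]: "f \<in> Arr C \<Longrightarrow> g \<in> Arr C \<Longrightarrow> Cod C f = Dom C g \<Longrightarrow> g \<cdot> f \<in> Arr C"
  and dom_comp [simp]: "f \<in> Arr C \<Longrightarrow> g \<in> Arr C \<Longrightarrow> Cod C f = Dom C g \<Longrightarrow> Dom C (g \<cdot> f) = Dom C f"
  and cod_comp [simp]: "f \<in> Arr C \<Longrightarrow> g \<in> Arr C \<Longrightarrow> Cod C f = Dom C g \<Longrightarrow> Cod C (g \<cdot> f) = Cod C g"
  using comp_hom[of f "Dom C f" "Cod C f" g "Cod C g"] by (auto simp: hom_def)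

lemma assoc: "f \<in> Arr C \<Longrightarrow> g \<in> Arr C \<Longrightarrow> h \<in> Arr C \<Longrightarrow> Cod C f = Dom C g \<Longrightarrow> Cod C g = Dom C h \<Longrightarrow>
    (h \<cdot> g) \<cdot> f = h \<cdot> (g \<cdot> f)"
  using comp_assoc[of f "Dom C f" "Cod C f" g "Cod C g" h "Cod C h"] by (auto simp: hom_def)

lemma dom_in [simp]: "f \<in> Arr C \<Longrightarrow> Dom C f \<in> Obj C"
  and cod_in [simp]: "f \<in> Arr C \<Longrightarrow> Cod C f \<in> Obj C"
  by (auto intro: dom_obj cod_obj)

lemma ident_arr [simp]: "a \<in> Obj C \<Longrightarrow> Ident C a \<in> Arr C"
  and ident_dom [simp]: "a \<in> Obj C \<Longrightarrow> Dom C (Ident C a) = a"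
  and ident_cod [simp]: "a \<in> Obj C \<Longrightarrow> Cod C (Ident C a) = a"
  using ident_hom[of a] by (auto simp: hom_def)

lemma ident_l [simp]: "f \<in> Arr C \<Longrightarrow> Cod C f = b \<Longrightarrow> Ident C b \<cdot> f = f"
  and ident_r [simp]: "f \<in> Arr C \<Longrightarrow> Dom C f = a \<Longrightarrow> f \<cdot> Ident C a = f"
  using ident_left ident_right by (auto simp: hom_def)

lemma trm_terminal: "is_terminal C (trm C)"
  using has_trm unfolding has_terminal_def trm_def by (rule someI_ex)

lemma trm_obj [simp]: "trm C \<in> Obj C"
  using trm_terminal by (simp add: is_terminal_def)

lemma bang_hom: "a \<in> Obj C \<Longrightarrow> bang C a \<in> hom C a (trm C)"
  using trm_terminal unfolding is_terminal_def bang_def by (metis (mono_tags, lifting) theI')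

lemma bang_simps [simp]: "a \<in> Obj C \<Longrightarrow> bang C a \<in> Arr C" "a \<in> Obj C \<Longrightarrow> Dom C (bang C a) = a"
    "a \<in> Obj C \<Longrightarrow> Cod C (bang C a) = trm C"
  using bang_hom by (auto simp: hom_def)

lemma terminal_unique: "is_terminal C t \<Longrightarrow> f \<in> hom C a t \<Longrightarrow> g \<in> hom C a t \<Longrightarrow> f = g"
  unfolding is_terminal_def by (metis hom_iff dom_in)

lemma bang_unique: "f \<in> hom C a (trm C) \<Longrightarrow> bang C a = f"
  by (metis bang_hom terminal_unique trm_terminal hom_iff dom_in)

lemma bang_comp: "f \<in> hom C a b \<Longrightarrow> bang C b \<cdot> f = bang C a"
  by (rule bang_unique[symmetric]) (auto simp: hom_iff)

lemma pb_is_pullback: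
  assumes "f \<in> Arr C" "g \<in> Arr C" "Cod C f = Cod C g"
  shows "is_pullback C f g (pbo C f g) (pb1 C f g) (pb2 C f g)"
proof -
  have "\<exists>t. (case t of (p, \<pi>1, \<pi>2) \<Rightarrow> is_pullback C f g p \<pi>1 \<pi>2)"
    using has_pb assms unfolding has_pullbacks_def by auto
  then have "case pb C f g of (p, \<pi>1, \<pi>2) \<Rightarrow> is_pullback C f g p \<pi>1 \<pi>2"
    unfolding pb_def by (rule someI_ex)
  then show ?thesis by (simp add: pbo_def pb1_def pb2_def split: prod.splits)
qed

lemma is_pullback_sym: "is_pullback C f g p q1 q2 \<Longrightarrow> is_pullback C g f p q2 q1"
  unfolding is_pullback_def by metis

lemma is_pullbackD:
  assumes "is_pullback C f g p q1 q2"
  shows "f \<in> Arr C" "g \<in> Arr C" "Cod C f = Cod C g" "p \<in> Obj C"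
    "q1 \<in> Arr C" "Dom C q1 = p" "Cod C q1 = Dom C f"
    "q2 \<in> Arr C" "Dom C q2 = p" "Cod C q2 = Dom C g" "f \<cdot> q1 = g \<cdot> q2"
  using assms by (auto simp: is_pullback_def hom_def)

lemma pullback_eqI:
  assumes "is_pullback C f g p q1 q2" "h \<in> hom C z p" "h' \<in> hom C z p"
    "q1 \<cdot> h = q1 \<cdot> h'" "q2 \<cdot> h = q2 \<cdot> h'"
  shows "h = h'"
proof -
  note d = is_pullbackD[OF assms(1)]
  have z: "z \<in> Obj C" using assms(2) by (auto simp: hom_def)
  have "f \<cdot> (q1 \<cdot> h) = g \<cdot> (q2 \<cdot> h)"
    using assoc[of h q1 f] assoc[of h q2 g] d assms(2) by (simp add: hom_def)
  moreover have "q1 \<cdot> h \<in> hom C z (Dom C f)" "q2 \<cdot> h \<in> hom C z (Dom C g)"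
    using d assms(2) by (auto simp: hom_def)
  ultimately have "\<exists>!k. k \<in> hom C z p \<and> q1 \<cdot> k = q1 \<cdot> h \<and> q2 \<cdot> k = q2 \<cdot> h"
    using assms(1) z unfolding is_pullback_def by blast
  then show ?thesis using assms by metis
qed

lemma pullback_ex:
  assumes "is_pullback C f g p q1 q2" "x \<in> hom C z (Dom C f)" "y \<in> hom C z (Dom C g)" "f \<cdot> x = g \<cdot> y"
  shows "\<exists>h. h \<in> hom C z p \<and> q1 \<cdot> h = x \<and> q2 \<cdot> h = y"
proof -
  have z: "z \<in> Obj C" using assms(2) by (auto simp: hom_def)
  then show ?thesis using assms unfolding is_pullback_def by blast
qed

lemma pbtup:
  assumes "f \<in> Arr C" "g \<in> Arr C" "Cod C f = Cod C g"
    "x \<in> hom C z (Dom C f)" "y \<in> hom C z (Dom C g)" "f \<cdot> x = g \<cdot> y"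
  shows "pbtup C f g x y \<in> hom C z (pbo C f g)"
    "pb1 C f g \<cdot> pbtup C f g x y = x" "pb2 C f g \<cdot> pbtup C f g x y = y"
proof -
  note P = pb_is_pullback[OF assms(1-3)]
  have "Dom C x = z" using assms(4) by (simp add: hom_def)
  moreover obtain h where "h \<in> hom C z (pbo C f g)" "pb1 C f g \<cdot> h = x" "pb2 C f g \<cdot> h = y"
    using pullback_ex[OF P assms(4-6)] by auto
  ultimately have "\<exists>!h. h \<in> hom C (Dom C x) (pbo C f g) \<and> pb1 C f g \<cdot> h = x \<and> pb2 C f g \<cdot> h = y"
    using pullback_eqI[OF P] by metis
  from theI'[OF this]
  show "pbtup C f g x y \<in> hom C z (pbo C f g)"
    "pb1 C f g \<cdot> pbtup C f g x y = x" "pb2 C f g \<cdot> pbtup C f g x y = y"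
    using \<open>Dom C x = z\<close> unfolding pbtup_def by auto
qed

section \<open>Generalised elements of finite products\<close>

lemma elems_Nil [simp]: "fs \<in> elems C z [] \<longleftrightarrow> fs = []"
  by (simp add: elems_def)

lemma elems_Cons: "fs \<in> elems C z (x # xs) \<longleftrightarrow>
    (\<exists>f fs'. fs = f # fs' \<and> f \<in> hom C z x \<and> fs' \<in> elems C z xs)"
  by (auto simp: elems_def list_all2_Cons1)

lemma elems_Cons_iff [simp]: "f # fs \<in> elems C z (x # xs) \<longleftrightarrow> f \<in> hom C z x \<and> fs \<in> elems C z xs"
  by (simp add: elems_def)

lemma elems_Cod: "fs \<in> elems C z xs \<Longrightarrow> map (Cod C) fs = xs"
  unfolding elems_def mem_Collect_eq by (induction xs fs rule: list_all2_induct) (auto simp: hom_def)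

lemma elems_obj: "fs \<in> elems C z xs \<Longrightarrow> set xs \<subseteq> Obj C"
  unfolding elems_def mem_Collect_eq by (induction xs fs rule: list_all2_induct) (auto simp: hom_def)

lemma elems_comp:
  "fs \<in> elems C z xs \<Longrightarrow> c \<in> hom C z' z \<Longrightarrow> map (\<lambda>f. f \<cdot> c) fs \<in> elems C z' xs"
  unfolding elems_def mem_Collect_eq by (induction xs fs rule: list_all2_induct) (auto simp: hom_def)

lemma elems_rev [simp]: "rev fs \<in> elems C z (rev xs) \<longleftrightarrow> fs \<in> elems C z xs"
  by (simp add: elems_def)

lemma elems_append:
  "fs \<in> elems C z xs \<Longrightarrow> gs \<in> elems C z ys \<Longrightarrow> fs @ gs \<in> elems C z (xs @ ys)"
  by (simp add: elems_def list_all2_appendI)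

lemma elems_nth: "fs \<in> elems C z xs \<longleftrightarrow> length fs = length xs \<and> (\<forall>i < length xs. fs ! i \<in> hom C z (xs ! i))"
  by (auto simp: elems_def list_all2_conv_all_nth)

lemma elems_hom: "fs \<in> elems C z xs \<Longrightarrow> f \<in> set fs \<Longrightarrow> f \<in> Arr C \<and> Dom C f = z"
  unfolding elems_def mem_Collect_eq by (induction xs fs rule: list_all2_induct) (auto simp: hom_def)

lemma map_comp_comp: "fs \<in> elems C z xs \<Longrightarrow> c \<in> hom C z' z \<Longrightarrow> d \<in> hom C z'' z' \<Longrightarrow>
   map ((\<lambda>f. f \<cdot> d) \<circ> (\<lambda>f. f \<cdot> c)) fs = map (\<lambda>f. f \<cdot> (c \<cdot> d)) fs"
  using elems_hom assoc by (auto simp: hom_def)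

lemma map_comp_ident: "fs \<in> elems C z xs \<Longrightarrow> map (\<lambda>f. f \<cdot> Ident C z) fs = fs"
  by (rule map_idI) (auto dest: elems_hom)

text \<open>The empty product is a terminal object, and a product with one more factor is a pullback
  over the terminal object.\<close>

lemma ex_product: "set xs \<subseteq> Obj C \<Longrightarrow> \<exists>p \<pi>s. is_product C xs p \<pi>s"
proof (induction xs)
  case Nil
  show ?case using trm_terminal
    by (intro exI[of _ "trm C"] exI[of _ "[]"]) (auto simp: is_product_def is_terminal_def)
next
  case (Cons x xs)
  then obtain p ps where p: "is_product C xs p ps" by auto
  have x: "x \<in> Obj C" and xs: "set xs \<subseteq> Obj C" using Cons.prems by auto
  have pO: "p \<in> Obj C" and ps: "ps \<in> elems C p xs" using p by (auto simp: is_product_def)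
  let ?f = "bang C x" and ?g = "bang C p"
  let ?q = "pbo C ?f ?g" and ?q1 = "pb1 C ?f ?g" and ?q2 = "pb2 C ?f ?g"
  have P: "is_pullback C ?f ?g ?q ?q1 ?q2"
    using x pO by (intro pb_is_pullback) auto
  note d = is_pullbackD[OF P]
  have q2: "?q2 \<in> hom C ?q p" using d pO by (simp add: hom_def)
  have q1: "?q1 \<in> hom C ?q x" using d x by (simp add: hom_def)
  have "is_product C (x # xs) ?q (?q1 # map (\<lambda>f. f \<cdot> ?q2) ps)"
    unfolding is_product_def
  proof (intro conjI ballI)
    show "set (x # xs) \<subseteq> Obj C" by fact
    show "?q \<in> Obj C" using d by simp
    show "?q1 # map (\<lambda>f. f \<cdot> ?q2) ps \<in> elems C ?q (x # xs)"
      using q1 elems_comp[OF ps q2] by simp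
    fix z fs assume z: "z \<in> Obj C" and fs: "fs \<in> elems C z (x # xs)"
    obtain f fs' where f: "fs = f # fs'" "f \<in> hom C z x" "fs' \<in> elems C z xs"
      using fs by (auto simp: elems_Cons)
    have ex1: "\<exists>!k. k \<in> hom C z p \<and> map (\<lambda>\<pi>. \<pi> \<cdot> k) ps = fs'"
      using p z f(3) unfolding is_product_def by blast
    have eqv: "map (\<lambda>\<pi>. \<pi> \<cdot> h) (map (\<lambda>f. f \<cdot> ?q2) ps) = map (\<lambda>\<pi>. \<pi> \<cdot> (?q2 \<cdot> h)) ps"
      if "h \<in> hom C z ?q" for h
      using map_comp_comp[OF ps q2 that] by simp
    show "\<exists>!h. h \<in> hom C z ?q \<and> map (\<lambda>\<pi>. \<pi> \<cdot> h) (?q1 # map (\<lambda>f. f \<cdot> ?q2) ps) = fs"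
    proof -
      obtain k where k: "k \<in> hom C z p" "map (\<lambda>\<pi>. \<pi> \<cdot> k) ps = fs'" using ex1 by auto
      have bb: "bang C x \<cdot> f = bang C p \<cdot> k" using bang_comp[OF f(2)] bang_comp[OF k(1)] by simp
      obtain h where h: "h \<in> hom C z ?q" "?q1 \<cdot> h = f" "?q2 \<cdot> h = k"
        using pullback_ex[OF P, of f z k] f(2) k(1) bb x pO by auto
      show ?thesis
      proof (rule ex1I[of _ h])
        show "h \<in> hom C z ?q \<and> map (\<lambda>\<pi>. \<pi> \<cdot> h) (?q1 # map (\<lambda>f. f \<cdot> ?q2) ps) = fs"
          using h k f eqv[OF h(1)] by simp
      next
        fix h' assume h': "h' \<in> hom C z ?q \<and> map (\<lambda>\<pi>. \<pi> \<cdot> h') (?q1 # map (\<lambda>f. f \<cdot> ?q2) ps) = fs"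
        then have "?q1 \<cdot> h' = f" "map (\<lambda>\<pi>. \<pi> \<cdot> (?q2 \<cdot> h')) ps = fs'"
          using f eqv[of h'] by auto
        moreover have "?q2 \<cdot> h' \<in> hom C z p" using h' q2 by (auto simp: hom_def)
        ultimately show "h' = h"
          using pullback_eqI[OF P] h h' k ex1 by metis
      qed
    qed
  qed
  then show ?case by blast
qed

lemma prd_is_product: "set xs \<subseteq> Obj C \<Longrightarrow> is_product C xs (prd C xs) (prjs C xs)"
proof -
  assume "set xs \<subseteq> Obj C"
  then have "\<exists>t. case t of (p, \<pi>s) \<Rightarrow> is_product C xs p \<pi>s" using ex_product by auto
  then have "case prd_cone C xs of (p, \<pi>s) \<Rightarrow> is_product C xs p \<pi>s"
    unfolding prd_cone_def by (rule someI_ex)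
  then show ?thesis by (simp add: prd_def prjs_def split: prod.splits)
qed

lemma prd_obj [simp]: "set xs \<subseteq> Obj C \<Longrightarrow> prd C xs \<in> Obj C"
  using prd_is_product by (auto simp: is_product_def)

lemma prjs_elems: "set xs \<subseteq> Obj C \<Longrightarrow> prjs C xs \<in> elems C (prd C xs) xs"
  using prd_is_product by (auto simp: is_product_def)

text \<open>\<open>tup\<close> reads its list of objects off the codomains, which
  \<open>elems_Cod\<close> identifies with \<open>xs\<close>.\<close>

lemma tup:
  assumes "z \<in> Obj C" "fs \<in> elems C z xs"
  shows tup_hom: "tup C z fs \<in> hom C z (prd C xs)"
    and prjs_tup: "map (\<lambda>\<pi>. \<pi> \<cdot> tup C z fs) (prjs C xs) = fs"
proof -
  have "\<exists>!h. h \<in> hom C z (prd C xs) \<and> map (\<lambda>\<pi>. \<pi> \<cdot> h) (prjs C xs) = fs"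
    using prd_is_product[OF elems_obj[OF assms(2)]] assms unfolding is_product_def by blast
  from theI'[OF this] show "tup C z fs \<in> hom C z (prd C xs)"
    "map (\<lambda>\<pi>. \<pi> \<cdot> tup C z fs) (prjs C xs) = fs"
    unfolding tup_def Let_def elems_Cod[OF assms(2)] by auto
qed

lemma prd_eqI:
  assumes "set xs \<subseteq> Obj C" "h \<in> hom C z (prd C xs)" "h' \<in> hom C z (prd C xs)"
    "map (\<lambda>\<pi>. \<pi> \<cdot> h) (prjs C xs) = map (\<lambda>\<pi>. \<pi> \<cdot> h') (prjs C xs)"
  shows "h = h'"
proof -
  have "z \<in> Obj C" using assms(2) by (auto simp: hom_def)
  moreover have "map (\<lambda>\<pi>. \<pi> \<cdot> h) (prjs C xs) \<in> elems C z xs"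
    using elems_comp[OF prjs_elems] assms by auto
  ultimately show ?thesis using prd_is_product[OF assms(1)] assms unfolding is_product_def by metis
qed

lemma tup_prjs: "set xs \<subseteq> Obj C \<Longrightarrow> h \<in> hom C z (prd C xs) \<Longrightarrow> tup C z (map (\<lambda>\<pi>. \<pi> \<cdot> h) (prjs C xs)) = h"
  using tup[OF _ elems_comp[OF prjs_elems]] by (intro prd_eqI[of xs]) (auto simp: hom_def)

lemma tup_comp:
  assumes "fs \<in> elems C z xs" "c \<in> hom C z' z"
  shows "tup C z fs \<cdot> c = tup C z' (map (\<lambda>f. f \<cdot> c) fs)"
proof (rule prd_eqI)
  show xs: "set xs \<subseteq> Obj C" using elems_obj assms by blast
  have z: "z \<in> Obj C" "z' \<in> Obj C" using assms by (auto simp: hom_def)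
  note t = tup[OF z(1) assms(1)] and t' = tup[OF z(2) elems_comp[OF assms]]
  show "tup C z fs \<cdot> c \<in> hom C z' (prd C xs)" using t assms by (auto simp: hom_def)
  show "tup C z' (map (\<lambda>f. f \<cdot> c) fs) \<in> hom C z' (prd C xs)" by (rule t')
  have "map (\<lambda>\<pi>. \<pi> \<cdot> (tup C z fs \<cdot> c)) (prjs C xs)
      = map (\<lambda>f. f \<cdot> c) (map (\<lambda>\<pi>. \<pi> \<cdot> tup C z fs) (prjs C xs))"
    using map_comp_comp[OF prjs_elems[OF xs] t(1) assms(2)] by simp
  then show "map (\<lambda>\<pi>. \<pi> \<cdot> (tup C z fs \<cdot> c)) (prjs C xs) =
      map (\<lambda>\<pi>. \<pi> \<cdot> tup C z' (map (\<lambda>f. f \<cdot> c) fs)) (prjs C xs)"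
    using t t' by simp
qed

lemma tup_inj:
  "z \<in> Obj C \<Longrightarrow> fs \<in> elems C z xs \<Longrightarrow> fs' \<in> elems C z xs \<Longrightarrow> tup C z fs = tup C z fs' \<Longrightarrow> fs = fs'"
  by (metis prjs_tup)

lemma iso_obtain:
  assumes "is_iso C f"
  obtains g where "g \<in> Arr C" "Dom C g = Cod C f" "Cod C g = Dom C f" "g \<cdot> f = Ident C (Dom C f)"
    "f \<cdot> g = Ident C (Cod C f)"
  using assms by (auto simp: is_iso_def hom_def)

text \<open>Later \<open>t\<close> is the hom-object of the terminal graph: strings in it carry no
  information beyond their length.\<close>

lemma terminal_elems_eq:
  "is_terminal C t \<Longrightarrow> fs \<in> elems C z (replicate k t) \<Longrightarrow> gs \<in> elems C z (replicate k t) \<Longrightarrow> fs = gs"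
  by (rule nth_equalityI) (auto simp: elems_nth intro: terminal_unique)

lemma elems_replicate: "fs \<in> elems C z (replicate k x) \<longleftrightarrow> length fs = k \<and> (\<forall>i < k. fs ! i \<in> hom C z x)"
  by (auto simp: elems_nth)

section \<open>Covering families\<close>

text \<open>\<open>csieve\<close> is the canonical Grothendieck topology: a sieve covers if it and all its pullbacks
  are effective-epimorphic.\<close>

definition effective :: "'o \<Rightarrow> 'm set \<Rightarrow> bool" where
  "effective Z S \<longleftrightarrow> (\<forall>b \<phi>. b \<in> Obj C \<longrightarrow> (\<forall>c \<in> S. \<phi> c \<in> hom C (Dom C c) b) \<longrightarrow>
     (\<forall>c \<in> S. \<forall>t \<in> Arr C. Cod C t = Dom C c \<longrightarrow> \<phi> (c \<cdot> t) = \<phi> c \<cdot> t) \<longrightarrow>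
     (\<exists>!h. h \<in> hom C Z b \<and> (\<forall>c \<in> S. h \<cdot> c = \<phi> c)))"

definition sieve :: "'o \<Rightarrow> 'm set \<Rightarrow> bool" where
  "sieve Z S \<longleftrightarrow> Z \<in> Obj C \<and> (\<forall>c \<in> S. c \<in> Arr C \<and> Cod C c = Z) \<and>
     (\<forall>c \<in> S. \<forall>t \<in> Arr C. Cod C t = Dom C c \<longrightarrow> c \<cdot> t \<in> S)"

definition pull :: "'m \<Rightarrow> 'm set \<Rightarrow> 'm set" where
  "pull f S = {t \<in> Arr C. Cod C t = Dom C f \<and> f \<cdot> t \<in> S}"

definition csieve :: "'o \<Rightarrow> 'm set \<Rightarrow> bool" where
  "csieve Z S \<longleftrightarrow> sieve Z S \<and> (\<forall>f \<in> Arr C. Cod C f = Z \<longrightarrow> effective (Dom C f) (pull f S))"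

lemma sieve_pull: "sieve Z S \<Longrightarrow> f \<in> Arr C \<Longrightarrow> Cod C f = Z \<Longrightarrow> sieve (Dom C f) (pull f S)"
  unfolding sieve_def pull_def by (auto simp flip: assoc)

lemma pull_pull: "f \<in> Arr C \<Longrightarrow> g \<in> Arr C \<Longrightarrow> Cod C g = Dom C f \<Longrightarrow> pull g (pull f S) = pull (f \<cdot> g) S"
  unfolding pull_def by (auto simp: assoc)

lemma csieve_pull: "csieve Z S \<Longrightarrow> f \<in> Arr C \<Longrightarrow> Cod C f = Z \<Longrightarrow> csieve (Dom C f) (pull f S)"
  unfolding csieve_def by (auto simp: sieve_pull pull_pull) (metis arr_comp cod_comp dom_comp)

lemma pull_ident: "sieve Z S \<Longrightarrow> pull (Ident C Z) S = S"
  unfolding pull_def sieve_def by auto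

lemma csieve_effective: "csieve Z S \<Longrightarrow> effective Z S"
  using pull_ident[of Z S] unfolding csieve_def sieve_def by (metis ident_arr ident_cod ident_dom)

text \<open>The restrictions of \<open>h\<close> form a matching family on \<open>S\<close>, and
  both \<open>h\<close> and \<open>h'\<close> amalgamate it.\<close>

lemma effective_eq: 
  assumes "effective Z S" "sieve Z S" "h \<in> hom C Z b" "h' \<in> hom C Z b" "\<And>c. c \<in> S \<Longrightarrow> h \<cdot> c = h' \<cdot> c"
  shows "h = h'"
proof -
  have "b \<in> Obj C" using assms(3) by (auto simp: hom_def)
  moreover have "\<forall>c\<in>S. h \<cdot> c \<in> hom C (Dom C c) b" using assms(2,3) by (auto simp: hom_def sieve_def)
  moreover have "\<forall>c \<in> S. \<forall>t \<in> Arr C. Cod C t = Dom C c \<longrightarrow> h \<cdot> (c \<cdot> t) = (h \<cdot> c) \<cdot> t"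
    using assms(2,3) by (auto simp: hom_def sieve_def assoc)
  ultimately have "\<exists>!k. k \<in> hom C Z b \<and> (\<forall>c \<in> S. k \<cdot> c = h \<cdot> c)"
    using assms(1)[unfolded effective_def, rule_format, of b "\<lambda>c. h \<cdot> c"] by blast
  then show ?thesis using assms(3,4,5) by metis
qed

text \<open>The sieve is then maximal, and a matching family is determined by its value at the
  identity.\<close>

lemma effective_ident: 
  assumes "sieve Z S" "Ident C Z \<in> S" shows "effective Z S"
  unfolding effective_def
proof (intro allI impI)
  fix b \<phi> assume b: "b \<in> Obj C" and 1: "\<forall>c \<in> S. \<phi> c \<in> hom C (Dom C c) b"
    and 2: "\<forall>c \<in> S. \<forall>t \<in> Arr C. Cod C t = Dom C c \<longrightarrow> \<phi> (c \<cdot> t) = \<phi> c \<cdot> t"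
  have Z: "Z \<in> Obj C" using assms by (simp add: sieve_def)
  show "\<exists>!h. h \<in> hom C Z b \<and> (\<forall>c \<in> S. h \<cdot> c = \<phi> c)"
  proof (rule ex1I[of _ "\<phi> (Ident C Z)"])
    show "\<phi> (Ident C Z) \<in> hom C Z b \<and> (\<forall>c\<in>S. \<phi> (Ident C Z) \<cdot> c = \<phi> c)"
    proof (intro conjI ballI)
      show "\<phi> (Ident C Z) \<in> hom C Z b" using 1 assms(2) Z by force
      fix c assume "c \<in> S"
      then have c: "c \<in> Arr C" "Cod C c = Z" using assms(1) by (auto simp: sieve_def)
      then have "\<phi> (Ident C Z \<cdot> c) = \<phi> (Ident C Z) \<cdot> c"
        using 2[rule_format, OF assms(2), of c] Z by simp
      then show "\<phi> (Ident C Z) \<cdot> c = \<phi> c" using c by simp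
    qed
  next
    fix h assume "h \<in> hom C Z b \<and> (\<forall>c\<in>S. h \<cdot> c = \<phi> c)"
    then show "h = \<phi> (Ident C Z)" using assms(2) by (auto simp: hom_def)
  qed
qed

text \<open>The local character axiom of a Grothendieck topology. A matching family on
  \<open>R\<close> is first amalgamated over each \<open>c\<close> in \<open>S\<close>, to
  \<open>k c\<close>; these form a matching family on \<open>S\<close>, and its amalgamation
  \<open>h\<close> is compared with the given family after pulling \<open>S\<close> back.\<close>

lemma csieve_trans:
  assumes S: "csieve Z S" and R: "sieve Z R" and SR: "\<And>c. c \<in> S \<Longrightarrow> csieve (Dom C c) (pull c R)"
  shows "csieve Z R"
proof -
  \<comment> \<open>Kept general in \<open>Z\<close>, \<open>S\<close> and \<open>R\<close>, because
    it is applied below to the pullbacks of the two sieves along every \<open>f\<close>.\<close>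
  have main: "effective Z R" if S: "csieve Z S" and R: "sieve Z R"
    and SR: "\<And>c. c \<in> S \<Longrightarrow> csieve (Dom C c) (pull c R)" for Z S R
    unfolding effective_def
  proof (intro allI impI)
    fix b \<phi> assume b: "b \<in> Obj C" and 1: "\<forall>c \<in> R. \<phi> c \<in> hom C (Dom C c) b"
      and 2: "\<forall>c \<in> R. \<forall>t \<in> Arr C. Cod C t = Dom C c \<longrightarrow> \<phi> (c \<cdot> t) = \<phi> c \<cdot> t"
    have sS: "sieve Z S" using S by (simp add: csieve_def)
    have arrS: "c \<in> Arr C" "Cod C c = Z" if "c \<in> S" for c using sS that by (auto simp: sieve_def)
    have arrR: "c \<in> Arr C" "Cod C c = Z" if "c \<in> R" for c using R that by (auto simp: sieve_def)
    have ex: "\<exists>k. k \<in> hom C (Dom C c) b \<and> (\<forall>t \<in> pull c R. k \<cdot> t = \<phi> (c \<cdot> t))" if c: "c \<in> S" for c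
    proof -
      note e = csieve_effective[OF SR[OF c]]
      have "\<forall>t\<in>pull c R. \<phi> (c \<cdot> t) \<in> hom C (Dom C t) b"
        using 1 arrS[OF c] by (force simp: pull_def)
      moreover have "\<forall>t\<in>pull c R. \<forall>s\<in>Arr C. Cod C s = Dom C t \<longrightarrow> \<phi> (c \<cdot> (t \<cdot> s)) = \<phi> (c \<cdot> t) \<cdot> s"
        using 2 arrS[OF c] by (auto simp: pull_def) (metis assoc dom_comp)
      ultimately show ?thesis
        using e[unfolded effective_def, rule_format, of b "\<lambda>t. \<phi> (c \<cdot> t)"] b by blast
    qed
    define k where "k c = (SOME k. k \<in> hom C (Dom C c) b \<and> (\<forall>t \<in> pull c R. k \<cdot> t = \<phi> (c \<cdot> t)))" for c
    have k: "k c \<in> hom C (Dom C c) b" "\<And>t. t \<in> pull c R \<Longrightarrow> k c \<cdot> t = \<phi> (c \<cdot> t)" if "c \<in> S" for c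
      using someI_ex[OF ex[OF that]] unfolding k_def[symmetric] by auto
    \<comment> \<open>Compatibility of the local solutions is itself checked locally, on the
      pullback of \<open>R\<close>.\<close>
    have kc: "k (c \<cdot> t) = k c \<cdot> t" if c: "c \<in> S" and t: "t \<in> Arr C" "Cod C t = Dom C c" for c t
    proof -
      have ct: "c \<cdot> t \<in> S" using sS c t by (auto simp: sieve_def)
      have d: "Dom C (c \<cdot> t) = Dom C t" using t arrS[OF c] by simp
      have cs: "csieve (Dom C t) (pull (c \<cdot> t) R)" using SR[OF ct] d by simp
      show ?thesis
      proof (rule effective_eq[OF csieve_effective[OF cs]])
        show "sieve (Dom C t) (pull (c \<cdot> t) R)" using cs by (simp add: csieve_def)
        show "k (c \<cdot> t) \<in> hom C (Dom C t) b" using k(1)[OF ct] d by simp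
        show "k c \<cdot> t \<in> hom C (Dom C t) b" using k(1)[OF c] t by (auto simp: hom_def)
        fix s assume s: "s \<in> pull (c \<cdot> t) R"
        then have ts: "t \<cdot> s \<in> pull c R" and s': "s \<in> Arr C" "Cod C s = Dom C t"
          using t arrS[OF c] by (auto simp: pull_def assoc)
        have "k (c \<cdot> t) \<cdot> s = \<phi> (c \<cdot> (t \<cdot> s))" using k(2)[OF ct s] s' t arrS[OF c] by (simp add: assoc)
        also have "\<dots> = k c \<cdot> (t \<cdot> s)" using k(2)[OF c ts] by simp
        also have "\<dots> = (k c \<cdot> t) \<cdot> s" using s' t k(1)[OF c] by (simp add: assoc hom_def)
        finally show "k (c \<cdot> t) \<cdot> s = (k c \<cdot> t) \<cdot> s" .
      qed
    qed
    have "\<exists>!h. h \<in> hom C Z b \<and> (\<forall>c \<in> S. h \<cdot> c = k c)"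
      using csieve_effective[OF S, unfolded effective_def, rule_format, of b k] b k(1) kc by blast
    then obtain h where h: "h \<in> hom C Z b" "\<And>c. c \<in> S \<Longrightarrow> h \<cdot> c = k c" by blast
    show "\<exists>!h. h \<in> hom C Z b \<and> (\<forall>c \<in> R. h \<cdot> c = \<phi> c)"
    proof (rule ex1I[of _ h], intro conjI ballI h)
      fix r assume r: "r \<in> R"
      note ra = arrR[OF r]
      \<comment> \<open>An arrow \<open>r\<close> of \<open>R\<close> need not lie in
        \<open>S\<close>, so \<open>h \<cdot> r\<close> and \<open>\<phi> r\<close> are compared on
        the pullback of \<open>S\<close> along \<open>r\<close>.\<close>
      have cs: "csieve (Dom C r) (pull r S)" using csieve_pull[OF S] ra by auto
      show "h \<cdot> r = \<phi> r"
      proof (rule effective_eq[OF csieve_effective[OF cs]])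
        show "sieve (Dom C r) (pull r S)" using cs by (simp add: csieve_def)
        show "h \<cdot> r \<in> hom C (Dom C r) b" using h(1) ra by (auto simp: hom_def)
        show "\<phi> r \<in> hom C (Dom C r) b" using 1 r by auto
        fix s assume "s \<in> pull r S"
        then have s: "s \<in> Arr C" "Cod C s = Dom C r" "r \<cdot> s \<in> S" by (auto simp: pull_def)
        have rs: "r \<cdot> s \<in> R" using R r s by (auto simp: sieve_def)
        have a: "r \<cdot> s \<in> Arr C" "Dom C (r \<cdot> s) = Dom C s" using ra s by auto
        \<comment> \<open>As \<open>r \<cdot> s\<close> is already in \<open>R\<close>, the local
          solution \<open>k (r \<cdot> s)\<close> may be evaluated at the identity.\<close>
        have "Ident C (Dom C s) \<in> pull (r \<cdot> s) R" using a s rs by (auto simp: pull_def)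
        then have "k (r \<cdot> s) = \<phi> (r \<cdot> s)" using k[OF s(3)] a s by (auto simp: hom_def) (metis ident_r)
        then have "h \<cdot> (r \<cdot> s) = \<phi> r \<cdot> s" using h(2)[OF s(3)] 2 r s by simp
        then show "(h \<cdot> r) \<cdot> s = \<phi> r \<cdot> s" using h(1) ra s by (simp add: assoc hom_def)
      qed
    next
      fix h' assume h': "h' \<in> hom C Z b \<and> (\<forall>c\<in>R. h' \<cdot> c = \<phi> c)"
      show "h' = h"
      proof (rule effective_eq[OF csieve_effective[OF S] sS])
        show "h' \<in> hom C Z b" "h \<in> hom C Z b" using h' h by auto
        fix c assume c: "c \<in> S"
        note ca = arrS[OF c]
        show "h' \<cdot> c = h \<cdot> c"
        proof (rule effective_eq[OF csieve_effective[OF SR[OF c]]])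
          show "sieve (Dom C c) (pull c R)" using SR[OF c] by (simp add: csieve_def)
          show "h' \<cdot> c \<in> hom C (Dom C c) b" "h \<cdot> c \<in> hom C (Dom C c) b"
            using h h' ca by (auto simp: hom_def)
          fix t assume t: "t \<in> pull c R"
          then have "(h' \<cdot> c) \<cdot> t = \<phi> (c \<cdot> t)" using h' ca by (auto simp: pull_def hom_def assoc)
          also have "\<dots> = (h \<cdot> c) \<cdot> t" using k(2)[OF c t] h(2)[OF c] by simp
          finally show "(h' \<cdot> c) \<cdot> t = (h \<cdot> c) \<cdot> t" .
        qed
      qed
    qed
  qed
  show ?thesis unfolding csieve_def
  proof (intro conjI R ballI impI)
    fix f assume f: "f \<in> Arr C" "Cod C f = Z"
    show "effective (Dom C f) (pull f R)"
    proof (rule main)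
      show "csieve (Dom C f) (pull f S)" using csieve_pull[OF S f] .
      show "sieve (Dom C f) (pull f R)" using sieve_pull[OF R f] .
      fix c assume "c \<in> pull f S"
      then show "csieve (Dom C c) (pull c (pull f R))"
        using SR[of "f \<cdot> c"] f by (auto simp: pull_def[of f S] pull_pull)
    qed
  qed
qed

lemma csieve_ident:
  assumes "sieve Z S" "Ident C Z \<in> S" shows "csieve Z S"
  unfolding csieve_def
proof (intro conjI assms ballI impI)
  fix f assume f: "f \<in> Arr C" "Cod C f = Z"
  have "Z \<in> Obj C" using assms(1) by (simp add: sieve_def)
  then have "Ident C Z \<cdot> f \<in> S" using assms f unfolding sieve_def by (metis ident_dom)
  then have "f \<in> S" using f by simp
  then have "Ident C (Dom C f) \<in> pull f S" using f by (auto simp: pull_def)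
  then show "effective (Dom C f) (pull f S)" using effective_ident sieve_pull[OF assms(1) f] by blast
qed

text \<open>For \<open>c\<close> in \<open>S\<close> the pullback of \<open>R\<close> along
  \<open>c\<close> contains the identity, so transitivity applies.\<close>

lemma csieve_mono:
  assumes "csieve Z S" "sieve Z R" "S \<subseteq> R" shows "csieve Z R"
proof (rule csieve_trans[OF assms(1,2)])
  fix c assume c: "c \<in> S"
  then have ca: "c \<in> Arr C" "Cod C c = Z" using assms by (auto simp: sieve_def)
  show "csieve (Dom C c) (pull c R)"
    using csieve_ident[OF sieve_pull[OF assms(2) ca]] c ca assms(3) by (auto simp: pull_def)
qed

section \<open>Properties that hold locally\<close>

definition gen :: "'o \<Rightarrow> ('m \<Rightarrow> bool) \<Rightarrow> 'm set" where
  "gen Z Q = {c \<cdot> s | c s. c \<in> Arr C \<and> Cod C c = Z \<and> Q c \<and> s \<in> Arr C \<and> Cod C s = Dom C c}"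

text \<open>Read \<open>covers Z Q\<close> as: \<open>Q\<close> holds locally on \<open>Z\<close>.
  The predicate may fail to be stable under restriction, since it only generates the sieve.\<close>

definition covers :: "'o \<Rightarrow> ('m \<Rightarrow> bool) \<Rightarrow> bool" where
  "covers Z Q \<longleftrightarrow> csieve Z (gen Z Q)"

lemma sieve_gen: "Z \<in> Obj C \<Longrightarrow> sieve Z (gen Z Q)"
  unfolding sieve_def gen_def by (auto simp: assoc) (metis arr_comp cod_comp)

lemma genI: "c \<in> Arr C \<Longrightarrow> Cod C c = Z \<Longrightarrow> Q c \<Longrightarrow> c \<in> gen Z Q"
  unfolding gen_def mem_Collect_eq by (rule exI[of _ c], rule exI[of _ "Ident C (Dom C c)"]) simp

lemma covers_obj: "covers Z Q \<Longrightarrow> Z \<in> Obj C"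
  by (auto simp: covers_def csieve_def sieve_def)

text \<open>Agreement on the generators passes to the generated sieve, and a covering sieve
  separates arrows.\<close>

lemma covers_eq:
  assumes "covers Z Q" "h \<in> hom C Z b" "h' \<in> hom C Z b"
    "\<And>c. c \<in> hom C (Dom C c) Z \<Longrightarrow> Q c \<Longrightarrow> h \<cdot> c = h' \<cdot> c"
  shows "h = h'"
proof (rule effective_eq[OF _ _ assms(2,3)])
  show "effective Z (gen Z Q)" using assms csieve_effective by (simp add: covers_def)
  show "sieve Z (gen Z Q)" using assms by (simp add: covers_def csieve_def)
  fix c assume "c \<in> gen Z Q"
  then obtain d s where "c = d \<cdot> s" "d \<in> Arr C" "Cod C d = Z" "Q d" "s \<in> Arr C" "Cod C s = Dom C d"
    by (auto simp: gen_def)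
  then show "h \<cdot> c = h' \<cdot> c" using assms(2-4) assoc[of s d h] assoc[of s d h'] by (auto simp: hom_def)
qed

lemma covers_mono:
  assumes "covers Z Q" "\<And>c. c \<in> hom C (Dom C c) Z \<Longrightarrow> Q c \<Longrightarrow> R c"
  shows "covers Z R"
  unfolding covers_def
proof (rule csieve_mono[OF assms(1)[unfolded covers_def]])
  show "sieve Z (gen Z R)" using covers_obj[OF assms(1)] by (rule sieve_gen)
  show "gen Z Q \<subseteq> gen Z R" using assms(2) by (auto simp: gen_def hom_def)
qed

text \<open>Used to decompose in stages, for instance a path first and the entries of its string
  afterwards.\<close>

lemma covers_trans:
  assumes Q: "covers Z Q" and R: "\<And>c. c \<in> hom C (Dom C c) Z \<Longrightarrow> Q c \<Longrightarrow> covers (Dom C c) (\<lambda>t. R (c \<cdot> t))"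
  shows "covers Z R"
  unfolding covers_def
proof (rule csieve_trans[OF Q[unfolded covers_def]])
  show sR: "sieve Z (gen Z R)" using covers_obj[OF Q] by (rule sieve_gen)
  fix g assume "g \<in> gen Z Q"
  then obtain c s where g: "g = c \<cdot> s" "c \<in> Arr C" "Cod C c = Z" "Q c" "s \<in> Arr C" "Cod C s = Dom C c"
    by (auto simp: gen_def)
  have cs: "csieve (Dom C c) (gen (Dom C c) (\<lambda>t. R (c \<cdot> t)))"
    using R[of c] g by (simp add: hom_def covers_def)
  have "gen (Dom C c) (\<lambda>t. R (c \<cdot> t)) \<subseteq> pull c (gen Z R)"
  proof
    fix x assume "x \<in> gen (Dom C c) (\<lambda>t. R (c \<cdot> t))"
    then obtain t u where x: "x = t \<cdot> u" "t \<in> Arr C" "Cod C t = Dom C c" "R (c \<cdot> t)" "u \<in> Arr C" "Cod C u = Dom C t"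
      by (auto simp: gen_def)
    have "c \<cdot> x = (c \<cdot> t) \<cdot> u" using x g by (simp add: assoc)
    then have "c \<cdot> x \<in> gen Z R" unfolding gen_def mem_Collect_eq using x g
      by (intro exI[of _ "c \<cdot> t"] exI[of _ u] conjI) simp_all
    then show "x \<in> pull c (gen Z R)" using x g by (simp add: pull_def)
  qed
  then have "csieve (Dom C c) (pull c (gen Z R))"
    using csieve_mono[OF cs] sieve_pull[OF sR] g by auto
  then have "csieve (Dom C s) (pull s (pull c (gen Z R)))" using csieve_pull g by auto
  then show "csieve (Dom C g) (pull g (gen Z R))" using g by (simp add: pull_pull)
qed

lemma covers_triv: "Z \<in> Obj C \<Longrightarrow> R (Ident C Z) \<Longrightarrow> covers Z R"
  unfolding covers_def by (intro csieve_ident sieve_gen genI) auto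

text \<open>An arrow \<open>t\<close> belongs to the pulled-back sieve exactly when
  \<open>f \<cdot> t\<close> factors through a generator; this gives the last hypothesis its
  form.\<close>

lemma covers_pull:
  assumes "covers Z Q" "f \<in> hom C W Z" "\<And>c t s. c \<in> hom C (Dom C c) Z \<Longrightarrow> Q c \<Longrightarrow> t \<in> hom C (Dom C t) W
     \<Longrightarrow> s \<in> hom C (Dom C t) (Dom C c) \<Longrightarrow> f \<cdot> t = c \<cdot> s \<Longrightarrow> R t"
  shows "covers W R"
  unfolding covers_def
proof (rule csieve_mono)
  have f: "f \<in> Arr C" "Dom C f = W" "Cod C f = Z" using assms(2) by (auto simp: hom_def)
  show "csieve W (pull f (gen Z Q))" using csieve_pull[OF assms(1)[unfolded covers_def]] f by auto
  show "sieve W (gen W R)" using f by (auto intro: sieve_gen)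
  show "pull f (gen Z Q) \<subseteq> gen W R"
  proof
    fix t assume "t \<in> pull f (gen Z Q)"
    then obtain c s where t: "t \<in> Arr C" "Cod C t = W" "f \<cdot> t = c \<cdot> s" "c \<in> Arr C" "Cod C c = Z" "Q c" "s \<in> Arr C" "Cod C s = Dom C c"
      using f by (auto simp: gen_def pull_def)
    have "Dom C s = Dom C t" using t f by (metis dom_comp)
    then have "R t" using assms(3)[of c t s] t by (auto simp: hom_def)
    then show "t \<in> gen W R" using t by (auto intro: genI)
  qed
qed

text \<open>\<open>\<rho>\<close> is the graph of a compatible family of arrows on the members of the cover.\<close>

lemma covers_glue:
  assumes Q: "covers Z Q" and b: "b \<in> Obj C"
    and ex: "\<And>c. c \<in> hom C (Dom C c) Z \<Longrightarrow> Q c \<Longrightarrow> \<exists>v. \<rho> c v"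
    and ty: "\<And>c v. c \<in> hom C (Dom C c) Z \<Longrightarrow> \<rho> c v \<Longrightarrow> v \<in> hom C (Dom C c) b"
    and un: "\<And>c v v'. c \<in> hom C (Dom C c) Z \<Longrightarrow> \<rho> c v \<Longrightarrow> \<rho> c v' \<Longrightarrow> v = v'"
    and st: "\<And>c v t. c \<in> hom C (Dom C c) Z \<Longrightarrow> \<rho> c v \<Longrightarrow> t \<in> hom C (Dom C t) (Dom C c) \<Longrightarrow> \<rho> (c \<cdot> t) (v \<cdot> t)"
  shows "\<exists>!h. h \<in> hom C Z b \<and> (\<forall>c v. c \<in> hom C (Dom C c) Z \<longrightarrow> \<rho> c v \<longrightarrow> h \<cdot> c = v)"
proof -
  let ?R = "\<lambda>c. \<exists>v. \<rho> c v"
  have cR: "covers Z ?R" by (rule covers_mono[OF Q]) (rule ex)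
  \<comment> \<open>By \<open>st\<close> the domain of \<open>\<rho>\<close> is closed under
    restriction, so the sieve it generates stays inside it. Single-valuedness then turns
    \<open>\<rho>\<close> into a matching family.\<close>
  have gR: "c \<in> hom C (Dom C c) Z \<and> ?R c" if "c \<in> gen Z ?R" for c
    using that st by (auto simp: gen_def hom_def)
  define \<phi> where "\<phi> c = (THE v. \<rho> c v)" for c
  have \<phi>: "\<phi> c = v" if "c \<in> hom C (Dom C c) Z" "\<rho> c v" for c v
    unfolding \<phi>_def using that un by blast
  have "effective Z (gen Z ?R)" using cR csieve_effective by (simp add: covers_def)
  moreover have "\<forall>c \<in> gen Z ?R. \<phi> c \<in> hom C (Dom C c) b" using gR \<phi> ty by metis
  moreover have "\<forall>c \<in> gen Z ?R. \<forall>t \<in> Arr C. Cod C t = Dom C c \<longrightarrow> \<phi> (c \<cdot> t) = \<phi> c \<cdot> t"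
  proof (intro ballI impI)
    fix c t assume "c \<in> gen Z ?R" and t: "t \<in> Arr C" "Cod C t = Dom C c"
    then obtain v where c: "c \<in> hom C (Dom C c) Z" "\<rho> c v" using gR by auto
    have "\<rho> (c \<cdot> t) (v \<cdot> t)" using st c t by (auto simp: hom_def)
    moreover have "c \<cdot> t \<in> hom C (Dom C (c \<cdot> t)) Z" using c t by (auto simp: hom_def)
    ultimately show "\<phi> (c \<cdot> t) = \<phi> c \<cdot> t" using \<phi> c by metis
  qed
  ultimately have E: "\<exists>!h. h \<in> hom C Z b \<and> (\<forall>c \<in> gen Z ?R. h \<cdot> c = \<phi> c)"
    unfolding effective_def using b by blast
  have eq: "(\<forall>c \<in> gen Z ?R. h \<cdot> c = \<phi> c) \<longleftrightarrow> (\<forall>c v. c \<in> hom C (Dom C c) Z \<longrightarrow> \<rho> c v \<longrightarrow> h \<cdot> c = v)" for h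
  proof
    assume A: "\<forall>c \<in> gen Z ?R. h \<cdot> c = \<phi> c"
    show "\<forall>c v. c \<in> hom C (Dom C c) Z \<longrightarrow> \<rho> c v \<longrightarrow> h \<cdot> c = v"
    proof (intro allI impI)
      fix c v assume c: "c \<in> hom C (Dom C c) Z" "\<rho> c v"
      then have "c \<in> gen Z ?R" by (intro genI) (auto simp: hom_def)
      then show "h \<cdot> c = v" using A \<phi> c by auto
    qed
  next
    assume "\<forall>c v. c \<in> hom C (Dom C c) Z \<longrightarrow> \<rho> c v \<longrightarrow> h \<cdot> c = v"
    then show "\<forall>c \<in> gen Z ?R. h \<cdot> c = \<phi> c" using gR \<phi> by metis
  qed
  show ?thesis using E by (simp add: eq)
qed

text \<open>A void object is a strict initial one; a generalised element at a void stage carries no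
  information, so normal forms of elements are unique only up to void stages.\<close>

abbreviation void :: "'o \<Rightarrow> bool" where
  "void z \<equiv> covers z (\<lambda>_. False)"

text \<open>Agreement on the empty cover is vacuous.\<close>

lemma void_eq: "void z \<Longrightarrow> f \<in> hom C z b \<Longrightarrow> g \<in> hom C z b \<Longrightarrow> f = g"
  by (rule covers_eq[of z "\<lambda>_. False"]) auto

lemma void_covers: "void z \<Longrightarrow> covers z R"
  by (erule covers_mono) simp

text \<open>Stability under restriction keeps the earlier properties valid when the stage is refined
  for the next one.\<close>

lemma covers_finite:
  fixes n :: nat
  assumes Z: "Z \<in> Obj C" and cv: "\<And>i. i < n \<Longrightarrow> covers Z (R i)"
    and st: "\<And>i c t. i < n \<Longrightarrow> c \<in> hom C (Dom C c) Z \<Longrightarrow> R i c \<Longrightarrow> t \<in> hom C (Dom C t) (Dom C c) \<Longrightarrow> R i (c \<cdot> t)"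
  shows "covers Z (\<lambda>c. \<forall>i < n. R i c)"
  using cv st
proof (induction n)
  case 0
  show ?case using covers_triv[OF Z] by simp
next
  case (Suc n)
  have 1: "covers Z (\<lambda>c. \<forall>i < n. R i c)" using Suc by simp
  show ?case
  proof (rule covers_trans[OF 1])
    fix c assume c: "c \<in> hom C (Dom C c) Z" "\<forall>i < n. R i c"
    show "covers (Dom C c) (\<lambda>t. \<forall>i<Suc n. R i (c \<cdot> t))"
    proof (rule covers_pull[OF Suc.prems(1)[of n] c(1)])
      fix d t s assume d: "d \<in> hom C (Dom C d) Z" "R n d" and t: "t \<in> hom C (Dom C t) (Dom C c)"
        and s: "s \<in> hom C (Dom C t) (Dom C d)" "c \<cdot> t = d \<cdot> s"
      have "R n (c \<cdot> t)" using Suc.prems(2)[of n d s] d s by (simp add: hom_iff)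
      moreover have "R i (c \<cdot> t)" if "i < n" for i using Suc.prems(2)[of i c t] c t that by simp
      ultimately show "\<forall>i<Suc n. R i (c \<cdot> t)" by (simp add: less_Suc_eq)
    qed simp
  qed
qed

text \<open>The witnesses for finitely many indices, such as the edges of a path, are collected in
  one list over a common refinement. A restricted stage may have a different witness.\<close>

lemma covers_choice:
  fixes n :: nat
  assumes Z: "Z \<in> Obj C" and cv: "\<And>i. i < n \<Longrightarrow> covers Z (\<lambda>c. \<exists>v. R i c v)"
    and st: "\<And>i c t v. i < n \<Longrightarrow> c \<in> hom C (Dom C c) Z \<Longrightarrow> R i c v \<Longrightarrow> t \<in> hom C (Dom C t) (Dom C c) \<Longrightarrow> \<exists>v. R i (c \<cdot> t) v"
  shows "covers Z (\<lambda>c. \<exists>vs. length vs = n \<and> (\<forall>i < n. R i c (vs ! i)))"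
proof -
  have "covers Z (\<lambda>c. \<forall>i < n. \<exists>v. R i c v)"
    by (rule covers_finite[OF Z cv]) (use st in blast)+
  then show ?thesis by (simp add: Skolem_list_nth)
qed

section \<open>Coproducts\<close>

lemma iso_intro: "f \<in> hom C a b \<Longrightarrow> g \<in> hom C b a \<Longrightarrow> g \<cdot> f = Ident C a \<Longrightarrow> f \<cdot> g = Ident C b \<Longrightarrow> is_iso C f"
  by (auto simp: is_iso_def hom_def)

lemma iso_hom: "is_iso C f \<Longrightarrow> f \<in> hom C a b \<Longrightarrow>
    \<exists>g. g \<in> hom C b a \<and> g \<cdot> f = Ident C a \<and> f \<cdot> g = Ident C b \<and> is_iso C g"
  by (auto simp: hom_def elim!: iso_obtain) (metis is_iso_def hom_iff)

lemma iso_comp: 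
  assumes "is_iso C f" "is_iso C g" "Cod C f = Dom C g" shows "is_iso C (g \<cdot> f)"
proof -
  have f: "f \<in> hom C (Dom C f) (Cod C f)" and g: "g \<in> hom C (Cod C f) (Cod C g)"
    using assms by (auto simp: is_iso_def hom_def)
  obtain f' where f': "f' \<in> hom C (Cod C f) (Dom C f)" "f' \<cdot> f = Ident C (Dom C f)" "f \<cdot> f' = Ident C (Cod C f)"
    using iso_hom[OF assms(1) f] by auto
  obtain g' where g': "g' \<in> hom C (Cod C g) (Cod C f)" "g' \<cdot> g = Ident C (Cod C f)" "g \<cdot> g' = Ident C (Cod C g)"
    using iso_hom[OF assms(2) g] by auto
  have "(f' \<cdot> g') \<cdot> (g \<cdot> f) = f' \<cdot> ((g' \<cdot> g) \<cdot> f)" using f g f'(1) g'(1) by (simp add: hom_def assoc)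
  moreover have "(g \<cdot> f) \<cdot> (f' \<cdot> g') = g \<cdot> ((f \<cdot> f') \<cdot> g')" using f g f'(1) g'(1) by (simp add: hom_def assoc)
  ultimately show ?thesis using f g f' g'
    by (intro iso_intro[of _ "Dom C f" "Cod C g" "f' \<cdot> g'"]) (auto simp: hom_def)
qed

lemma iso_cancel: 
  assumes "is_iso C k" "x \<in> hom C z (Dom C k)" "y \<in> hom C z (Dom C k)" "k \<cdot> x = k \<cdot> y"
  shows "x = y"
proof -
  obtain g where g: "g \<in> hom C (Cod C k) (Dom C k)" "g \<cdot> k = Ident C (Dom C k)"
    using assms(1) by (auto simp: is_iso_def)
  have "k \<in> Arr C" using assms(1) by (auto simp: is_iso_def)
  then have "(g \<cdot> k) \<cdot> x = g \<cdot> (k \<cdot> x)" "(g \<cdot> k) \<cdot> y = g \<cdot> (k \<cdot> y)" using assms(2,3) g(1) by (auto simp: hom_def assoc)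
  then show ?thesis using g(2) assms(2-4) by (simp add: hom_def)
qed

lemma iso_cancel_right: 
  assumes "is_iso C k" "x \<in> hom C (Cod C k) z" "y \<in> hom C (Cod C k) z" "x \<cdot> k = y \<cdot> k"
  shows "x = y"
proof -
  obtain g where g: "g \<in> hom C (Cod C k) (Dom C k)" "k \<cdot> g = Ident C (Cod C k)"
    using assms(1) by (auto simp: is_iso_def)
  have "k \<in> Arr C" using assms(1) by (auto simp: is_iso_def)
  then have "x \<cdot> (k \<cdot> g) = (x \<cdot> k) \<cdot> g" "y \<cdot> (k \<cdot> g) = (y \<cdot> k) \<cdot> g" using assms(2,3) g(1) by (auto simp: hom_def assoc)
  then show ?thesis using g(2) assms(2-4) by (simp add: hom_def)
qed

text \<open>The inverse of \<open>q2\<close> is induced by \<open>f' \<cdot> g\<close> and the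
  identity, where \<open>f'\<close> is the inverse of \<open>f\<close>.\<close>

lemma pullback_iso:
  assumes P: "is_pullback C f g p q1 q2" and f: "is_iso C f"
  shows "is_iso C q2"
proof -
  note d = is_pullbackD[OF P]
  obtain f' where f': "f' \<in> hom C (Cod C f) (Dom C f)" "f' \<cdot> f = Ident C (Dom C f)" "f \<cdot> f' = Ident C (Cod C f)"
    using f by (auto simp: is_iso_def)
  have "f \<cdot> (f' \<cdot> g) = (f \<cdot> f') \<cdot> g" using f'(1) d by (simp add: hom_def assoc)
  then have "f \<cdot> (f' \<cdot> g) = g \<cdot> Ident C (Dom C g)" using f' d by simp
  then obtain h where h: "h \<in> hom C (Dom C g) p" "q1 \<cdot> h = f' \<cdot> g" "q2 \<cdot> h = Ident C (Dom C g)"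
    using pullback_ex[OF P, of "f' \<cdot> g" "Dom C g" "Ident C (Dom C g)"] f'(1) d by (auto simp: hom_def)
  have "q2 \<cdot> (h \<cdot> q2) = (q2 \<cdot> h) \<cdot> q2" using h(1) d by (simp add: hom_def assoc)
  then have 2: "q2 \<cdot> (h \<cdot> q2) = q2 \<cdot> Ident C p" using h d by simp
  have "q1 \<cdot> (h \<cdot> q2) = (q1 \<cdot> h) \<cdot> q2" using h(1) d by (simp add: hom_def assoc)
  also have "\<dots> = f' \<cdot> (g \<cdot> q2)" using h(2) f'(1) d by (simp add: hom_def assoc)
  also have "\<dots> = f' \<cdot> (f \<cdot> q1)" using d by simp
  also have "\<dots> = (f' \<cdot> f) \<cdot> q1" using f'(1) d by (simp add: hom_def assoc)
  also have "\<dots> = q1 \<cdot> Ident C p" using f' d by simp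
  finally have 1: "q1 \<cdot> (h \<cdot> q2) = q1 \<cdot> Ident C p" .
  have t: "h \<cdot> q2 \<in> hom C p p" "Ident C p \<in> hom C p p" using h(1) d by (simp_all add: hom_def)
  have "h \<cdot> q2 = Ident C p" by (rule pullback_eqI[OF P t 1 2])
  then show ?thesis using h d by (intro iso_intro[of _ p "Dom C g" h]) (auto simp: hom_def)
qed

section \<open>Coproducts and their transport\<close>

lemma coproductD:
  assumes "is_coproduct C I X c \<iota>"
  shows "c \<in> Obj C" "i \<in> I \<Longrightarrow> X i \<in> Obj C" "i \<in> I \<Longrightarrow> \<iota> i \<in> hom C (X i) c"
  using assms by (auto simp: is_coproduct_def)

lemma coproduct_ex:
  assumes "is_coproduct C I X c \<iota>" "z \<in> Obj C" "\<And>i. i \<in> I \<Longrightarrow> f i \<in> hom C (X i) z"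
  shows "\<exists>h. h \<in> hom C c z \<and> (\<forall>i \<in> I. h \<cdot> \<iota> i = f i)"
proof -
  have "\<exists>!h. h \<in> hom C c z \<and> (\<forall>i \<in> I. h \<cdot> \<iota> i = f i)" using assms unfolding is_coproduct_def by blast
  then show ?thesis by blast
qed

lemma coproduct_eqI:
  assumes "is_coproduct C I X c \<iota>" "h \<in> hom C c z" "h' \<in> hom C c z" "\<And>i. i \<in> I \<Longrightarrow> h \<cdot> \<iota> i = h' \<cdot> \<iota> i"
  shows "h = h'"
proof -
  have z: "z \<in> Obj C" using assms(2) by (auto simp: hom_def)
  have "\<forall>i \<in> I. h \<cdot> \<iota> i \<in> hom C (X i) z"
    using comp_hom[OF coproductD(3)[OF assms(1)] assms(2)] by blast
  then have "\<exists>!k. k \<in> hom C c z \<and> (\<forall>i \<in> I. k \<cdot> \<iota> i = h \<cdot> \<iota> i)"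
    using assms(1)[unfolded is_coproduct_def] z by (elim conjE) (drule (1) bspec, elim allE, erule (1) mp)
  then show ?thesis using assms(2-4) by metis
qed

lemma is_coproductI:
  assumes "c \<in> Obj C" "\<And>i. i \<in> I \<Longrightarrow> \<iota> i \<in> hom C (X i) c"
    and "\<And>z f. z \<in> Obj C \<Longrightarrow> (\<And>i. i \<in> I \<Longrightarrow> f i \<in> hom C (X i) z) \<Longrightarrow> \<exists>h. h \<in> hom C c z \<and> (\<forall>i \<in> I. h \<cdot> \<iota> i = f i)"
    and "\<And>z h h'. h \<in> hom C c z \<Longrightarrow> h' \<in> hom C c z \<Longrightarrow> (\<And>i. i \<in> I \<Longrightarrow> h \<cdot> \<iota> i = h' \<cdot> \<iota> i) \<Longrightarrow> h = h'"
  shows "is_coproduct C I X c \<iota>"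
  unfolding is_coproduct_def
proof (intro conjI ballI allI impI)
  show "X ` I \<subseteq> Obj C" using assms(2) by (metis dom_in hom_iff image_subsetI)
  show "c \<in> Obj C" by fact
  show "\<iota> i \<in> hom C (X i) c" if "i \<in> I" for i using assms(2) that by auto
  fix z f assume z: "z \<in> Obj C" and f: "\<forall>i\<in>I. f i \<in> hom C (X i) z"
  obtain h where h: "h \<in> hom C c z \<and> (\<forall>i \<in> I. h \<cdot> \<iota> i = f i)" using assms(3)[OF z, of f] f by auto
  show "\<exists>!h. h \<in> hom C c z \<and> (\<forall>i\<in>I. h \<cdot> \<iota> i = f i)"
  proof (rule ex1I[of _ h], rule h)
    fix h' assume "h' \<in> hom C c z \<and> (\<forall>i\<in>I. h' \<cdot> \<iota> i = f i)"
    then show "h' = h" using assms(4)[of h' z h] h by auto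
  qed
qed

text \<open>Lets families indexed by pairs, lists or numbers profit from hypotheses that concern
  index sets of type \<open>'u set\<close>.\<close>

lemma coproduct_reindex:
  assumes P: "is_coproduct C J Y c \<kappa>" and e: "bij_betw e I J"
    and X: "\<And>i. i \<in> I \<Longrightarrow> X i = Y (e i)" and \<iota>: "\<And>i. i \<in> I \<Longrightarrow> \<iota> i = \<kappa> (e i)"
  shows "is_coproduct C I X c \<iota>"
proof (rule is_coproductI)
  have eI: "e i \<in> J" if "i \<in> I" for i using e that by (auto simp: bij_betw_def)
  have eJ: "\<exists>i \<in> I. j = e i" if "j \<in> J" for j using e that by (auto simp: bij_betw_def)
  show "c \<in> Obj C" by (rule coproductD[OF P])
  show "\<iota> i \<in> hom C (X i) c" if "i \<in> I" for i using coproductD[OF P] that eI X \<iota> by auto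
  show "h = h'" if "h \<in> hom C c z" "h' \<in> hom C c z" "\<And>i. i \<in> I \<Longrightarrow> h \<cdot> \<iota> i = h' \<cdot> \<iota> i" for z h h'
  proof (rule coproduct_eqI[OF P that(1,2)])
    fix j assume "j \<in> J"
    then obtain i where "i \<in> I" "j = e i" using eJ by auto
    then show "h \<cdot> \<kappa> j = h' \<cdot> \<kappa> j" using that(3)[of i] \<iota> by simp
  qed
  fix z f assume z: "z \<in> Obj C" and f: "\<And>i. i \<in> I \<Longrightarrow> f i \<in> hom C (X i) z"
  have inv: "inv_into I e j \<in> I" "e (inv_into I e j) = j" if "j \<in> J" for j
    using e that by (auto simp: bij_betw_def inv_into_into f_inv_into_f)
  have "f (inv_into I e j) \<in> hom C (Y j) z" if "j \<in> J" for j
    using f[OF inv(1)[OF that]] X[OF inv(1)[OF that]] inv(2)[OF that] by simp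
  then obtain h where h: "h \<in> hom C c z" "\<And>j. j \<in> J \<Longrightarrow> h \<cdot> \<kappa> j = f (inv_into I e j)"
    using coproduct_ex[OF P z, of "\<lambda>j. f (inv_into I e j)"] by auto
  have "h \<cdot> \<iota> i = f i" if "i \<in> I" for i
    using h(2)[OF eI[OF that]] \<iota>[OF that] e that by (simp add: bij_betw_def inv_into_f_f)
  then show "\<exists>h. h \<in> hom C c z \<and> (\<forall>i \<in> I. h \<cdot> \<iota> i = f i)" using h(1) by auto
qed

lemma coproduct_iso:
  assumes P: "is_coproduct C I X c \<iota>" and k: "is_iso C k" "k \<in> hom C c d"
  shows "is_coproduct C I X d (\<lambda>i. k \<cdot> \<iota> i)"
proof (rule is_coproductI)
  note D = coproductD[OF P]
  obtain k' where k': "k' \<in> hom C d c" "k' \<cdot> k = Ident C c" "k \<cdot> k' = Ident C d" using iso_hom[OF k] by auto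
  show "d \<in> Obj C" using k by (auto simp: hom_def)
  show "k \<cdot> \<iota> i \<in> hom C (X i) d" if "i \<in> I" for i using D(3)[OF that] k(2) by (rule comp_hom)
  fix z assume z: "z \<in> Obj C"
  fix f assume f: "\<And>i. i \<in> I \<Longrightarrow> f i \<in> hom C (X i) z"
  obtain h where h: "h \<in> hom C c z" "\<And>i. i \<in> I \<Longrightarrow> h \<cdot> \<iota> i = f i" using coproduct_ex[OF P z f] by auto
  have "(h \<cdot> k') \<cdot> (k \<cdot> \<iota> i) = f i" if i: "i \<in> I" for i
  proof -
    have "(h \<cdot> k') \<cdot> (k \<cdot> \<iota> i) = h \<cdot> ((k' \<cdot> k) \<cdot> \<iota> i)" using h(1) k'(1) k(2) D(3)[OF i] by (simp add: hom_def assoc)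
    then show ?thesis using h k' D(3)[OF i] i by (simp add: hom_def)
  qed
  moreover have "h \<cdot> k' \<in> hom C d z" using k' h by (auto intro: comp_hom)
  ultimately show "\<exists>h. h \<in> hom C d z \<and> (\<forall>i\<in>I. h \<cdot> (k \<cdot> \<iota> i) = f i)" by blast
next
  note D = coproductD[OF P]
  fix z h h' assume h: "h \<in> hom C d z" "h' \<in> hom C d z" "\<And>i. i \<in> I \<Longrightarrow> h \<cdot> (k \<cdot> \<iota> i) = h' \<cdot> (k \<cdot> \<iota> i)"
  have "h \<cdot> k = h' \<cdot> k"
  proof (rule coproduct_eqI[OF P])
    show "h \<cdot> k \<in> hom C c z" "h' \<cdot> k \<in> hom C c z" using h k(2) by (auto intro: comp_hom)
    show "(h \<cdot> k) \<cdot> \<iota> i = (h' \<cdot> k) \<cdot> \<iota> i" if "i \<in> I" for i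
      using h(3)[OF that] D(3)[OF that] h(1,2) k(2) by (simp add: hom_def assoc)
  qed
  then show "h = h'" using iso_cancel_right[OF k(1), of h z h'] h k by (simp add: hom_def)
qed

lemma coproduct_unique_iso:
  assumes P: "is_coproduct C I X c \<iota>" and Q: "is_coproduct C I X d \<kappa>"
  shows "\<exists>k. is_iso C k \<and> k \<in> hom C c d \<and> (\<forall>i \<in> I. k \<cdot> \<iota> i = \<kappa> i)"
proof -
  note D = coproductD[OF P] and D' = coproductD[OF Q]
  obtain k where k: "k \<in> hom C c d" "\<And>i. i \<in> I \<Longrightarrow> k \<cdot> \<iota> i = \<kappa> i" using coproduct_ex[OF P D'(1) D'(3)] by auto
  obtain l where l: "l \<in> hom C d c" "\<And>i. i \<in> I \<Longrightarrow> l \<cdot> \<kappa> i = \<iota> i" using coproduct_ex[OF Q D(1) D(3)] by auto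
  have "l \<cdot> k = Ident C c"
  proof (rule coproduct_eqI[OF P])
    show "l \<cdot> k \<in> hom C c c" using k l by (auto intro: comp_hom)
    show "Ident C c \<in> hom C c c" using D by (auto simp: hom_def)
    fix i assume i: "i \<in> I"
    have "(l \<cdot> k) \<cdot> \<iota> i = l \<cdot> (k \<cdot> \<iota> i)" using k(1) l(1) D(3)[OF i] by (simp add: hom_def assoc)
    then show "(l \<cdot> k) \<cdot> \<iota> i = Ident C c \<cdot> \<iota> i" using k(2)[OF i] l(2)[OF i] D(3)[OF i] by (simp add: hom_def)
  qed
  moreover have "k \<cdot> l = Ident C d"
  proof (rule coproduct_eqI[OF Q])
    show "k \<cdot> l \<in> hom C d d" using k l by (auto intro: comp_hom)
    show "Ident C d \<in> hom C d d" using D' by (auto simp: hom_def)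
    fix i assume i: "i \<in> I"
    have "(k \<cdot> l) \<cdot> \<kappa> i = k \<cdot> (l \<cdot> \<kappa> i)" using k(1) l(1) D'(3)[OF i] by (simp add: hom_def assoc)
    then show "(k \<cdot> l) \<cdot> \<kappa> i = Ident C d \<cdot> \<kappa> i" using k(2)[OF i] l(2)[OF i] D'(3)[OF i] by (simp add: hom_def)
  qed
  ultimately have "is_iso C k" by (intro iso_intro[OF k(1) l(1)])
  then show ?thesis using k by blast
qed

lemma cpr_is_coproduct: "\<exists>c \<iota>. is_coproduct C I X c \<iota> \<Longrightarrow> is_coproduct C I X (cpr C I X) (inc C I X)"
proof -
  assume "\<exists>c \<iota>. is_coproduct C I X c \<iota>"
  then have "\<exists>t. case t of (p, \<pi>s) \<Rightarrow> is_coproduct C I X p \<pi>s" by auto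
  then have "case cpr_cocone C I X of (p, \<pi>s) \<Rightarrow> is_coproduct C I X p \<pi>s"
    unfolding cpr_cocone_def by (rule someI_ex)
  then show ?thesis by (simp add: cpr_def inc_def split: prod.splits)
qed

lemma cotup:
  assumes "is_coproduct C I X (cpr C I X) (inc C I X)" "z \<in> Obj C" "\<forall>i \<in> I. f i \<in> hom C (X i) z"
  shows "cotup C I X z f \<in> hom C (cpr C I X) z" "i \<in> I \<Longrightarrow> cotup C I X z f \<cdot> inc C I X i = f i"
proof -
  have "\<exists>!h. h \<in> hom C (cpr C I X) z \<and> (\<forall>i \<in> I. h \<cdot> inc C I X i = f i)"
    using coproduct_ex[OF assms(1,2), of f] assms(3) coproduct_eqI[OF assms(1)] by metis
  from theI'[OF this] show "cotup C I X z f \<in> hom C (cpr C I X) z"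
    "i \<in> I \<Longrightarrow> cotup C I X z f \<cdot> inc C I X i = f i" unfolding cotup_def by auto
qed

text \<open>The object \<open>X k\<close> with its identity is also such a coproduct, and the
  comparison of the two is \<open>\<iota> k\<close>.\<close>

lemma singleton_coproduct_iso:
  assumes P: "is_coproduct C {k} X c \<iota>" shows "is_iso C (\<iota> k)"
proof -
  note D = coproductD[OF P]
  have Q: "is_coproduct C {k} X (X k) (\<lambda>_. Ident C (X k))"
    using D by (intro is_coproductI) (auto simp: hom_def)
  obtain l where "is_iso C l" "l \<in> hom C (X k) c" "l \<cdot> Ident C (X k) = \<iota> k"
    using coproduct_unique_iso[OF Q P] by auto
  then show ?thesis by (simp add: hom_def)
qed

end

section \<open>Small coproducts: universality and disjointness\<close>

locale ext_cat = cart_cat C for C :: "('o, 'm) cat" (structure) +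
  fixes U :: "'u itself"
  assumes infinite_U: "infinite (UNIV :: 'u set)"
    and small_cop: "has_small_coproducts U C"
    and commute: "small_coproducts_commute_with_pullbacks U C"
begin

definition small :: "'i set \<Rightarrow> bool" where
  "small I \<longleftrightarrow> (\<exists>e :: 'i \<Rightarrow> 'u. inj_on e I)"

lemma small_U [simp]: "small (I :: 'u set)"
  unfolding small_def by (rule exI[of _ id]) simp

lemma ex_inj_pair: "\<exists>e :: 'u \<times> 'u \<Rightarrow> 'u. inj e"
proof -
  obtain e where "bij_betw e (UNIV \<times> UNIV :: ('u \<times> 'u) set) (UNIV :: 'u set)"
    using card_of_Times_same_infinite[OF infinite_U] card_of_ordIso by blast
  then show ?thesis by (auto simp: bij_betw_def)
qed

lemma small_pair [simp]: "small (I :: ('u \<times> 'u) set)"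
  unfolding small_def using ex_inj_pair inj_on_subset by blast

lemma ex_inj_nat: "\<exists>e :: nat \<Rightarrow> 'u. inj e"
  using infinite_U infinite_countable_subset by blast

lemma small_nat [simp]: "small (I :: nat set)"
  unfolding small_def using ex_inj_nat inj_on_subset by blast

lemma small_list [simp]: "small (I :: 'u list set)"
proof -
  obtain p :: "'u \<times> 'u \<Rightarrow> 'u" where p: "inj p" using ex_inj_pair by auto
  obtain n :: "nat \<Rightarrow> 'u" where n: "inj n" using ex_inj_nat by auto
  define e where "e xs = foldr (\<lambda>x y. p (x, y)) xs (n 0)" for xs
  have e: "e xs = e ys \<Longrightarrow> xs = ys" if "length xs = length ys" for xs ys
    using that by (induction xs ys rule: list_induct2) (auto simp: e_def dest: injD[OF p])
  \<comment> \<open>Folding the pairing separates lists of equal length only, as \<open>n 0\<close>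
    may itself be the code of a pair; so the length is recorded as well.\<close>
  have "inj (\<lambda>xs. p (n (length xs), e xs))"
    by (rule injI) (auto dest!: injD[OF p] injD[OF n] intro: e)
  then show ?thesis unfolding small_def using inj_on_subset by blast
qed

text \<open>A coproduct is formed over the image of \<open>I\<close> in \<open>'u\<close> and
  reindexed.\<close>

lemma cpr_coproduct:
  fixes I :: "'i set"
  assumes "small I" "\<And>i. i \<in> I \<Longrightarrow> X i \<in> Obj C"
  shows "is_coproduct C I X (cpr C I X) (inc C I X)"
proof (rule cpr_is_coproduct)
  obtain e :: "'i \<Rightarrow> 'u" where e: "inj_on e I" using assms by (auto simp: small_def)
  then have b: "bij_betw e I (e ` I)" by (simp add: bij_betw_def)
  have "(\<lambda>j. X (inv_into I e j)) ` (e ` I) \<subseteq> Obj C" using e assms by auto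
  then obtain c \<kappa> where P: "is_coproduct C (e ` I) (\<lambda>j. X (inv_into I e j)) c \<kappa>"
    using small_cop[unfolded has_small_coproducts_def, rule_format, of "\<lambda>j. X (inv_into I e j)" "e ` I"] by auto
  have "is_coproduct C I X c (\<lambda>i. \<kappa> (e i))" by (rule coproduct_reindex[OF P b]) (simp_all add: e)
  then show "\<exists>c \<iota>. is_coproduct C I X c \<iota>" by blast
qed

text \<open>Take \<open>K\<close> a singleton in the hypothesis on coproducts: one of the two arrows between coproducts
  is then invertible and its pullback is \<open>z\<close> itself.\<close>

lemma coproduct_pullback:
  fixes I :: "'u set"
  assumes P: "is_coproduct C I X c \<iota>" and x: "x \<in> hom C z c"
  shows "is_coproduct C I (\<lambda>i. pbo C (\<iota> i) x) z (\<lambda>i. pb2 C (\<iota> i) x)"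
proof -
  note D = coproductD[OF P]
  \<comment> \<open>Any element of \<open>'u\<close> serves as the single index.\<close>
  define k :: 'u where "k = undefined"
  let ?K = "{k}" and ?C = "\<lambda>_ :: 'u. c" and ?B = "\<lambda>_ :: 'u. z"
  have xx: "x \<in> Arr C" "Dom C x = z" "Cod C x = c" "z \<in> Obj C" using x by (auto simp: hom_def)
  have cK: "is_coproduct C ?K ?C (cpr C ?K ?C) (inc C ?K ?C)" by (rule cpr_coproduct) (auto simp: D)
  have cB: "is_coproduct C ?K ?B (cpr C ?K ?B) (inc C ?K ?B)" by (rule cpr_coproduct) (auto simp: xx)
  have cX: "is_coproduct C I X (cpr C I X) (inc C I X)" by (rule cpr_coproduct) (auto simp: D)
  let ?f = "cotup C I X (cpr C ?K ?C) (\<lambda>i. inc C ?K ?C k \<cdot> \<iota> i)"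
  let ?g = "cotup C ?K ?B (cpr C ?K ?C) (\<lambda>j. inc C ?K ?C k \<cdot> x)"
  let ?PI = "{(i, j). i \<in> I \<and> j \<in> ?K \<and> k = k}"
  let ?W = "\<lambda>(i, j). pbo C (\<iota> i) x"
  let ?h = "\<lambda>(i, j). pbtup C ?f ?g (inc C I X i \<cdot> pb1 C (\<iota> i) x) (inc C ?K ?B j \<cdot> pb2 C (\<iota> i) x)"
  let ?can = "cotup C ?PI ?W (pbo C ?f ?g) ?h"
  have can: "is_iso C ?can"
    using commute[unfolded small_coproducts_commute_with_pullbacks_def, rule_format,
        of "\<lambda>_. k" I ?K "\<lambda>_. k" ?K X ?B ?C \<iota> "\<lambda>_. x"] D x by (auto simp: Let_def xx)
  have kk: "inc C ?K ?C k \<in> hom C c (cpr C ?K ?C)" using coproductD(3)[OF cK] by simp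
  have kB: "inc C ?K ?B k \<in> hom C z (cpr C ?K ?B)" using coproductD(3)[OF cB] by simp
  have inX: "inc C I X i \<in> hom C (X i) (cpr C I X)" if "i \<in> I" for i using coproductD(3)[OF cX that] .
  have ki: "\<forall>i \<in> I. inc C ?K ?C k \<cdot> \<iota> i \<in> hom C (X i) (cpr C ?K ?C)"
    using comp_hom[OF D(3) kk] by blast
  have kx: "\<forall>j \<in> ?K. inc C ?K ?C k \<cdot> x \<in> hom C z (cpr C ?K ?C)" using comp_hom[OF x kk] by blast
  note f = cotup[OF cX coproductD(1)[OF cK] ki]
  have gA: "?g \<in> hom C (cpr C ?K ?B) (cpr C ?K ?C)" by (rule cotup[OF cB coproductD(1)[OF cK] kx])
  have gB: "?g \<cdot> inc C ?K ?B k = inc C ?K ?C k \<cdot> x" using cotup(2)[OF cB coproductD(1)[OF cK] kx, of k] by simp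
  \<comment> \<open>\<open>?f\<close> is the comparison of two coproducts of \<open>X\<close>,
    followed by the inclusion into a one-term coproduct.\<close>
  have fiso: "is_iso C ?f"
  proof -
    obtain a where a: "is_iso C a" "a \<in> hom C (cpr C I X) c" "\<And>i. i \<in> I \<Longrightarrow> a \<cdot> inc C I X i = \<iota> i"
      using coproduct_unique_iso[OF cX P] by auto
    have "?f = inc C ?K ?C k \<cdot> a"
    proof (rule coproduct_eqI[OF cX f(1)])
      show "inc C ?K ?C k \<cdot> a \<in> hom C (cpr C I X) (cpr C ?K ?C)" using a(2) kk by (rule comp_hom)
      show "?f \<cdot> inc C I X i = (inc C ?K ?C k \<cdot> a) \<cdot> inc C I X i" if "i \<in> I" for i
        using f(2)[OF that] a(2) a(3)[OF that] kk inX[OF that] by (simp add: assoc hom_def)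
    qed
    moreover have "is_iso C (inc C ?K ?C k)" by (rule singleton_coproduct_iso[OF cK])
    ultimately show ?thesis using iso_comp[OF a(1)] a(2) kk by (simp add: hom_def)
  qed
  have PF: "is_pullback C ?f ?g (pbo C ?f ?g) (pb1 C ?f ?g) (pb2 C ?f ?g)"
    using f(1) gA by (intro pb_is_pullback) (auto simp: hom_def)
  note PD = is_pullbackD[OF PF]
  have i2: "is_iso C (pb2 C ?f ?g)" by (rule pullback_iso[OF PF fiso])
  have "is_iso C (inc C ?K ?B k)" by (rule singleton_coproduct_iso[OF cB])
  then obtain l where l: "l \<in> hom C (cpr C ?K ?B) z" "l \<cdot> inc C ?K ?B k = Ident C z" "is_iso C l"
    using iso_hom[OF _ kB] by blast
  have PI: "is_pullback C (\<iota> i) x (pbo C (\<iota> i) x) (pb1 C (\<iota> i) x) (pb2 C (\<iota> i) x)" if "i \<in> I" for i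
    using D(3)[OF that] x by (intro pb_is_pullback) (auto simp: hom_def)
  note PId = is_pullbackD[OF PI]
  have cW: "is_coproduct C ?PI ?W (cpr C ?PI ?W) (inc C ?PI ?W)"
    by (rule cpr_coproduct) (auto simp: PId)
  have h: "?h (i, k) \<in> hom C (pbo C (\<iota> i) x) (pbo C ?f ?g)"
      "pb2 C ?f ?g \<cdot> ?h (i, k) = inc C ?K ?B k \<cdot> pb2 C (\<iota> i) x" if i: "i \<in> I" for i
  proof -
    note p = PId[OF i]
    have io: "\<iota> i \<in> Arr C" "Dom C (\<iota> i) = X i" "Cod C (\<iota> i) = c" using D(3)[OF i] by (auto simp: hom_def)
    have "?f \<cdot> (inc C I X i \<cdot> pb1 C (\<iota> i) x) = (?f \<cdot> inc C I X i) \<cdot> pb1 C (\<iota> i) x"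
      using f(1) inX[OF i] p io by (simp add: assoc hom_def)
    also have "\<dots> = inc C ?K ?C k \<cdot> (\<iota> i \<cdot> pb1 C (\<iota> i) x)"
      using f(2)[OF i] p io kk by (simp add: assoc hom_def)
    also have "\<dots> = (inc C ?K ?C k \<cdot> x) \<cdot> pb2 C (\<iota> i) x" using p io xx kk by (simp add: assoc hom_def)
    also have "\<dots> = ?g \<cdot> (inc C ?K ?B k \<cdot> pb2 C (\<iota> i) x)"
      using gA gB kB p xx by (simp add: assoc[symmetric] hom_def)
    finally have eq: "?f \<cdot> (inc C I X i \<cdot> pb1 C (\<iota> i) x) = ?g \<cdot> (inc C ?K ?B k \<cdot> pb2 C (\<iota> i) x)" .
    have t: "inc C I X i \<cdot> pb1 C (\<iota> i) x \<in> hom C (pbo C (\<iota> i) x) (Dom C ?f)"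
        "inc C ?K ?B k \<cdot> pb2 C (\<iota> i) x \<in> hom C (pbo C (\<iota> i) x) (Dom C ?g)"
      using f(1) gA inX[OF i] kB p io xx by (auto simp: hom_def)
    note q = pbtup[OF PD(1-3) t eq]
    show "?h (i, k) \<in> hom C (pbo C (\<iota> i) x) (pbo C ?f ?g)"
      "pb2 C ?f ?g \<cdot> ?h (i, k) = inc C ?K ?B k \<cdot> pb2 C (\<iota> i) x" using q by auto
  qed
  have ht: "\<forall>p \<in> ?PI. ?h p \<in> hom C (?W p) (pbo C ?f ?g)" using h(1) by auto
  note cn = cotup[OF cW PD(4) ht]
  \<comment> \<open>The canonical arrow is invertible, and so is \<open>pb2 C ?f ?g\<close> as a
    pullback of the invertible \<open>?f\<close>. The composite to \<open>z\<close> restricts on the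
    summand \<open>i\<close> to \<open>pb2 C (\<iota> i) x\<close>.\<close>
  let ?\<Phi> = "l \<cdot> (pb2 C ?f ?g \<cdot> ?can)"
  have T: "pb2 C ?f ?g \<in> hom C (pbo C ?f ?g) (cpr C ?K ?B)" using PD gA by (simp add: hom_def)
  have Phi: "?\<Phi> \<in> hom C (cpr C ?PI ?W) z" using comp_hom[OF comp_hom[OF cn(1) T] l(1)] by simp
  have Phiiso: "is_iso C ?\<Phi>"
    using T l cn(1) by (intro iso_comp[OF iso_comp[OF can i2] l(3)]) (auto simp: hom_def)
  note Q = coproduct_iso[OF cW Phiiso Phi]
  show ?thesis
  proof (rule coproduct_reindex[OF Q, of "\<lambda>i. (i, k)"])
    show "bij_betw (\<lambda>i. (i, k)) I ?PI" by (auto simp: bij_betw_def inj_on_def)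
    fix i assume i: "i \<in> I"
    then have ik: "(i, k) \<in> ?PI" by simp
    have in1: "inc C ?PI ?W (i, k) \<in> hom C (pbo C (\<iota> i) x) (cpr C ?PI ?W)"
      using coproductD(3)[OF cW ik] by simp
    have "?\<Phi> \<cdot> inc C ?PI ?W (i, k) = l \<cdot> (pb2 C ?f ?g \<cdot> (?can \<cdot> inc C ?PI ?W (i, k)))"
      using in1 cn(1) l(1) T by (simp add: hom_def assoc)
    also have "\<dots> = l \<cdot> (inc C ?K ?B k \<cdot> pb2 C (\<iota> i) x)" using cn(2)[OF ik] h(2)[OF i] by simp
    also have "\<dots> = (l \<cdot> inc C ?K ?B k) \<cdot> pb2 C (\<iota> i) x" using l(1) kB PId[OF i] xx by (simp add: hom_def assoc)
    also have "\<dots> = pb2 C (\<iota> i) x" using l(2) PId[OF i] xx by simp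
    finally show "pb2 C (\<iota> i) x = ?\<Phi> \<cdot> inc C ?PI ?W (i, k)" by simp
  qed simp
qed

text \<open>By \<open>coproduct_pullback\<close> the pulled-back inclusions form a coproduct cocone
  on every stage over \<open>Z\<close>. Each arrow of the pulled-back sieve factors through one of
  them, so a matching family is amalgamated by the arrow that its values on these inclusions
  induce.\<close>

lemma covers_coproduct_U:
  fixes I :: "'u set"
  assumes P: "is_coproduct C I X c \<iota>" and x: "x \<in> hom C Z c"
  shows "covers Z (\<lambda>t. \<exists>i \<in> I. \<exists>y \<in> hom C (Dom C t) (X i). x \<cdot> t = \<iota> i \<cdot> y)"
    (is "covers Z ?Q")
proof -
  note D = coproductD[OF P]
  have Z: "Z \<in> Obj C" and xx: "x \<in> Arr C" "Dom C x = Z" "Cod C x = c" using x by (auto simp: hom_def)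
  show ?thesis unfolding covers_def csieve_def
  proof (intro conjI sieve_gen Z ballI impI)
    fix f assume f: "f \<in> Arr C" "Cod C f = Z"
    let ?W = "Dom C f" and ?S = "pull f (gen Z ?Q)"
    have xf: "x \<cdot> f \<in> hom C ?W c" using f xx by (simp add: hom_def)
    let ?\<kappa> = "\<lambda>i. pb2 C (\<iota> i) (x \<cdot> f)"
    have PI: "is_pullback C (\<iota> i) (x \<cdot> f) (pbo C (\<iota> i) (x \<cdot> f)) (pb1 C (\<iota> i) (x \<cdot> f)) (?\<kappa> i)" if "i \<in> I" for i
      using D(3)[OF that] xf by (intro pb_is_pullback) (auto simp: hom_def)
    note K = coproduct_pullback[OF P xf]
    note KD = coproductD[OF K]
    have k1: "?\<kappa> i \<in> ?S" if i: "i \<in> I" for i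
    proof -
      note p = is_pullbackD[OF PI[OF i]]
      have k: "?\<kappa> i \<in> Arr C" "Cod C (?\<kappa> i) = ?W" "Dom C (?\<kappa> i) = pbo C (\<iota> i) (x \<cdot> f)"
        using KD(3)[OF i] by (auto simp: hom_def)
      have "x \<cdot> (f \<cdot> ?\<kappa> i) = (x \<cdot> f) \<cdot> ?\<kappa> i" using f xx k by (simp add: assoc)
      also have "\<dots> = \<iota> i \<cdot> pb1 C (\<iota> i) (x \<cdot> f)" using p by simp
      finally have e: "x \<cdot> (f \<cdot> ?\<kappa> i) = \<iota> i \<cdot> pb1 C (\<iota> i) (x \<cdot> f)" .
      have y: "pb1 C (\<iota> i) (x \<cdot> f) \<in> hom C (Dom C (f \<cdot> ?\<kappa> i)) (X i)"
        using p k f D(3)[OF i] by (simp add: hom_def)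
      have "?Q (f \<cdot> ?\<kappa> i)" using e y i by blast
      then have "f \<cdot> ?\<kappa> i \<in> gen Z ?Q" using f k by (intro genI) auto
      then show ?thesis using k by (simp add: pull_def)
    qed
    have k2: "\<exists>i \<in> I. \<exists>u. u \<in> hom C (Dom C t) (pbo C (\<iota> i) (x \<cdot> f)) \<and> t = ?\<kappa> i \<cdot> u" if t: "t \<in> ?S" for t
    proof -
      obtain d s where t: "t \<in> Arr C" "Cod C t = ?W" "f \<cdot> t = d \<cdot> s" "d \<in> Arr C" "Cod C d = Z" "?Q d"
          "s \<in> Arr C" "Cod C s = Dom C d"
        using t f by (auto simp: gen_def pull_def)
      obtain i y where i: "i \<in> I" "y \<in> hom C (Dom C d) (X i)" "x \<cdot> d = \<iota> i \<cdot> y" using t(6) by auto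
      have ds: "Dom C s = Dom C t" using t f by (metis dom_comp)
      have io: "\<iota> i \<in> Arr C" "Dom C (\<iota> i) = X i" using D(3)[OF i(1)] by (auto simp: hom_def)
      have "\<iota> i \<cdot> (y \<cdot> s) = (x \<cdot> d) \<cdot> s" using i(2,3) t io by (simp add: assoc hom_def)
      also have "\<dots> = (x \<cdot> f) \<cdot> t" using t f xx by (simp add: assoc)
      finally have e: "\<iota> i \<cdot> (y \<cdot> s) = (x \<cdot> f) \<cdot> t" .
      have "y \<cdot> s \<in> hom C (Dom C t) (Dom C (\<iota> i))" using i(2) t io ds by (simp add: hom_def)
      moreover have "t \<in> hom C (Dom C t) (Dom C (x \<cdot> f))" using t f xx by (simp add: hom_def)
      ultimately obtain u where "u \<in> hom C (Dom C t) (pbo C (\<iota> i) (x \<cdot> f))" "?\<kappa> i \<cdot> u = t"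
        using pullback_ex[OF PI[OF i(1)] _ _ e] by auto
      then show ?thesis using i(1) by auto
    qed
    show "effective ?W ?S" unfolding effective_def
    proof (intro allI impI)
      fix b \<phi> assume b: "b \<in> Obj C" and 1: "\<forall>c\<in>?S. \<phi> c \<in> hom C (Dom C c) b"
        and 2: "\<forall>c\<in>?S. \<forall>t\<in>Arr C. Cod C t = Dom C c \<longrightarrow> \<phi> (c \<cdot> t) = \<phi> c \<cdot> t"
      have kd: "?\<kappa> i \<in> Arr C" "Dom C (?\<kappa> i) = pbo C (\<iota> i) (x \<cdot> f)" "Cod C (?\<kappa> i) = ?W" if "i \<in> I" for i
        using KD(3)[OF that] by (auto simp: hom_def)
      have "\<phi> (?\<kappa> i) \<in> hom C (pbo C (\<iota> i) (x \<cdot> f)) b" if "i \<in> I" for i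
        using bspec[OF 1 k1[OF that]] unfolding kd(2)[OF that] .
      then obtain h where h: "h \<in> hom C ?W b" "\<And>i. i \<in> I \<Longrightarrow> h \<cdot> ?\<kappa> i = \<phi> (?\<kappa> i)"
        using coproduct_ex[OF K b, of "\<lambda>i. \<phi> (?\<kappa> i)"] by auto
      show "\<exists>!h. h \<in> hom C ?W b \<and> (\<forall>c\<in>?S. h \<cdot> c = \<phi> c)"
      proof (rule ex1I[of _ h], intro conjI ballI h(1))
        fix t assume t: "t \<in> ?S"
        then obtain i u where u: "i \<in> I" "u \<in> hom C (Dom C t) (pbo C (\<iota> i) (x \<cdot> f))" "t = ?\<kappa> i \<cdot> u"
          using k2 by blast
        have "h \<cdot> (?\<kappa> i \<cdot> u) = (h \<cdot> ?\<kappa> i) \<cdot> u" using h(1) kd[OF u(1)] u(2) by (simp add: assoc hom_def)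
        also have "\<dots> = \<phi> (?\<kappa> i \<cdot> u)" using h(2)[OF u(1)] 2 k1[OF u(1)] kd[OF u(1)] u(2) by (simp add: hom_def)
        finally show "h \<cdot> t = \<phi> t" using u(3) by simp
      next
        fix h' assume A: "h' \<in> hom C ?W b \<and> (\<forall>c\<in>?S. h' \<cdot> c = \<phi> c)"
        show "h' = h"
        proof (rule coproduct_eqI[OF K conjunct1[OF A] h(1)])
          fix i assume i: "i \<in> I"
          show "h' \<cdot> ?\<kappa> i = h \<cdot> ?\<kappa> i" unfolding h(2)[OF i] by (rule bspec[OF conjunct2[OF A] k1[OF i]])
        qed
      qed
    qed
  qed
qed

lemma covers_coproduct:
  fixes I :: "'i set"
  assumes I: "small I" and P: "is_coproduct C I X c \<iota>" and x: "x \<in> hom C Z c"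
  shows "covers Z (\<lambda>t. \<exists>i \<in> I. \<exists>y \<in> hom C (Dom C t) (X i). x \<cdot> t = \<iota> i \<cdot> y)"
proof -
  obtain e :: "'i \<Rightarrow> 'u" where e: "inj_on e I" using I by (auto simp: small_def)
  then have b: "bij_betw (inv_into I e) (e ` I) I" by (simp add: bij_betw_def inj_on_inv_into)
  have Q: "is_coproduct C (e ` I) (\<lambda>j. X (inv_into I e j)) c (\<lambda>j. \<iota> (inv_into I e j))"
    by (rule coproduct_reindex[OF P b]) auto
  show ?thesis using covers_coproduct_U[OF Q x] by (rule covers_mono) (auto simp: e)
qed

text \<open>Take singletons \<open>I = {i}\<close> and \<open>J = {j}\<close> in the hypothesis on coproducts.\<close>

lemma inc_eq_U:
  fixes K :: "'u set"
  assumes X: "\<And>i. i \<in> K \<Longrightarrow> X i \<in> Obj C" and i: "i \<in> K" and j: "j \<in> K"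
    and y: "y \<in> hom C z (X i)" and y': "y' \<in> hom C z (X j)" and eq: "inc C K X i \<cdot> y = inc C K X j \<cdot> y'"
  shows "(i = j \<and> y = y') \<or> void z"
proof -
  have cK: "is_coproduct C K X (cpr C K X) (inc C K X)" by (rule cpr_coproduct) (auto simp: X)
  have ci: "is_coproduct C {k} X (cpr C {k} X) (inc C {k} X)" if "k \<in> K" for k
    by (rule cpr_coproduct) (auto simp: X that)
  note KD = coproductD[OF cK]
  \<comment> \<open>\<open>F k\<close> is the arrow between coproducts induced by the inclusion of
    \<open>{k}\<close> into \<open>K\<close>, with identities on the summands.\<close>
  define F where "F k = cotup C {k} X (cpr C K X) (\<lambda>i. inc C K X i \<cdot> Ident C (X i))" for k
  have iid: "inc C K X k \<cdot> Ident C (X k) \<in> hom C (X k) (cpr C K X)" if "k \<in> K" for k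
    using KD(3)[OF that] X[OF that] by (simp add: hom_def)
  have iid': "\<forall>l \<in> {k}. inc C K X l \<cdot> Ident C (X l) \<in> hom C (X l) (cpr C K X)" if "k \<in> K" for k
    using iid that by auto
  have F: "F k \<in> hom C (cpr C {k} X) (cpr C K X)" "F k \<cdot> inc C {k} X k = inc C K X k" if "k \<in> K" for k
    unfolding F_def using cotup[OF ci[OF that] KD(1) iid'[OF that]] KD(3)[OF that] X[OF that]
    by (auto simp: hom_def)
  have k1: "inc C {k} X k \<in> hom C (X k) (cpr C {k} X)" if "k \<in> K" for k
    using coproductD(3)[OF ci[OF that]] by simp
  have Pf: "is_pullback C (F i) (F j) (pbo C (F i) (F j)) (pb1 C (F i) (F j)) (pb2 C (F i) (F j))"
    using F(1)[OF i] F(1)[OF j] by (intro pb_is_pullback) (auto simp: hom_def)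
  \<comment> \<open>Empty for \<open>i \<noteq> j\<close> and a single pair otherwise; the two cases
    yield disjointness of summands and monic inclusions.\<close>
  let ?PI = "{(a, b). a \<in> {i} \<and> b \<in> {j} \<and> a = b}"
  let ?W = "\<lambda>(i, j). pbo C (Ident C (X i)) (Ident C (X j))"
  let ?h = "\<lambda>(a, b). pbtup C (F i) (F j) (inc C {i} X a \<cdot> pb1 C (Ident C (X a)) (Ident C (X b)))
          (inc C {j} X b \<cdot> pb2 C (Ident C (X a)) (Ident C (X b)))"
  let ?can = "cotup C ?PI ?W (pbo C (F i) (F j)) ?h"
  have can: "is_iso C ?can"
    using commute[unfolded small_coproducts_commute_with_pullbacks_def, rule_format,
        of "\<lambda>x. x" "{i}" K "\<lambda>x. x" "{j}" X X X "\<lambda>i. Ident C (X i)" "\<lambda>i. Ident C (X i)"] i j X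
    by (auto simp: Let_def F_def[symmetric] hom_def)
  have e1: "F i \<cdot> (inc C {i} X i \<cdot> y) = F j \<cdot> (inc C {j} X j \<cdot> y')"
  proof -
    have "F i \<cdot> (inc C {i} X i \<cdot> y) = (F i \<cdot> inc C {i} X i) \<cdot> y" using F(1)[OF i] k1[OF i] y by (simp add: assoc hom_def)
    moreover have "F j \<cdot> (inc C {j} X j \<cdot> y') = (F j \<cdot> inc C {j} X j) \<cdot> y'"
      using F(1)[OF j] k1[OF j] y' by (simp add: assoc hom_def)
    ultimately show ?thesis using F(2)[OF i] F(2)[OF j] eq by simp
  qed
  have y1: "inc C {i} X i \<cdot> y \<in> hom C z (Dom C (F i))" using k1[OF i] y F(1)[OF i] by (simp add: hom_def)
  have y2: "inc C {j} X j \<cdot> y' \<in> hom C z (Dom C (F j))" using k1[OF j] y' F(1)[OF j] by (simp add: hom_def)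
  obtain t where t: "t \<in> hom C z (pbo C (F i) (F j))" "pb1 C (F i) (F j) \<cdot> t = inc C {i} X i \<cdot> y"
      "pb2 C (F i) (F j) \<cdot> t = inc C {j} X j \<cdot> y'"
    using pullback_ex[OF Pf y1 y2 e1] by auto
  have idp: "is_pullback C (Ident C (X k)) (Ident C (X k)) (pbo C (Ident C (X k)) (Ident C (X k)))
      (pb1 C (Ident C (X k)) (Ident C (X k))) (pb2 C (Ident C (X k)) (Ident C (X k)))" if "k \<in> K" for k
    using X[OF that] by (intro pb_is_pullback) (auto simp: hom_def)
  have cW: "is_coproduct C ?PI ?W (cpr C ?PI ?W) (inc C ?PI ?W)"
    by (rule cpr_coproduct) (use is_pullbackD(4)[OF idp] i in auto)
  note fD = is_pullbackD[OF Pf]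
  show ?thesis
  proof (cases "i = j")
    case False
    \<comment> \<open>The pullback of \<open>F i\<close> and \<open>F j\<close> is then an empty
      coproduct, and \<open>t\<close> maps \<open>z\<close> into it; by
      \<open>covers_coproduct\<close> the empty family covers \<open>z\<close>.\<close>
    then have em: "?PI = {}" by auto
    have cd: "?can \<in> hom C (cpr C ?PI ?W) (pbo C (F i) (F j))"
      by (rule cotup(1)[OF cW fD(4)]) (use em in blast)
    have "is_coproduct C ?PI ?W (pbo C (F i) (F j)) (\<lambda>i. ?can \<cdot> inc C ?PI ?W i)"
      by (rule coproduct_iso[OF cW can cd])
    then have "covers z (\<lambda>s. \<exists>i \<in> ?PI. \<exists>y\<in>hom C (Dom C s) (?W i). t \<cdot> s = (?can \<cdot> inc C ?PI ?W i) \<cdot> y)"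
      by (rule covers_coproduct[OF small_pair _ t(1)])
    then have "void z" by (rule covers_mono) (use em in auto)
    then show ?thesis ..
  next
    case True
    have h1: "?h (i, i) \<in> hom C (?W (i, i)) (pbo C (F i) (F j)) \<and>
       pb1 C (F i) (F j) \<cdot> ?h (i, i) = pb2 C (F i) (F j) \<cdot> ?h (i, i)"
    proof -
      note ip = is_pullbackD[OF idp[OF i]]
      have q: "pb1 C (Ident C (X i)) (Ident C (X i)) = pb2 C (Ident C (X i)) (Ident C (X i))"
        using ip X[OF i] by simp
      let ?a = "inc C {i} X i \<cdot> pb2 C (Ident C (X i)) (Ident C (X i))"
      have "?a \<in> hom C (?W (i, i)) (Dom C (F i))" using ip k1[OF i] X[OF i] F(1)[OF i] by (simp add: hom_def)
      then show ?thesis using pbtup[OF fD(1-3), of ?a "?W (i, i)" ?a] True q by simp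
    qed
    have ht: "\<forall>p \<in> ?PI. ?h p \<in> hom C (?W p) (pbo C (F i) (F j))" using True h1 by auto
    note cn = cotup[OF cW fD(4) ht]
    \<comment> \<open>The canonical arrow equalises the projections, because the two projections of
      the pullback of an identity along itself agree. Being invertible, it forces the projections of
      the pullback of \<open>F i\<close> along itself to agree.\<close>
    have "pb1 C (F i) (F j) \<cdot> ?can = pb2 C (F i) (F j) \<cdot> ?can"
    proof (rule coproduct_eqI[OF cW])
      show "pb1 C (F i) (F j) \<cdot> ?can \<in> hom C (cpr C ?PI ?W) (cpr C {i} X)"
        "pb2 C (F i) (F j) \<cdot> ?can \<in> hom C (cpr C ?PI ?W) (cpr C {i} X)"
        using cn(1) fD F(1)[OF i] True by (auto simp: hom_def)
      fix p assume p: "p \<in> ?PI"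
      then have pi: "p = (i, i)" by auto
      have ip: "inc C ?PI ?W p \<in> hom C (?W p) (cpr C ?PI ?W)" using coproductD(3)[OF cW p] .
      show "(pb1 C (F i) (F j) \<cdot> ?can) \<cdot> inc C ?PI ?W p = (pb2 C (F i) (F j) \<cdot> ?can) \<cdot> inc C ?PI ?W p"
        using cn(1) cn(2)[OF p] fD ip h1 pi by (simp add: assoc hom_def)
    qed
    moreover have cod_can: "Cod C ?can = pbo C (F i) (F j)" using cn(1) by (simp only: hom_iff)
    moreover have "pb1 C (F i) (F j) \<in> hom C (Cod C ?can) (cpr C {i} X)"
        "pb2 C (F i) (F j) \<in> hom C (Cod C ?can) (cpr C {i} X)"
      using fD(5-10) F(1)[OF i] F(1)[OF j] True cod_can by (simp_all only: hom_iff)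
    ultimately have eqp: "pb1 C (F i) (F j) = pb2 C (F i) (F j)"
      using iso_cancel_right[OF can] by blast
    have "inc C {i} X i \<cdot> y = inc C {j} X j \<cdot> y'" using t(2,3) unfolding eqp by (rule trans[OF sym])
    then have e: "inc C {i} X i \<cdot> y = inc C {i} X i \<cdot> y'" unfolding True[symmetric] .
    have "y \<in> hom C z (Dom C (inc C {i} X i))" "y' \<in> hom C z (Dom C (inc C {i} X i))"
      using k1[OF i] y y' True by (auto simp only: hom_iff)
    then have "y = y'" by (rule iso_cancel[OF singleton_coproduct_iso[OF ci[OF i]] _ _ e])
    then show ?thesis using True by simp
  qed
qed

lemma inc_eq:
  fixes K :: "'i set"
  assumes K: "small K" and X: "\<And>i. i \<in> K \<Longrightarrow> X i \<in> Obj C" and i: "i \<in> K" and j: "j \<in> K"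
    and y: "y \<in> hom C z (X i)" and y': "y' \<in> hom C z (X j)" and eq: "inc C K X i \<cdot> y = inc C K X j \<cdot> y'"
  shows "(i = j \<and> y = y') \<or> void z"
proof -
  obtain e :: "'i \<Rightarrow> 'u" where e: "inj_on e K" using K by (auto simp: small_def)
  then have b: "bij_betw (inv_into K e) (e ` K) K" by (simp add: bij_betw_def inj_on_inv_into)
  let ?Y = "\<lambda>j. X (inv_into K e j)"
  have P: "is_coproduct C K X (cpr C K X) (inc C K X)" by (rule cpr_coproduct[OF K X])
  have Q: "is_coproduct C (e ` K) ?Y (cpr C K X) (\<lambda>j. inc C K X (inv_into K e j))"
    by (rule coproduct_reindex[OF P b]) auto
  have R: "is_coproduct C (e ` K) ?Y (cpr C (e ` K) ?Y) (inc C (e ` K) ?Y)"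
    by (rule cpr_coproduct) (use X e in auto)
  obtain k where k: "k \<in> hom C (cpr C K X) (cpr C (e ` K) ?Y)"
      "\<And>l. l \<in> e ` K \<Longrightarrow> k \<cdot> inc C K X (inv_into K e l) = inc C (e ` K) ?Y l"
    using coproduct_unique_iso[OF Q R] by blast
  have *: "inc C (e ` K) ?Y (e l) \<cdot> w = k \<cdot> (inc C K X l \<cdot> w)" if "l \<in> K" "w \<in> hom C z (X l)" for l w
    using k(1) k(2)[of "e l"] that e coproductD(3)[OF P that(1)] by (simp add: assoc hom_def flip: k(2))
  have "inc C (e ` K) ?Y (e i) \<cdot> y = inc C (e ` K) ?Y (e j) \<cdot> y'" using *[OF i y] *[OF j y'] eq by simp
  then have "(e i = e j \<and> y = y') \<or> void z"
    by (intro inc_eq_U) (use X e i j y y' in auto)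
  then show ?thesis using e i j by (auto dest: inj_onD)
qed

end

section \<open>Enriched graphs\<close>

lemma mk_graph_sel [simp]:
  "Verts (mk_graph S E) = S"
  "a \<in> S \<Longrightarrow> b \<in> S \<Longrightarrow> Edge (mk_graph S E) a b = E a b"
  by (auto simp: mk_graph_def)

lemma mk_vgmor_sel [simp]:
  "GDom (mk_vgmor A B f e) = A" "GCod (mk_vgmor A B f e) = B"
  "a \<in> Verts A \<Longrightarrow> Vmap (mk_vgmor A B f e) a = f a"
  "a \<in> Verts A \<Longrightarrow> b \<in> Verts A \<Longrightarrow> Emap (mk_vgmor A B f e) a b = e a b"
  by (auto simp: mk_vgmor_def)

lemma is_vgraph_mk [simp]: "is_vgraph V (mk_graph S E) \<longleftrightarrow> (\<forall>a \<in> S. \<forall>b \<in> S. E a b \<in> Obj V)"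
  by (auto simp: is_vgraph_def) (auto simp: mk_graph_def fun_eq_iff)

lemma mk_vgmor_cong:
  assumes "A = A'" "B = B'" "\<And>a. a \<in> Verts A \<Longrightarrow> f a = f' a"
    "\<And>a b. a \<in> Verts A \<Longrightarrow> b \<in> Verts A \<Longrightarrow> e a b = e' a b"
  shows "mk_vgmor A B f e = mk_vgmor A' B' f' e'"
  using assms by (auto simp: mk_vgmor_def fun_eq_iff)

lemma VGph_simps [simp]:
  "Obj (VGph V) = {A. is_vgraph V A}" "Arr (VGph V) = {f. is_vgmor V f}"
  "Dom (VGph V) = GDom" "Cod (VGph V) = GCod"
  by (simp_all add: VGph_def)

lemma vhom_iff: "f \<in> hom (VGph V) A B \<longleftrightarrow> is_vgmor V f \<and> GDom f = A \<and> GCod f = B"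
  by (auto simp: hom_def)

lemma vhomD:
  assumes "f \<in> hom (VGph V) A B"
  shows "is_vgraph V A" "is_vgraph V B" "GDom f = A" "GCod f = B"
    "a \<in> Verts A \<Longrightarrow> Vmap f a \<in> Verts B"
    "a \<in> Verts A \<Longrightarrow> b \<in> Verts A \<Longrightarrow> Emap f a b \<in> hom V (Edge A a b) (Edge B (Vmap f a) (Vmap f b))"
  using assms by (auto simp: vhom_iff is_vgmor_def)

lemma vhomI:
  assumes "is_vgraph V A" "is_vgraph V B" "\<And>a. a \<in> Verts A \<Longrightarrow> f a \<in> Verts B"
    "\<And>a b. a \<in> Verts A \<Longrightarrow> b \<in> Verts A \<Longrightarrow> e a b \<in> hom V (Edge A a b) (Edge B (f a) (f b))"
  shows "mk_vgmor A B f e \<in> hom (VGph V) A B"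
  using assms by (auto simp: vhom_iff is_vgmor_def intro!: mk_vgmor_cong)

lemma vhom_eqI:
  assumes "f \<in> hom (VGph V) A B" "g \<in> hom (VGph V) A B" "\<And>a. a \<in> Verts A \<Longrightarrow> Vmap f a = Vmap g a"
    "\<And>a b. a \<in> Verts A \<Longrightarrow> b \<in> Verts A \<Longrightarrow> Emap f a b = Emap g a b"
  shows "f = g"
proof -
  have "f = mk_vgmor A B (Vmap f) (Emap f)" "g = mk_vgmor A B (Vmap g) (Emap g)"
    using assms(1,2) by (auto simp: vhom_iff is_vgmor_def)
  moreover have "mk_vgmor A B (Vmap f) (Emap f) = mk_vgmor A B (Vmap g) (Emap g)"
    by (rule mk_vgmor_cong) (use assms in auto)
  ultimately show ?thesis by simp
qed

lemma Vmap_comp: 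
  "f \<in> hom (VGph V) A B \<Longrightarrow> a \<in> Verts A \<Longrightarrow> Vmap (g \<cdot>\<^bsub>VGph V\<^esub> f) a = Vmap g (Vmap f a)"
  by (auto simp: VGph_def hom_def)

lemma Emap_comp: 
  "f \<in> hom (VGph V) A B \<Longrightarrow> a \<in> Verts A \<Longrightarrow> b \<in> Verts A \<Longrightarrow>
     Emap (g \<cdot>\<^bsub>VGph V\<^esub> f) a b = Emap g (Vmap f a) (Vmap f b) \<cdot>\<^bsub>V\<^esub> Emap f a b"
  by (auto simp: VGph_def hom_def)

lemma Ident_vg:
  "a \<in> Verts A \<Longrightarrow> Vmap (Ident (VGph V) A) a = a"
  "a \<in> Verts A \<Longrightarrow> b \<in> Verts A \<Longrightarrow> Emap (Ident (VGph V) A) a b = Ident V (Edge A a b)"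
  by (auto simp: VGph_def)

lemma is_vgraph_Edge: "is_vgraph V A \<Longrightarrow> a \<in> Verts A \<Longrightarrow> b \<in> Verts A \<Longrightarrow> Edge A a b \<in> Obj V"
  by (auto simp: is_vgraph_def)

lemma (in category) VGph_category: "category (VGph C :: (('v, 'o) vgraph, ('v, 'o, 'm) vgmor) cat)"
proof
  let ?G = "VGph C :: (('v, 'o) vgraph, ('v, 'o, 'm) vgmor) cat"
  show "Dom ?G f \<in> Obj ?G" "Cod ?G f \<in> Obj ?G" if "f \<in> Arr ?G" for f :: "('v, 'o, 'm) vgmor"
    using that by (auto simp: is_vgmor_def)
  show id: "Ident ?G A \<in> hom ?G A A" if "A \<in> Obj ?G" for A :: "('v, 'o) vgraph"
  proof -
    have "mk_vgmor A A (\<lambda>a. a) (\<lambda>a b. Ident C (Edge A a b)) \<in> hom ?G A A"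
      using that by (intro vhomI) (auto intro: ident_hom is_vgraph_Edge)
    then show ?thesis by (simp add: VGph_def)
  qed
  show cmp: "g \<cdot>\<^bsub>?G\<^esub> f \<in> hom ?G A D" if f: "f \<in> hom ?G A B" and g: "g \<in> hom ?G B D"
    for f g :: "('v, 'o, 'm) vgmor" and A B D
  proof -
    have "mk_vgmor (GDom f) (GCod g) (\<lambda>a. Vmap g (Vmap f a))
               (\<lambda>a b. Emap g (Vmap f a) (Vmap f b) \<cdot>\<^bsub>C\<^esub> Emap f a b) \<in> hom ?G (GDom f) (GCod g)"
      using vhomD[OF f] vhomD[OF g] by (intro vhomI) (auto intro!: comp_hom)
    then show ?thesis using vhomD[OF f] vhomD[OF g] by (simp add: VGph_def)
  qed
  fix f g h :: "('v, 'o, 'm) vgmor" and A B D F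
  assume f: "f \<in> hom ?G A B"
  note Df = vhomD[OF f]
  show "Ident ?G B \<cdot>\<^bsub>?G\<^esub> f = f"
    by (rule vhom_eqI[OF cmp[OF f id] f])
      (use Df ident_left[OF Df(6)] in \<open>auto simp: Vmap_comp[OF f] Emap_comp[OF f] Ident_vg\<close>)
  have idA: "Ident ?G A \<in> hom ?G A A" using Df id by simp
  show "f \<cdot>\<^bsub>?G\<^esub> Ident ?G A = f"
    by (rule vhom_eqI[OF cmp[OF idA f] f])
      (use Df ident_right[OF Df(6)] in \<open>auto simp: Vmap_comp[OF idA] Emap_comp[OF idA] Ident_vg\<close>)
  assume g: "g \<in> hom ?G B D" and h: "h \<in> hom ?G D F"
  note gf = cmp[OF f g] and hg = cmp[OF g h]
  show "(h \<cdot>\<^bsub>?G\<^esub> g) \<cdot>\<^bsub>?G\<^esub> f = h \<cdot>\<^bsub>?G\<^esub> (g \<cdot>\<^bsub>?G\<^esub> f)"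
  proof (rule vhom_eqI[OF cmp[OF f hg] cmp[OF gf h]])
    fix a b assume a: "a \<in> Verts A" "b \<in> Verts A"
    show "Vmap ((h \<cdot>\<^bsub>?G\<^esub> g) \<cdot>\<^bsub>?G\<^esub> f) a = Vmap (h \<cdot>\<^bsub>?G\<^esub> (g \<cdot>\<^bsub>?G\<^esub> f)) a" if "a \<in> Verts A" for a
      using that Df by (simp add: Vmap_comp[OF f] Vmap_comp[OF g] Vmap_comp[OF gf])
    show "Emap ((h \<cdot>\<^bsub>?G\<^esub> g) \<cdot>\<^bsub>?G\<^esub> f) a b = Emap (h \<cdot>\<^bsub>?G\<^esub> (g \<cdot>\<^bsub>?G\<^esub> f)) a b"
      using a Df(5) comp_assoc[OF Df(6)[OF a] vhomD(6)[OF g] vhomD(6)[OF h]] vhomD(5)[OF g]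
      by (simp add: Vmap_comp[OF f] Vmap_comp[OF g] Vmap_comp[OF gf] Emap_comp[OF f] Emap_comp[OF g] Emap_comp[OF gf])
  qed
qed

section \<open>Probing graphs by a single edge\<close>

context ext_cat begin

abbreviation Gph :: "(('u, 'o) vgraph, ('u, 'o, 'm) vgmor) cat" where
  "Gph \<equiv> VGph C"

abbreviation graph_comp (infixr "\<odot>" 70) where
  "g \<odot> f \<equiv> g \<cdot>\<^bsub>Gph\<^esub> f"

lemma Emap_comp_el:
  assumes f: "f \<in> hom Gph A B" and g: "g \<in> hom Gph B D" and a: "a \<in> Verts A" "b \<in> Verts A"
    and x: "x \<in> hom C z (Edge A a b)"
  shows "Emap (g \<odot> f) a b \<cdot> x = Emap g (Vmap f a) (Vmap f b) \<cdot> (Emap f a b \<cdot> x)"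
  unfolding Emap_comp[OF f a]
  using comp_assoc[OF x vhomD(6)[OF f a] vhomD(6)[OF g vhomD(5)[OF f a(1)] vhomD(5)[OF f a(2)]]] .

text \<open>An initial object, as the empty coproduct; \<open>trm C\<close> only fills in a family
  over the empty set.\<close>

definition ini :: 'o where
  "ini = cpr C ({} :: 'u set) (\<lambda>_. trm C)"

lemma ini_coproduct: "is_coproduct C ({} :: 'u set) (\<lambda>_. trm C) ini (inc C {} (\<lambda>_. trm C))"
  unfolding ini_def by (rule cpr_coproduct) auto

lemma ini_obj [simp]: "ini \<in> Obj C"
  using coproductD(1)[OF ini_coproduct] .

lemma ini_eq: "f \<in> hom C ini b \<Longrightarrow> g \<in> hom C ini b \<Longrightarrow> f = g"
  by (rule coproduct_eqI[OF ini_coproduct]) auto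

lemma ini_ex: "b \<in> Obj C \<Longrightarrow> \<exists>f. f \<in> hom C ini b"
  using coproduct_ex[OF ini_coproduct, of b] by auto

definition u0 :: 'u where "u0 = undefined"
definition u1 :: 'u where "u1 = (SOME u. u \<noteq> u0)"

lemma u1_neq: "u1 \<noteq> u0"
proof -
  have "\<exists>u. u \<noteq> u0" using infinite_U by (metis (full_types) UNIV_eq_I finite.simps insertCI)
  then show ?thesis unfolding u1_def by (rule someI_ex)
qed

text \<open>Morphisms from \<open>edge_graph z\<close> to \<open>A\<close> are the elements at stage \<open>z\<close> of the hom-objects of \<open>A\<close>:
  all hom-objects except the one from \<open>u0\<close> to \<open>u1\<close> are initial.\<close>

definition edge_graph :: "'o \<Rightarrow> ('u, 'o) vgraph" where
  "edge_graph z = mk_graph {u0, u1} (\<lambda>a b. if a = u0 \<and> b = u1 then z else ini)"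

definition edge_mor :: "'o \<Rightarrow> ('u, 'o) vgraph \<Rightarrow> 'u \<Rightarrow> 'u \<Rightarrow> 'm \<Rightarrow> ('u, 'o, 'm) vgmor" where
  "edge_mor z A a b x = (let f = (\<lambda>v. if v = u0 then a else b) in mk_vgmor (edge_graph z) A f
     (\<lambda>v w. if v = u0 \<and> w = u1 then x else (SOME h. h \<in> hom C ini (Edge A (f v) (f w)))))"

lemma edge_graph_simps [simp]: "Verts (edge_graph z) = {u0, u1}" "Edge (edge_graph z) u0 u1 = z"
    "z \<in> Obj C \<Longrightarrow> is_vgraph C (edge_graph z)"
  by (auto simp: edge_graph_def)

lemma edge_graph_ini: "v \<in> {u0, u1} \<Longrightarrow> w \<in> {u0, u1} \<Longrightarrow> \<not> (v = u0 \<and> w = u1) \<Longrightarrow> Edge (edge_graph z) v w = ini"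
  unfolding edge_graph_def by (subst mk_graph_sel(2)) auto

lemma edge_mor_sel [simp]: "Vmap (edge_mor z A a b x) u0 = a" "Vmap (edge_mor z A a b x) u1 = b" "Emap (edge_mor z A a b x) u0 u1 = x"
  using u1_neq by (auto simp: edge_mor_def)

lemma edge_mor_hom:
  assumes A: "is_vgraph C A" and ab: "a \<in> Verts A" "b \<in> Verts A" and x: "x \<in> hom C z (Edge A a b)"
  shows "edge_mor z A a b x \<in> hom Gph (edge_graph z) A"
proof -
  let ?f = "\<lambda>v. if v = u0 then a else b"
  have z: "z \<in> Obj C" using x by (auto simp: hom_def)
  have f: "?f v \<in> Verts A" for v using ab by auto
  have s: "(SOME h. h \<in> hom C ini (Edge A (?f v) (?f w))) \<in> hom C ini (Edge A (?f v) (?f w))" for v w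
    by (rule someI_ex, rule ini_ex, rule is_vgraph_Edge[OF A f f])
  show ?thesis unfolding edge_mor_def Let_def
  proof (rule vhomI)
    fix v w assume vw: "v \<in> Verts (edge_graph z)" "w \<in> Verts (edge_graph z)"
    show "(if v = u0 \<and> w = u1 then x else SOME h. h \<in> hom C ini (Edge A (?f v) (?f w)))
      \<in> hom C (Edge (edge_graph z) v w) (Edge A (?f v) (?f w))"
    proof (cases "v = u0 \<and> w = u1")
      case True then show ?thesis using x u1_neq by simp
    next
      case False
      then have "Edge (edge_graph z) v w = ini" using vw by (intro edge_graph_ini) auto
      then show ?thesis unfolding if_not_P[OF False] using s[of v w] by simp
    qed
  qed (use A z f in auto)
qed

text \<open>All other hom-objects of \<open>edge_graph z\<close> are initial, so the remaining
  components agree by themselves.\<close>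

lemma edge_mor_eqI:
  assumes "f \<in> hom Gph (edge_graph z) A" "g \<in> hom Gph (edge_graph z) A" "Vmap f u0 = Vmap g u0" "Vmap f u1 = Vmap g u1"
    "Emap f u0 u1 = Emap g u0 u1"
  shows "f = g"
proof (rule vhom_eqI[OF assms(1,2)])
  show v: "Vmap f a = Vmap g a" if "a \<in> Verts (edge_graph z)" for a using that assms by auto
  fix a b assume ab: "a \<in> Verts (edge_graph z)" "b \<in> Verts (edge_graph z)"
  show "Emap f a b = Emap g a b"
  proof (cases "a = u0 \<and> b = u1")
    case True then show ?thesis using assms by simp
  next
    case False
    then have "Edge (edge_graph z) a b = ini" using ab by (intro edge_graph_ini) auto
    then show ?thesis using vhomD(6)[OF assms(1) ab] vhomD(6)[OF assms(2) ab] v[OF ab(1)] v[OF ab(2)]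
      by (metis ini_eq)
  qed
qed

lemma edge_mor_comp:
  assumes "is_vgraph C A" "a \<in> Verts A" "b \<in> Verts A" "x \<in> hom C z (Edge A a b)" "g \<in> hom Gph A B"
  shows "g \<odot> edge_mor z A a b x = edge_mor z B (Vmap g a) (Vmap g b) (Emap g a b \<cdot> x)"
proof -
  note t = edge_mor_hom[OF assms(1-4)] and gD = vhomD[OF assms(5)]
  show ?thesis
  proof (rule edge_mor_eqI[OF category.comp_hom[OF VGph_category t assms(5)] edge_mor_hom])
    show "Emap g a b \<cdot> x \<in> hom C z (Edge B (Vmap g a) (Vmap g b))"
      using comp_hom[OF assms(4) gD(6)[OF assms(2,3)]] .
  qed (use assms gD in \<open>auto simp: Vmap_comp[OF t] Emap_comp[OF t]\<close>)
qed

text \<open>The terminal graph is known only through its universal property. Probing with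
  \<open>edge_graph ini\<close>, whose edge carries no information, shows that any two vertices
  coincide; probing with \<open>edge_graph z\<close> shows that the hom-object is terminal.\<close>

lemma terminal_graph:
  assumes t: "is_terminal Gph t"
  shows "\<exists>pt. Verts t = {pt} \<and> is_terminal C (Edge t pt pt)"
proof -
  have T: "is_vgraph C t" using t by (simp add: is_terminal_def)
  have un: "f = g" if "f \<in> hom Gph A t" "g \<in> hom Gph A t" for A f g
    using t vhomD(1)[OF that(1)] that unfolding is_terminal_def by auto
  have ex: "\<exists>f. f \<in> hom Gph (edge_graph z) t" if "z \<in> Obj C" for z
    using t edge_graph_simps(3)[OF that] unfolding is_terminal_def VGph_simps by blast
  obtain f where f: "f \<in> hom Gph (edge_graph ini) t" using ex ini_obj by blast
  define pt where "pt = Vmap f u0"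
  have pt: "pt \<in> Verts t" using vhomD(5)[OF f] by (simp add: pt_def)
  have "a = pt" if a: "a \<in> Verts t" for a
  proof -
    obtain x y where "x \<in> hom C ini (Edge t a a)" "y \<in> hom C ini (Edge t pt pt)"
      using ini_ex is_vgraph_Edge[OF T] a pt by metis
    then have "edge_mor ini t a a x = edge_mor ini t pt pt y" using un edge_mor_hom[OF T] a pt by metis
    then show ?thesis by (metis edge_mor_sel(1))
  qed
  then have V: "Verts t = {pt}" using pt by blast
  moreover have "is_terminal C (Edge t pt pt)" unfolding is_terminal_def
  proof (intro conjI ballI)
    show "Edge t pt pt \<in> Obj C" using is_vgraph_Edge[OF T pt pt] .
    fix z assume z: "z \<in> Obj C"
    obtain f where f: "f \<in> hom Gph (edge_graph z) t" using ex[OF z] by blast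
    have "Vmap f u0 = pt" "Vmap f u1 = pt" using vhomD(5)[OF f] V by simp_all
    then have "Emap f u0 u1 \<in> hom C z (Edge t pt pt)" using vhomD(6)[OF f, of u0 u1] by simp
    moreover have "x = y" if "x \<in> hom C z (Edge t pt pt)" "y \<in> hom C z (Edge t pt pt)" for x y
      using un[OF edge_mor_hom[OF T pt pt that(1)] edge_mor_hom[OF T pt pt that(2)]] by (metis edge_mor_sel(3))
    ultimately show "\<exists>!h. h \<in> hom C z (Edge t pt pt)" by blast
  qed
  ultimately show ?thesis by blast
qed

lemma VGph_terminal: "is_terminal Gph (mk_graph {u0} (\<lambda>_ _. trm C))"
  unfolding is_terminal_def
proof (intro conjI ballI)
  show "mk_graph {u0} (\<lambda>_ _. trm C) \<in> Obj Gph" by simp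
  fix A :: "('u, 'o) vgraph" assume "A \<in> Obj Gph"
  then have A: "is_vgraph C A" by simp
  let ?t = "mk_graph {u0} (\<lambda>_ _. trm C)"
  have 1: "mk_vgmor A ?t (\<lambda>_. u0) (\<lambda>a b. bang C (Edge A a b)) \<in> hom Gph A ?t"
    by (rule vhomI) (auto simp: A intro: bang_hom is_vgraph_Edge[OF A])
  have 2: "f = g" if f: "f \<in> hom Gph A ?t" and g: "g \<in> hom Gph A ?t" for f g
  proof (rule vhom_eqI[OF f g])
    have v: "Vmap f a = u0" "Vmap g a = u0" if "a \<in> Verts A" for a
      using vhomD(5)[OF f that] vhomD(5)[OF g that] by auto
    then show "Vmap f a = Vmap g a" if "a \<in> Verts A" for a using that by simp
    fix a b assume ab: "a \<in> Verts A" "b \<in> Verts A"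
    show "Emap f a b = Emap g a b"
      using vhomD(6)[OF f ab] vhomD(6)[OF g ab] v ab by (simp add: terminal_unique[OF trm_terminal])
  qed
  show "\<exists>!h. h \<in> hom Gph A ?t" using 1 2 by blast
qed

text \<open>Vertices and hom-objects are pulled back separately. Vertices must lie in
  \<open>'u\<close>, hence pairs of vertices are coded by an injection \<open>e\<close> with
  decodings \<open>d1\<close> and \<open>d2\<close>.\<close>

lemma VGph_has_pullbacks: "has_pullbacks Gph"
  unfolding has_pullbacks_def
proof (intro ballI impI)
  fix f g :: "('u, 'o, 'm) vgmor"
  assume fg: "f \<in> Arr Gph" "g \<in> Arr Gph" "Cod Gph f = Cod Gph g"
  define A B D where "A = GDom f" and "B = GDom g" and "D = GCod f"
  have f: "f \<in> hom Gph A D" and g: "g \<in> hom Gph B D" using fg by (auto simp: vhom_iff A_def B_def D_def)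
  note fD = vhomD[OF f] and gD = vhomD[OF g]
  obtain e :: "'u \<times> 'u \<Rightarrow> 'u" where e: "inj e" using ex_inj_pair by auto
  define d1 where "d1 v = fst (inv e v)" for v
  define d2 where "d2 v = snd (inv e v)" for v
  have d [simp]: "d1 (e (a, b)) = a" "d2 (e (a, b)) = b" for a b using e by (auto simp: d1_def d2_def)
  define S where "S = {e (a, b) | a b. a \<in> Verts A \<and> b \<in> Verts B \<and> Vmap f a = Vmap g b}"
  have S: "d1 v \<in> Verts A" "d2 v \<in> Verts B" "Vmap f (d1 v) = Vmap g (d2 v)" if "v \<in> S" for v
    using that by (auto simp: S_def)
  have Se: "v = e (d1 v, d2 v)" if "v \<in> S" for v using that by (auto simp: S_def)
  define F where "F v w = Emap f (d1 v) (d1 w)" for v w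
  define H where "H v w = Emap g (d2 v) (d2 w)" for v w
  have F: "F v w \<in> hom C (Edge A (d1 v) (d1 w)) (Edge D (Vmap f (d1 v)) (Vmap f (d1 w)))"
    and H: "H v w \<in> hom C (Edge B (d2 v) (d2 w)) (Edge D (Vmap f (d1 v)) (Vmap f (d1 w)))"
    if "v \<in> S" "w \<in> S" for v w
    using fD(6)[OF S(1)[OF that(1)] S(1)[OF that(2)]] gD(6)[OF S(2)[OF that(1)] S(2)[OF that(2)]]
      S(3)[OF that(1)] S(3)[OF that(2)] by (simp_all add: F_def H_def)
  have PB: "is_pullback C (F v w) (H v w) (pbo C (F v w) (H v w)) (pb1 C (F v w) (H v w)) (pb2 C (F v w) (H v w))"
    if "v \<in> S" "w \<in> S" for v w
    using F[OF that] H[OF that] by (intro pb_is_pullback) (auto simp: hom_def)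
  define P where "P = mk_graph S (\<lambda>v w. pbo C (F v w) (H v w))"
  have P: "is_vgraph C P" "Verts P = S" using is_pullbackD(4)[OF PB] by (auto simp: P_def)
  have PE: "Edge P v w = pbo C (F v w) (H v w)" if "v \<in> S" "w \<in> S" for v w using that by (simp add: P_def)
  define q1 where "q1 = mk_vgmor P A d1 (\<lambda>v w. pb1 C (F v w) (H v w))"
  define q2 where "q2 = mk_vgmor P B d2 (\<lambda>v w. pb2 C (F v w) (H v w))"
  have q1: "q1 \<in> hom Gph P A" unfolding q1_def
  proof (rule vhomI)
    fix v w assume "v \<in> Verts P" "w \<in> Verts P"
    then have vw: "v \<in> S" "w \<in> S" using P by auto
    show "pb1 C (F v w) (H v w) \<in> hom C (Edge P v w) (Edge A (d1 v) (d1 w))"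
      using is_pullbackD[OF PB[OF vw]] F[OF vw] PE[OF vw] by (simp add: hom_def)
  qed (use P S fD in auto)
  have q2: "q2 \<in> hom Gph P B" unfolding q2_def
  proof (rule vhomI)
    fix v w assume "v \<in> Verts P" "w \<in> Verts P"
    then have vw: "v \<in> S" "w \<in> S" using P by auto
    show "pb2 C (F v w) (H v w) \<in> hom C (Edge P v w) (Edge B (d2 v) (d2 w))"
      using is_pullbackD[OF PB[OF vw]] H[OF vw] PE[OF vw] by (simp add: hom_def)
  qed (use P S gD in auto)
  have qv: "Vmap q1 v = d1 v" "Vmap q2 v = d2 v" if "v \<in> S" for v
    using that P by (auto simp: q1_def q2_def)
  have qe: "Emap q1 v w = pb1 C (F v w) (H v w)" "Emap q2 v w = pb2 C (F v w) (H v w)" if "v \<in> S" "w \<in> S" for v w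
    using that P by (auto simp: q1_def q2_def)
  note cmp = category.comp_hom[OF VGph_category]
  have sq: "f \<odot> q1 = g \<odot> q2"
    by (rule vhom_eqI[OF cmp[OF q1 f] cmp[OF q2 g]])
      (use P S is_pullbackD(11)[OF PB] in \<open>auto simp: Vmap_comp[OF q1] Vmap_comp[OF q2] Emap_comp[OF q1]
          Emap_comp[OF q2] qv qe F_def H_def\<close>)
  have univ: "\<exists>!h. h \<in> hom Gph Z P \<and> q1 \<odot> h = x \<and> q2 \<odot> h = y"
    if x: "x \<in> hom Gph Z A" and y: "y \<in> hom Gph Z B" and eq: "f \<odot> x = g \<odot> y" for Z x y
  proof -
    note xD = vhomD[OF x] and yD = vhomD[OF y]
    define k where "k a = e (Vmap x a, Vmap y a)" for a
    have k: "k a \<in> S" if "a \<in> Verts Z" for a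
      using that xD(5) yD(5) arg_cong[OF eq, of "\<lambda>t. Vmap t a"]
      by (auto simp: k_def S_def Vmap_comp[OF x] Vmap_comp[OF y])
    have kd: "d1 (k a) = Vmap x a" "d2 (k a) = Vmap y a" for a by (auto simp: k_def)
    have ex: "\<exists>h. h \<in> hom C (Edge Z a b) (pbo C (F (k a) (k b)) (H (k a) (k b))) \<and>
       pb1 C (F (k a) (k b)) (H (k a) (k b)) \<cdot> h = Emap x a b \<and>
       pb2 C (F (k a) (k b)) (H (k a) (k b)) \<cdot> h = Emap y a b" if ab: "a \<in> Verts Z" "b \<in> Verts Z" for a b
    proof (rule pullback_ex[OF PB[OF k[OF ab(1)] k[OF ab(2)]]])
      show "Emap x a b \<in> hom C (Edge Z a b) (Dom C (F (k a) (k b)))"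
        using xD(6)[OF ab] F[OF k[OF ab(1)] k[OF ab(2)]] by (simp add: kd hom_def)
      show "Emap y a b \<in> hom C (Edge Z a b) (Dom C (H (k a) (k b)))"
        using yD(6)[OF ab] H[OF k[OF ab(1)] k[OF ab(2)]] by (simp add: kd hom_def)
      show "F (k a) (k b) \<cdot> Emap x a b = H (k a) (k b) \<cdot> Emap y a b"
        using arg_cong[OF eq, of "\<lambda>t. Emap t a b"] ab
        by (simp add: Emap_comp[OF x] Emap_comp[OF y] F_def H_def kd)
    qed
    define m where "m a b = (SOME h. h \<in> hom C (Edge Z a b) (pbo C (F (k a) (k b)) (H (k a) (k b))) \<and>
       pb1 C (F (k a) (k b)) (H (k a) (k b)) \<cdot> h = Emap x a b \<and>
       pb2 C (F (k a) (k b)) (H (k a) (k b)) \<cdot> h = Emap y a b)" for a b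
    have m: "m a b \<in> hom C (Edge Z a b) (Edge P (k a) (k b))"
      "pb1 C (F (k a) (k b)) (H (k a) (k b)) \<cdot> m a b = Emap x a b"
      "pb2 C (F (k a) (k b)) (H (k a) (k b)) \<cdot> m a b = Emap y a b" if ab: "a \<in> Verts Z" "b \<in> Verts Z" for a b
      using someI_ex[OF ex[OF ab]] PE[OF k[OF ab(1)] k[OF ab(2)]] unfolding m_def[symmetric] by auto
    define h where "h = mk_vgmor Z P k m"
    have h: "h \<in> hom Gph Z P" unfolding h_def
      by (rule vhomI) (use P k m xD in auto)
    have hs: "Vmap h a = k a" "b \<in> Verts Z \<Longrightarrow> Emap h a b = m a b" if "a \<in> Verts Z" for a b
      using that by (auto simp: h_def)
    have 1: "q1 \<odot> h = x"
      by (rule vhom_eqI[OF cmp[OF h q1] x])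
        (simp_all add: Vmap_comp[OF h] Emap_comp[OF h] hs qv qe k kd m)
    have 2: "q2 \<odot> h = y"
      by (rule vhom_eqI[OF cmp[OF h q2] y])
        (simp_all add: Vmap_comp[OF h] Emap_comp[OF h] hs qv qe k kd m)
    show ?thesis
    proof (rule ex1I[of _ h])
      show "h \<in> hom Gph Z P \<and> q1 \<odot> h = x \<and> q2 \<odot> h = y" using h 1 2 by simp
      fix h' assume h': "h' \<in> hom Gph Z P \<and> q1 \<odot> h' = x \<and> q2 \<odot> h' = y"
      then have h'1: "h' \<in> hom Gph Z P" by simp
      note hD = vhomD[OF h] and hD' = vhomD[OF h'1]
      have hS: "Vmap h' a \<in> S" "Vmap h a \<in> S" if "a \<in> Verts Z" for a using hD'(5) hD(5) that P by auto
      \<comment> \<open>Vertices are settled first: a vertex in \<open>S\<close> is the code of its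
        two decodings. Both edge components then lie in the same hom-object.\<close>
      have v: "Vmap h' a = Vmap h a" if a: "a \<in> Verts Z" for a
      proof -
        have "d1 (Vmap h' a) = Vmap x a" "d2 (Vmap h' a) = Vmap y a"
          using h' a hS[OF a] qv by (metis Vmap_comp)+
        then have "Vmap h' a = k a" using Se[OF hS(1)[OF a]] by (simp add: k_def)
        then show ?thesis using a by (simp add: h_def)
      qed
      show "h' = h"
      proof (rule vhom_eqI[OF h'1 h v])
        fix a b assume ab: "a \<in> Verts Z" "b \<in> Verts Z"
        note vv = v[OF ab(1)] v[OF ab(2)] and SS = hS(2)[OF ab(1)] hS(2)[OF ab(2)]
        have E1: "Emap q1 (Vmap h a) (Vmap h b) \<cdot> Emap h' a b = Emap q1 (Vmap h a) (Vmap h b) \<cdot> Emap h a b"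
          using Emap_comp[OF h'1 ab, of q1] Emap_comp[OF h ab, of q1] h' 1 vv by simp
        have E2: "Emap q2 (Vmap h a) (Vmap h b) \<cdot> Emap h' a b = Emap q2 (Vmap h a) (Vmap h b) \<cdot> Emap h a b"
          using Emap_comp[OF h'1 ab, of q2] Emap_comp[OF h ab, of q2] h' 2 vv by simp
        show "Emap h' a b = Emap h a b"
          using pullback_eqI[OF PB[OF SS] _ _ E1[unfolded qe[OF SS]] E2[unfolded qe[OF SS]]]
            hD(6)[OF ab] hD'(6)[OF ab] vv PE[OF SS] by simp
      qed
    qed
  qed
  have "is_pullback Gph f g P q1 q2"
    unfolding is_pullback_def using fg P sq univ vhomD[OF q1] q1 q2 by (auto simp: A_def B_def)
  then show "\<exists>p \<pi>1 \<pi>2. is_pullback Gph f g p \<pi>1 \<pi>2" by blast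
qed

sublocale Gph: cart_cat "VGph C :: (('u, 'o) vgraph, ('u, 'o, 'm) vgmor) cat"
proof (intro cart_cat.intro cart_cat_axioms.intro)
  show "category Gph" by (rule VGph_category)
  show "has_pullbacks Gph" by (rule VGph_has_pullbacks)
  show "has_terminal Gph" unfolding has_terminal_def using VGph_terminal by blast
qed

section \<open>Vertices and elements of an unspecified pullback of graphs\<close>

context
  fixes f g :: "('u, 'o, 'm) vgmor" and A B D P q1 q2
  assumes P: "is_pullback Gph f g P q1 q2" and f: "f \<in> hom Gph A D" and g: "g \<in> hom Gph B D"
begin

lemma vpb_hom: "q1 \<in> hom Gph P A" "q2 \<in> hom Gph P B"
  using P f g by (auto simp: is_pullback_def vhom_iff)

lemma vpb_graph: "is_vgraph C P"
  using vhomD[OF vpb_hom(1)] by simp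

lemma vpb_sq: "f \<odot> q1 = g \<odot> q2"
  using P by (simp add: is_pullback_def)

lemma vpb_lift:
  assumes "x \<in> hom Gph Z A" "y \<in> hom Gph Z B" "f \<odot> x = g \<odot> y"
  shows "\<exists>h. h \<in> hom Gph Z P \<and> q1 \<odot> h = x \<and> q2 \<odot> h = y"
  using Gph.pullback_ex[OF P, of x Z y] assms vhomD(3)[OF f] vhomD(3)[OF g] by simp

lemma vpb_sqV: "w \<in> Verts P \<Longrightarrow> Vmap f (Vmap q1 w) = Vmap g (Vmap q2 w)"
  using Vmap_comp[OF vpb_hom(1), of w f] Vmap_comp[OF vpb_hom(2), of w g] vpb_sq by simp

text \<open>A compatible pair of vertices extends to a compatible pair of morphisms from
  \<open>edge_graph ini\<close>, because parallel arrows out of \<open>ini\<close> agree; the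
  induced morphism names the vertex.\<close>

lemma vpb_vertex:
  assumes a: "a \<in> Verts A" and b: "b \<in> Verts B" and eq: "Vmap f a = Vmap g b"
  shows "\<exists>w \<in> Verts P. Vmap q1 w = a \<and> Vmap q2 w = b"
proof -
  note fD = vhomD[OF f] and gD = vhomD[OF g]
  obtain x y where x: "x \<in> hom C ini (Edge A a a)" and y: "y \<in> hom C ini (Edge B b b)"
    using ini_ex is_vgraph_Edge fD(1) gD(1) a b by metis
  have "Emap f a a \<cdot> x = Emap g b b \<cdot> y"
    using comp_hom[OF x fD(6)[OF a a]] comp_hom[OF y gD(6)[OF b b]] eq by (simp add: ini_eq)
  then have e: "f \<odot> edge_mor ini A a a x = g \<odot> edge_mor ini B b b y"
    using edge_mor_comp[OF fD(1) a a x f] edge_mor_comp[OF gD(1) b b y g] eq by simp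
  obtain h where h: "h \<in> hom Gph (edge_graph ini) P" "q1 \<odot> h = edge_mor ini A a a x" "q2 \<odot> h = edge_mor ini B b b y"
    using vpb_lift[OF edge_mor_hom[OF fD(1) a a x] edge_mor_hom[OF gD(1) b b y] e] by blast
  have "Vmap h u0 \<in> Verts P" using vhomD(5)[OF h(1)] by simp
  moreover have "Vmap q1 (Vmap h u0) = a" "Vmap q2 (Vmap h u0) = b"
    using Vmap_comp[OF h(1), of u0] h(2,3) by (metis insertI1 edge_graph_simps(1) edge_mor_sel(1))+
  ultimately show ?thesis by blast
qed

text \<open>Elements are morphisms from \<open>edge_graph z\<close>, which the two projections
  separate.\<close>

lemma vpb_elem_eq:
  assumes w: "w \<in> Verts P" "w' \<in> Verts P" and v: "v \<in> Verts P" "v' \<in> Verts P"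
    and c: "c \<in> hom C z (Edge P w w')" and d: "d \<in> hom C z (Edge P v v')"
    and eq: "Vmap q1 w = Vmap q1 v" "Vmap q2 w = Vmap q2 v" "Vmap q1 w' = Vmap q1 v'" "Vmap q2 w' = Vmap q2 v'"
      "Emap q1 w w' \<cdot> c = Emap q1 v v' \<cdot> d" "Emap q2 w w' \<cdot> c = Emap q2 v v' \<cdot> d"
  shows "w = v \<and> w' = v' \<and> c = d"
proof -
  have "edge_mor z P w w' c = edge_mor z P v v' d"
    by (rule Gph.pullback_eqI[OF P edge_mor_hom[OF vpb_graph w c] edge_mor_hom[OF vpb_graph v d]])
      (simp_all add: edge_mor_comp[OF vpb_graph w c vpb_hom(1)] edge_mor_comp[OF vpb_graph w c vpb_hom(2)]
        edge_mor_comp[OF vpb_graph v d vpb_hom(1)] edge_mor_comp[OF vpb_graph v d vpb_hom(2)] eq)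
  then show ?thesis by (metis edge_mor_sel)
qed

text \<open>At stage \<open>ini\<close> parallel elements agree, so \<open>vpb_elem_eq\<close>
  compares endpoints only.\<close>

lemma vpb_vertex_eq:
  assumes w: "w \<in> Verts P" and v: "v \<in> Verts P" and eq: "Vmap q1 w = Vmap q1 v" "Vmap q2 w = Vmap q2 v"
  shows "w = v"
proof -
  obtain c d where c: "c \<in> hom C ini (Edge P w w)" and d: "d \<in> hom C ini (Edge P v v)"
    using ini_ex is_vgraph_Edge vpb_graph w v by metis
  note D1 = vhomD[OF vpb_hom(1)] and D2 = vhomD[OF vpb_hom(2)]
  have "Emap q1 w w \<cdot> c = Emap q1 v v \<cdot> d" "Emap q2 w w \<cdot> c = Emap q2 v v \<cdot> d"
    using comp_hom[OF c D1(6)[OF w w]] comp_hom[OF d D1(6)[OF v v]]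
      comp_hom[OF c D2(6)[OF w w]] comp_hom[OF d D2(6)[OF v v]] eq by (auto intro: ini_eq)
  then show ?thesis using vpb_elem_eq[OF w w v v c d] eq by simp
qed

end

end

section \<open>The free enriched category monad\<close>

lemma plen_Cons [simp]: "plen (a # as) = length as"
  by (simp add: plen_def)

lemma length_edges [simp]: "length (edges A as) = plen as"
  by (simp add: edges_def plen_def)

lemma edges_nth: "i < plen as \<Longrightarrow> edges A as ! i = Edge A (as ! i) (as ! Suc i)"
  by (simp add: edges_def plen_def nth_tl)

lemma edges_simps [simp]: "edges A [a] = []" "edges A (a # b # as) = Edge A a b # edges A (b # as)"
  by (simp_all add: edges_def)

lemma paths_iff: "as \<in> paths A a b \<longleftrightarrow> as \<noteq> [] \<and> set as \<subseteq> Verts A \<and> hd as = a \<and> last as = b"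
  by (auto simp: paths_def all_paths_def)

lemma all_paths_iff: "as \<in> all_paths A \<longleftrightarrow> as \<noteq> [] \<and> set as \<subseteq> Verts A"
  by (auto simp: all_paths_def)

lemma all_paths_paths: "as \<in> all_paths A \<Longrightarrow> as \<in> paths A (hd as) (last as)"
  by (simp add: paths_def)

lemma paths_all_paths: "as \<in> paths A a b \<Longrightarrow> as \<in> all_paths A"
  by (simp add: paths_def)

lemma path_nth:
  assumes "as \<in> all_paths A" "i < plen as"
  shows "as ! i \<in> Verts A" "as ! Suc i \<in> Verts A"
  using assms by (auto simp: all_paths_iff plen_def intro!: nth_mem[THEN subsetD[rotated]])

lemma edges_obj: "is_vgraph V A \<Longrightarrow> as \<in> all_paths A \<Longrightarrow> set (edges A as) \<subseteq> Obj V"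
  by (auto simp: in_set_conv_nth edges_nth is_vgraph_Edge path_nth)

lemma paths_verts: "as \<in> paths A a b \<Longrightarrow> a \<in> Verts A \<and> b \<in> Verts A"
  by (auto simp: paths_iff)

text \<open>\<open>p @ tl q\<close> glues two paths at their common endpoint, which must be listed
  once.\<close>

lemma edges_append:
  "p \<noteq> [] \<Longrightarrow> q \<noteq> [] \<Longrightarrow> last p = hd q \<Longrightarrow> edges A (p @ tl q) = edges A p @ edges A q"
proof (induction p rule: induct_list012)
  case (2 x)
  then show ?case by (cases q) auto
qed auto

lemma map_string_nth: "i < plen as \<Longrightarrow> i < length xs \<Longrightarrow>
    map_string V f as xs ! i = Emap f (as ! i) (as ! Suc i) \<cdot>\<^bsub>V\<^esub> xs ! i"
  by (simp add: map_string_def plen_def nth_tl)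

lemma length_map_string [simp]: "length (map_string V f as xs) = min (plen as) (length xs)"
  by (simp add: map_string_def plen_def)

lemma map_string_Cons [simp]:
  "map_string V f [a] xs = []"
  "map_string V f (a # b # as) (x # xs) = (Emap f a b \<cdot>\<^bsub>V\<^esub> x) # map_string V f (b # as) xs"
  by (simp_all add: map_string_def)

lemma map_string_append:
  "p \<noteq> [] \<Longrightarrow> q \<noteq> [] \<Longrightarrow> last p = hd q \<Longrightarrow> length xs = plen p \<Longrightarrow>
    map_string V f (p @ tl q) (xs @ ys) = map_string V f p xs @ map_string V f q ys"
proof (induction p arbitrary: xs rule: induct_list012)
  case (2 x)
  then show ?case by (cases q) auto
next
  case (3 x y zs)
  then show ?case by (cases xs) auto
qed auto

lemma blocks_iff: "ps \<in> blocks A as \<longleftrightarrow>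
    length ps = plen as \<and> (\<forall>i < plen as. ps ! i \<in> paths A (as ! i) (as ! Suc i))"
  by (auto simp: blocks_def list_all2_conv_all_nth plen_def nth_tl)

lemma blocks_simps [simp]:
  "ps \<in> blocks A [a] \<longleftrightarrow> ps = []"
  "ps \<in> blocks A (a # b # as) \<longleftrightarrow> (\<exists>p ps'. ps = p # ps' \<and> p \<in> paths A a b \<and> ps' \<in> blocks A (b # as))"
  by (auto simp: blocks_def list_all2_Cons1)

text \<open>A recursion for \<open>join\<close>: the \<open>tl\<close> drops the cut point with
  which \<open>p\<close> already ends.\<close>

lemma join_simps [simp]:
  "join [a] [] = [a]"
  "p \<in> paths A a b \<Longrightarrow> join (a # b # as) (p # ps) = p @ tl (join (b # as) ps)"
  by (auto simp: join_def paths_iff)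

lemma join_paths:
  "as \<in> paths A a b \<Longrightarrow> ps \<in> blocks A as \<Longrightarrow> join as ps \<in> paths A a b"
proof (induction as arbitrary: a ps rule: induct_list012)
  case (3 x y zs)
  then obtain p ps' where p: "ps = p # ps'" "p \<in> paths A x y" "ps' \<in> blocks A (y # zs)" by auto
  have ys: "y # zs \<in> paths A y b" using 3(3) by (auto simp: paths_iff)
  let ?j = "join (y # zs) ps'"
  have j: "?j \<in> paths A y b" using 3(2)[OF ys p(3)] .
  have jq: "join (x # y # zs) ps = p @ tl ?j" using p by simp
  obtain js where js: "?j = y # js" using j by (cases ?j) (auto simp: paths_iff)
  show ?case using 3(3) p(2) j unfolding jq js by (auto simp: paths_iff split: if_splits)
qed (auto simp: paths_iff)

lemma edges_join:
  "as \<in> paths A a b \<Longrightarrow> ps \<in> blocks A as \<Longrightarrow> edges A (join as ps) = concat (map (edges A) ps)"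
proof (induction as arbitrary: a ps rule: induct_list012)
  case (3 x y zs)
  then obtain p ps' where p: "ps = p # ps'" "p \<in> paths A x y" "ps' \<in> blocks A (y # zs)" by auto
  have ys: "y # zs \<in> paths A y b" using 3(3) by (auto simp: paths_iff)
  have j: "join (y # zs) ps' \<in> paths A y b" using join_paths[OF ys p(3)] .
  have "join (x # y # zs) ps = p @ tl (join (y # zs) ps')" using p by simp
  moreover have "edges A (p @ tl (join (y # zs) ps')) = edges A p @ edges A (join (y # zs) ps')"
    using p(2) j by (intro edges_append) (auto simp: paths_iff)
  ultimately show ?case using 3(2)[OF ys p(3)] p(1) by simp
qed (auto simp: paths_iff)

text \<open>\<open>plen\<close> counts edges, and the edges of the joined path are those of the
  blocks in order.\<close>

lemma plen_join:
  assumes "as \<in> paths A a b" "ps \<in> blocks A as"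
  shows "plen (join as ps) = sum_list (map plen ps)"
proof -
  have "plen (join as ps) = length (concat (map (edges A) ps))"
    using edges_join[OF assms] length_edges[of A "join as ps"] by simp
  then show ?thesis by (simp add: length_concat comp_def)
qed

lemma map_join:
  "as \<noteq> [] \<Longrightarrow> map g (join as ps) = join (map g as) (map (map g) ps)"
  by (simp add: join_def hd_map map_concat comp_def map_tl)

lemma map_string_join:
  "as \<in> paths A a b \<Longrightarrow> ps \<in> blocks A as \<Longrightarrow> list_all2 (\<lambda>p xs. length xs = plen p) ps xss \<Longrightarrow>
    map_string V f (join as ps) (concat xss) = concat (map2 (map_string V f) ps xss)"
proof (induction as arbitrary: a ps xss rule: induct_list012)
  case (3 x y zs)
  then obtain p ps' where p: "ps = p # ps'" "p \<in> paths A x y" "ps' \<in> blocks A (y # zs)" by auto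
  obtain xs xss' where xs: "xss = xs # xss'" "length xs = plen p" "list_all2 (\<lambda>p xs. length xs = plen p) ps' xss'"
    using 3(5) p(1) by (auto simp: list_all2_Cons1)
  have ys: "y # zs \<in> paths A y b" using 3(3) by (auto simp: paths_iff)
  have j: "join (y # zs) ps' \<in> paths A y b" using join_paths[OF ys p(3)] .
  have "join (x # y # zs) ps = p @ tl (join (y # zs) ps')" using p by simp
  moreover have "map_string V f (p @ tl (join (y # zs) ps')) (xs @ concat xss') =
      map_string V f p xs @ map_string V f (join (y # zs) ps') (concat xss')"
    using p(2) j xs(2) by (intro map_string_append) (auto simp: paths_iff)
  ultimately show ?case using 3(2)[OF ys p(3) xs(3)] p(1) xs(1) by simp
qed (auto simp: paths_iff)

lemma map_paths:
  "f \<in> hom (VGph V) A B \<Longrightarrow> as \<in> paths A a b \<Longrightarrow> map (Vmap f) as \<in> paths B (Vmap f a) (Vmap f b)"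
  using vhomD(5)[of f V A B] by (auto simp: paths_iff hd_map last_map)

lemma map_all_paths:
  "f \<in> hom (VGph V) A B \<Longrightarrow> as \<in> all_paths A \<Longrightarrow> map (Vmap f) as \<in> all_paths B"
  using vhomD(5)[of f V A B] by (auto simp: all_paths_iff)

lemma plen_map [simp]: "plen (map g as) = plen as"
  by (simp add: plen_def)

lemma map_blocks:
  assumes f: "f \<in> hom (VGph V) A B" and ps: "ps \<in> blocks A as"
  shows "map (map (Vmap f)) ps \<in> blocks B (map (Vmap f) as)"
  unfolding blocks_iff
proof (intro conjI allI impI)
  show "length (map (map (Vmap f)) ps) = plen (map (Vmap f) as)" using ps by (simp add: blocks_iff)
  fix i assume i: "i < plen (map (Vmap f) as)"
  then have "i < length as" "Suc i < length as" by (auto simp: plen_def)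
  then show "map (map (Vmap f)) ps ! i \<in> paths B (map (Vmap f) as ! i) (map (Vmap f) as ! Suc i)"
    using i ps map_paths[OF f, of "ps ! i"] by (simp add: blocks_iff)
qed

lemma one_vertex_path: "Verts A = {v} \<Longrightarrow> as \<in> all_paths A \<Longrightarrow> as = replicate (Suc (plen as)) v"
  by (cases as) (auto simp: all_paths_iff intro: replicate_eqI)

lemma one_vertex_eqI: "Verts A = {v} \<Longrightarrow> as \<in> all_paths A \<Longrightarrow> bs \<in> all_paths A \<Longrightarrow> plen as = plen bs \<Longrightarrow> as = bs"
  by (metis one_vertex_path)

lemma edges_one_vertex: "Verts A = {v} \<Longrightarrow> as \<in> all_paths A \<Longrightarrow> edges A as = replicate (plen as) (Edge A v v)"
proof (rule nth_equalityI)
  assume "Verts A = {v}" "as \<in> all_paths A"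
  then show "edges A as ! i = replicate (plen as) (Edge A v v) ! i" if "i < length (edges A as)" for i
    using that path_nth[of as A i] by (simp add: edges_nth)
qed simp

section \<open>The free category functor and its unit on strings\<close>

context ext_cat begin

text \<open>The normal form of an element of a hom-object of \<open>fc_ob C A\<close>: a path with
  one element on each edge.\<close>

definition fcel :: "('u, 'o) vgraph \<Rightarrow> 'o \<Rightarrow> 'u list \<Rightarrow> 'm list \<Rightarrow> 'm" where
  "fcel A z as xs = path_inc C A as \<cdot> tup C z (rev xs)"

lemma Verts_fc_ob [simp]: "Verts (fc_ob C A) = Verts A"
  by (simp add: fc_ob_def)

lemma paths_fc_ob [simp]: "paths (fc_ob C A) = paths A" "all_paths (fc_ob C A) = all_paths A"
  by (auto simp: fun_eq_iff paths_def all_paths_def)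

context
  fixes A :: "('u, 'o) vgraph"
  assumes A: "is_vgraph C A"
begin

lemma fc_coproduct:
  "is_coproduct C (paths A a b) (\<lambda>as. prd C (rev (edges A as)))
      (cpr C (paths A a b) (\<lambda>as. prd C (rev (edges A as))))
      (inc C (paths A a b) (\<lambda>as. prd C (rev (edges A as))))"
proof (rule cpr_coproduct[OF small_list])
  fix as assume "as \<in> paths A a b"
  then show "prd C (rev (edges A as)) \<in> Obj C" using edges_obj[OF A paths_all_paths] by (intro prd_obj) auto
qed

lemma fc_Edge: "a \<in> Verts A \<Longrightarrow> b \<in> Verts A \<Longrightarrow>
    Edge (fc_ob C A) a b = cpr C (paths A a b) (\<lambda>as. prd C (rev (edges A as)))"
  by (simp add: fc_ob_def)

lemma is_vgraph_fc_ob: "is_vgraph C (fc_ob C A)"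
  unfolding fc_ob_def using coproductD(1)[OF fc_coproduct] by simp

lemma path_inc_hom:
  assumes "as \<in> paths A a b"
  shows "path_inc C A as \<in> hom C (prd C (rev (edges A as))) (Edge (fc_ob C A) a b)"
proof -
  have "hd as = a" "last as = b" "a \<in> Verts A" "b \<in> Verts A"
    using assms paths_verts[OF assms] by (auto simp: paths_iff)
  then show ?thesis using coproductD(3)[OF fc_coproduct assms] by (simp add: path_inc_def fc_Edge)
qed

lemma fcel_hom:
  "as \<in> paths A a b \<Longrightarrow> z \<in> Obj C \<Longrightarrow> xs \<in> elems C z (edges A as) \<Longrightarrow>
    fcel A z as xs \<in> hom C z (Edge (fc_ob C A) a b)"
  unfolding fcel_def using comp_hom[OF tup_hom path_inc_hom] by auto

lemma fcel_comp:
  assumes "as \<in> all_paths A" "xs \<in> elems C z (edges A as)" "c \<in> hom C z' z"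
  shows "fcel A z as xs \<cdot> c = fcel A z' as (map (\<lambda>x. x \<cdot> c) xs)"
proof -
  have z: "z \<in> Obj C" using assms(3) by (auto simp: hom_def)
  have r: "rev xs \<in> elems C z (rev (edges A as))" using assms by simp
  show ?thesis unfolding fcel_def
    using comp_assoc[OF assms(3) tup_hom[OF z r] path_inc_hom[OF all_paths_paths[OF assms(1)]]]
      tup_comp[OF r assms(3)] by (simp add: rev_map)
qed

text \<open>The path is recovered because summands are disjoint, the string because inclusions are
  monic; \<open>inc_eq\<close> gives both up to void stages.\<close>

lemma fcel_eq:
  assumes as: "as \<in> paths A a b" and bs: "bs \<in> paths A a b" and z: "z \<in> Obj C"
    and xs: "xs \<in> elems C z (edges A as)" and ys: "ys \<in> elems C z (edges A bs)"
    and eq: "fcel A z as xs = fcel A z bs ys"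
  shows "(as = bs \<and> xs = ys) \<or> void z"
proof -
  have xs': "rev xs \<in> elems C z (rev (edges A as))" and ys': "rev ys \<in> elems C z (rev (edges A bs))"
    using xs ys by auto
  have h: "hd as = a" "last as = b" "hd bs = a" "last bs = b" using as bs by (auto simp: paths_iff)
  have "(as = bs \<and> tup C z (rev xs) = tup C z (rev ys)) \<or> void z"
  proof (rule inc_eq[OF small_list _ as bs tup_hom[OF z xs'] tup_hom[OF z ys']])
    show "inc C (paths A a b) (\<lambda>as. prd C (rev (edges A as))) as \<cdot> tup C z (rev xs)
      = inc C (paths A a b) (\<lambda>as. prd C (rev (edges A as))) bs \<cdot> tup C z (rev ys)"
      using eq h by (simp add: fcel_def path_inc_def)
    show "prd C (rev (edges A i)) \<in> Obj C" if "i \<in> paths A a b" for i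
      using coproductD(2)[OF fc_coproduct that] .
  qed
  then show ?thesis using tup_inj[OF z xs', of "rev ys"] ys' by auto
qed

lemma covers_fc:
  assumes a: "a \<in> Verts A" "b \<in> Verts A" and x: "x \<in> hom C Z (Edge (fc_ob C A) a b)"
  shows "covers Z (\<lambda>c. \<exists>as \<in> paths A a b. \<exists>xs \<in> elems C (Dom C c) (edges A as). x \<cdot> c = fcel A (Dom C c) as xs)"
proof (rule covers_mono[OF covers_coproduct[OF small_list fc_coproduct x[unfolded fc_Edge[OF a]]]])
  fix c assume c: "c \<in> hom C (Dom C c) Z"
    and "\<exists>as \<in> paths A a b. \<exists>y\<in>hom C (Dom C c) (prd C (rev (edges A as))).
         x \<cdot> c = inc C (paths A a b) (\<lambda>as. prd C (rev (edges A as))) as \<cdot> y"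
  then obtain as y where as: "as \<in> paths A a b" and y: "y \<in> hom C (Dom C c) (prd C (rev (edges A as)))"
    and e: "x \<cdot> c = inc C (paths A a b) (\<lambda>as. prd C (rev (edges A as))) as \<cdot> y" by blast
  have s: "set (rev (edges A as)) \<subseteq> Obj C" using edges_obj[OF A paths_all_paths[OF as]] by simp
  let ?xs = "rev (map (\<lambda>\<pi>. \<pi> \<cdot> y) (prjs C (rev (edges A as))))"
  have "map (\<lambda>\<pi>. \<pi> \<cdot> y) (prjs C (rev (edges A as))) \<in> elems C (Dom C c) (rev (edges A as))"
    using elems_comp[OF prjs_elems[OF s] y] .
  then have "?xs \<in> elems C (Dom C c) (edges A as)" by (metis elems_rev rev_rev_ident)
  moreover have "x \<cdot> c = fcel A (Dom C c) as ?xs"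
    using e tup_prjs[OF s y] as by (auto simp: fcel_def path_inc_def paths_iff)
  ultimately show "\<exists>as\<in>paths A a b. \<exists>xs\<in>elems C (Dom C c) (edges A as). x \<cdot> c = fcel A (Dom C c) as xs"
    using as by blast
qed

text \<open>Strings cover the hom-objects of \<open>fc_ob C A\<close>, as \<open>covers_fc\<close>
  shows for the generic element, the identity of a hom-object.\<close>

lemma vhom_fc_eqI:
  assumes f: "f \<in> hom Gph (fc_ob C A) B" and g: "g \<in> hom Gph (fc_ob C A) B"
    and v: "\<And>a. a \<in> Verts A \<Longrightarrow> Vmap f a = Vmap g a"
    and e: "\<And>a b as z xs. as \<in> paths A a b \<Longrightarrow> z \<in> Obj C \<Longrightarrow> xs \<in> elems C z (edges A as) \<Longrightarrow>
       Emap f a b \<cdot> fcel A z as xs = Emap g a b \<cdot> fcel A z as xs"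
  shows "f = g"
proof (rule vhom_eqI[OF f g])
  show "Vmap f a = Vmap g a" if "a \<in> Verts (fc_ob C A)" for a using v that by simp
  fix a b assume ab: "a \<in> Verts (fc_ob C A)" "b \<in> Verts (fc_ob C A)"
  then have ab': "a \<in> Verts A" "b \<in> Verts A" by auto
  let ?E = "Edge (fc_ob C A) a b"
  have E: "?E \<in> Obj C" using is_vgraph_Edge[OF is_vgraph_fc_ob ab] .
  show "Emap f a b = Emap g a b"
  proof (rule covers_eq[OF covers_fc[OF ab' ident_hom[OF E]] vhomD(6)[OF f ab]])
    show "Emap g a b \<in> hom C ?E (Edge B (Vmap f a) (Vmap f b))" using vhomD(6)[OF g ab] v ab' by simp
    fix c assume c: "c \<in> hom C (Dom C c) ?E"
      and "\<exists>as\<in>paths A a b. \<exists>xs\<in>elems C (Dom C c) (edges A as). Ident C ?E \<cdot> c = fcel A (Dom C c) as xs"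
    then obtain as xs where "as \<in> paths A a b" "xs \<in> elems C (Dom C c) (edges A as)" "c = fcel A (Dom C c) as xs"
      unfolding ident_left[OF c] by blast
    moreover have "Dom C c \<in> Obj C" using c by (simp add: hom_iff)
    ultimately show "Emap f a b \<cdot> c = Emap g a b \<cdot> c" using e by metis
  qed
qed

end

lemma map_string_elems:
  assumes f: "f \<in> hom Gph A B" and as: "as \<in> all_paths A" and xs: "xs \<in> elems C z (edges A as)"
  shows "map_string C f as xs \<in> elems C z (edges B (map (Vmap f) as))"
  unfolding elems_nth
proof (intro conjI allI impI)
  have l: "length xs = plen as" using xs by (simp add: elems_nth)
  show "length (map_string C f as xs) = length (edges B (map (Vmap f) as))" using l by simp
  fix i assume "i < length (edges B (map (Vmap f) as))"
  then have i: "i < plen as" by simp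
  then have i': "i < length as" "Suc i < length as" by (auto simp: plen_def)
  have "xs ! i \<in> hom C z (Edge A (as ! i) (as ! Suc i))" using xs i by (simp add: elems_nth edges_nth)
  then show "map_string C f as xs ! i \<in> hom C z (edges B (map (Vmap f) as) ! i)"
    using i i' l comp_hom[OF _ vhomD(6)[OF f path_nth[OF as i]]] by (simp add: map_string_nth edges_nth)
qed

lemma map_string_restrict:
  assumes f: "f \<in> hom Gph A B" and as: "as \<in> all_paths A" and xs: "xs \<in> elems C z (edges A as)"
    and c: "c \<in> hom C z' z"
  shows "map (\<lambda>x. x \<cdot> c) (map_string C f as xs) = map_string C f as (map (\<lambda>x. x \<cdot> c) xs)"
proof (rule nth_equalityI)
  have l: "length xs = plen as" using xs by (simp add: elems_nth)
  show "length (map (\<lambda>x. x \<cdot> c) (map_string C f as xs)) = length (map_string C f as (map (\<lambda>x. x \<cdot> c) xs))" by simp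
  fix i assume "i < length (map (\<lambda>x. x \<cdot> c) (map_string C f as xs))"
  then have i: "i < plen as" by simp
  then have "xs ! i \<in> hom C z (Edge A (as ! i) (as ! Suc i))" using xs by (simp add: elems_nth edges_nth)
  then show "map (\<lambda>x. x \<cdot> c) (map_string C f as xs) ! i = map_string C f as (map (\<lambda>x. x \<cdot> c) xs) ! i"
    using i l comp_assoc[OF c _ vhomD(6)[OF f path_nth[OF as i]]] by (simp add: map_string_nth)
qed

lemma map_string_comp:
  assumes f: "f \<in> hom Gph A B" and g: "g \<in> hom Gph B D" and as: "as \<in> all_paths A" and xs: "xs \<in> elems C z (edges A as)"
  shows "map_string C (g \<odot> f) as xs = map_string C g (map (Vmap f) as) (map_string C f as xs)"
proof (rule nth_equalityI)
  have l: "length xs = plen as" using xs by (simp add: elems_nth)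
  then show "length (map_string C (g \<odot> f) as xs) = length (map_string C g (map (Vmap f) as) (map_string C f as xs))" by simp
  fix i assume "i < length (map_string C (g \<odot> f) as xs)"
  then have i: "i < plen as" by simp
  then have i': "i < length as" "Suc i < length as" by (auto simp: plen_def)
  have "xs ! i \<in> hom C z (Edge A (as ! i) (as ! Suc i))" using xs i by (simp add: elems_nth edges_nth)
  then show "map_string C (g \<odot> f) as xs ! i = map_string C g (map (Vmap f) as) (map_string C f as xs) ! i"
    using i i' l Emap_comp_el[OF f g path_nth[OF as i]] by (simp add: map_string_nth)
qed

lemma map_string_ident:
  assumes as: "as \<in> all_paths A" and xs: "xs \<in> elems C z (edges A as)"
  shows "map_string C (Ident Gph A) as xs = xs"
proof (rule nth_equalityI)
  have l: "length xs = plen as" using xs by (simp add: elems_nth)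
  then show "length (map_string C (Ident Gph A) as xs) = length xs" by simp
  fix i assume "i < length (map_string C (Ident Gph A) as xs)"
  then have i: "i < plen as" by simp
  then have "xs ! i \<in> hom C z (Edge A (as ! i) (as ! Suc i))" using xs by (simp add: elems_nth edges_nth)
  then show "map_string C (Ident Gph A) as xs ! i = xs ! i"
    using i l path_nth[OF as i] ident_left by (simp add: map_string_nth Ident_vg)
qed

text \<open>\<open>fc_ar\<close> is prescribed on the generic string, that of the projections. Any
  other string is the restriction of this one along its \<open>tup\<close>, which gives
  \<open>fc_ar_el\<close>.\<close>

lemma fc_ar_props:
  assumes f: "f \<in> hom Gph A B"
  shows fc_ar_hom: "fc_ar C f \<in> hom Gph (fc_ob C A) (fc_ob C B)"
    and Vmap_fc_ar: "a \<in> Verts A \<Longrightarrow> Vmap (fc_ar C f) a = Vmap f a"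
    and fc_ar_el: "as \<in> paths A a b \<Longrightarrow> z \<in> Obj C \<Longrightarrow> xs \<in> elems C z (edges A as) \<Longrightarrow>
      Emap (fc_ar C f) a b \<cdot> fcel A z as xs = fcel B z (map (Vmap f) as) (map_string C f as xs)"
proof -
  note fD = vhomD[OF f]
  define H where "H as = fcel B (prd C (rev (edges A as))) (map (Vmap f) as)
     (map_string C f as (rev (prjs C (rev (edges A as)))))" for as
  define e where "e a b = cotup C (paths A a b) (\<lambda>as. prd C (rev (edges A as)))
        (Edge (fc_ob C B) (Vmap f a) (Vmap f b)) H" for a b
  have ar: "fc_ar C f = mk_vgmor (fc_ob C A) (fc_ob C B) (Vmap f) e"
    unfolding fc_ar_def Let_def e_def H_def fcel_def using fD by simp
  have s: "set (rev (edges A as)) \<subseteq> Obj C" if "as \<in> all_paths A" for as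
    using edges_obj[OF fD(1) that] by simp
  have pe: "rev (prjs C (rev (edges A as))) \<in> elems C (prd C (rev (edges A as))) (edges A as)" if "as \<in> all_paths A" for as
    using prjs_elems[OF s[OF that]] by (metis elems_rev rev_rev_ident)
  have H: "H as \<in> hom C (prd C (rev (edges A as))) (Edge (fc_ob C B) (Vmap f a) (Vmap f b))" if "as \<in> paths A a b" for as a b
    unfolding H_def
    by (rule fcel_hom[OF fD(2) map_paths[OF f that] prd_obj[OF s[OF paths_all_paths[OF that]]]
          map_string_elems[OF f paths_all_paths[OF that] pe[OF paths_all_paths[OF that]]]])
  have ct: "e a b \<in> hom C (Edge (fc_ob C A) a b) (Edge (fc_ob C B) (Vmap f a) (Vmap f b))"
     "as \<in> paths A a b \<Longrightarrow> e a b \<cdot> inc C (paths A a b) (\<lambda>as. prd C (rev (edges A as))) as = H as"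
    if ab: "a \<in> Verts A" "b \<in> Verts A" for a b as
  proof -
    have E: "Edge (fc_ob C B) (Vmap f a) (Vmap f b) \<in> Obj C"
      by (rule is_vgraph_Edge[OF is_vgraph_fc_ob[OF fD(2)]]) (use ab fD(5) in auto)
    have "\<forall>as \<in> paths A a b. H as \<in> hom C (prd C (rev (edges A as))) (Edge (fc_ob C B) (Vmap f a) (Vmap f b))"
      using H by blast
    note c = cotup[OF fc_coproduct[OF fD(1)] E this]
    show "e a b \<in> hom C (Edge (fc_ob C A) a b) (Edge (fc_ob C B) (Vmap f a) (Vmap f b))"
      unfolding e_def fc_Edge[OF fD(1) ab] by (rule c(1))
    show "as \<in> paths A a b \<Longrightarrow> e a b \<cdot> inc C (paths A a b) (\<lambda>as. prd C (rev (edges A as))) as = H as"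
      unfolding e_def by (rule c(2))
  qed
  show "fc_ar C f \<in> hom Gph (fc_ob C A) (fc_ob C B)"
    unfolding ar by (rule vhomI) (use fD ct is_vgraph_fc_ob in auto)
  show "Vmap (fc_ar C f) a = Vmap f a" if "a \<in> Verts A" for a using that unfolding ar by simp
  show "Emap (fc_ar C f) a b \<cdot> fcel A z as xs = fcel B z (map (Vmap f) as) (map_string C f as xs)"
    if as: "as \<in> paths A a b" and z: "z \<in> Obj C" and xs: "xs \<in> elems C z (edges A as)"
  proof -
    have ab: "a \<in> Verts A" "b \<in> Verts A" using paths_verts[OF as] by auto
    note asp = paths_all_paths[OF as]
    have r: "rev xs \<in> elems C z (rev (edges A as))" using xs by simp
    note t = tup_hom[OF z r]
    have "Emap (fc_ar C f) a b \<cdot> fcel A z as xs = e a b \<cdot> (path_inc C A as \<cdot> tup C z (rev xs))"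
      using ab unfolding ar by (simp add: fcel_def)
    also have "\<dots> = (e a b \<cdot> path_inc C A as) \<cdot> tup C z (rev xs)"
      using comp_assoc[OF t path_inc_hom[OF fD(1) as] ct(1)[OF ab]] by simp
    also have "e a b \<cdot> path_inc C A as = H as" using ct(2)[OF ab as] as by (auto simp: path_inc_def paths_iff)
    also have "H as \<cdot> tup C z (rev xs) = fcel B z (map (Vmap f) as)
        (map (\<lambda>x. x \<cdot> tup C z (rev xs)) (map_string C f as (rev (prjs C (rev (edges A as))))))"
      unfolding H_def using fcel_comp[OF fD(2) map_all_paths[OF f asp] map_string_elems[OF f asp pe[OF asp]] t] .
    also have "map (\<lambda>x. x \<cdot> tup C z (rev xs)) (map_string C f as (rev (prjs C (rev (edges A as)))))
        = map_string C f as (map (\<lambda>x. x \<cdot> tup C z (rev xs)) (rev (prjs C (rev (edges A as)))))"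
      using map_string_restrict[OF f asp pe[OF asp] t] .
    also have "map (\<lambda>x. x \<cdot> tup C z (rev xs)) (rev (prjs C (rev (edges A as)))) = xs"
      using prjs_tup[OF z r] by (simp add: rev_map[symmetric])
    finally show ?thesis .
  qed
qed

lemma fc_ar_comp:
  assumes f: "f \<in> hom Gph A B" and g: "g \<in> hom Gph B D"
  shows "fc_ar C (g \<odot> f) = fc_ar C g \<odot> fc_ar C f"
proof (rule vhom_fc_eqI[OF vhomD(1)[OF f]])
  note gf = Gph.comp_hom[OF f g] and F = fc_ar_hom[OF f] and G = fc_ar_hom[OF g]
  show "fc_ar C (g \<odot> f) \<in> hom Gph (fc_ob C A) (fc_ob C D)" by (rule fc_ar_hom[OF gf])
  show "fc_ar C g \<odot> fc_ar C f \<in> hom Gph (fc_ob C A) (fc_ob C D)" by (rule Gph.comp_hom[OF F G])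
  fix a assume a: "a \<in> Verts A"
  then show "Vmap (fc_ar C (g \<odot> f)) a = Vmap (fc_ar C g \<odot> fc_ar C f) a"
    using vhomD(5)[OF f] by (simp add: Vmap_fc_ar[OF gf] Vmap_comp[OF f] Vmap_comp[OF F] Vmap_fc_ar[OF f] Vmap_fc_ar[OF g])
next
  note gf = Gph.comp_hom[OF f g] and F = fc_ar_hom[OF f] and G = fc_ar_hom[OF g] and A = vhomD(1)[OF f]
  fix a b as z xs assume as: "as \<in> paths A a b" and z: "z \<in> Obj C" and xs: "xs \<in> elems C z (edges A as)"
  note asp = paths_all_paths[OF as]
  have ab: "a \<in> Verts (fc_ob C A)" "b \<in> Verts (fc_ob C A)" "a \<in> Verts A" "b \<in> Verts A" using paths_verts[OF as] by auto
  have m: "map (Vmap (g \<odot> f)) as = map (Vmap g) (map (Vmap f) as)"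
    using asp by (auto simp: Vmap_comp[OF f] all_paths_iff)
  show "Emap (fc_ar C (g \<odot> f)) a b \<cdot> fcel A z as xs = Emap (fc_ar C g \<odot> fc_ar C f) a b \<cdot> fcel A z as xs"
    unfolding fc_ar_el[OF gf as z xs] Emap_comp_el[OF F G ab(1,2) fcel_hom[OF A as z xs]] fc_ar_el[OF f as z xs]
      Vmap_fc_ar[OF f ab(3)] Vmap_fc_ar[OF f ab(4)] fc_ar_el[OF g map_paths[OF f as] z map_string_elems[OF f asp xs]]
      map_string_comp[OF f g asp xs] m ..
qed

lemma fc_ar_ident:
  assumes A: "is_vgraph C A"
  shows "fc_ar C (Ident Gph A) = Ident Gph (fc_ob C A)"
proof (rule vhom_fc_eqI[OF A])
  have i: "Ident Gph A \<in> hom Gph A A" using A by (simp add: Gph.ident_hom)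
  show "fc_ar C (Ident Gph A) \<in> hom Gph (fc_ob C A) (fc_ob C A)" by (rule fc_ar_hom[OF i])
  show "Ident Gph (fc_ob C A) \<in> hom Gph (fc_ob C A) (fc_ob C A)" using is_vgraph_fc_ob[OF A] by (simp add: Gph.ident_hom)
  show "Vmap (fc_ar C (Ident Gph A)) a = Vmap (Ident Gph (fc_ob C A)) a" if "a \<in> Verts A" for a
    using that by (simp add: Vmap_fc_ar[OF i] Ident_vg)
  fix a b as z xs assume as: "as \<in> paths A a b" and z: "z \<in> Obj C" and xs: "xs \<in> elems C z (edges A as)"
  note asp = paths_all_paths[OF as]
  have m: "map (Vmap (Ident Gph A)) as = as"
    using asp by (auto simp: Ident_vg all_paths_iff intro!: map_idI)
  show "Emap (fc_ar C (Ident Gph A)) a b \<cdot> fcel A z as xs = Emap (Ident Gph (fc_ob C A)) a b \<cdot> fcel A z as xs"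
    unfolding fc_ar_el[OF i as z xs] m map_string_ident[OF asp xs]
    using paths_verts[OF as] ident_left[OF fcel_hom[OF A as z xs]] by (simp add: Ident_vg)
qed

lemma fc_eta_props:
  assumes A: "is_vgraph C A"
  shows fc_eta_hom: "fc_eta C A \<in> hom Gph A (fc_ob C A)"
    and Vmap_fc_eta: "a \<in> Verts A \<Longrightarrow> Vmap (fc_eta C A) a = a"
    and fc_eta_el: "a \<in> Verts A \<Longrightarrow> b \<in> Verts A \<Longrightarrow> x \<in> hom C z (Edge A a b) \<Longrightarrow>
       Emap (fc_eta C A) a b \<cdot> x = fcel A z [a, b] [x]"
proof -
  have E: "fcel A (Edge A a b) [a, b] [Ident C (Edge A a b)] \<in> hom C (Edge A a b) (Edge (fc_ob C A) a b)"
    if "a \<in> Verts A" "b \<in> Verts A" for a b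
    using is_vgraph_Edge[OF A that] that by (intro fcel_hom[OF A]) (auto simp: paths_iff intro: ident_hom)
  have eta: "fc_eta C A = mk_vgmor A (fc_ob C A) (\<lambda>a. a) (\<lambda>a b. fcel A (Edge A a b) [a, b] [Ident C (Edge A a b)])"
    unfolding fc_eta_def fcel_def by simp
  show "fc_eta C A \<in> hom Gph A (fc_ob C A)"
    unfolding eta by (rule vhomI) (use A is_vgraph_fc_ob[OF A] E in auto)
  show "Vmap (fc_eta C A) a = a" if "a \<in> Verts A" using that by (simp add: eta)
  show "Emap (fc_eta C A) a b \<cdot> x = fcel A z [a, b] [x]" if "a \<in> Verts A" "b \<in> Verts A" "x \<in> hom C z (Edge A a b)"
  proof -
    have "[a, b] \<in> all_paths A" using that by (simp add: all_paths_iff)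
    moreover have "[Ident C (Edge A a b)] \<in> elems C (Edge A a b) (edges A [a, b])"
      using is_vgraph_Edge[OF A that(1,2)] by (simp add: ident_hom)
    ultimately have "fcel A (Edge A a b) [a, b] [Ident C (Edge A a b)] \<cdot> x = fcel A z [a, b] [Ident C (Edge A a b) \<cdot> x]"
      using fcel_comp[OF A _ _ that(3)] by simp
    then show ?thesis using that ident_left[OF that(3)] by (simp add: eta)
  qed
qed

text \<open>The two edge maps are compared on the generic element of \<open>Edge A a b\<close>, its
  identity.\<close>

lemma fc_eta_natural:
  assumes f: "f \<in> hom Gph A B"
  shows "fc_ar C f \<odot> fc_eta C A = fc_eta C B \<odot> f"
proof (rule vhom_eqI)
  note A = vhomD(1)[OF f] and B = vhomD(2)[OF f]
  note eA = fc_eta_hom[OF A] and eB = fc_eta_hom[OF B] and F = fc_ar_hom[OF f]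
  show "fc_ar C f \<odot> fc_eta C A \<in> hom Gph A (fc_ob C B)" by (rule Gph.comp_hom[OF eA F])
  show "fc_eta C B \<odot> f \<in> hom Gph A (fc_ob C B)" by (rule Gph.comp_hom[OF f eB])
  fix a b assume ab: "a \<in> Verts A" "b \<in> Verts A"
  show "Vmap (fc_ar C f \<odot> fc_eta C A) a = Vmap (fc_eta C B \<odot> f) a" if "a \<in> Verts A" for a
    using that vhomD(5)[OF f] by (simp add: Vmap_comp[OF eA] Vmap_comp[OF f] Vmap_fc_eta A B Vmap_fc_ar[OF f])
  let ?E = "Edge A a b"
  have E: "?E \<in> Obj C" using is_vgraph_Edge[OF A ab] .
  have i: "Ident C ?E \<in> hom C ?E ?E" using E by (rule ident_hom)
  have p: "[a, b] \<in> paths A a b" using ab by (simp add: paths_iff)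
  have fv: "Vmap f a \<in> Verts B" "Vmap f b \<in> Verts B" using vhomD(5)[OF f] ab by auto
  have fe: "Emap f a b \<in> hom C ?E (Edge B (Vmap f a) (Vmap f b))" using vhomD(6)[OF f ab] .
  have "Emap (fc_ar C f \<odot> fc_eta C A) a b = Emap (fc_ar C f) a b \<cdot> (Emap (fc_eta C A) a b \<cdot> Ident C ?E)"
    using Emap_comp[OF eA ab, of "fc_ar C f"] Vmap_fc_eta[OF A] ab ident_right[OF vhomD(6)[OF eA ab]] by simp
  also have "\<dots> = fcel B ?E [Vmap f a, Vmap f b] [Emap f a b]"
    unfolding fc_eta_el[OF A ab i] using fc_ar_el[OF f p E, of "[Ident C ?E]"] i ident_right[OF fe] by simp
  also have "\<dots> = Emap (fc_eta C B) (Vmap f a) (Vmap f b) \<cdot> Emap f a b" using fc_eta_el[OF B fv fe] by simp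
  also have "\<dots> = Emap (fc_eta C B \<odot> f) a b" using Emap_comp[OF f ab] by simp
  finally show "Emap (fc_ar C f \<odot> fc_eta C A) a b = Emap (fc_eta C B \<odot> f) a b" .
qed

section \<open>Strings of strings and the multiplication\<close>

abbreviation okss :: "('u, 'o) vgraph \<Rightarrow> 'o \<Rightarrow> 'u list list \<Rightarrow> 'm list list \<Rightarrow> bool" where
  "okss A z \<equiv> list_all2 (\<lambda>bs xs. xs \<in> elems C z (edges A bs))"

abbreviation fcels :: "('u, 'o) vgraph \<Rightarrow> 'o \<Rightarrow> 'u list list \<Rightarrow> 'm list list \<Rightarrow> 'm list" where
  "fcels A z \<equiv> map2 (fcel A z)"

lemma okss_comp: "okss A z ps xss \<Longrightarrow> c \<in> hom C z' z \<Longrightarrow> okss A z' ps (map (map (\<lambda>x. x \<cdot> c)) xss)"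
  by (auto simp: list_all2_conv_all_nth intro: elems_comp)

lemma okss_concat: "okss A z ps xss \<Longrightarrow> concat xss \<in> elems C z (concat (map (edges A) ps))"
  by (induction rule: list_all2_induct) (auto intro: elems_append)

context
  fixes A :: "('u, 'o) vgraph"
  assumes A: "is_vgraph C A"
begin

lemma fcels_elems:
  assumes as: "as \<in> all_paths A" and ps: "ps \<in> blocks A as" and z: "z \<in> Obj C" and xss: "okss A z ps xss"
  shows "fcels A z ps xss \<in> elems C z (edges (fc_ob C A) as)"
  using assms fcel_hom[OF A _ z] by (auto simp: elems_nth list_all2_conv_all_nth blocks_iff edges_nth)

lemma fcels_comp:
  assumes as: "as \<in> all_paths A" and ps: "ps \<in> blocks A as" and xss: "okss A z ps xss" and c: "c \<in> hom C z' z"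
  shows "map (\<lambda>x. x \<cdot> c) (fcels A z ps xss) = fcels A z' ps (map (map (\<lambda>x. x \<cdot> c)) xss)"
proof (rule nth_equalityI)
  fix i assume "i < length (map (\<lambda>x. x \<cdot> c) (fcels A z ps xss))"
  then have i: "i < length ps" "i < length xss" by auto
  then have "ps ! i \<in> all_paths A" "xss ! i \<in> elems C z (edges A (ps ! i))"
    using ps xss paths_all_paths[of "ps ! i"] by (auto simp: blocks_iff list_all2_conv_all_nth)
  then show "map (\<lambda>x. x \<cdot> c) (fcels A z ps xss) ! i = fcels A z' ps (map (map (\<lambda>x. x \<cdot> c)) xss) ! i"
    using i fcel_comp[OF A _ _ c] by simp
qed simp

text \<open>Outside void stages every entry determines its block and its string by
  \<open>fcel_eq\<close>.\<close>

lemma fcels_eq: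
  assumes as: "as \<in> all_paths A" and ps: "ps \<in> blocks A as" and qs: "qs \<in> blocks A as" and z: "z \<in> Obj C"
    and xss: "okss A z ps xss" and yss: "okss A z qs yss" and eq: "fcels A z ps xss = fcels A z qs yss"
  shows "(ps = qs \<and> xss = yss) \<or> void z"
proof (cases "void z")
  case False
  have l: "length ps = plen as" "length qs = plen as" "length xss = plen as" "length yss = plen as"
    using ps qs xss yss by (auto simp: blocks_iff list_all2_conv_all_nth)
  have "ps ! i = qs ! i \<and> xss ! i = yss ! i" if i: "i < plen as" for i
  proof -
    have "fcel A z (ps ! i) (xss ! i) = fcel A z (qs ! i) (yss ! i)"
      using arg_cong[OF eq, of "\<lambda>l. l ! i"] i l by simp
    then show ?thesis using fcel_eq[OF A, of "ps ! i" "as ! i" "as ! Suc i" "qs ! i" z "xss ! i" "yss ! i"]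
        ps qs xss yss i l z False by (auto simp: blocks_iff list_all2_conv_all_nth)
  qed
  then show ?thesis using l by (auto intro: nth_equalityI)
qed simp

lemma covers_fcels:
  assumes as: "as \<in> all_paths A" and Z: "Z \<in> Obj C" and ys: "ys \<in> elems C Z (edges (fc_ob C A) as)"
  shows "covers Z (\<lambda>c. \<exists>ps \<in> blocks A as. \<exists>xss. okss A (Dom C c) ps xss \<and> map (\<lambda>y. y \<cdot> c) ys = fcels A (Dom C c) ps xss)"
proof -
  \<comment> \<open>Path and string are packed as a pair, so that one application of
    \<open>Skolem_list_nth\<close> selects both.\<close>
  define R where "R i c \<longleftrightarrow> (\<exists>p. fst p \<in> paths A (as ! i) (as ! Suc i) \<and> snd p \<in> elems C (Dom C c) (edges A (fst p)) \<and>
      ys ! i \<cdot> c = fcel A (Dom C c) (fst p) (snd p))" for i c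
  have l: "length ys = plen as" using ys by (simp add: elems_nth)
  have yi: "ys ! i \<in> hom C Z (Edge (fc_ob C A) (as ! i) (as ! Suc i))" if "i < plen as" for i
    using ys that by (simp add: elems_nth edges_nth)
  have "covers Z (\<lambda>c. \<forall>i < plen as. R i c)"
  proof (rule covers_finite[OF Z])
    show "covers Z (R i)" if i: "i < plen as" for i
      by (rule covers_mono[OF covers_fc[OF A path_nth[OF as i] yi[OF i]]]) (auto simp: R_def)
    fix i c t assume i: "i < plen as" and c: "c \<in> hom C (Dom C c) Z" "R i c" and t: "t \<in> hom C (Dom C t) (Dom C c)"
    then obtain p xs where p: "p \<in> paths A (as ! i) (as ! Suc i)" "xs \<in> elems C (Dom C c) (edges A p)"
      "ys ! i \<cdot> c = fcel A (Dom C c) p xs" by (auto simp: R_def)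
    have "ys ! i \<cdot> (c \<cdot> t) = fcel A (Dom C t) p (map (\<lambda>x. x \<cdot> t) xs)"
      using comp_assoc[OF t c(1) yi[OF i]] p(3) fcel_comp[OF A paths_all_paths[OF p(1)] p(2) t] by simp
    moreover have "Dom C (c \<cdot> t) = Dom C t" using c t by (simp add: hom_iff)
    ultimately show "R i (c \<cdot> t)" unfolding R_def using p elems_comp[OF p(2) t]
      by (intro exI[of _ "(p, map (\<lambda>x. x \<cdot> t) xs)"]) simp
  qed
  then show ?thesis
  proof (rule covers_mono)
    fix c assume c: "c \<in> hom C (Dom C c) Z" "\<forall>i < plen as. R i c"
    then obtain vs where vs: "length vs = plen as" "\<forall>i < plen as. fst (vs ! i) \<in> paths A (as ! i) (as ! Suc i) \<and>
       snd (vs ! i) \<in> elems C (Dom C c) (edges A (fst (vs ! i))) \<and> ys ! i \<cdot> c = fcel A (Dom C c) (fst (vs ! i)) (snd (vs ! i))"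
      unfolding R_def Skolem_list_nth by blast
    have "map fst vs \<in> blocks A as" using vs by (simp add: blocks_iff)
    moreover have "okss A (Dom C c) (map fst vs) (map snd vs)" using vs by (simp add: list_all2_conv_all_nth)
    moreover have "map (\<lambda>y. y \<cdot> c) ys = fcels A (Dom C c) (map fst vs) (map snd vs)"
      using vs l by (intro nth_equalityI) (auto simp: case_prod_beta)
    ultimately show "\<exists>ps \<in> blocks A as. \<exists>xss. okss A (Dom C c) ps xss \<and> map (\<lambda>y. y \<cdot> c) ys = fcels A (Dom C c) ps xss"
      by blast
  qed
qed

text \<open>Locally there is one outer path; locally again each of the finitely many entries along
  it is a string.\<close>

lemma covers_fcfc:
  assumes a: "a \<in> Verts A" "b \<in> Verts A" and x: "x \<in> hom C Z (Edge (fc_ob C (fc_ob C A)) a b)"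
  shows "covers Z (\<lambda>c. \<exists>as \<in> paths A a b. \<exists>ps \<in> blocks A as. \<exists>xss. okss A (Dom C c) ps xss \<and>
     x \<cdot> c = fcel (fc_ob C A) (Dom C c) as (fcels A (Dom C c) ps xss))"
proof (rule covers_trans[OF covers_fc[OF is_vgraph_fc_ob[OF A] _ _ x]])
  note fA = is_vgraph_fc_ob[OF A]
  fix c assume c: "c \<in> hom C (Dom C c) Z"
    and "\<exists>as\<in>paths (fc_ob C A) a b. \<exists>xs\<in>elems C (Dom C c) (edges (fc_ob C A) as). x \<cdot> c = fcel (fc_ob C A) (Dom C c) as xs"
  then obtain as ys where as: "as \<in> paths A a b" and ys: "ys \<in> elems C (Dom C c) (edges (fc_ob C A) as)"
    and e: "x \<cdot> c = fcel (fc_ob C A) (Dom C c) as ys" by auto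
  note asp = paths_all_paths[OF as]
  have Dc: "Dom C c \<in> Obj C" using c by (simp add: hom_iff)
  show "covers (Dom C c) (\<lambda>t. \<exists>as \<in> paths A a b. \<exists>ps \<in> blocks A as. \<exists>xss. okss A (Dom C (c \<cdot> t)) ps xss \<and>
     x \<cdot> (c \<cdot> t) = fcel (fc_ob C A) (Dom C (c \<cdot> t)) as (fcels A (Dom C (c \<cdot> t)) ps xss))"
  proof (rule covers_mono[OF covers_fcels[OF asp Dc ys]])
    fix t assume t: "t \<in> hom C (Dom C t) (Dom C c)"
      and "\<exists>ps\<in>blocks A as. \<exists>xss. okss A (Dom C t) ps xss \<and> map (\<lambda>y. y \<cdot> t) ys = fcels A (Dom C t) ps xss"
    then obtain ps xss where ps: "ps \<in> blocks A as" "okss A (Dom C t) ps xss" "map (\<lambda>y. y \<cdot> t) ys = fcels A (Dom C t) ps xss" by blast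
    have d: "Dom C (c \<cdot> t) = Dom C t" using c t by (simp add: hom_iff)
    have "x \<cdot> (c \<cdot> t) = fcel (fc_ob C A) (Dom C t) as (fcels A (Dom C t) ps xss)"
      using comp_assoc[OF t c x] e fcel_comp[OF fA _ ys t] asp ps(3) by simp
    then show "\<exists>as \<in> paths A a b. \<exists>ps \<in> blocks A as. \<exists>xss. okss A (Dom C (c \<cdot> t)) ps xss \<and>
     x \<cdot> (c \<cdot> t) = fcel (fc_ob C A) (Dom C (c \<cdot> t)) as (fcels A (Dom C (c \<cdot> t)) ps xss)"
      unfolding d using as ps by blast
  qed
qed (use a in auto)

lemma okss_join:
  assumes "as \<in> paths A a b" "ps \<in> blocks A as" "okss A z ps xss"
  shows "concat xss \<in> elems C z (edges A (join as ps))"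
  using okss_concat[OF assms(3)] edges_join[OF assms(1,2)] by simp

text \<open>Justifies the \<open>THE\<close> in \<open>fc_mu\<close>: strings of strings cover, and
  concatenating them is single-valued because outside void stages the element determines path,
  blocks and strings.\<close>

lemma fc_mu_ex1:
  assumes ab: "a \<in> Verts A" "b \<in> Verts A"
  shows "\<exists>!h. h \<in> hom C (Edge (fc_ob C (fc_ob C A)) a b) (Edge (fc_ob C A) a b) \<and>
        (\<forall>as \<in> paths A a b. \<forall>ps \<in> blocks A as. \<forall>z \<in> Obj C. \<forall>xss. okss A z ps xss \<longrightarrow>
             h \<cdot> fcel (fc_ob C A) z as (fcels A z ps xss) = fcel A z (join as ps) (concat xss))"
proof -
  note fA = is_vgraph_fc_ob[OF A]
  note ffA = is_vgraph_fc_ob[OF fA]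
  let ?W = "Edge (fc_ob C (fc_ob C A)) a b"
  have W: "?W \<in> Obj C" using is_vgraph_Edge[OF ffA] ab by simp
  have Ea: "Edge (fc_ob C A) a b \<in> Obj C" using is_vgraph_Edge[OF fA] ab by simp
  \<comment> \<open>The graph of concatenation, on those arrows into \<open>?W\<close> that are
    themselves strings of strings.\<close>
  define \<rho> where "\<rho> c v \<longleftrightarrow> (\<exists>as \<in> paths A a b. \<exists>ps \<in> blocks A as. \<exists>xss. okss A (Dom C c) ps xss \<and>
     c = fcel (fc_ob C A) (Dom C c) as (fcels A (Dom C c) ps xss) \<and> v = fcel A (Dom C c) (join as ps) (concat xss))" for c v
  have "\<exists>!h. h \<in> hom C ?W (Edge (fc_ob C A) a b) \<and> (\<forall>c v. c \<in> hom C (Dom C c) ?W \<longrightarrow> \<rho> c v \<longrightarrow> h \<cdot> c = v)"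
  proof (rule covers_glue[OF covers_fcfc[OF ab ident_hom[OF W]] Ea])
    fix c assume c: "c \<in> hom C (Dom C c) ?W"
    have Dc: "Dom C c \<in> Obj C" using c by (simp add: hom_iff)
    show "\<exists>v. \<rho> c v" if "\<exists>as\<in>paths A a b. \<exists>ps\<in>blocks A as. \<exists>xss. okss A (Dom C c) ps xss \<and>
         Ident C ?W \<cdot> c = fcel (fc_ob C A) (Dom C c) as (fcels A (Dom C c) ps xss)"
      using that unfolding ident_left[OF c] \<rho>_def by blast
    show ty: "v \<in> hom C (Dom C c) (Edge (fc_ob C A) a b)" if "\<rho> c v" for v
      using that fcel_hom[OF A join_paths Dc okss_join] unfolding \<rho>_def by blast
    show "v = v'" if v: "\<rho> c v" and v': "\<rho> c v'" for v v'
    proof (cases "void (Dom C c)")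
      case True
      then show ?thesis using void_eq ty v v' by blast
    next
      case False
      obtain as ps xss where 1: "as \<in> paths A a b" "ps \<in> blocks A as" "okss A (Dom C c) ps xss"
         "c = fcel (fc_ob C A) (Dom C c) as (fcels A (Dom C c) ps xss)" "v = fcel A (Dom C c) (join as ps) (concat xss)"
        using v unfolding \<rho>_def by blast
      obtain as' ps' xss' where 2: "as' \<in> paths A a b" "ps' \<in> blocks A as'" "okss A (Dom C c) ps' xss'"
         "c = fcel (fc_ob C A) (Dom C c) as' (fcels A (Dom C c) ps' xss')" "v' = fcel A (Dom C c) (join as' ps') (concat xss')"
        using v' unfolding \<rho>_def by blast
      note p1 = paths_all_paths[OF 1(1)] and p2 = paths_all_paths[OF 2(1)]
      have as: "as = as'" "fcels A (Dom C c) ps xss = fcels A (Dom C c) ps' xss'"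
        using fcel_eq[OF fA _ _ Dc fcels_elems[OF p1 1(2) Dc 1(3)] fcels_elems[OF p2 2(2) Dc 2(3)]] 1 2 False by auto
      then have "ps = ps' \<and> xss = xss'" using fcels_eq[OF p1 1(2) _ Dc 1(3) 2(3)] 2(2) False by auto
      then show ?thesis using 1 2 as by simp
    qed
    show "\<rho> (c \<cdot> t) (v \<cdot> t)" if v: "\<rho> c v" and t: "t \<in> hom C (Dom C t) (Dom C c)" for v t
    proof -
      obtain as ps xss where 1: "as \<in> paths A a b" "ps \<in> blocks A as" "okss A (Dom C c) ps xss"
         "c = fcel (fc_ob C A) (Dom C c) as (fcels A (Dom C c) ps xss)" "v = fcel A (Dom C c) (join as ps) (concat xss)"
        using v unfolding \<rho>_def by blast
      note p1 = paths_all_paths[OF 1(1)]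
      have d: "Dom C (c \<cdot> t) = Dom C t" using c t by (simp add: hom_iff)
      have "c \<cdot> t = fcel (fc_ob C A) (Dom C c) as (fcels A (Dom C c) ps xss) \<cdot> t" using 1(4) by simp
      also have "\<dots> = fcel (fc_ob C A) (Dom C t) as (fcels A (Dom C t) ps (map (map (\<lambda>x. x \<cdot> t)) xss))"
        using fcel_comp[OF fA _ fcels_elems[OF p1 1(2) Dc 1(3)] t] p1 fcels_comp[OF p1 1(2,3) t] by simp
      finally have "c \<cdot> t = \<dots>" .
      moreover have "v \<cdot> t = fcel A (Dom C t) (join as ps) (concat (map (map (\<lambda>x. x \<cdot> t)) xss))"
        unfolding 1(5) using fcel_comp[OF A paths_all_paths[OF join_paths[OF 1(1,2)]] okss_join[OF 1(1-3)] t]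
        by (simp add: map_concat)
      ultimately show ?thesis unfolding \<rho>_def d using 1 okss_comp[OF 1(3) t] by blast
    qed
  qed
  \<comment> \<open>Translates values on arrows \<open>c\<close> into the quantification over stages
    and strings that \<open>fc_mu\<close> uses.\<close>
  moreover have "(\<forall>c v. c \<in> hom C (Dom C c) ?W \<longrightarrow> \<rho> c v \<longrightarrow> h \<cdot> c = v) \<longleftrightarrow>
    (\<forall>as \<in> paths A a b. \<forall>ps \<in> blocks A as. \<forall>z \<in> Obj C. \<forall>xss. okss A z ps xss \<longrightarrow>
             h \<cdot> fcel (fc_ob C A) z as (fcels A z ps xss) = fcel A z (join as ps) (concat xss))" for h
  proof (intro iffI ballI allI impI)
    fix as ps z xss assume h: "\<forall>c v. c \<in> hom C (Dom C c) ?W \<longrightarrow> \<rho> c v \<longrightarrow> h \<cdot> c = v"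
      and 1: "as \<in> paths A a b" "ps \<in> blocks A as" "z \<in> Obj C" "okss A z ps xss"
    let ?c = "fcel (fc_ob C A) z as (fcels A z ps xss)"
    have c: "?c \<in> hom C z ?W"
      using fcel_hom[OF fA _ 1(3) fcels_elems[OF paths_all_paths[OF 1(1)] 1(2-4)]] 1(1) by simp
    then have d: "Dom C ?c = z" by (simp add: hom_iff)
    have "\<rho> ?c (fcel A z (join as ps) (concat xss))" unfolding \<rho>_def d using 1 by blast
    then show "h \<cdot> ?c = fcel A z (join as ps) (concat xss)" using h c d by simp
  next
    fix c v assume h: "\<forall>as \<in> paths A a b. \<forall>ps \<in> blocks A as. \<forall>z \<in> Obj C. \<forall>xss. okss A z ps xss \<longrightarrow>
             h \<cdot> fcel (fc_ob C A) z as (fcels A z ps xss) = fcel A z (join as ps) (concat xss)"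
      and c: "c \<in> hom C (Dom C c) ?W" and r: "\<rho> c v"
    have "Dom C c \<in> Obj C" using c by (simp add: hom_iff)
    then show "h \<cdot> c = v" using r h unfolding \<rho>_def by metis
  qed
  ultimately show ?thesis by simp
qed

lemma fc_mu_props:
  shows fc_mu_hom: "fc_mu C A \<in> hom Gph (fc_ob C (fc_ob C A)) (fc_ob C A)"
    and Vmap_fc_mu: "a \<in> Verts A \<Longrightarrow> Vmap (fc_mu C A) a = a"
    and fc_mu_el: "as \<in> paths A a b \<Longrightarrow> ps \<in> blocks A as \<Longrightarrow> z \<in> Obj C \<Longrightarrow> okss A z ps xss \<Longrightarrow>
      Emap (fc_mu C A) a b \<cdot> fcel (fc_ob C A) z as (fcels A z ps xss) = fcel A z (join as ps) (concat xss)"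
proof -
  define m where "m a b = (THE h. h \<in> hom C (Edge (fc_ob C (fc_ob C A)) a b) (Edge (fc_ob C A) a b) \<and>
        (\<forall>as \<in> paths A a b. \<forall>ps \<in> blocks A as. \<forall>z \<in> Obj C. \<forall>xss. okss A z ps xss \<longrightarrow>
             h \<cdot> fcel (fc_ob C A) z as (fcels A z ps xss) = fcel A z (join as ps) (concat xss)))" for a b
  have mu: "fc_mu C A = mk_vgmor (fc_ob C (fc_ob C A)) (fc_ob C A) (\<lambda>a. a) m"
    unfolding fc_mu_def m_def fcel_def by simp
  have m: "m a b \<in> hom C (Edge (fc_ob C (fc_ob C A)) a b) (Edge (fc_ob C A) a b)"
    "\<forall>as \<in> paths A a b. \<forall>ps \<in> blocks A as. \<forall>z \<in> Obj C. \<forall>xss. okss A z ps xss \<longrightarrow>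
             m a b \<cdot> fcel (fc_ob C A) z as (fcels A z ps xss) = fcel A z (join as ps) (concat xss)"
    if "a \<in> Verts A" "b \<in> Verts A" for a b
    using theI'[OF fc_mu_ex1[OF that]] unfolding m_def[symmetric] by auto
  show "fc_mu C A \<in> hom Gph (fc_ob C (fc_ob C A)) (fc_ob C A)"
    unfolding mu by (rule vhomI) (use is_vgraph_fc_ob A m in auto)
  show "Vmap (fc_mu C A) a = a" if "a \<in> Verts A" using that by (simp add: mu)
  show "Emap (fc_mu C A) a b \<cdot> fcel (fc_ob C A) z as (fcels A z ps xss) = fcel A z (join as ps) (concat xss)"
    if "as \<in> paths A a b" "ps \<in> blocks A as" "z \<in> Obj C" "okss A z ps xss"
    using m(2)[of a b] that paths_verts[OF that(1)] by (simp add: mu)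
qed

end

lemma okss_lengths: "okss A z ps xss \<Longrightarrow> list_all2 (\<lambda>p xs. length xs = plen p) ps xss"
  by (auto simp: list_all2_conv_all_nth elems_nth)

lemma okss_map_string:
  assumes f: "f \<in> hom Gph A B" and ps: "ps \<in> blocks A as" and xss: "okss A z ps xss"
  shows "okss B z (map (map (Vmap f)) ps) (map2 (map_string C f) ps xss)"
proof -
  have "ps ! i \<in> all_paths A" if "i < length ps" for i
    using ps that paths_all_paths by (metis blocks_iff)
  then show ?thesis using xss map_string_elems[OF f] by (auto simp: list_all2_conv_all_nth)
qed

lemma map_string_fcels:
  assumes f: "f \<in> hom Gph A B" and as: "as \<in> all_paths A" and ps: "ps \<in> blocks A as" and z: "z \<in> Obj C" and xss: "okss A z ps xss"
  shows "map_string C (fc_ar C f) as (fcels A z ps xss) = fcels B z (map (map (Vmap f)) ps) (map2 (map_string C f) ps xss)"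
proof (rule nth_equalityI)
  have l: "length ps = plen as" "length xss = plen as"
    using ps xss by (auto simp: blocks_iff list_all2_conv_all_nth)
  then show "length (map_string C (fc_ar C f) as (fcels A z ps xss)) =
     length (fcels B z (map (map (Vmap f)) ps) (map2 (map_string C f) ps xss))" by simp
  fix i assume "i < length (map_string C (fc_ar C f) as (fcels A z ps xss))"
  then have i: "i < plen as" by simp
  show "map_string C (fc_ar C f) as (fcels A z ps xss) ! i =
     fcels B z (map (map (Vmap f)) ps) (map2 (map_string C f) ps xss) ! i"
    using i l fc_ar_el[OF f _ z, of "ps ! i" "as ! i" "as ! Suc i" "xss ! i"] ps xss
    by (simp add: map_string_nth blocks_iff list_all2_conv_all_nth)
qed

text \<open>Both sides send a string of strings to the concatenation of the images, by
  \<open>map_join\<close> and \<open>map_string_join\<close>.\<close>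

lemma fc_mu_natural:
  assumes f: "f \<in> hom Gph A B"
  shows "fc_ar C f \<odot> fc_mu C A = fc_mu C B \<odot> fc_ar C (fc_ar C f)"
proof (rule vhom_eqI)
  note A = vhomD(1)[OF f] and B = vhomD(2)[OF f]
  note fA = is_vgraph_fc_ob[OF A]
  note mA = fc_mu_hom[OF A] and mB = fc_mu_hom[OF B] and F = fc_ar_hom[OF f]
  note FF = fc_ar_hom[OF F]
  show H1: "fc_ar C f \<odot> fc_mu C A \<in> hom Gph (fc_ob C (fc_ob C A)) (fc_ob C B)" by (rule Gph.comp_hom[OF mA F])
  show H2: "fc_mu C B \<odot> fc_ar C (fc_ar C f) \<in> hom Gph (fc_ob C (fc_ob C A)) (fc_ob C B)" by (rule Gph.comp_hom[OF FF mB])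
  show V: "Vmap (fc_ar C f \<odot> fc_mu C A) a = Vmap (fc_mu C B \<odot> fc_ar C (fc_ar C f)) a"
    if "a \<in> Verts (fc_ob C (fc_ob C A))" for a
    using that vhomD(5)[OF f] by (simp add: Vmap_comp[OF mA] Vmap_comp[OF FF] Vmap_fc_mu A B Vmap_fc_ar[OF f] Vmap_fc_ar[OF F])
  fix a b assume ab: "a \<in> Verts (fc_ob C (fc_ob C A))" "b \<in> Verts (fc_ob C (fc_ob C A))"
  then have ab': "a \<in> Verts A" "b \<in> Verts A" by auto
  let ?W = "Edge (fc_ob C (fc_ob C A)) a b"
  have W: "?W \<in> Obj C" using is_vgraph_Edge[OF is_vgraph_fc_ob[OF fA] ab] .
  show "Emap (fc_ar C f \<odot> fc_mu C A) a b = Emap (fc_mu C B \<odot> fc_ar C (fc_ar C f)) a b"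
  proof (rule covers_eq[OF covers_fcfc[OF A ab' ident_hom[OF W]] vhomD(6)[OF H1 ab]])
    show "Emap (fc_mu C B \<odot> fc_ar C (fc_ar C f)) a b \<in> hom C ?W (Edge (fc_ob C B)
      (Vmap (fc_ar C f \<odot> fc_mu C A) a) (Vmap (fc_ar C f \<odot> fc_mu C A) b))"
      unfolding V[OF ab(1)] V[OF ab(2)] by (rule vhomD(6)[OF H2 ab])
    fix c assume c: "c \<in> hom C (Dom C c) ?W" and "\<exists>as\<in>paths A a b. \<exists>ps\<in>blocks A as. \<exists>xss. okss A (Dom C c) ps xss \<and>
         Ident C ?W \<cdot> c = fcel (fc_ob C A) (Dom C c) as (fcels A (Dom C c) ps xss)"
    then obtain as ps xss where as: "as \<in> paths A a b" and ps: "ps \<in> blocks A as" and xss: "okss A (Dom C c) ps xss"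
       and ce: "c = fcel (fc_ob C A) (Dom C c) as (fcels A (Dom C c) ps xss)" unfolding ident_left[OF c] by blast
    define z where "z = Dom C c"
    have z: "z \<in> Obj C" using c by (simp add: hom_iff z_def)
    have cz: "c \<in> hom C z ?W" using c by (simp add: z_def)
    note asp = paths_all_paths[OF as] and xss = xss[folded z_def] and ce = ce[folded z_def]
    note mE = fcels_elems[OF A asp ps z xss]
    have "Emap (fc_ar C f \<odot> fc_mu C A) a b \<cdot> c = Emap (fc_ar C f) a b \<cdot> (Emap (fc_mu C A) a b \<cdot> c)"
      using Emap_comp_el[OF mA F ab cz] Vmap_fc_mu[OF A] ab' by simp
    also have "Emap (fc_mu C A) a b \<cdot> c = fcel A z (join as ps) (concat xss)"
      unfolding ce by (rule fc_mu_el[OF A as ps z xss])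
    also have "Emap (fc_ar C f) a b \<cdot> \<dots> = fcel B z (join (map (Vmap f) as) (map (map (Vmap f)) ps)) (concat (map2 (map_string C f) ps xss))"
      using fc_ar_el[OF f join_paths[OF as ps] z okss_join[OF A as ps xss]] asp
        map_string_join[OF as ps okss_lengths[OF xss], of C f] by (simp add: map_join all_paths_iff)
    also have "\<dots> = Emap (fc_mu C B) (Vmap f a) (Vmap f b) \<cdot> fcel (fc_ob C B) z (map (Vmap f) as)
          (fcels B z (map (map (Vmap f)) ps) (map2 (map_string C f) ps xss))"
      using fc_mu_el[OF B map_paths[OF f as] map_blocks[OF f ps] z okss_map_string[OF f ps xss]] by simp
    also have "fcel (fc_ob C B) z (map (Vmap f) as) (fcels B z (map (map (Vmap f)) ps) (map2 (map_string C f) ps xss))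
       = Emap (fc_ar C (fc_ar C f)) a b \<cdot> c"
    proof -
      have m: "map (Vmap (fc_ar C f)) as = map (Vmap f) as" using asp by (auto simp: Vmap_fc_ar[OF f] all_paths_iff)
      have "as \<in> paths (fc_ob C A) a b" using as by simp
      from fc_ar_el[OF F this z mE] show ?thesis
        unfolding map_string_fcels[OF f asp ps z xss] m ce[symmetric] ..
    qed
    also have "Emap (fc_mu C B) (Vmap f a) (Vmap f b) \<cdot> (Emap (fc_ar C (fc_ar C f)) a b \<cdot> c)
       = Emap (fc_mu C B \<odot> fc_ar C (fc_ar C f)) a b \<cdot> c"
      using Emap_comp_el[OF FF mB ab cz] ab' by (simp add: Vmap_fc_ar[OF F] Vmap_fc_ar[OF f])
    finally show "Emap (fc_ar C f \<odot> fc_mu C A) a b \<cdot> c = Emap (fc_mu C B \<odot> fc_ar C (fc_ar C f)) a b \<cdot> c" .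
  qed
qed

lemma fc_simps [simp]: "TOb (fc C) = fc_ob C" "TAr (fc C) = fc_ar C" "TEta (fc C) = fc_eta C" "TMu (fc C) = fc_mu C"
  by (simp_all add: fc_def)

section \<open>Elements of hom-objects\<close>

text \<open>An element of a graph is one of some hom-object, together with the endpoints; \<open>ap f\<close> applies a
  graph morphism to it and \<open>rs\<close> restricts it to another stage.\<close>

definition el :: "('u, 'o) vgraph \<Rightarrow> 'o \<Rightarrow> ('u \<times> 'u \<times> 'm) set" where
  "el A z = {(a, b, x). a \<in> Verts A \<and> b \<in> Verts A \<and> x \<in> hom C z (Edge A a b)}"

definition ap :: "('u, 'o, 'm) vgmor \<Rightarrow> 'u \<times> 'u \<times> 'm \<Rightarrow> 'u \<times> 'u \<times> 'm" where
  "ap f t = (case t of (a, b, x) \<Rightarrow> (Vmap f a, Vmap f b, Emap f a b \<cdot> x))"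

definition rs :: "'u \<times> 'u \<times> 'm \<Rightarrow> 'm \<Rightarrow> 'u \<times> 'u \<times> 'm" where
  "rs t c = (case t of (a, b, x) \<Rightarrow> (a, b, x \<cdot> c))"

text \<open>The endpoints are read off the path, so that equations need no separate hypotheses on
  vertices.\<close>

definition FE :: "('u, 'o) vgraph \<Rightarrow> 'o \<Rightarrow> 'u list \<Rightarrow> 'm list \<Rightarrow> 'u \<times> 'u \<times> 'm" where
  "FE A z as xs = (hd as, last as, fcel A z as xs)"

lemma ap_el: "f \<in> hom Gph A B \<Longrightarrow> t \<in> el A z \<Longrightarrow> ap f t \<in> el B z"
  using vhomD(5,6) comp_hom by (fastforce simp: el_def ap_def)

lemma el_obj: "t \<in> el A z \<Longrightarrow> z \<in> Obj C"
  by (auto simp: el_def hom_iff)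

lemma ap_comp: "f \<in> hom Gph A B \<Longrightarrow> g \<in> hom Gph B D \<Longrightarrow> t \<in> el A z \<Longrightarrow> ap (g \<odot> f) t = ap g (ap f t)"
  by (auto simp: el_def ap_def Vmap_comp Emap_comp_el)

lemma ap_ident: "t \<in> el A z \<Longrightarrow> ap (Ident Gph A) t = t"
  by (auto simp: el_def ap_def Ident_vg ident_left)

lemma rs_el: "t \<in> el A z \<Longrightarrow> c \<in> hom C z' z \<Longrightarrow> rs t c \<in> el A z'"
  by (auto simp: el_def rs_def intro: comp_hom)

lemma rs_rs: "t \<in> el A z \<Longrightarrow> c \<in> hom C z' z \<Longrightarrow> d \<in> hom C z'' z' \<Longrightarrow> rs (rs t c) d = rs t (c \<cdot> d)"
  by (auto simp: el_def rs_def comp_assoc)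

lemma ap_rs: "f \<in> hom Gph A B \<Longrightarrow> t \<in> el A z \<Longrightarrow> c \<in> hom C z' z \<Longrightarrow> ap f (rs t c) = rs (ap f t) c"
  using comp_assoc[OF _ _ vhomD(6)[of f C A B]] by (auto simp: el_def rs_def ap_def)

text \<open>The local hypothesis is applied to the identity of a hom-object; restricting this
  generic element along \<open>c\<close> gives \<open>c\<close> itself.\<close>

lemma vhom_el_eqI:
  assumes f: "f \<in> hom Gph A B" and g: "g \<in> hom Gph A B" and v: "\<And>a. a \<in> Verts A \<Longrightarrow> Vmap f a = Vmap g a"
    and e: "\<And>Z t. t \<in> el A Z \<Longrightarrow> covers Z (\<lambda>c. ap f (rs t c) = ap g (rs t c))"
  shows "f = g"
proof (rule vhom_eqI[OF f g v])
  fix a b assume ab: "a \<in> Verts A" "b \<in> Verts A"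
  let ?E = "Edge A a b"
  have E: "?E \<in> Obj C" using is_vgraph_Edge[OF vhomD(1)[OF f] ab] .
  have "(a, b, Ident C ?E) \<in> el A ?E" using ab ident_hom[OF E] by (simp add: el_def)
  from covers_eq[OF e[OF this] vhomD(6)[OF f ab]]
  show "Emap f a b = Emap g a b" using vhomD(6)[OF g ab] v ab E by (simp add: rs_def ap_def hom_iff)
qed

text \<open>The two elements are morphisms from \<open>edge_graph z\<close>; the induced morphism
  into the pullback, applied to the generic edge, is the required element.\<close>

lemma vpb_el:
  assumes P: "is_pullback Gph f g P q1 q2" and f: "f \<in> hom Gph A D" and g: "g \<in> hom Gph B D"
    and s: "s \<in> el A z" and t: "t \<in> el B z" and eq: "ap f s = ap g t"
  shows "\<exists>u. u \<in> el P z \<and> ap q1 u = s \<and> ap q2 u = t"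
proof -
  obtain a a' x where s': "s = (a, a', x)" by (cases s)
  obtain b b' y where t': "t = (b, b', y)" by (cases t)
  have a: "a \<in> Verts A" "a' \<in> Verts A" "x \<in> hom C z (Edge A a a')" using s s' by (auto simp: el_def)
  have b: "b \<in> Verts B" "b' \<in> Verts B" "y \<in> hom C z (Edge B b b')" using t t' by (auto simp: el_def)
  note fD = vhomD[OF f] and gD = vhomD[OF g]
  have e: "f \<odot> edge_mor z A a a' x = g \<odot> edge_mor z B b b' y"
    using edge_mor_comp[OF fD(1) a f] edge_mor_comp[OF gD(1) b g] eq s' t' by (simp add: ap_def)
  obtain h where h: "h \<in> hom Gph (edge_graph z) P" "q1 \<odot> h = edge_mor z A a a' x" "q2 \<odot> h = edge_mor z B b b' y"
    using vpb_lift[OF P f g edge_mor_hom[OF fD(1) a] edge_mor_hom[OF gD(1) b] e] by blast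
  have "z \<in> Obj C" using el_obj[OF s] .
  then have i: "(u0, u1, Ident C z) \<in> el (edge_graph z) z" by (auto simp: el_def intro: ident_hom)
  have tmi: "ap (edge_mor z A a a' x) (u0, u1, Ident C z) = s" "ap (edge_mor z B b b' y) (u0, u1, Ident C z) = t"
    using ident_right[OF a(3)] ident_right[OF b(3)] s' t' by (auto simp: ap_def)
  have "ap h (u0, u1, Ident C z) \<in> el P z" using ap_el[OF h(1) i] .
  moreover have "ap q1 (ap h (u0, u1, Ident C z)) = s" "ap q2 (ap h (u0, u1, Ident C z)) = t"
    using ap_comp[OF h(1) vpb_hom(1)[OF P f g] i] ap_comp[OF h(1) vpb_hom(2)[OF P f g] i] h tmi by auto
  ultimately show ?thesis by blast
qed

lemma vpb_el_eq:
  assumes P: "is_pullback Gph f g P q1 q2" and f: "f \<in> hom Gph A D" and g: "g \<in> hom Gph B D"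
    and s: "s \<in> el P z" and t: "t \<in> el P z" and eq: "ap q1 s = ap q1 t" "ap q2 s = ap q2 t"
  shows "s = t"
  using vpb_elem_eq[OF P f g] s t eq by (fastforce simp: el_def ap_def)

lemma FE_el:
  assumes A: "is_vgraph C A" and "as \<in> all_paths A" "z \<in> Obj C" "xs \<in> elems C z (edges A as)"
  shows "FE A z as xs \<in> el (fc_ob C A) z"
  using fcel_hom[OF A all_paths_paths assms(3,4)] assms(2) by (auto simp: FE_def el_def all_paths_iff)

lemma FE_eq:
  assumes A: "is_vgraph C A" and "as \<in> all_paths A" "bs \<in> all_paths A" "z \<in> Obj C"
    "xs \<in> elems C z (edges A as)" "ys \<in> elems C z (edges A bs)" "FE A z as xs = FE A z bs ys"
  shows "(as = bs \<and> xs = ys) \<or> void z"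
  using fcel_eq[OF A, of as "hd as" "last as" bs z xs ys] assms all_paths_paths
  by (metis FE_def Pair_inject)

lemma FE_rs:
  assumes A: "is_vgraph C A" and "as \<in> all_paths A" "xs \<in> elems C z (edges A as)" "c \<in> hom C z' z"
  shows "rs (FE A z as xs) c = FE A z' as (map (\<lambda>x. x \<cdot> c) xs)"
  using fcel_comp[OF assms] by (simp add: FE_def rs_def)

lemma covers_FE:
  assumes A: "is_vgraph C A" and t: "t \<in> el (fc_ob C A) Z"
  shows "covers Z (\<lambda>c. \<exists>as \<in> all_paths A. \<exists>xs \<in> elems C (Dom C c) (edges A as). rs t c = FE A (Dom C c) as xs)"
proof -
  obtain a b x where t': "t = (a, b, x)" by (cases t)
  have ab: "a \<in> Verts A" "b \<in> Verts A" "x \<in> hom C Z (Edge (fc_ob C A) a b)" using t t' by (auto simp: el_def)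
  show ?thesis
    by (rule covers_mono[OF covers_fc[OF A ab]]) (auto simp: rs_def FE_def t' paths_def)
qed

lemma ap_fc:
  assumes f: "f \<in> hom Gph A B" and as: "as \<in> all_paths A" and z: "z \<in> Obj C" and xs: "xs \<in> elems C z (edges A as)"
  shows "ap (fc_ar C f) (FE A z as xs) = FE B z (map (Vmap f) as) (map_string C f as xs)"
proof -
  have "as \<noteq> []" "hd as \<in> Verts A" "last as \<in> Verts A" using as by (auto simp: all_paths_iff)
  then show ?thesis using fc_ar_el[OF f all_paths_paths[OF as] z xs]
    by (simp add: ap_def FE_def Vmap_fc_ar[OF f] hd_map last_map)
qed

lemma ap_eta:
  assumes A: "is_vgraph C A" and t: "(a, b, x) \<in> el A z"
  shows "ap (fc_eta C A) (a, b, x) = FE A z [a, b] [x]"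
  using t fc_eta_el[OF A] by (auto simp: ap_def FE_def el_def Vmap_fc_eta[OF A])

lemma ap_mu:
  assumes A: "is_vgraph C A" and as: "as \<in> all_paths A" and ps: "ps \<in> blocks A as" and z: "z \<in> Obj C" and xss: "okss A z ps xss"
  shows "ap (fc_mu C A) (FE (fc_ob C A) z as (fcels A z ps xss)) = FE A z (join as ps) (concat xss)"
proof -
  have "hd (join as ps) = hd as" "last (join as ps) = last as"
    using join_paths[OF all_paths_paths[OF as] ps] by (auto simp: paths_iff)
  moreover have "hd as \<in> Verts A" "last as \<in> Verts A" using as by (auto simp: all_paths_iff)
  ultimately show ?thesis using fc_mu_el[OF A all_paths_paths[OF as] ps z xss]
    by (simp add: ap_def FE_def Vmap_fc_mu[OF A])
qed

lemma ap_nth: "i < plen as \<Longrightarrow> length xs = plen as \<Longrightarrow>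
    ap f (as ! i, as ! Suc i, xs ! i) = (map (Vmap f) as ! i, map (Vmap f) as ! Suc i, map_string C f as xs ! i)"
  by (simp add: ap_def map_string_nth plen_def)

lemma nth_el:
  assumes "as \<in> all_paths A" "xs \<in> elems C z (edges A as)" "i < plen as"
  shows "(as ! i, as ! Suc i, xs ! i) \<in> el A z"
  using assms path_nth[OF assms(1,3)] by (auto simp: el_def elems_nth edges_nth)

end

section \<open>The suspension\<close>

locale operad_cat = ext_cat C U for C :: "('o, 'm) cat" (structure) and U :: "'u itself" +
  fixes P :: "('o, 'm) ns_operad"
  assumes operad: "is_ns_operad C P"
begin

abbreviation ty :: "('u, 'o, 'm) vgmor itself" where "ty \<equiv> TYPE(('u, 'o, 'm) vgmor)"
abbreviation one :: "('u, 'o) vgraph" where "one \<equiv> trm Gph"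
abbreviation pt :: 'u where "pt \<equiv> susp_pt ty C"
abbreviation S :: "('u, 'o) vgraph" where "S \<equiv> susp_graph ty C P"
abbreviation d :: "('u, 'o, 'm) vgmor" where "d \<equiv> susp_map ty C P"
abbreviation e :: "('u, 'o, 'm) vgmor" where "e \<equiv> susp_unit ty C P"
abbreviation m :: "('u, 'o, 'm) vgmor" where "m \<equiv> susp_mult ty C P"

lemma operadD:
  shows op_obj [simp]: "OpOb P k \<in> Obj C"
    and op_unit: "OpUnit P \<in> hom C (trm C) (OpOb P 1)"
    and op_comp: "OpComp P ks \<in> hom C (prd C (OpOb P (length ks) # map (OpOb P) ks)) (OpOb P (sum_list ks))"
    and op_lunit: "z \<in> Obj C \<Longrightarrow> p \<in> hom C z (OpOb P k) \<Longrightarrow> OpComp P [k] \<cdot> tup C z [OpUnit P \<cdot> bang C z, p] = p"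
    and op_runit: "z \<in> Obj C \<Longrightarrow> p \<in> hom C z (OpOb P k) \<Longrightarrow>
      OpComp P (replicate k 1) \<cdot> tup C z (p # replicate k (OpUnit P \<cdot> bang C z)) = p"
    and op_assoc: "z \<in> Obj C \<Longrightarrow> p \<in> hom C z (OpOb P (length lss)) \<Longrightarrow>
      qs \<in> elems C z (map (\<lambda>ls. OpOb P (length ls)) lss) \<Longrightarrow>
      list_all2 (\<lambda>ls rs. rs \<in> elems C z (map (OpOb P) ls)) lss rss \<Longrightarrow>
          OpComp P (concat lss) \<cdot>
            tup C z ((OpComp P (map length lss) \<cdot> tup C z (p # qs)) # concat rss)
          = OpComp P (map sum_list lss) \<cdot>
            tup C z (p # map (\<lambda>i. OpComp P (lss ! i) \<cdot> tup C z (qs ! i # rss ! i)) [0..<length lss])"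
proof -
  note o = operad[unfolded is_ns_operad_def]
  note o1 = conjunct1[OF o] and o2 = conjunct1[OF conjunct2[OF o]] and o3 = conjunct1[OF conjunct2[OF conjunct2[OF o]]]
    and o4 = conjunct1[OF conjunct2[OF conjunct2[OF conjunct2[OF o]]]]
    and o5 = conjunct2[OF conjunct2[OF conjunct2[OF conjunct2[OF o]]]]
  show "OpOb P k \<in> Obj C" using o1 by (rule spec)
  show "OpUnit P \<in> hom C (trm C) (OpOb P 1)" by (rule o2)
  show "OpComp P ks \<in> hom C (prd C (OpOb P (length ks) # map (OpOb P) ks)) (OpOb P (sum_list ks))"
    using o3 by (rule spec)
  show "OpComp P [k] \<cdot> tup C z [OpUnit P \<cdot> bang C z, p] = p"
    "OpComp P (replicate k 1) \<cdot> tup C z (p # replicate k (OpUnit P \<cdot> bang C z)) = p"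
    if "z \<in> Obj C" "p \<in> hom C z (OpOb P k)"
    using bspec[OF bspec[OF spec[OF o4, of k] that(1)] that(2)] by auto
  show "OpComp P (concat lss) \<cdot>
            tup C z ((OpComp P (map length lss) \<cdot> tup C z (p # qs)) # concat rss)
          = OpComp P (map sum_list lss) \<cdot>
            tup C z (p # map (\<lambda>i. OpComp P (lss ! i) \<cdot> tup C z (qs ! i # rss ! i)) [0..<length lss])"
    if "z \<in> Obj C" "p \<in> hom C z (OpOb P (length lss))"
      "qs \<in> elems C z (map (\<lambda>ls. OpOb P (length ls)) lss)"
      "list_all2 (\<lambda>ls rs. rs \<in> elems C z (map (OpOb P) ls)) lss rss"
    using bspec[OF bspec[OF bspec[OF spec[OF o5, of lss] that(1)] that(2)] that(3)] that(4) by blast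
qed

section \<open>The underlying collection of the suspension\<close>

lemma one_graph: "is_vgraph C one"
  using Gph.trm_obj by simp

lemma one_terminal: "Verts one = {pt}" "is_terminal C (Edge one pt pt)"
proof -
  obtain v where "Verts one = {v} \<and> is_terminal C (Edge one v v)" using terminal_graph[OF Gph.trm_terminal] by blast
  moreover from this have "pt = v" by (simp add: susp_pt_def)
  ultimately show "Verts one = {pt}" "is_terminal C (Edge one pt pt)" by auto
qed

lemma S_graph [simp]: "is_vgraph C S" "Verts S = {pt}" "Edge S pt pt = cpr C UNIV (OpOb P)"
  using coproductD(1)[OF cpr_coproduct[OF small_nat, of UNIV "OpOb P"]] by (simp_all add: susp_graph_def)

lemma S_coproduct: "is_coproduct C UNIV (OpOb P) (Edge S pt pt) (susp_inc C P)"
  using cpr_coproduct[OF small_nat, of UNIV "OpOb P"] by (simp add: susp_inc_def)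

lemma susp_inc_hom: "susp_inc C P k \<in> hom C (OpOb P k) (Edge S pt pt)"
  using coproductD(3)[OF S_coproduct] by simp

text \<open>An operation of arity \<open>k\<close>, regarded as an element of
  \<open>\<Sigma>P\<close> at its single object.\<close>

definition SE :: "nat \<Rightarrow> 'm \<Rightarrow> 'u \<times> 'u \<times> 'm" where
  "SE k p = (pt, pt, susp_inc C P k \<cdot> p)"

lemma SE_el: "p \<in> hom C z (OpOb P k) \<Longrightarrow> SE k p \<in> el S z"
  using comp_hom[OF _ susp_inc_hom] by (simp add: el_def SE_def)

lemma SE_rs: "p \<in> hom C z (OpOb P k) \<Longrightarrow> c \<in> hom C z' z \<Longrightarrow> rs (SE k p) c = SE k (p \<cdot> c)"
  using comp_assoc[OF _ _ susp_inc_hom] by (simp add: SE_def rs_def)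

lemma SE_eq: "p \<in> hom C z (OpOb P k) \<Longrightarrow> q \<in> hom C z (OpOb P l) \<Longrightarrow> SE k p = SE l q \<Longrightarrow> (k = l \<and> p = q) \<or> void z"
  using inc_eq[OF small_nat, of UNIV "OpOb P" k l p z q] by (simp add: SE_def susp_inc_def)

lemma covers_SE:
  assumes t: "t \<in> el S Z"
  shows "covers Z (\<lambda>c. \<exists>k. \<exists>p \<in> hom C (Dom C c) (OpOb P k). rs t c = SE k p)"
proof -
  obtain x where t': "t = (pt, pt, x)" "x \<in> hom C Z (Edge S pt pt)" using t by (auto simp: el_def)
  show ?thesis
    by (rule covers_mono[OF covers_coproduct[OF small_nat S_coproduct t'(2)]]) (auto simp: rs_def SE_def t')
qed

lemma one_elems_eq:
  assumes "as \<in> all_paths one" "xs \<in> elems C z (edges one as)" "ys \<in> elems C z (edges one as)"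
  shows "xs = ys"
  using terminal_elems_eq[OF one_terminal(2)] assms by (metis edges_one_vertex[OF one_terminal(1)])

lemma one_elems_ex:
  assumes "as \<in> all_paths one" "z \<in> Obj C"
  shows "\<exists>xs. xs \<in> elems C z (edges one as)"
proof -
  obtain h where "h \<in> hom C z (Edge one pt pt)" using one_terminal(2) assms(2) unfolding is_terminal_def by blast
  then have "replicate (plen as) h \<in> elems C z (edges one as)"
    unfolding edges_one_vertex[OF one_terminal(1) assms(1)] by (simp add: elems_replicate)
  then show ?thesis ..
qed

lemma loop_path: "loop ty C k \<in> all_paths A" if "Verts A = {pt}" for A :: "('u, 'o) vgraph"
  unfolding loop_def all_paths_iff that by auto

lemma loop_eq: "Verts A = {pt} \<Longrightarrow> as \<in> all_paths A \<Longrightarrow> as = loop ty C (plen as)" for A :: "('u, 'o) vgraph"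
  using one_vertex_path by (simp add: loop_def)

lemma plen_loop [simp]: "plen (loop ty C k) = k"
  by (simp add: loop_def plen_def)

lemma loop_hd_last [simp]: "hd (loop ty C k) = pt" "last (loop ty C k) = pt"
  by (auto simp: loop_def)

text \<open>Over the terminal graph a string is determined by its length, so \<open>d\<close>
  remembers of an operation its arity alone.\<close>

lemma d_props:
  shows d_hom: "d \<in> hom Gph S (fc_ob C one)"
    and ap_d: "as \<in> all_paths one \<Longrightarrow> p \<in> hom C z (OpOb P (plen as)) \<Longrightarrow> xs \<in> elems C z (edges one as) \<Longrightarrow>
      ap d (SE (plen as) p) = FE one z as xs"
proof -
  define Q where "Q k = prd C (rev (edges one (loop ty C k)))" for k
  define h where "h k = (THE h. h \<in> hom C (OpOb P k) (Q k))" for k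
  define F where "F = cotup C UNIV (OpOb P) (Edge (fc_ob C one) pt pt) (\<lambda>k. path_inc C one (loop ty C k) \<cdot> h k)"
  note lp = loop_path[OF one_terminal(1)]
  have dd: "d = mk_vgmor S (fc_ob C one) (\<lambda>_. pt) (\<lambda>_ _. F)"
    by (simp add: susp_map_def Let_def F_def h_def Q_def)
  have s: "set (rev (edges one (loop ty C k))) \<subseteq> Obj C" for k using edges_obj[OF one_graph lp] by simp
  have Qeq: "f = g" if "f \<in> hom C z (Q k)" "g \<in> hom C z (Q k)" for f g z k
  proof (rule prd_eqI[OF s])
    show "f \<in> hom C z (prd C (rev (edges one (loop ty C k))))" "g \<in> hom C z (prd C (rev (edges one (loop ty C k))))"
      using that by (auto simp: Q_def)
    have r: "rev (edges one (loop ty C k)) = replicate k (Edge one pt pt)"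
      using edges_one_vertex[OF one_terminal(1) lp] by simp
    show "map (\<lambda>\<pi>. \<pi> \<cdot> f) (prjs C (rev (edges one (loop ty C k)))) = map (\<lambda>\<pi>. \<pi> \<cdot> g) (prjs C (rev (edges one (loop ty C k))))"
      using terminal_elems_eq[OF one_terminal(2) elems_comp[OF prjs_elems[OF s[of k]], of f z, unfolded r]
          elems_comp[OF prjs_elems[OF s[of k]], of g z, unfolded r]] that unfolding Q_def r .
  qed
  \<comment> \<open>The product of \<open>k\<close> terminal objects is again terminal; this makes
    the \<open>THE\<close> in \<open>susp_map\<close> meaningful.\<close>
  have hh: "h k \<in> hom C (OpOb P k) (Q k)" for k
  proof -
    obtain xs where "xs \<in> elems C (OpOb P k) (edges one (loop ty C k))" using one_elems_ex[OF lp op_obj] by blast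
    then have "tup C (OpOb P k) (rev xs) \<in> hom C (OpOb P k) (Q k)" unfolding Q_def by (intro tup_hom) auto
    then have "\<exists>!h. h \<in> hom C (OpOb P k) (Q k)" using Qeq by blast
    from theI'[OF this] show ?thesis by (simp add: h_def)
  qed
  have pi: "path_inc C one (loop ty C k) \<in> hom C (Q k) (Edge (fc_ob C one) pt pt)" for k
    using path_inc_hom[OF one_graph all_paths_paths[OF lp]] by (simp add: Q_def)
  have E: "Edge (fc_ob C one) pt pt \<in> Obj C" using is_vgraph_Edge[OF is_vgraph_fc_ob[OF one_graph]] one_terminal by simp
  have "\<forall>k \<in> UNIV. path_inc C one (loop ty C k) \<cdot> h k \<in> hom C (OpOb P k) (Edge (fc_ob C one) pt pt)"
    using comp_hom[OF hh pi] by blast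
  note F = cotup[OF cpr_coproduct[OF small_nat op_obj] E this, folded F_def]
  show dh: "d \<in> hom Gph S (fc_ob C one)" unfolding dd
    by (rule vhomI) (use is_vgraph_fc_ob[OF one_graph] one_terminal F(1) in auto)
  show "ap d (SE (plen as) p) = FE one z as xs" if as: "as \<in> all_paths one" and p: "p \<in> hom C z (OpOb P (plen as))"
    and xs: "xs \<in> elems C z (edges one as)"
  proof -
    have z: "z \<in> Obj C" using p by (auto simp: hom_iff)
    define k where "k = plen as"
    have l: "as = loop ty C k" using loop_eq[OF one_terminal(1) as] by (simp add: k_def)
    have r: "rev xs \<in> elems C z (rev (edges one (loop ty C k)))" using xs l by simp
    have "F \<cdot> (susp_inc C P k \<cdot> p) = (F \<cdot> susp_inc C P k) \<cdot> p"
      using comp_assoc[OF p susp_inc_hom, of F] F(1) by (simp add: k_def)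
    also have "\<dots> = path_inc C one (loop ty C k) \<cdot> (h k \<cdot> p)"
      using comp_assoc[OF p[folded k_def] hh pi] F(2)[of k] by (simp add: susp_inc_def)
    also have "h k \<cdot> p = tup C z (rev xs)"
      using Qeq[OF comp_hom[OF p[folded k_def] hh]] tup_hom[OF z r] by (simp add: Q_def)
    finally show ?thesis using l by (simp add: ap_def SE_def FE_def dd fcel_def k_def[symmetric])
  qed
qed

lemma e_props:
  shows e_hom: "e \<in> hom Gph one S"
    and ap_e: "t \<in> el one z \<Longrightarrow> ap e t = SE 1 (OpUnit P \<cdot> bang C z)"
proof -
  let ?E = "Edge one pt pt"
  have e: "e = mk_vgmor one S (\<lambda>_. pt) (\<lambda>a b. susp_inc C P 1 \<cdot> (OpUnit P \<cdot> bang C (Edge one a b)))"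
    by (simp add: susp_unit_def Let_def)
  have E: "?E \<in> Obj C" using one_terminal(2) by (simp add: is_terminal_def)
  have u: "OpUnit P \<cdot> bang C ?E \<in> hom C ?E (OpOb P 1)" using comp_hom[OF bang_hom[OF E] op_unit] .
  show "e \<in> hom Gph one S" unfolding e
    by (rule vhomI) (use one_graph one_terminal comp_hom[OF u susp_inc_hom] in auto)
  show "ap e t = SE 1 (OpUnit P \<cdot> bang C z)" if t: "t \<in> el one z"
  proof -
    obtain x where x: "t = (pt, pt, x)" "x \<in> hom C z ?E" using t one_terminal by (auto simp: el_def)
    show ?thesis using comp_assoc[OF x(2) u susp_inc_hom] comp_assoc[OF x(2) bang_hom[OF E] op_unit] bang_comp[OF x(2)]
      by (simp add: ap_def e one_terminal x(1) SE_def)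
  qed
qed

abbreviation TB :: "('u, 'o) vgraph \<Rightarrow> ('u, 'o, 'm) vgmor" where
  "TB A \<equiv> fc_ar C (bang Gph A)"

lemma Tbang_eq [simp]: "Tbang Gph (fc C) A = TB A"
  by (simp add: Tbang_def)

lemma bang_vhom: "is_vgraph C A \<Longrightarrow> bang Gph A \<in> hom Gph A one"
  using Gph.bang_hom by simp

lemma TB_hom: "is_vgraph C A \<Longrightarrow> TB A \<in> hom Gph (fc_ob C A) (fc_ob C one)"
  by (rule fc_ar_hom[OF bang_vhom])

text \<open>\<open>d\<close> retains the arity of an operation and \<open>TB A\<close> the length of
  a path, so an operation and a string are compatible in the pullback exactly when the two numbers
  agree, up to void stages.\<close>

lemma d_TB:
  assumes A: "is_vgraph C A" and as: "as \<in> all_paths A" and xs: "xs \<in> elems C z (edges A as)" and p: "p \<in> hom C z (OpOb P k)"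
  shows d_TB_eq: "k = plen as \<Longrightarrow> ap d (SE k p) = ap (TB A) (FE A z as xs)"
    and d_TB_plen: "ap d (SE k p) = ap (TB A) (FE A z as xs) \<Longrightarrow> k = plen as \<or> void z"
proof -
  note b = bang_vhom[OF A]
  have z: "z \<in> Obj C" using p by (auto simp: hom_iff)
  let ?as = "map (Vmap (bang Gph A)) as" and ?xs = "map_string C (bang Gph A) as xs"
  have 1: "ap (TB A) (FE A z as xs) = FE one z ?as ?xs" by (rule ap_fc[OF b as z xs])
  have as1: "?as \<in> all_paths one" using map_all_paths[OF b as] .
  have xs1: "?xs \<in> elems C z (edges one ?as)" using map_string_elems[OF b as xs] .
  show "ap d (SE k p) = ap (TB A) (FE A z as xs)" if "k = plen as"
    unfolding 1 using ap_d[OF as1 _ xs1] p that by simp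
  show "k = plen as \<or> void z" if e: "ap d (SE k p) = ap (TB A) (FE A z as xs)"
  proof -
    note lp = loop_path[OF one_terminal(1), of k]
    obtain ys where ys: "ys \<in> elems C z (edges one (loop ty C k))" using one_elems_ex[OF lp z] by blast
    have "FE one z (loop ty C k) ys = FE one z ?as ?xs" using ap_d[OF lp _ ys] p e 1 by simp
    from FE_eq[OF one_graph lp as1 z ys xs1 this] show ?thesis using plen_loop[of k] by (metis plen_map)
  qed
qed

text \<open>In the pullback of \<open>d\<close> and \<open>TB A\<close>, the element \<open>t\<close> is the pair of the operation \<open>p\<close> and the string
  \<open>xs\<close> along \<open>as\<close>. Locally every element is of this form.\<close>

definition represents :: "('u, 'o) vgraph \<Rightarrow> ('u, 'o, 'm) vgmor \<Rightarrow> ('u, 'o, 'm) vgmor \<Rightarrow> 'o \<Rightarrow> 'u list \<Rightarrow> 'm \<Rightarrow> 'm list \<Rightarrow>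
    'u \<times> 'u \<times> 'm \<Rightarrow> bool" where
  "represents A w1 w2 z as p xs t \<longleftrightarrow> as \<in> all_paths A \<and> p \<in> hom C z (OpOb P (plen as)) \<and> xs \<in> elems C z (edges A as) \<and>
     ap w1 t = SE (plen as) p \<and> ap w2 t = FE A z as xs"

section \<open>Elements of a pullback of \<open>d\<close> and \<open>TB A\<close>\<close>

context
  fixes A W :: "('u, 'o) vgraph" and w1 w2 :: "('u, 'o, 'm) vgmor"
  assumes A: "is_vgraph C A" and W: "is_pullback Gph d (TB A) W w1 w2"
begin

lemmas W_hom = vpb_hom[OF W d_hom TB_hom[OF A]]
lemmas W_graph = vpb_graph[OF W d_hom TB_hom[OF A]]

text \<open>Here \<open>W\<close> is any pullback of \<open>d\<close> and \<open>TB A\<close>. It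
  will be the value of the induced monad and, with the legs interchanged, a tensor product with
  \<open>d\<close> as second factor.\<close>

lemma represents_ex:
  assumes "as \<in> all_paths A" "p \<in> hom C z (OpOb P (plen as))" "xs \<in> elems C z (edges A as)"
  shows "\<exists>t \<in> el W z. represents A w1 w2 z as p xs t"
proof -
  have z: "z \<in> Obj C" using assms(2) by (auto simp: hom_iff)
  show ?thesis
    using vpb_el[OF W d_hom TB_hom[OF A] SE_el[OF assms(2)] FE_el[OF A assms(1) z assms(3)] d_TB_eq[OF A assms(1,3,2) refl]] assms
    unfolding represents_def by blast
qed

lemma represents_inj: "t \<in> el W z \<Longrightarrow> t' \<in> el W z \<Longrightarrow> represents A w1 w2 z as p xs t \<Longrightarrow> represents A w1 w2 z as p xs t' \<Longrightarrow> t = t'"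
  using vpb_el_eq[OF W d_hom TB_hom[OF A]] unfolding represents_def by metis

lemma represents_eq:
  assumes "represents A w1 w2 z as p xs t" "represents A w1 w2 z as' p' xs' t"
  shows "(as = as' \<and> p = p' \<and> xs = xs') \<or> void z"
proof -
  have z: "z \<in> Obj C" using assms(1) by (auto simp: represents_def hom_iff)
  have "(as = as' \<and> xs = xs') \<or> void z" using FE_eq[OF A _ _ z] assms unfolding represents_def by metis
  moreover have "(plen as = plen as' \<and> p = p') \<or> void z" using SE_eq[of p z "plen as" p' "plen as'"] assms unfolding represents_def by metis
  ultimately show ?thesis by blast
qed

lemma represents_rs:
  assumes t: "t \<in> el W z" and c: "c \<in> hom C z' z" and r: "represents A w1 w2 z as p xs t"
  shows "represents A w1 w2 z' as (p \<cdot> c) (map (\<lambda>x. x \<cdot> c) xs) (rs t c)"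
  using r c comp_hom[OF c] elems_comp[OF _ c] unfolding represents_def
  by (auto simp: ap_rs[OF W_hom(1) t c] ap_rs[OF W_hom(2) t c] SE_rs FE_rs[OF A])

text \<open>The two components are decomposed one after the other; the pullback square then forces
  arity and length to agree.\<close>

lemma covers_represents:
  assumes t: "t \<in> el W Z"
  shows "covers Z (\<lambda>c. \<exists>as p xs. represents A w1 w2 (Dom C c) as p xs (rs t c))" (is "covers Z ?R")
proof (rule covers_trans[OF covers_SE[OF ap_el[OF W_hom(1) t]]])
  fix c1 assume c1: "c1 \<in> hom C (Dom C c1) Z" and "\<exists>k. \<exists>p\<in>hom C (Dom C c1) (OpOb P k). rs (ap w1 t) c1 = SE k p"
  then obtain k p where p: "p \<in> hom C (Dom C c1) (OpOb P k)" "rs (ap w1 t) c1 = SE k p" by blast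
  let ?t1 = "rs t c1"
  note t1 = rs_el[OF t c1]
  show "covers (Dom C c1) (\<lambda>s. ?R (c1 \<cdot> s))"
  proof (rule covers_trans[OF covers_FE[OF A ap_el[OF W_hom(2) t1]]])
    fix c2 assume c2: "c2 \<in> hom C (Dom C c2) (Dom C c1)"
      and "\<exists>as\<in>all_paths A. \<exists>xs\<in>elems C (Dom C c2) (edges A as). rs (ap w2 (rs t c1)) c2 = FE A (Dom C c2) as xs"
    then obtain as xs where as: "as \<in> all_paths A" and xs: "xs \<in> elems C (Dom C c2) (edges A as)"
      and e: "rs (ap w2 ?t1) c2 = FE A (Dom C c2) as xs" by blast
    let ?t2 = "rs ?t1 c2" and ?z = "Dom C c2"
    note t2 = rs_el[OF t1 c2]
    have z: "?z \<in> Obj C" using el_obj[OF t2] .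
    have e2: "ap w2 ?t2 = FE A ?z as xs" using ap_rs[OF W_hom(2) t1 c2] e by simp
    have e1: "ap w1 ?t2 = SE k (p \<cdot> c2)"
      using ap_rs[OF W_hom(1) t1 c2] ap_rs[OF W_hom(1) t c1] p SE_rs[OF p(1) c2] by simp
    have p2: "p \<cdot> c2 \<in> hom C ?z (OpOb P k)" using comp_hom[OF c2 p(1)] .
    have "ap d (ap w1 ?t2) = ap (TB A) (ap w2 ?t2)"
      using ap_comp[OF W_hom(1) d_hom t2] ap_comp[OF W_hom(2) TB_hom[OF A] t2] vpb_sq[OF W d_hom TB_hom[OF A]] by simp
    \<comment> \<open>If arity and length differ, the stage is void, and there every property holds
      locally.\<close>
    then have "k = plen as \<or> void ?z" using d_TB_plen[OF A as xs p2] e1 e2 by simp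
    then show "covers ?z (\<lambda>s. ?R (c1 \<cdot> (c2 \<cdot> s)))"
    proof
      assume k: "k = plen as"
      show ?thesis
      proof (rule covers_triv[OF z])
        have i: "c2 \<cdot> Ident C ?z = c2" using c2 z by (simp add: hom_iff)
        have "rs t (c1 \<cdot> c2) = ?t2" "Dom C (c1 \<cdot> c2) = ?z" using rs_rs[OF t c1 c2] c1 c2 by (auto simp: hom_iff)
        then show "?R (c1 \<cdot> (c2 \<cdot> Ident C ?z))" unfolding i represents_def using as xs e1 e2 p2 k by auto
      qed
    qed (rule void_covers)
  qed
qed

text \<open>\<open>S\<close> and \<open>fc_ob C one\<close> have one vertex each, so the vertices of
  \<open>W\<close> are those of \<open>A\<close>.\<close>

lemma W_vertex: "a \<in> Verts A \<Longrightarrow> \<exists>w \<in> Verts W. Vmap w2 w = a"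
  using vpb_vertex[OF W d_hom TB_hom[OF A], of pt a] vhomD(5)[OF TB_hom[OF A], of a] vhomD(5)[OF d_hom, of pt] one_terminal
  by auto

lemma W_vertex_eq: "w \<in> Verts W \<Longrightarrow> v \<in> Verts W \<Longrightarrow> Vmap w2 w = Vmap w2 v \<Longrightarrow> w = v"
  using vpb_vertex_eq[OF W d_hom TB_hom[OF A], of w v] vhomD(5)[OF W_hom(1)] by auto

end

abbreviation sels :: "nat list \<Rightarrow> 'm list \<Rightarrow> 'm list" where
  "sels \<equiv> map2 (\<lambda>k q. susp_inc C P k \<cdot> q)"

lemma sels_elems:
  assumes "as \<in> all_paths S" "length ks = plen as" "qs \<in> elems C z (map (OpOb P) ks)"
  shows "sels ks qs \<in> elems C z (edges S as)"
  unfolding edges_one_vertex[OF S_graph(2) assms(1)] elems_replicate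
  using assms(2,3) comp_hom[OF _ susp_inc_hom] by (auto simp: elems_nth)

lemma sels_comp:
  assumes "qs \<in> elems C z (map (OpOb P) ks)" "c \<in> hom C z' z"
  shows "map (\<lambda>x. x \<cdot> c) (sels ks qs) = sels ks (map (\<lambda>x. x \<cdot> c) qs)"
  using assms comp_assoc[OF assms(2) _ susp_inc_hom] by (intro nth_equalityI) (auto simp: elems_nth)

lemma sels_eq:
  assumes "qs \<in> elems C z (map (OpOb P) ks)" "rs' \<in> elems C z (map (OpOb P) ls)" "length ks = length ls" "sels ks qs = sels ls rs'"
  shows "(ks = ls \<and> qs = rs') \<or> void z"
proof (cases "void z")
  case False
  have l: "length qs = length ks" "length rs' = length ks" using assms by (auto simp: elems_nth)
  have "ks ! i = ls ! i \<and> qs ! i = rs' ! i" if i: "i < length ks" for i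
  proof -
    have "SE (ks ! i) (qs ! i) = SE (ls ! i) (rs' ! i)"
      using arg_cong[OF assms(4), of "\<lambda>l. l ! i"] i l assms(3) by (simp add: SE_def)
    then show ?thesis using SE_eq[of "qs ! i" z "ks ! i" "rs' ! i" "ls ! i"] assms i False by (auto simp: elems_nth)
  qed
  then show ?thesis using l assms(3) by (auto intro: nth_equalityI)
qed simp

text \<open>The arities of the entries may vary over the stage; \<open>covers_choice\<close> finds a
  common refinement on which all of them are fixed.\<close>

lemma covers_sels:
  assumes as: "as \<in> all_paths S" and Z: "Z \<in> Obj C" and ys: "ys \<in> elems C Z (edges S as)"
  shows "covers Z (\<lambda>c. \<exists>ks qs. length ks = plen as \<and> qs \<in> elems C (Dom C c) (map (OpOb P) ks) \<and>
     map (\<lambda>x. x \<cdot> c) ys = sels ks qs)"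
proof -
  define R where "R i c v \<longleftrightarrow> snd v \<in> hom C (Dom C c) (OpOb P (fst v)) \<and> ys ! i \<cdot> c = susp_inc C P (fst v) \<cdot> snd v" for i c v
  have yi: "ys ! i \<in> hom C Z (Edge S pt pt)" if "i < plen as" for i
    using ys that unfolding edges_one_vertex[OF S_graph(2) as] elems_replicate by simp
  have l: "length ys = plen as" using ys by (simp add: elems_nth)
  have "covers Z (\<lambda>c. \<exists>vs. length vs = plen as \<and> (\<forall>i < plen as. R i c (vs ! i)))"
  proof (rule covers_choice[OF Z])
    fix i assume i: "i < plen as"
    have "(pt, pt, ys ! i) \<in> el S Z" using yi[OF i] by (simp add: el_def)
    from covers_SE[OF this] show "covers Z (\<lambda>c. \<exists>v. R i c v)"
      by (rule covers_mono) (auto simp: R_def SE_def rs_def)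
    fix c t v assume c: "c \<in> hom C (Dom C c) Z" and v: "R i c v" and t: "t \<in> hom C (Dom C t) (Dom C c)"
    have "Dom C (c \<cdot> t) = Dom C t" using c t by (simp add: hom_iff)
    then have "R i (c \<cdot> t) (fst v, snd v \<cdot> t)"
      using v comp_assoc[OF t c yi[OF i]] comp_assoc[OF t _ susp_inc_hom] comp_hom[OF t] unfolding R_def by simp
    then show "\<exists>v. R i (c \<cdot> t) v" ..
  qed
  then show ?thesis
  proof (rule covers_mono)
    fix c assume "\<exists>vs. length vs = plen as \<and> (\<forall>i < plen as. R i c (vs ! i))"
    then obtain vs where vs: "length vs = plen as" "\<forall>i < plen as. R i c (vs ! i)" by blast
    have "map snd vs \<in> elems C (Dom C c) (map (OpOb P) (map fst vs))" using vs by (simp add: elems_nth R_def)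
    moreover have "map (\<lambda>x. x \<cdot> c) ys = sels (map fst vs) (map snd vs)"
      using vs l by (intro nth_equalityI) (auto simp: R_def case_prod_beta)
    ultimately show "\<exists>ks qs. length ks = plen as \<and> qs \<in> elems C (Dom C c) (map (OpOb P) ks) \<and> map (\<lambda>x. x \<cdot> c) ys = sels ks qs"
      using vs(1) by (intro exI[of _ "map fst vs"] exI[of _ "map snd vs"]) simp
  qed
qed

lemma sels_concat:
  "list_all2 (\<lambda>ks qs. length ks = length qs) kss qss \<Longrightarrow> concat (map2 sels kss qss) = sels (concat kss) (concat qss)"
  by (induction rule: list_all2_induct) auto

text \<open>The operadic composite \<open>p(q_1, ..., q_m)\<close> of generalised elements at stage
  \<open>z\<close>.\<close>

definition opc :: "'o \<Rightarrow> nat list \<Rightarrow> 'm \<Rightarrow> 'm list \<Rightarrow> 'm" where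
  "opc z ks p qs = OpComp P ks \<cdot> tup C z (p # qs)"

lemma opc_hom:
  assumes "p \<in> hom C z (OpOb P (length ks))" "qs \<in> elems C z (map (OpOb P) ks)"
  shows "opc z ks p qs \<in> hom C z (OpOb P (sum_list ks))"
  unfolding opc_def by (rule comp_hom[OF tup_hom op_comp]) (use assms in \<open>auto simp: hom_iff\<close>)

lemma opc_comp:
  assumes "p \<in> hom C z (OpOb P (length ks))" "qs \<in> elems C z (map (OpOb P) ks)" "c \<in> hom C z' z"
  shows "opc z ks p qs \<cdot> c = opc z' ks (p \<cdot> c) (map (\<lambda>x. x \<cdot> c) qs)"
proof -
  have z: "z \<in> Obj C" using assms(1) by (auto simp: hom_iff)
  have e: "p # qs \<in> elems C z (OpOb P (length ks) # map (OpOb P) ks)" using assms by simp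
  show ?thesis unfolding opc_def using comp_assoc[OF assms(3) tup_hom[OF z e] op_comp] tup_comp[OF e assms(3)] by simp
qed

section \<open>Tensor products of collections\<close>

abbreviation tob where "tob \<equiv> tens_ob Gph (fc C)"
abbreviation t1 where "t1 \<equiv> tens1 Gph (fc C)"
abbreviation t2 where "t2 \<equiv> tens2 Gph (fc C)"
abbreviation "coll A \<equiv> hom Gph A (fc_ob C one)"

lemma tens_pb:
  assumes "\<alpha> \<in> coll A" "\<beta> \<in> coll B"
  shows "is_pullback Gph (TB A) \<beta> (tob \<alpha> \<beta>) (t1 \<alpha> \<beta>) (t2 \<alpha> \<beta>)"
proof -
  note a = vhomD[OF assms(1)]
  show ?thesis unfolding tens_ob_def tens1_def tens2_def
    using TB_hom[OF a(1)] assms a by (simp add: vhom_iff) (rule Gph.pb_is_pullback, auto)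
qed

lemma tens_homs:
  assumes "\<alpha> \<in> coll A" "\<beta> \<in> coll B"
  shows "t1 \<alpha> \<beta> \<in> hom Gph (tob \<alpha> \<beta>) (fc_ob C A)" "t2 \<alpha> \<beta> \<in> hom Gph (tob \<alpha> \<beta>) B"
    "TB A \<odot> t1 \<alpha> \<beta> = \<beta> \<odot> t2 \<alpha> \<beta>"
  using vpb_hom[OF tens_pb[OF assms] TB_hom assms(2)] vpb_sq[OF tens_pb[OF assms] TB_hom assms(2)] vhomD(1)[OF assms(1)] by auto

lemma tens_hom:
  assumes "\<alpha> \<in> coll A" "\<beta> \<in> coll B"
  shows "tens Gph (fc C) \<alpha> \<beta> \<in> coll (tob \<alpha> \<beta>)"
  unfolding tens_def fc_simps
  by (rule Gph.comp_hom[OF Gph.comp_hom[OF tens_homs(1)[OF assms] fc_ar_hom[OF assms(1)]] fc_mu_hom[OF one_graph]])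

lemma tens_tup:
  assumes "\<alpha> \<in> coll A" "\<beta> \<in> coll B" "x \<in> hom Gph Z (fc_ob C A)" "y \<in> hom Gph Z B" "TB A \<odot> x = \<beta> \<odot> y"
  shows "tens_tup Gph (fc C) \<alpha> \<beta> x y \<in> hom Gph Z (tob \<alpha> \<beta>)"
    "t1 \<alpha> \<beta> \<odot> tens_tup Gph (fc C) \<alpha> \<beta> x y = x"
    "t2 \<alpha> \<beta> \<odot> tens_tup Gph (fc C) \<alpha> \<beta> x y = y"
proof -
  note a = vhomD[OF assms(1)] and b = vhomD[OF assms(2)]
  note T = vhomD[OF TB_hom[OF a(1)]]
  have D: "Dom Gph \<alpha> = A" "TB A \<in> Arr Gph" "\<beta> \<in> Arr Gph" "Cod Gph (TB A) = Cod Gph \<beta>"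
    "x \<in> hom Gph Z (Dom Gph (TB A))" "y \<in> hom Gph Z (Dom Gph \<beta>)"
    using a b T assms TB_hom[OF a(1)] by (simp_all add: vhom_iff)
  show "tens_tup Gph (fc C) \<alpha> \<beta> x y \<in> hom Gph Z (tob \<alpha> \<beta>)"
    "t1 \<alpha> \<beta> \<odot> tens_tup Gph (fc C) \<alpha> \<beta> x y = x"
    "t2 \<alpha> \<beta> \<odot> tens_tup Gph (fc C) \<alpha> \<beta> x y = y"
    unfolding tens_tup_def tens_ob_def tens1_def tens2_def Tbang_eq D(1)
    using Gph.pbtup[OF D(2-6) assms(5)] by auto
qed

text \<open>The unique arrows to the terminal graph commute with \<open>f\<close>, and
  \<open>fc_ar\<close> preserves composition.\<close>

lemma TB_natural: 
  assumes f: "f \<in> hom Gph A B"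
  shows "TB B \<odot> fc_ar C f = TB A"
  using fc_ar_comp[OF f bang_vhom[OF vhomD(2)[OF f]]] Gph.bang_comp[OF f] by simp

lemma tens_ar:
  assumes a: "\<alpha> \<in> coll A" and b: "\<beta> \<in> coll B" and a': "\<alpha>' \<in> coll A'" and b': "\<beta>' \<in> coll B'"
    and f: "f \<in> hom Gph A A'" and g: "g \<in> hom Gph B B'" and gb: "\<beta>' \<odot> g = \<beta>"
  shows "tens_ar Gph (fc C) \<alpha> \<beta> \<alpha>' \<beta>' f g \<in> hom Gph (tob \<alpha> \<beta>) (tob \<alpha>' \<beta>')"
    "t1 \<alpha>' \<beta>' \<odot> tens_ar Gph (fc C) \<alpha> \<beta> \<alpha>' \<beta>' f g = fc_ar C f \<odot> t1 \<alpha> \<beta>"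
    "t2 \<alpha>' \<beta>' \<odot> tens_ar Gph (fc C) \<alpha> \<beta> \<alpha>' \<beta>' f g = g \<odot> t2 \<alpha> \<beta>"
proof -
  note h = tens_homs[OF a b] and F = fc_ar_hom[OF f]
  have "TB A' \<odot> (fc_ar C f \<odot> t1 \<alpha> \<beta>) = (TB A' \<odot> fc_ar C f) \<odot> t1 \<alpha> \<beta>"
    using Gph.comp_assoc[OF h(1) F TB_hom[OF vhomD(2)[OF f]]] by simp
  also have "\<dots> = (\<beta>' \<odot> g) \<odot> t2 \<alpha> \<beta>" using TB_natural[OF f] h(3) gb by simp
  also have "\<dots> = \<beta>' \<odot> (g \<odot> t2 \<alpha> \<beta>)" by (rule Gph.comp_assoc[OF h(2) g b'])
  finally show "tens_ar Gph (fc C) \<alpha> \<beta> \<alpha>' \<beta>' f g \<in> hom Gph (tob \<alpha> \<beta>) (tob \<alpha>' \<beta>')"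
    "t1 \<alpha>' \<beta>' \<odot> tens_ar Gph (fc C) \<alpha> \<beta> \<alpha>' \<beta>' f g = fc_ar C f \<odot> t1 \<alpha> \<beta>"
    "t2 \<alpha>' \<beta>' \<odot> tens_ar Gph (fc C) \<alpha> \<beta> \<alpha>' \<beta>' f g = g \<odot> t2 \<alpha> \<beta>"
    unfolding tens_ar_def fc_simps
    using tens_tup[OF a' b' Gph.comp_hom[OF h(1) F] Gph.comp_hom[OF h(2) g]] by auto
qed

abbreviation WS where "WS \<equiv> tob d d"

text \<open>After interchanging the legs, a tensor product with \<open>d\<close> on the right is a
  pullback of the kind to which \<open>represents\<close> applies.\<close>

lemma tens_d_pb:
  assumes "\<alpha> \<in> coll A" shows "is_pullback Gph d (TB A) (tob \<alpha> d) (t2 \<alpha> d) (t1 \<alpha> d)"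
  using Gph.is_pullback_sym[OF tens_pb[OF assms d_hom]] .

lemmas WS_pb = tens_d_pb[OF d_hom]

lemma WS_graph: "is_vgraph C WS"
  using W_graph[OF S_graph(1) WS_pb] .

text \<open>The element \<open>t\<close> of the tensor square of the suspension is \<open>p \<in> P(m)\<close> together with
  \<open>qs = q\<^sub>1, \<dots>, q\<^sub>m\<close>, where \<open>q\<^sub>i \<in> P(k\<^sub>i)\<close>.\<close>

definition mult_represents :: "'o \<Rightarrow> nat list \<Rightarrow> 'm \<Rightarrow> 'm list \<Rightarrow> 'u \<times> 'u \<times> 'm \<Rightarrow> bool" where
  "mult_represents z ks p qs t \<longleftrightarrow> p \<in> hom C z (OpOb P (length ks)) \<and> qs \<in> elems C z (map (OpOb P) ks) \<and>
     ap (t2 d d) t = SE (length ks) p \<and> ap (t1 d d) t = FE S z (loop ty C (length ks)) (sels ks qs)"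

text \<open>Compared with \<open>represents\<close>, each entry of the string along the loop is now
  required to lie in a definite summand of the hom-object of \<open>S\<close>.\<close>

lemma mult_represents_represents: "mult_represents z ks p qs t \<longleftrightarrow> qs \<in> elems C z (map (OpOb P) ks) \<and>
    represents S (t2 d d) (t1 d d) z (loop ty C (length ks)) p (sels ks qs) t"
  using sels_elems[OF loop_path[OF S_graph(2)], of ks "length ks" qs z]
  by (auto simp: mult_represents_def represents_def loop_path)

lemma mult_represents_rs:
  assumes "t \<in> el WS z" "c \<in> hom C z' z" "mult_represents z ks p qs t"
  shows "mult_represents z' ks (p \<cdot> c) (map (\<lambda>x. x \<cdot> c) qs) (rs t c)"
  using assms(3) represents_rs[OF S_graph(1) WS_pb assms(1,2)] elems_comp[OF _ assms(2)] sels_comp[OF _ assms(2)]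
  unfolding mult_represents_represents by metis

lemma mult_represents_eq:
  assumes "mult_represents z ks p qs t" "mult_represents z ks' p' qs' t"
  shows "(ks = ks' \<and> p = p' \<and> qs = qs') \<or> void z"
proof -
  have "(loop ty C (length ks) = loop ty C (length ks') \<and> p = p' \<and> sels ks qs = sels ks' qs') \<or> void z"
    using represents_eq[OF S_graph(1) WS_pb] assms unfolding mult_represents_represents by blast
  then show ?thesis using sels_eq[of qs z ks qs' ks'] assms unfolding mult_represents_represents by (metis plen_loop)
qed

text \<open>The entries of the string delivered by \<open>represents\<close> are arbitrary elements
  of a coproduct; a further refinement puts each into one summand.\<close>

lemma covers_mult_represents:
  assumes t: "t \<in> el WS Z"
  shows "covers Z (\<lambda>c. \<exists>ks p qs. mult_represents (Dom C c) ks p qs (rs t c))"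
proof (rule covers_trans[OF covers_represents[OF S_graph(1) WS_pb t]])
  fix c assume c: "c \<in> hom C (Dom C c) Z" and "\<exists>as p xs. represents S (t2 d d) (t1 d d) (Dom C c) as p xs (rs t c)"
  then obtain as p ys where r: "represents S (t2 d d) (t1 d d) (Dom C c) as p ys (rs t c)" by blast
  have as: "as \<in> all_paths S" and ys: "ys \<in> elems C (Dom C c) (edges S as)" using r by (auto simp: represents_def)
  have z: "Dom C c \<in> Obj C" using c by (simp add: hom_iff)
  note tc = rs_el[OF t c]
  show "covers (Dom C c) (\<lambda>s. \<exists>ks p qs. mult_represents (Dom C (c \<cdot> s)) ks p qs (rs t (c \<cdot> s)))"
  proof (rule covers_mono[OF covers_sels[OF as z ys]])
    fix s assume s: "s \<in> hom C (Dom C s) (Dom C c)"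
      and "\<exists>ks qs. length ks = plen as \<and> qs \<in> elems C (Dom C s) (map (OpOb P) ks) \<and> map (\<lambda>x. x \<cdot> s) ys = sels ks qs"
    then obtain ks qs where k: "length ks = plen as" "qs \<in> elems C (Dom C s) (map (OpOb P) ks)" "map (\<lambda>x. x \<cdot> s) ys = sels ks qs"
      by blast
    have "mult_represents (Dom C s) ks (p \<cdot> s) qs (rs (rs t c) s)" unfolding mult_represents_represents
      using represents_rs[OF S_graph(1) WS_pb tc s r] k loop_eq[OF S_graph(2) as] by simp
    moreover have "Dom C (c \<cdot> s) = Dom C s" using c s by (simp add: hom_iff)
    ultimately show "\<exists>ks p qs. mult_represents (Dom C (c \<cdot> s)) ks p qs (rs t (c \<cdot> s))" using rs_rs[OF t c s] by auto
  qed
qed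

text \<open>Justifies the \<open>THE\<close> in \<open>susp_mult\<close> by the same gluing as for
  \<open>fc_mu\<close>, now along the normal forms of \<open>mult_represents\<close>.\<close>

lemma m_props:
  shows m_hom: "m \<in> hom Gph WS S"
    and ap_m: "t \<in> el WS z \<Longrightarrow> mult_represents z ks p qs t \<Longrightarrow> ap m t = SE (sum_list ks) (opc z ks p qs)"
proof -
  note H = W_hom[OF S_graph(1) WS_pb]
  let ?Q = "\<lambda>x y h. h \<in> hom C (Edge WS x y) (Edge S pt pt) \<and>
     (\<forall>ks. \<forall>z \<in> Obj C. \<forall>p \<in> hom C z (OpOb P (length ks)). \<forall>qs \<in> elems C z (map (OpOb P) ks).
       \<forall>c \<in> hom C z (Edge WS x y).
         Emap (t1 d d) x y \<cdot> c = path_inc C S (loop ty C (length ks)) \<cdot> tup C z (rev (sels ks qs)) \<longrightarrow>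
         Emap (t2 d d) x y \<cdot> c = susp_inc C P (length ks) \<cdot> p \<longrightarrow>
         h \<cdot> c = susp_inc C P (sum_list ks) \<cdot> (OpComp P ks \<cdot> tup C z (p # qs)))"
  define h where "h x y = (THE h. ?Q x y h)" for x y
  have mm: "m = mk_vgmor WS S (\<lambda>_. pt) h"
    unfolding susp_mult_def Let_def h_def ..
  have pt1: "Vmap (t1 d d) x = pt" "Vmap (t2 d d) x = pt" if "x \<in> Verts WS" for x
    using vhomD(5)[OF H(1) that] vhomD(5)[OF H(2) that] by auto
  \<comment> \<open>For fixed vertices the premises of the condition in \<open>susp_mult\<close> say
    exactly that \<open>c\<close> has the given normal form.\<close>
  have MRx: "mult_represents z ks p qs (x, y, c) \<longleftrightarrow> p \<in> hom C z (OpOb P (length ks)) \<and> qs \<in> elems C z (map (OpOb P) ks) \<and>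
     Emap (t1 d d) x y \<cdot> c = path_inc C S (loop ty C (length ks)) \<cdot> tup C z (rev (sels ks qs)) \<and>
     Emap (t2 d d) x y \<cdot> c = susp_inc C P (length ks) \<cdot> p" if "x \<in> Verts WS" "y \<in> Verts WS" for x y z ks p qs c
    using pt1[OF that(1)] pt1[OF that(2)] by (auto simp: mult_represents_def SE_def FE_def ap_def fcel_def)
  have ex1: "\<exists>!h. ?Q x y h" if xy: "x \<in> Verts WS" "y \<in> Verts WS" for x y
  proof -
    let ?W = "Edge WS x y"
    have W: "?W \<in> Obj C" using is_vgraph_Edge[OF WS_graph xy] .
    have sp: "Edge S pt pt \<in> Obj C" using coproductD(1)[OF S_coproduct] .
    have cel: "(x, y, c) \<in> el WS z" if "c \<in> hom C z ?W" for c z using that xy by (simp add: el_def)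
    define \<rho> where "\<rho> c v \<longleftrightarrow> (\<exists>ks p qs. mult_represents (Dom C c) ks p qs (x, y, c) \<and> v = susp_inc C P (sum_list ks) \<cdot> opc (Dom C c) ks p qs)" for c v
    have "\<exists>!h. h \<in> hom C ?W (Edge S pt pt) \<and> (\<forall>c v. c \<in> hom C (Dom C c) ?W \<longrightarrow> \<rho> c v \<longrightarrow> h \<cdot> c = v)"
    proof (rule covers_glue[OF covers_mult_represents[OF cel[OF ident_hom[OF W]]] sp])
      fix c assume c: "c \<in> hom C (Dom C c) ?W"
      show "\<exists>v. \<rho> c v" if "\<exists>ks p qs. mult_represents (Dom C c) ks p qs (rs (x, y, Ident C ?W) c)"
        using that ident_left[OF c] by (auto simp: \<rho>_def rs_def)
      show ty: "v \<in> hom C (Dom C c) (Edge S pt pt)" if "\<rho> c v" for v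
        using that comp_hom[OF opc_hom susp_inc_hom] unfolding \<rho>_def mult_represents_def by blast
      show "v = v'" if v: "\<rho> c v" "\<rho> c v'" for v v'
      proof (cases "void (Dom C c)")
        case True then show ?thesis using void_eq ty v by blast
      next
        case False then show ?thesis using v mult_represents_eq unfolding \<rho>_def by blast
      qed
      show "\<rho> (c \<cdot> t) (v \<cdot> t)" if v: "\<rho> c v" and t: "t \<in> hom C (Dom C t) (Dom C c)" for v t
      proof -
        obtain ks p qs where k: "mult_represents (Dom C c) ks p qs (x, y, c)" "v = susp_inc C P (sum_list ks) \<cdot> opc (Dom C c) ks p qs"
          using v unfolding \<rho>_def by blast
        have D: "Dom C (c \<cdot> t) = Dom C t" using c t by (simp add: hom_iff)
        have k': "p \<in> hom C (Dom C c) (OpOb P (length ks))" "qs \<in> elems C (Dom C c) (map (OpOb P) ks)" using k(1) by (auto simp: mult_represents_def)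
        have "v \<cdot> t = susp_inc C P (sum_list ks) \<cdot> opc (Dom C t) ks (p \<cdot> t) (map (\<lambda>x. x \<cdot> t) qs)"
          using comp_assoc[OF t opc_hom[OF k'] susp_inc_hom] opc_comp[OF k' t] k(2) by simp
        moreover have "mult_represents (Dom C t) ks (p \<cdot> t) (map (\<lambda>x. x \<cdot> t) qs) (x, y, c \<cdot> t)"
          using mult_represents_rs[OF cel[OF c] t k(1)] by (simp add: rs_def)
        ultimately show ?thesis unfolding \<rho>_def D by blast
      qed
    qed
    moreover have "(\<forall>c v. c \<in> hom C (Dom C c) ?W \<longrightarrow> \<rho> c v \<longrightarrow> h \<cdot> c = v) \<longleftrightarrow>
      (\<forall>ks. \<forall>z \<in> Obj C. \<forall>p \<in> hom C z (OpOb P (length ks)). \<forall>qs \<in> elems C z (map (OpOb P) ks).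
       \<forall>c \<in> hom C z (Edge WS x y).
         Emap (t1 d d) x y \<cdot> c = path_inc C S (loop ty C (length ks)) \<cdot> tup C z (rev (sels ks qs)) \<longrightarrow>
         Emap (t2 d d) x y \<cdot> c = susp_inc C P (length ks) \<cdot> p \<longrightarrow>
         h \<cdot> c = susp_inc C P (sum_list ks) \<cdot> (OpComp P ks \<cdot> tup C z (p # qs)))" (is "?L \<longleftrightarrow> ?R") for h
    proof
      assume L: ?L
      show ?R
      proof (intro allI ballI impI)
        fix ks z p qs c assume a: "z \<in> Obj C" "p \<in> hom C z (OpOb P (length ks))" "qs \<in> elems C z (map (OpOb P) ks)"
          and c: "c \<in> hom C z ?W"
          and b: "Emap (t1 d d) x y \<cdot> c = path_inc C S (loop ty C (length ks)) \<cdot> tup C z (rev (sels ks qs))"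
          "Emap (t2 d d) x y \<cdot> c = susp_inc C P (length ks) \<cdot> p"
        have D: "Dom C c = z" using c by (simp add: hom_iff)
        have "\<rho> c (susp_inc C P (sum_list ks) \<cdot> opc z ks p qs)" unfolding \<rho>_def D MRx[OF xy] using a b by blast
        then show "h \<cdot> c = susp_inc C P (sum_list ks) \<cdot> (OpComp P ks \<cdot> tup C z (p # qs))"
          using L c D unfolding opc_def by blast
      qed
    next
      assume R: ?R
      show ?L
      proof (intro allI impI)
        fix c v assume c: "c \<in> hom C (Dom C c) ?W" and r: "\<rho> c v"
        then obtain ks p qs where k: "mult_represents (Dom C c) ks p qs (x, y, c)" "v = susp_inc C P (sum_list ks) \<cdot> opc (Dom C c) ks p qs"
          unfolding \<rho>_def by blast
        have "Dom C c \<in> Obj C" using c by (simp add: hom_iff)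
        then show "h \<cdot> c = v" using R c k unfolding MRx[OF xy] opc_def by blast
      qed
    qed
    ultimately show ?thesis by simp
  qed
  have hQ: "?Q x y (h x y)" if "x \<in> Verts WS" "y \<in> Verts WS" for x y
    unfolding h_def by (rule theI'[OF ex1[OF that]])
  show "m \<in> hom Gph WS S" unfolding mm by (rule vhomI) (use WS_graph hQ in auto)
  show "ap m t = SE (sum_list ks) (opc z ks p qs)" if t: "t \<in> el WS z" and r: "mult_represents z ks p qs t"
  proof -
    obtain x y c where t': "t = (x, y, c)" "x \<in> Verts WS" "y \<in> Verts WS" "c \<in> hom C z (Edge WS x y)"
      using t by (auto simp: el_def)
    have "h x y \<cdot> c = susp_inc C P (sum_list ks) \<cdot> opc z ks p qs"
      using hQ[OF t'(2,3)] r[unfolded t'(1) MRx[OF t'(2,3)]] t'(4) el_obj[OF t] unfolding opc_def by blast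
    then show ?thesis using t' by (simp add: ap_def mm SE_def)
  qed
qed

text \<open>A loop of length \<open>k\<close> lists \<open>Suc k\<close> vertices, hence the index
  \<open>k\<close> is allowed.\<close>

lemma loop_nth: "i \<le> k \<Longrightarrow> loop ty C k ! i = pt"
  unfolding loop_def by (rule nth_replicate) simp

lemma FE_one_eq:
  assumes "as \<in> all_paths one" "bs \<in> all_paths one" "plen as = plen bs" "xs \<in> elems C z (edges one as)" "ys \<in> elems C z (edges one bs)"
  shows "FE one z as xs = FE one z bs ys"
  using one_vertex_eqI[OF one_terminal(1) assms(1-3)] one_elems_eq assms by metis

text \<open>Serves both the associativity of \<open>m\<close> and the iterated monad: the entries of
  a string are decomposed further by a locally available description \<open>R\<close>, whose
  witnesses are collected over a common refinement.\<close>

lemma covers_represents2_gen: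
  assumes A: "is_vgraph C A" and W: "is_pullback Gph d (TB A) W w1 w2" and t: "t \<in> el W Z"
    and cv: "\<And>Z t. t \<in> el A Z \<Longrightarrow> covers Z (\<lambda>c. \<exists>v. R (Dom C c) v (rs t c))"
    and st: "\<And>z z' c t v. t \<in> el A z \<Longrightarrow> c \<in> hom C z' z \<Longrightarrow> R z v t \<Longrightarrow> \<exists>v. R z' v (rs t c)"
  shows "covers Z (\<lambda>c. \<exists>as p xs vs. represents A w1 w2 (Dom C c) as p xs (rs t c) \<and> length vs = plen as \<and>
     (\<forall>i < plen as. R (Dom C c) (vs ! i) (as ! i, as ! Suc i, xs ! i)))" (is "covers Z ?G")
proof (rule covers_trans[OF covers_represents[OF A W t]])
  fix c assume c: "c \<in> hom C (Dom C c) Z" and "\<exists>as p xs. represents A w1 w2 (Dom C c) as p xs (rs t c)"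
  then obtain as p xs where r: "represents A w1 w2 (Dom C c) as p xs (rs t c)" by blast
  have as: "as \<in> all_paths A" and xs: "xs \<in> elems C (Dom C c) (edges A as)" using r by (auto simp: represents_def)
  have z: "Dom C c \<in> Obj C" using c by (simp add: hom_iff)
  have l: "length xs = plen as" using xs by (simp add: elems_nth)
  note tc = rs_el[OF t c] and ni = nth_el[OF as xs]
  have "covers (Dom C c) (\<lambda>s. \<exists>vs. length vs = plen as \<and> (\<forall>i < plen as. R (Dom C s) (vs ! i) (rs (as ! i, as ! Suc i, xs ! i) s)))"
  proof (rule covers_choice[OF z])
    fix i assume i: "i < plen as"
    show "covers (Dom C c) (\<lambda>s. \<exists>v. R (Dom C s) v (rs (as ! i, as ! Suc i, xs ! i) s))" by (rule cv[OF ni[OF i]])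
    fix s u v assume s: "s \<in> hom C (Dom C s) (Dom C c)" and v: "R (Dom C s) v (rs (as ! i, as ! Suc i, xs ! i) s)"
      and u: "u \<in> hom C (Dom C u) (Dom C s)"
    have "Dom C (s \<cdot> u) = Dom C u" using s u by (simp add: hom_iff)
    then show "\<exists>v. R (Dom C (s \<cdot> u)) v (rs (as ! i, as ! Suc i, xs ! i) (s \<cdot> u))"
      using st[OF rs_el[OF ni[OF i] s] u v] rs_rs[OF ni[OF i] s u] by simp
  qed
  then show "covers (Dom C c) (\<lambda>s. ?G (c \<cdot> s))"
  proof (rule covers_mono)
    fix s assume s: "s \<in> hom C (Dom C s) (Dom C c)"
      and "\<exists>vs. length vs = plen as \<and> (\<forall>i < plen as. R (Dom C s) (vs ! i) (rs (as ! i, as ! Suc i, xs ! i) s))"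
    then obtain vs where vs: "length vs = plen as" "\<forall>i < plen as. R (Dom C s) (vs ! i) (rs (as ! i, as ! Suc i, xs ! i) s)" by blast
    have "Dom C (c \<cdot> s) = Dom C s" using c s by (simp add: hom_iff)
    moreover have "represents A w1 w2 (Dom C s) as (p \<cdot> s) (map (\<lambda>x. x \<cdot> s) xs) (rs t (c \<cdot> s))"
      using represents_rs[OF A W tc s r] rs_rs[OF t c s] by simp
    moreover have "\<forall>i < plen as. R (Dom C s) (vs ! i) (as ! i, as ! Suc i, map (\<lambda>x. x \<cdot> s) xs ! i)"
      using vs(2) l by (simp add: rs_def)
    ultimately show "?G (c \<cdot> s)" using vs(1) by metis
  qed
qed

lemma S_eqI:
  assumes f: "f \<in> hom Gph X S" and g: "g \<in> hom Gph X S"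
    and e: "\<And>Z t. t \<in> el X Z \<Longrightarrow> covers Z (\<lambda>c. ap f (rs t c) = ap g (rs t c))"
  shows "f = g"
  by (rule vhom_el_eqI[OF f g _ e]) (use vhomD(5)[OF f] vhomD(5)[OF g] in auto)

lemma map_S_path: "f \<in> hom Gph A S \<Longrightarrow> as \<in> all_paths A \<Longrightarrow> map (Vmap f) as = loop ty C (plen as)"
  using loop_eq[OF S_graph(2) map_all_paths] by simp

lemma map_string_S:
  assumes f: "f \<in> hom Gph A S" and as: "as \<in> all_paths A" and xs: "xs \<in> elems C z (edges A as)"
    and l: "length ks = plen as" "length qs = plen as"
    and e: "\<And>i. i < plen as \<Longrightarrow> ap f (as ! i, as ! Suc i, xs ! i) = SE (ks ! i) (qs ! i)"
  shows "map_string C f as xs = sels ks qs"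
proof (rule nth_equalityI)
  have lx: "length xs = plen as" using xs by (simp add: elems_nth)
  then show "length (map_string C f as xs) = length (sels ks qs)" using l by simp
  fix i assume "i < length (map_string C f as xs)"
  then have i: "i < plen as" by simp
  show "map_string C f as xs ! i = sels ks qs ! i"
    using e[OF i] i l unfolding ap_nth[OF i lx] by (simp add: SE_def)
qed

text \<open>Elements carry their endpoints, so equality with \<open>FE\<close> already places each
  path between consecutive vertices; this is the second conclusion.\<close>

lemma map_string_FE:
  assumes f: "f \<in> hom Gph A (fc_ob C B)" and as: "as \<in> all_paths A" and xs: "xs \<in> elems C z (edges A as)"
    and l: "length ps = plen as" "length xss = plen as"
    and ps: "\<forall>i < plen as. ps ! i \<in> all_paths B"
    and e: "\<forall>i < plen as. ap f (as ! i, as ! Suc i, xs ! i) = FE B z (ps ! i) (xss ! i)"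
  shows "map_string C f as xs = fcels B z ps xss" "ps \<in> blocks B (map (Vmap f) as)"
proof -
  have lx: "length xs = plen as" using xs by (simp add: elems_nth)
  show "map_string C f as xs = fcels B z ps xss"
  proof (rule nth_equalityI)
    show "length (map_string C f as xs) = length (fcels B z ps xss)" using l lx by simp
    fix i assume "i < length (map_string C f as xs)"
    then have i: "i < plen as" by simp
    show "map_string C f as xs ! i = fcels B z ps xss ! i"
      using e[rule_format, OF i] i l unfolding ap_nth[OF i lx] by (simp add: FE_def)
  qed
  show "ps \<in> blocks B (map (Vmap f) as)"
    unfolding blocks_iff using l e ap_nth[OF _ lx] all_paths_paths[OF ps[rule_format]] by (simp add: FE_def)
qed

abbreviation dd where "dd \<equiv> tens Gph (fc C) d d"

text \<open>Strings in \<open>one\<close> of equal length coincide, so only the length of the joined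
  loops matters, and it is the sum of \<open>ks\<close>.\<close>

lemma ap_dd:
  assumes t: "t \<in> el WS z" and r: "mult_represents z ks p qs t" and as: "as \<in> all_paths one" "plen as = sum_list ks" and xs: "xs \<in> elems C z (edges one as)"
  shows "ap dd t = FE one z as xs"
proof -
  note H = W_hom[OF S_graph(1) WS_pb]
  have z: "z \<in> Obj C" using el_obj[OF t] .
  let ?l = "loop ty C (length ks)"
  note lS = loop_path[OF S_graph(2), of "length ks"] and l1 = loop_path[OF one_terminal(1)]
  have qs: "qs \<in> elems C z (map (OpOb P) ks)" and e: "ap (t1 d d) t = FE S z ?l (sels ks qs)" using r by (auto simp: mult_represents_def)
  have qi: "qs ! i \<in> hom C z (OpOb P (ks ! i))" "length qs = length ks" if "i < length ks" for i using qs that by (auto simp: elems_nth)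
  have sq: "sels ks qs \<in> elems C z (edges S ?l)" using sels_elems[OF lS _ qs] by simp
  \<comment> \<open>At stage \<open>z\<close> there is exactly one string along each loop in
    \<open>one\<close>, so the choice is immaterial.\<close>
  define xss where "xss = map (\<lambda>k. SOME xs. xs \<in> elems C z (edges one (loop ty C k))) ks"
  have xs': "(SOME xs. xs \<in> elems C z (edges one (loop ty C k))) \<in> elems C z (edges one (loop ty C k))" for k
    using one_elems_ex[OF l1 z, of k] by (rule someI_ex)
  have pp: "\<forall>i < plen ?l. map (loop ty C) ks ! i \<in> all_paths one" using l1 by simp
  have ee: "ap d (?l ! i, ?l ! Suc i, sels ks qs ! i) = FE one z (map (loop ty C) ks ! i) (xss ! i)" if "i < plen ?l" for i
  proof -
    have i: "i < length ks" using that by simp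
    have "(?l ! i, ?l ! Suc i, sels ks qs ! i) = SE (ks ! i) (qs ! i)"
      using i qi(2)[OF i] by (simp add: SE_def loop_nth)
    then show ?thesis using ap_d[OF l1[of "ks ! i"] _ xs'] qi(1)[OF i] i by (simp add: xss_def)
  qed
  have ll: "length (map (loop ty C) ks) = plen ?l" "length xss = plen ?l" by (simp_all add: xss_def)
  have ee': "\<forall>i < plen ?l. ap d (?l ! i, ?l ! Suc i, sels ks qs ! i) = FE one z (map (loop ty C) ks ! i) (xss ! i)"
    using ee by blast
  note ms = map_string_FE[OF d_hom lS sq ll pp ee']
  have ok: "okss one z (map (loop ty C) ks) xss" using xs' by (simp add: list_all2_conv_all_nth xss_def)
  note ml = map_all_paths[OF d_hom lS, unfolded paths_fc_ob]
  have "ap dd t = ap (fc_mu C one) (ap (fc_ar C d) (FE S z ?l (sels ks qs)))"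
    unfolding tens_def fc_simps
    using ap_comp[OF Gph.comp_hom[OF H(2) fc_ar_hom[OF d_hom]] fc_mu_hom[OF one_graph] t]
      ap_comp[OF H(2) fc_ar_hom[OF d_hom] t] e by simp
  also have "\<dots> = FE one z (join (map (Vmap d) ?l) (map (loop ty C) ks)) (concat xss)"
    unfolding ap_fc[OF d_hom lS z sq] ms(1) by (rule ap_mu[OF one_graph ml ms(2) z ok])
  also have "\<dots> = FE one z as xs"
  proof (rule FE_one_eq[OF _ as(1) _ _ xs])
    note jp = all_paths_paths[OF ml]
    show "join (map (Vmap d) ?l) (map (loop ty C) ks) \<in> all_paths one"
      using paths_all_paths[OF join_paths[OF jp ms(2)]] .
    show "plen (join (map (Vmap d) ?l) (map (loop ty C) ks)) = plen as"
      using plen_join[OF jp ms(2)] as(2) by (simp add: comp_def)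
    show "concat xss \<in> elems C z (edges one (join (map (Vmap d) ?l) (map (loop ty C) ks)))"
      using okss_join[OF one_graph jp ms(2) ok] .
  qed
  finally show ?thesis .
qed

lemma dd_hom: "dd \<in> coll WS"
  by (rule tens_hom[OF d_hom d_hom])

text \<open>The arity of a composite is the sum of the inner arities, which is what
  \<open>dd\<close> records.\<close>

lemma d_m: "d \<odot> m = dd"
proof (rule vhom_el_eqI[OF Gph.comp_hom[OF m_hom d_hom] dd_hom])
  have v: "v = pt" if "v \<in> Verts (fc_ob C one)" for v using that one_terminal by simp
  show "Vmap (d \<odot> m) a = Vmap dd a" if "a \<in> Verts WS" for a
    using v[OF vhomD(5)[OF Gph.comp_hom[OF m_hom d_hom] that]] v[OF vhomD(5)[OF dd_hom that]] by simp
  fix Z t assume t: "t \<in> el WS Z"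
  show "covers Z (\<lambda>c. ap (d \<odot> m) (rs t c) = ap dd (rs t c))"
  proof (rule covers_mono[OF covers_mult_represents[OF t]])
    fix c assume c: "c \<in> hom C (Dom C c) Z" and "\<exists>ks p qs. mult_represents (Dom C c) ks p qs (rs t c)"
    then obtain ks p qs where r: "mult_represents (Dom C c) ks p qs (rs t c)" by blast
    let ?z = "Dom C c"
    note tc = rs_el[OF t c]
    have z: "?z \<in> Obj C" using el_obj[OF tc] .
    let ?l = "loop ty C (sum_list ks)"
    note l1 = loop_path[OF one_terminal(1), of "sum_list ks"]
    obtain xs where xs: "xs \<in> elems C ?z (edges one ?l)" using one_elems_ex[OF l1 z] by blast
    have "opc ?z ks p qs \<in> hom C ?z (OpOb P (plen ?l))" using opc_hom r by (simp add: mult_represents_def)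
    from ap_d[OF l1 this xs]
    show "ap (d \<odot> m) (rs t c) = ap dd (rs t c)"
      using ap_comp[OF m_hom d_hom tc] ap_m[OF tc r] ap_dd[OF tc r l1 _ xs] by simp
  qed
qed

text \<open>The unit has arity 1, and \<open>fc_eta\<close> yields paths of length 1.\<close>

lemma d_e: "d \<odot> e = fc_eta C one"
proof (rule vhom_el_eqI[OF Gph.comp_hom[OF e_hom d_hom] fc_eta_hom[OF one_graph]])
  have v: "v = pt" if "v \<in> Verts (fc_ob C one)" for v using that one_terminal by simp
  show "Vmap (d \<odot> e) a = Vmap (fc_eta C one) a" if "a \<in> Verts one" for a
    using v[OF vhomD(5)[OF Gph.comp_hom[OF e_hom d_hom] that]] v[OF vhomD(5)[OF fc_eta_hom[OF one_graph] that]] by simp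
  fix Z t assume t: "t \<in> el one Z"
  have Z: "Z \<in> Obj C" using el_obj[OF t] .
  have ti: "rs t (Ident C Z) = t" using t by (auto simp: rs_def el_def ident_right)
  obtain x where x: "t = (pt, pt, x)" "x \<in> hom C Z (Edge one pt pt)" using t one_terminal(1) by (auto simp: el_def)
  have l: "[pt, pt] \<in> all_paths one" "plen [pt, pt] = 1" using one_terminal(1) by (auto simp: all_paths_iff)
  have u: "OpUnit P \<cdot> bang C Z \<in> hom C Z (OpOb P 1)" using comp_hom[OF bang_hom[OF Z] op_unit] .
  have "ap (d \<odot> e) t = ap (fc_eta C one) t"
    using ap_comp[OF e_hom d_hom t] ap_e[OF t] ap_d[OF l(1), of _ Z "[x]"] ap_eta[OF one_graph t[unfolded x]] x u l(2) by simp
  then show "covers Z (\<lambda>c. ap (d \<odot> e) (rs t c) = ap (fc_eta C one) (rs t c))"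
    using ti by (intro covers_triv[OF Z]) simp
qed

section \<open>The monoid laws for the suspension\<close>

abbreviation "tar \<equiv> tens_ar Gph (fc C)"
abbreviation I where "I \<equiv> fc_eta C one"
abbreviation idS where "idS \<equiv> Ident Gph S"

lemma idS_hom: "idS \<in> hom Gph S S"
  by (rule Gph.ident_hom) simp

lemma I_hom: "I \<in> coll one"
  by (rule fc_eta_hom[OF one_graph])

text \<open>The left tensor factor holds the inner operations. Tensoring with the unit on the left
  thus inserts units below \<open>p\<close>, and the law becomes the right unit law
  \<open>p(1, ..., 1) = p\<close> of the operad.\<close>

lemma susp_left_unit: "m \<odot> tar I d d d e idS = t2 I d"
proof (rule S_eqI)
  have di: "d \<odot> idS = d" using Gph.ident_right[OF d_hom] .
  note a = tens_ar[OF I_hom d_hom d_hom d_hom e_hom idS_hom di]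
  note h = tens_homs[OF I_hom d_hom] and hS = tens_homs[OF d_hom d_hom] and pb = tens_d_pb[OF I_hom]
  show "m \<odot> tar I d d d e idS \<in> hom Gph (tob I d) S" by (rule Gph.comp_hom[OF a(1) m_hom])
  show "t2 I d \<in> hom Gph (tob I d) S" by (rule h(2))
  fix Z t assume t: "t \<in> el (tob I d) Z"
  show "covers Z (\<lambda>c. ap (m \<odot> tar I d d d e idS) (rs t c) = ap (t2 I d) (rs t c))"
  proof (rule covers_mono[OF covers_represents[OF one_graph pb t]])
    fix c assume c: "c \<in> hom C (Dom C c) Z" and "\<exists>as p xs. represents one (t2 I d) (t1 I d) (Dom C c) as p xs (rs t c)"
    then obtain as p xs where r: "represents one (t2 I d) (t1 I d) (Dom C c) as p xs (rs t c)" by blast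
    let ?z = "Dom C c" and ?s = "rs t c"
    note s = rs_el[OF t c]
    have z: "?z \<in> Obj C" using el_obj[OF s] .
    have as: "as \<in> all_paths one" and p: "p \<in> hom C ?z (OpOb P (plen as))" and xs: "xs \<in> elems C ?z (edges one as)"
      and r1: "ap (t2 I d) ?s = SE (plen as) p" and r2: "ap (t1 I d) ?s = FE one ?z as xs"
      using r by (auto simp: represents_def)
    let ?u = "OpUnit P \<cdot> bang C ?z" and ?ks = "replicate (plen as) (1::nat)"
    let ?us = "replicate (plen as) ?u"
    have u: "?u \<in> hom C ?z (OpOb P 1)" using comp_hom[OF bang_hom[OF z] op_unit] .
    have ms: "map_string C e as xs = sels ?ks ?us"
      by (rule map_string_S[OF e_hom as xs]) (use ap_e nth_el[OF as xs] in auto)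
    note as' = ap_el[OF a(1) s]
    have e1: "ap (t1 d d) (ap (tar I d d d e idS) ?s) = FE S ?z (loop ty C (plen as)) (sels ?ks ?us)"
      using ap_comp[OF a(1) hS(1) s] ap_comp[OF h(1) fc_ar_hom[OF e_hom] s] a(2) r2
        ap_fc[OF e_hom as z xs] map_S_path[OF e_hom as] ms by simp
    have e2: "ap (t2 d d) (ap (tar I d d d e idS) ?s) = SE (plen as) p"
      using ap_comp[OF a(1) hS(2) s] a(3) r1 Gph.ident_left[OF h(2)] by simp
    have M: "mult_represents ?z ?ks p ?us (ap (tar I d d d e idS) ?s)"
      unfolding mult_represents_def using e1 e2 p u by (auto simp: elems_nth)
    have "ap (m \<odot> tar I d d d e idS) ?s = SE (sum_list ?ks) (opc ?z ?ks p ?us)"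
      using ap_comp[OF a(1) m_hom s] ap_m[OF as' M] by simp
    also have "opc ?z ?ks p ?us = p" unfolding opc_def by (rule op_runit[OF z p])
    finally show "ap (m \<odot> tar I d d d e idS) ?s = ap (t2 I d) ?s" using r1 by (simp add: sum_list_replicate)
  qed
qed

text \<open>Here the unit is the outer operation, applied to the single inner operation
  \<open>p\<close>; the law becomes \<open>1(p) = p\<close>.\<close>

lemma susp_right_unit: "m \<odot> (tar d I d d idS e \<odot> tens_runit_inv Gph (fc C) d) = idS"
proof (rule S_eqI)
  let ?r = "tens_runit_inv Gph (fc C) d"
  have dS: "Dom Gph d = S" using vhomD(3)[OF d_hom] by simp
  have rt: "?r = tens_tup Gph (fc C) d I (fc_eta C S) (bang Gph S)"
    by (simp add: tens_runit_inv_def coll_unit_def dS del: VGph_simps)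
  have nat: "TB S \<odot> fc_eta C S = I \<odot> bang Gph S"
    using fc_eta_natural[OF bang_vhom[OF S_graph(1)]] .
  note r = tens_tup[OF d_hom I_hom fc_eta_hom[OF S_graph(1)] bang_vhom[OF S_graph(1)] nat, folded rt]
  note a = tens_ar[OF d_hom I_hom d_hom d_hom idS_hom e_hom d_e]
  note h = tens_homs[OF d_hom I_hom] and hS = tens_homs[OF d_hom d_hom]
  note ar = Gph.comp_hom[OF r(1) a(1)]
  show "m \<odot> (tar d I d d idS e \<odot> ?r) \<in> hom Gph S S" by (rule Gph.comp_hom[OF ar m_hom])
  show "idS \<in> hom Gph S S" by (rule idS_hom)
  fix Z t assume t: "t \<in> el S Z"
  show "covers Z (\<lambda>c. ap (m \<odot> (tar d I d d idS e \<odot> ?r)) (rs t c) = ap idS (rs t c))"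
  proof (rule covers_mono[OF covers_SE[OF t]])
    fix c assume c: "c \<in> hom C (Dom C c) Z" and "\<exists>k. \<exists>p\<in>hom C (Dom C c) (OpOb P k). rs t c = SE k p"
    then obtain k p where p: "p \<in> hom C (Dom C c) (OpOb P k)" and sk: "rs t c = SE k p" by blast
    let ?z = "Dom C c" and ?s = "SE k p"
    have s: "?s \<in> el S ?z" by (rule SE_el[OF p])
    have z: "?z \<in> Obj C" using el_obj[OF s] .
    let ?u = "OpUnit P \<cdot> bang C ?z"
    have u: "?u \<in> hom C ?z (OpOb P 1)" using comp_hom[OF bang_hom[OF z] op_unit] .
    let ?q = "ap (tar d I d d idS e \<odot> ?r) ?s"
    have q: "?q = ap (tar d I d d idS e) (ap ?r ?s)" by (rule ap_comp[OF r(1) a(1) s])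
    note rs = ap_el[OF r(1) s]
    have "ap (t1 d d) ?q = ap (t1 d I) (ap ?r ?s)"
      unfolding q using ap_comp[OF a(1) hS(1) rs] ap_comp[OF h(1) fc_ar_hom[OF idS_hom] rs] a(2)
        fc_ar_ident[OF S_graph(1)] ap_ident[OF ap_el[OF h(1) rs]] by simp
    also have "\<dots> = ap (fc_eta C S) ?s" using ap_comp[OF r(1) h(1) s] r(2) by simp
    also have "\<dots> = FE S ?z (loop ty C 1) (sels [k] [p])"
      using ap_eta[OF S_graph(1), of pt pt "susp_inc C P k \<cdot> p" ?z] s by (simp add: SE_def loop_def)
    finally have e1: "ap (t1 d d) ?q = FE S ?z (loop ty C 1) (sels [k] [p])" .
    have "ap (t2 d d) ?q = ap e (ap (t2 d I) (ap ?r ?s))"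
      unfolding q using ap_comp[OF a(1) hS(2) rs] ap_comp[OF h(2) e_hom rs] a(3) by simp
    also have "\<dots> = SE 1 ?u" using ap_e[OF ap_el[OF h(2) rs]] .
    finally have e2: "ap (t2 d d) ?q = SE 1 ?u" .
    have M: "mult_represents ?z [k] ?u [p] ?q" unfolding mult_represents_def using e1 e2 p u by simp
    show "ap (m \<odot> (tar d I d d idS e \<odot> ?r)) (rs t c) = ap idS (rs t c)"
      unfolding sk ap_comp[OF ar m_hom s] ap_m[OF ap_el[OF ar s] M] ap_ident[OF s]
      using op_lunit[OF z p] by (simp add: opc_def)
  qed
qed

text \<open>An element consists locally of \<open>p\<close>, operations \<open>ps\<close> below it
  and lists \<open>qss\<close> below these. The left side composes \<open>ps\<close> with
  \<open>qss\<close> first, the right side \<open>p\<close> with \<open>ps\<close>; equality is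
  \<open>op_assoc\<close>.\<close>

lemma susp_assoc:
  "m \<odot> tar dd d d d m idS = m \<odot> (tar d dd d d idS m \<odot> tens_assoc Gph (fc C) d d d)"
proof (rule S_eqI)
  let ?X = "tob dd d" and ?q = "t1 dd d" and ?B = "tens_assoc Gph (fc C) d d d"
  have di: "d \<odot> idS = d" using Gph.ident_right[OF d_hom] .
  note a1 = tens_ar[OF dd_hom d_hom d_hom d_hom m_hom idS_hom di]
  note a2 = tens_ar[OF d_hom dd_hom d_hom d_hom idS_hom m_hom d_m]
  note h = tens_homs[OF dd_hom d_hom] and hS = tens_homs[OF d_hom d_hom] and hD = tens_homs[OF d_hom dd_hom]
  note pb = tens_d_pb[OF dd_hom]
  let ?J = "tens_tup Gph (fc C) d d (fc_ar C (t2 d d) \<odot> ?q) (t2 dd d)"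
  let ?K = "fc_mu C S \<odot> (fc_ar C (t1 d d) \<odot> ?q)"
  have dS: "Dom Gph d = S" using vhomD(3)[OF d_hom] by simp
  have Bt: "?B = tens_tup Gph (fc C) d dd ?K ?J"
    by (simp add: tens_assoc_def Let_def dS del: VGph_simps)
  note F1 = fc_ar_hom[OF hS(1)] and F2 = fc_ar_hom[OF hS(2)] and mS = fc_mu_hom[OF S_graph(1)] and Fd = fc_ar_hom[OF d_hom]
  have q2: "fc_ar C (t2 d d) \<odot> ?q \<in> hom Gph ?X (fc_ob C S)" by (rule Gph.comp_hom[OF h(1) F2])
  have q1: "fc_ar C (t1 d d) \<odot> ?q \<in> hom Gph ?X (fc_ob C (fc_ob C S))" by (rule Gph.comp_hom[OF h(1) F1])
  have Jc: "TB S \<odot> (fc_ar C (t2 d d) \<odot> ?q) = d \<odot> t2 dd d"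
    using Gph.comp_assoc[OF h(1) F2 TB_hom[OF S_graph(1)]] TB_natural[OF hS(2)] h(3) by simp
  note J = tens_tup[OF d_hom d_hom q2 h(2) Jc]
  have K: "?K \<in> hom Gph ?X (fc_ob C S)" by (rule Gph.comp_hom[OF q1 mS])
  \<comment> \<open>Needed for \<open>?K\<close> and \<open>?J\<close> to induce
    \<open>tens_assoc\<close>: naturality of the multiplication moves \<open>TB S\<close> across
    \<open>fc_mu\<close>, and the pullback squares do the rest.\<close>
  have Bc: "TB S \<odot> ?K = dd \<odot> ?J"
  proof -
    note m1 = fc_mu_hom[OF one_graph] and TS = TB_hom[OF S_graph(1)]
    note FTS = fc_ar_hom[OF TS]
    have dd_eq: "dd = fc_mu C one \<odot> (fc_ar C d \<odot> t1 d d)" by (simp add: tens_def)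
    have "TB S \<odot> ?K = (TB S \<odot> fc_mu C S) \<odot> (fc_ar C (t1 d d) \<odot> ?q)"
      using Gph.comp_assoc[OF q1 mS TS] by simp
    also have "TB S \<odot> fc_mu C S = fc_mu C one \<odot> fc_ar C (TB S)"
      by (rule fc_mu_natural[OF bang_vhom[OF S_graph(1)]])
    also have "(fc_mu C one \<odot> fc_ar C (TB S)) \<odot> (fc_ar C (t1 d d) \<odot> ?q)
        = fc_mu C one \<odot> (fc_ar C (TB S) \<odot> (fc_ar C (t1 d d) \<odot> ?q))"
      by (rule Gph.comp_assoc[OF q1 FTS m1])
    also have "fc_ar C (TB S) \<odot> (fc_ar C (t1 d d) \<odot> ?q) = fc_ar C (TB S \<odot> t1 d d) \<odot> ?q"
      using Gph.comp_assoc[OF h(1) F1 FTS] fc_ar_comp[OF hS(1) TS] by simp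
    also have "TB S \<odot> t1 d d = d \<odot> t2 d d" by (rule hS(3))
    also have "fc_ar C (d \<odot> t2 d d) \<odot> ?q = fc_ar C d \<odot> (t1 d d \<odot> ?J)"
      using Gph.comp_assoc[OF h(1) F2 Fd] fc_ar_comp[OF hS(2) d_hom] J(2) by simp
    also have "\<dots> = (fc_ar C d \<odot> t1 d d) \<odot> ?J" using Gph.comp_assoc[OF J(1) hS(1) Fd] by simp
    also have "fc_mu C one \<odot> \<dots> = dd \<odot> ?J"
      using Gph.comp_assoc[OF J(1) Gph.comp_hom[OF hS(1) Fd] m1] unfolding dd_eq[symmetric] by simp
    finally show ?thesis .
  qed
  note B = tens_tup[OF d_hom dd_hom K J(1) Bc, folded Bt]
  note a2B = Gph.comp_hom[OF B(1) a2(1)]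
  show "m \<odot> tar dd d d d m idS \<in> hom Gph ?X S" by (rule Gph.comp_hom[OF a1(1) m_hom])
  show "m \<odot> (tar d dd d d idS m \<odot> ?B) \<in> hom Gph ?X S" by (rule Gph.comp_hom[OF a2B m_hom])
  fix Z t assume t: "t \<in> el ?X Z"
  \<comment> \<open>A witness is the triple of arities, outer operation and inner
    operations.\<close>
  define R where "R z v u \<longleftrightarrow> mult_represents z (fst v) (fst (snd v)) (snd (snd v)) u" for z v u
  have cv: "covers Z (\<lambda>c. \<exists>v. R (Dom C c) v (rs t c))" if "t \<in> el WS Z" for Z t
    using covers_mult_represents[OF that] by (rule covers_mono) (auto simp: R_def)
  have st: "\<exists>v. R z' v (rs u c)" if u: "u \<in> el WS z" "c \<in> hom C z' z" "R z v u" for z z' c u v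
    using mult_represents_rs[OF u(1,2) u(3)[unfolded R_def]] unfolding R_def by fastforce
  show "covers Z (\<lambda>c. ap (m \<odot> tar dd d d d m idS) (rs t c) = ap (m \<odot> (tar d dd d d idS m \<odot> ?B)) (rs t c))"
  proof (rule covers_mono[OF covers_represents2_gen[OF WS_graph pb t, of R, OF cv st]])
    fix c assume c: "c \<in> hom C (Dom C c) Z" and
      "\<exists>as p xs vs. represents WS (t2 dd d) ?q (Dom C c) as p xs (rs t c) \<and> length vs = plen as \<and>
         (\<forall>i<plen as. R (Dom C c) (vs ! i) (as ! i, as ! Suc i, xs ! i))"
    then obtain ws p cs vs where r: "represents WS (t2 dd d) ?q (Dom C c) ws p cs (rs t c)" and lv: "length vs = plen ws"
      and vs: "\<And>i. i < plen ws \<Longrightarrow> R (Dom C c) (vs ! i) (ws ! i, ws ! Suc i, cs ! i)" by blast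
    define z where "z = Dom C c"
    define s where "s = rs t c"
    have s: "s \<in> el ?X z" using rs_el[OF t c] by (simp add: s_def z_def)
    have z: "z \<in> Obj C" using el_obj[OF s] .
    have ws: "ws \<in> all_paths WS" and p: "p \<in> hom C z (OpOb P (plen ws))" and cs: "cs \<in> elems C z (edges WS ws)"
      and r1: "ap (t2 dd d) s = SE (plen ws) p" and r2: "ap ?q s = FE WS z ws cs"
      using r by (auto simp: represents_def s_def z_def)
    define kss where "kss = map fst vs"
    define ps where "ps = map (\<lambda>v. fst (snd v)) vs"
    define qss where "qss = map (\<lambda>v. snd (snd v)) vs"
    have l: "length kss = plen ws" "length ps = plen ws" "length qss = plen ws" using lv by (auto simp: kss_def ps_def qss_def)
    have M: "mult_represents z (kss ! i) (ps ! i) (qss ! i) (ws ! i, ws ! Suc i, cs ! i)" if "i < plen ws" for i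
      using vs[OF that] that lv by (simp add: R_def kss_def ps_def qss_def z_def)
    have pi: "ps ! i \<in> hom C z (OpOb P (length (kss ! i)))" "qss ! i \<in> elems C z (map (OpOb P) (kss ! i))"
      "ap (t2 d d) (ws ! i, ws ! Suc i, cs ! i) = SE (length (kss ! i)) (ps ! i)"
      "ap (t1 d d) (ws ! i, ws ! Suc i, cs ! i) = FE S z (loop ty C (length (kss ! i))) (sels (kss ! i) (qss ! i))"
      if "i < plen ws" for i using M[OF that] by (auto simp: mult_represents_def)
    have wi: "(ws ! i, ws ! Suc i, cs ! i) \<in> el WS z" if "i < plen ws" for i using nth_el[OF ws cs that] .
    let ?os = "map (\<lambda>i. opc z (kss ! i) (ps ! i) (qss ! i)) [0..<length kss]"
    let ?lss = "map length kss" and ?sss = "map sum_list kss"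
    have os: "?os \<in> elems C z (map (OpOb P) ?sss)" using opc_hom[OF pi(1,2)] l by (simp add: elems_nth)
    have ps: "ps \<in> elems C z (map (OpOb P) ?lss)" using pi(1) l by (simp add: elems_nth)
    have lq: "list_all2 (\<lambda>ks qs. qs \<in> elems C z (map (OpOb P) ks)) kss qss"
      using pi(2) l by (simp add: list_all2_conv_all_nth)
    have lq': "list_all2 (\<lambda>ks qs. length ks = length qs) kss qss"
      using lq by (rule list_all2_mono) (simp add: elems_nth)
    have qs: "concat qss \<in> elems C z (map (OpOb P) (concat kss))"
      using lq by (induction rule: list_all2_induct) (auto intro: elems_append)
    have ms1: "map_string C m ws cs = sels ?sss ?os"
      by (rule map_string_S[OF m_hom ws cs]) (use l ap_m[OF wi M] in auto)
    have ms2: "map_string C (t2 d d) ws cs = sels ?lss ps"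
      by (rule map_string_S[OF hS(2) ws cs]) (use l pi(3) in auto)
    let ?ls = "map (\<lambda>ks. loop ty C (length ks)) kss" and ?xss = "map2 sels kss qss"
    have ms3: "map_string C (t1 d d) ws cs = fcels S z ?ls ?xss" "?ls \<in> blocks S (map (Vmap (t1 d d)) ws)"
      using map_string_FE[OF hS(1) ws cs, of ?ls ?xss] l pi(4) loop_path[OF S_graph(2)] by simp_all
    have e1: "ap (t1 d d) (ap (tar dd d d d m idS) s) = FE S z (loop ty C (plen ws)) (sels ?sss ?os)"
      using ap_comp[OF a1(1) hS(1) s] a1(2) ap_comp[OF h(1) fc_ar_hom[OF m_hom] s] r2
        ap_fc[OF m_hom ws z cs] map_S_path[OF m_hom ws] ms1 by simp
    have e2: "ap (t2 d d) (ap (tar dd d d d m idS) s) = SE (plen ws) p"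
      using ap_comp[OF a1(1) hS(2) s] a1(3) Gph.ident_left[OF h(2)] r1 by simp
    have M1: "mult_represents z ?sss p ?os (ap (tar dd d d d m idS) s)"
      unfolding mult_represents_def using e1 e2 p os l by simp
    have L: "ap (m \<odot> tar dd d d d m idS) s = SE (sum_list ?sss) (opc z ?sss p ?os)"
      using ap_comp[OF a1(1) m_hom s] ap_m[OF ap_el[OF a1(1) s] M1] by simp
    have j1: "ap (t1 d d) (ap ?J s) = FE S z (loop ty C (plen ws)) (sels ?lss ps)"
      using ap_comp[OF J(1) hS(1) s] J(2) ap_comp[OF h(1) F2 s] r2
        ap_fc[OF hS(2) ws z cs] map_S_path[OF hS(2) ws] ms2 by simp
    have j2: "ap (t2 d d) (ap ?J s) = SE (plen ws) p" using ap_comp[OF J(1) hS(2) s] J(3) r1 by simp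
    have M2: "mult_represents z ?lss p ps (ap ?J s)" unfolding mult_represents_def using j1 j2 p ps l by simp
    let ?o = "opc z ?lss p ps"
    have o: "?o \<in> hom C z (OpOb P (sum_list ?lss))" by (rule opc_hom) (use p ps l in auto)
    have mj: "ap m (ap ?J s) = SE (sum_list ?lss) ?o" by (rule ap_m[OF ap_el[OF J(1) s] M2])
    let ?y = "ap (tar d dd d d idS m \<odot> ?B) s"
    have y: "?y = ap (tar d dd d d idS m) (ap ?B s)" by (rule ap_comp[OF B(1) a2(1) s])
    note Bs = ap_el[OF B(1) s]
    have y2: "ap (t2 d d) ?y = SE (sum_list ?lss) ?o"
      unfolding y using ap_comp[OF a2(1) hS(2) Bs] a2(3) ap_comp[OF hD(2) m_hom Bs] ap_comp[OF B(1) hD(2) s] B(3) mj by simp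
    let ?v = "map (Vmap (t1 d d)) ws"
    have v: "?v \<in> all_paths S" using map_all_paths[OF hS(1) ws] by simp
    have ok: "okss S z ?ls ?xss"
      using l pi(2) sels_elems[OF loop_path[OF S_graph(2)]] by (simp add: list_all2_conv_all_nth)
    \<comment> \<open>A path in \<open>S\<close> is determined by its length.\<close>
    have jn: "join ?v ?ls = loop ty C (sum_list ?lss)"
      using loop_eq[OF S_graph(2) paths_all_paths[OF join_paths[OF all_paths_paths[OF v] ms3(2)]]]
        plen_join[OF all_paths_paths[OF v] ms3(2)] by (simp add: comp_def)
    have "ap (t1 d d) ?y = ap (t1 d dd) (ap ?B s)"
      unfolding y using ap_comp[OF a2(1) hS(1) Bs] a2(2) ap_comp[OF hD(1) fc_ar_hom[OF idS_hom] Bs]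
        fc_ar_ident[OF S_graph(1)] ap_ident[OF ap_el[OF hD(1) Bs]] by simp
    also have "\<dots> = ap ?K s" using ap_comp[OF B(1) hD(1) s] B(2) by simp
    also have "\<dots> = ap (fc_mu C S) (ap (fc_ar C (t1 d d)) (FE WS z ws cs))"
      using ap_comp[OF q1 mS s] ap_comp[OF h(1) F1 s] r2 by simp
    also have "\<dots> = ap (fc_mu C S) (FE (fc_ob C S) z ?v (fcels S z ?ls ?xss))"
      using ap_fc[OF hS(1) ws z cs] ms3(1) by simp
    also have "\<dots> = FE S z (join ?v ?ls) (concat ?xss)" by (rule ap_mu[OF S_graph(1) v ms3(2) z ok])
    also have "\<dots> = FE S z (loop ty C (sum_list ?lss)) (sels (concat kss) (concat qss))"
      unfolding jn sels_concat[OF lq'] ..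
    finally have y1: "ap (t1 d d) ?y = \<dots>" .
    have M3: "mult_represents z (concat kss) ?o (concat qss) ?y"
      unfolding mult_represents_def using y1 y2 o qs by (simp add: length_concat)
    have RR: "ap (m \<odot> (tar d dd d d idS m \<odot> ?B)) s = SE (sum_list (concat kss)) (opc z (concat kss) ?o (concat qss))"
      using ap_comp[OF a2B m_hom s] ap_m[OF ap_el[OF a2B s] M3] by simp
    have "ps \<in> elems C z (map (\<lambda>ls. OpOb P (length ls)) kss)" using ps by (simp add: comp_def)
    \<comment> \<open>The operad axiom is used with \<open>kss\<close> for \<open>lss\<close>,
      \<open>ps\<close> for \<open>qs\<close> and \<open>qss\<close> for \<open>rss\<close>.\<close>
    from op_assoc[OF z _ this lq] p l
    have "opc z (concat kss) ?o (concat qss) = opc z ?sss p ?os" unfolding opc_def by simp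
    moreover have "sum_list (concat kss) = sum_list ?sss" by (induction kss) auto
    ultimately show "ap (m \<odot> tar dd d d d m idS) (rs t c) = ap (m \<odot> (tar d dd d d idS m \<odot> ?B)) (rs t c)"
      using L RR by (simp add: s_def)
  qed
qed

lemma susp_gen_operad: "is_gen_operad Gph (fc C) (susp ty C P)"
proof -
  have D: "Dom Gph d = S" "Dom Gph I = one" "Dom Gph dd = WS" "d \<in> Arr Gph" "Cod Gph d = fc_ob C one"
    using d_hom I_hom dd_hom by (simp_all add: vhom_iff)
  show ?thesis
    unfolding is_gen_operad_def Let_def susp_def coll_unit_def is_coll_mor_def fc_simps gen_operad.simps D tens_lunit_def
    using D(4) e_hom d_e m_hom d_m susp_left_unit susp_right_unit susp_assoc by (intro conjI refl)
qed

section \<open>Algebras for the suspension\<close>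

abbreviation TR where "TR \<equiv> operad_monad Gph (fc C) (susp ty C P)"
abbreviation TW where "TW A \<equiv> pbo Gph d (TB A)"
abbreviation p1 where "p1 A \<equiv> pb1 Gph d (TB A)"
abbreviation p2 where "p2 A \<equiv> pb2 Gph d (TB A)"

lemma TW_pb:
  assumes "is_vgraph C A" shows "is_pullback Gph d (TB A) (TW A) (p1 A) (p2 A)"
  using d_hom TB_hom[OF assms] by (intro Gph.pb_is_pullback) (auto simp: vhom_iff)

lemmas TW_hom = W_hom[OF _ TW_pb]
lemmas TW_graph = W_graph[OF _ TW_pb]

lemma TW_sq: "is_vgraph C A \<Longrightarrow> d \<odot> p1 A = TB A \<odot> p2 A"
  using vpb_sq[OF TW_pb d_hom TB_hom] by simp

lemma TW_tup:
  assumes A: "is_vgraph C A" and xy: "x \<in> hom Gph Z S" "y \<in> hom Gph Z (fc_ob C A)" "d \<odot> x = TB A \<odot> y"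
  shows "pbtup Gph d (TB A) x y \<in> hom Gph Z (TW A)"
    "p1 A \<odot> pbtup Gph d (TB A) x y = x" "p2 A \<odot> pbtup Gph d (TB A) x y = y"
  using Gph.pbtup[of d "TB A" x Z y] xy d_hom TB_hom[OF A] by (auto simp: vhom_iff)

lemma TR_ob [simp]: "TOb TR A = TW A"
  by (simp add: operad_monad_def Let_def susp_def)

lemma TR_ar:
  assumes f: "f \<in> hom Gph A B"
  shows "TAr TR f \<in> hom Gph (TW A) (TW B)" "p1 B \<odot> TAr TR f = p1 A"
    "p2 B \<odot> TAr TR f = fc_ar C f \<odot> p2 A"
proof -
  note A = vhomD(1)[OF f] and B = vhomD(2)[OF f]
  have eq: "TAr TR f = pbtup Gph d (TB B) (p1 A) (fc_ar C f \<odot> p2 A)"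
    using vhomD(3,4)[OF f] by (simp add: operad_monad_def Let_def susp_def)
  have "d \<odot> p1 A = TB B \<odot> (fc_ar C f \<odot> p2 A)"
    using TW_sq[OF A] TB_natural[OF f] Gph.comp_assoc[OF TW_hom(2)[OF A A] fc_ar_hom[OF f] TB_hom[OF B]] by simp
  then show "TAr TR f \<in> hom Gph (TW A) (TW B)" "p1 B \<odot> TAr TR f = p1 A"
    "p2 B \<odot> TAr TR f = fc_ar C f \<odot> p2 A"
    unfolding eq using TW_tup[OF B TW_hom(1)[OF A A] Gph.comp_hom[OF TW_hom(2)[OF A A] fc_ar_hom[OF f]]] by auto
qed

text \<open>Needed to compose algebra morphisms; the two arrows have the same projections.\<close>

lemma TR_ar_comp:
  assumes f: "f \<in> hom Gph A B" and g: "g \<in> hom Gph B D"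
  shows "TAr TR (g \<odot> f) = TAr TR g \<odot> TAr TR f"
proof -
  note A = vhomD(1)[OF f] and B = vhomD(2)[OF f] and D = vhomD(2)[OF g]
  note gf = Gph.comp_hom[OF f g] and F = TR_ar[OF f] and G = TR_ar[OF g]
  show ?thesis
  proof (rule Gph.pullback_eqI[OF TW_pb[OF D] TR_ar(1)[OF gf] Gph.comp_hom[OF F(1) G(1)]])
    show "p1 D \<odot> TAr TR (g \<odot> f) = p1 D \<odot> (TAr TR g \<odot> TAr TR f)"
      using TR_ar(2)[OF gf] Gph.comp_assoc[OF F(1) G(1) TW_hom(1)[OF D D]] F(2) G(2) by simp
    have "p2 D \<odot> (TAr TR g \<odot> TAr TR f) = (fc_ar C g \<odot> p2 B) \<odot> TAr TR f"
      using Gph.comp_assoc[OF F(1) G(1) TW_hom(2)[OF D D]] G(3) by simp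
    also have "\<dots> = fc_ar C g \<odot> (fc_ar C f \<odot> p2 A)"
      using Gph.comp_assoc[OF F(1) TW_hom(2)[OF B B] fc_ar_hom[OF g]] F(3) by simp
    also have "\<dots> = fc_ar C (g \<odot> f) \<odot> p2 A"
      using Gph.comp_assoc[OF TW_hom(2)[OF A A] fc_ar_hom[OF f] fc_ar_hom[OF g]] fc_ar_comp[OF f g] by simp
    finally show "p2 D \<odot> TAr TR (g \<odot> f) = p2 D \<odot> (TAr TR g \<odot> TAr TR f)"
      using TR_ar(3)[OF gf] by simp
  qed
qed

lemma TR_ar_ident:
  assumes A: "is_vgraph C A"
  shows "TAr TR (Ident Gph A) = Ident Gph (TW A)"
proof -
  have i: "Ident Gph A \<in> hom Gph A A" using A by (simp add: Gph.ident_hom)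
  have j: "Ident Gph (TW A) \<in> hom Gph (TW A) (TW A)" using TW_graph[OF A A] by (simp add: Gph.ident_hom)
  show ?thesis
    by (rule Gph.pullback_eqI[OF TW_pb[OF A] TR_ar(1)[OF i] j])
      (simp_all only: TR_ar(2,3)[OF i] Gph.ident_right[OF TW_hom(1)[OF A A]] Gph.ident_right[OF TW_hom(2)[OF A A]]
        fc_ar_ident[OF A] Gph.ident_left[OF TW_hom(2)[OF A A]])
qed

abbreviation repr where "repr A \<equiv> represents A (p1 A) (p2 A)"

text \<open>The projections of \<open>TAr TR f\<close> show that the operation is kept and only the
  string is moved along \<open>f\<close>.\<close>

lemma repr_ar:
  assumes f: "f \<in> hom Gph A B" and t: "t \<in> el (TW A) z" and q: "repr A z as p xs t"
  shows "repr B z (map (Vmap f) as) p (map_string C f as xs) (ap (TAr TR f) t)"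
proof -
  note A = vhomD(1)[OF f] and B = vhomD(2)[OF f] and F = TR_ar[OF f]
  have as: "as \<in> all_paths A" "xs \<in> elems C z (edges A as)" using q by (auto simp: represents_def)
  have "ap (p1 B) (ap (TAr TR f) t) = ap (p1 A) t" using ap_comp[OF F(1) TW_hom(1)[OF B B] t] F(2) by simp
  moreover have "ap (p2 B) (ap (TAr TR f) t) = ap (fc_ar C f) (ap (p2 A) t)"
    using ap_comp[OF F(1) TW_hom(2)[OF B B] t] F(3) ap_comp[OF TW_hom(2)[OF A A] fc_ar_hom[OF f] t] by simp
  ultimately show ?thesis
    using q map_all_paths[OF f as(1)] map_string_elems[OF f as] ap_fc[OF f as(1) el_obj[OF t] as(2)] by (simp add: represents_def)
qed

lemma TR_eta:
  assumes A: "is_vgraph C A"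
  shows "TEta TR A \<in> hom Gph A (TW A)" "p1 A \<odot> TEta TR A = e \<odot> bang Gph A"
    "p2 A \<odot> TEta TR A = fc_eta C A"
proof -
  have eq: "TEta TR A = pbtup Gph d (TB A) (e \<odot> bang Gph A) (fc_eta C A)"
    by (simp add: operad_monad_def Let_def susp_def)
  have "d \<odot> (e \<odot> bang Gph A) = TB A \<odot> fc_eta C A"
    using Gph.comp_assoc[OF bang_vhom[OF A] e_hom d_hom] d_e fc_eta_natural[OF bang_vhom[OF A]] by simp
  then show "TEta TR A \<in> hom Gph A (TW A)" "p1 A \<odot> TEta TR A = e \<odot> bang Gph A"
    "p2 A \<odot> TEta TR A = fc_eta C A"
    unfolding eq using TW_tup[OF A Gph.comp_hom[OF bang_vhom[OF A] e_hom] fc_eta_hom[OF A]] by auto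
qed

lemma repr_eta:
  assumes A: "is_vgraph C A" and t: "(a, b, x) \<in> el A z"
  shows "repr A z [a, b] (OpUnit P \<cdot> bang C z) [x] (ap (TEta TR A) (a, b, x))"
proof -
  have ab: "a \<in> Verts A" "b \<in> Verts A" "x \<in> hom C z (Edge A a b)" using t by (auto simp: el_def)
  note E = TR_eta[OF A]
  have z: "z \<in> Obj C" using el_obj[OF t] .
  have u: "OpUnit P \<cdot> bang C z \<in> hom C z (OpOb P 1)" using comp_hom[OF bang_hom[OF z] op_unit] .
  have "ap (p1 A) (ap (TEta TR A) (a, b, x)) = SE 1 (OpUnit P \<cdot> bang C z)"
    using ap_comp[OF E(1) TW_hom(1)[OF A A] t] E(2) ap_comp[OF bang_vhom[OF A] e_hom t] ap_e[OF ap_el[OF bang_vhom[OF A] t]] by simp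
  moreover have "ap (p2 A) (ap (TEta TR A) (a, b, x)) = FE A z [a, b] [x]"
    using ap_comp[OF E(1) TW_hom(2)[OF A A] t] E(3) ap_eta[OF A t] by simp
  ultimately show ?thesis using ab u by (simp add: represents_def all_paths_iff)
qed

text \<open>\<open>J\<close> is the component into \<open>\<Sigma>P \<otimes> \<Sigma>P\<close>. The
  two components of the multiplication agree over \<open>fc_ob C one\<close> because
  \<open>m\<close> is a morphism of collections and \<open>fc_mu\<close> is natural.\<close>

lemma TR_mu:
  assumes A: "is_vgraph C A"
  defines "J \<equiv> tens_tup Gph (fc C) d d (fc_ar C (p1 A) \<odot> p2 (TW A)) (p1 (TW A))"
  shows "TMu TR A \<in> hom Gph (TW (TW A)) (TW A)" "p1 A \<odot> TMu TR A = m \<odot> J"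
    "p2 A \<odot> TMu TR A = fc_mu C A \<odot> (fc_ar C (p2 A) \<odot> p2 (TW A))"
    "J \<in> hom Gph (TW (TW A)) WS" "t1 d d \<odot> J = fc_ar C (p1 A) \<odot> p2 (TW A)"
    "t2 d d \<odot> J = p1 (TW A)"
proof -
  let ?W = "TW A"
  note W = TW_graph[OF A A] and h = TW_hom[OF A A]
  note H = TW_hom[OF W W] and hS = tens_homs[OF d_hom d_hom]
  note F1 = fc_ar_hom[OF h(1)] and F2 = fc_ar_hom[OF h(2)] and m1 = fc_mu_hom[OF one_graph] and mA = fc_mu_hom[OF A]
  note Fd = fc_ar_hom[OF d_hom] and TA = TB_hom[OF A] and TS = TB_hom[OF S_graph(1)]
  note FTA = fc_ar_hom[OF TA]
  have eq: "TMu TR A = pbtup Gph d (TB A) (m \<odot> J) (fc_mu C A \<odot> (fc_ar C (p2 A) \<odot> p2 ?W))"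
    by (simp add: operad_monad_def Let_def susp_def J_def)
  have x: "fc_ar C (p1 A) \<odot> p2 ?W \<in> hom Gph (TW ?W) (fc_ob C S)" by (rule Gph.comp_hom[OF H(2) F1])
  have Jc: "TB S \<odot> (fc_ar C (p1 A) \<odot> p2 ?W) = d \<odot> p1 ?W"
    using Gph.comp_assoc[OF H(2) F1 TS] TB_natural[OF h(1)] TW_sq[OF W] by simp
  note J = tens_tup[OF d_hom d_hom x H(1) Jc, folded J_def]
  have dd_eq: "dd = fc_mu C one \<odot> (fc_ar C d \<odot> t1 d d)" by (simp add: tens_def)
  have y: "fc_ar C (p2 A) \<odot> p2 ?W \<in> hom Gph (TW ?W) (fc_ob C (fc_ob C A))" by (rule Gph.comp_hom[OF H(2) F2])
  have "d \<odot> (m \<odot> J) = dd \<odot> J" using Gph.comp_assoc[OF J(1) m_hom d_hom] d_m by simp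
  also have "\<dots> = fc_mu C one \<odot> ((fc_ar C d \<odot> t1 d d) \<odot> J)"
    unfolding dd_eq by (rule Gph.comp_assoc[OF J(1) Gph.comp_hom[OF hS(1) Fd] m1])
  also have "(fc_ar C d \<odot> t1 d d) \<odot> J = fc_ar C d \<odot> (fc_ar C (p1 A) \<odot> p2 ?W)"
    using Gph.comp_assoc[OF J(1) hS(1) Fd] J(2) by simp
  also have "\<dots> = fc_ar C (d \<odot> p1 A) \<odot> p2 ?W"
    using Gph.comp_assoc[OF H(2) F1 Fd] fc_ar_comp[OF h(1) d_hom] by simp
  also have "d \<odot> p1 A = TB A \<odot> p2 A" by (rule TW_sq[OF A])
  also have "fc_ar C (TB A \<odot> p2 A) \<odot> p2 ?W = fc_ar C (TB A) \<odot> (fc_ar C (p2 A) \<odot> p2 ?W)"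
    using Gph.comp_assoc[OF H(2) F2 FTA] fc_ar_comp[OF h(2) TA] by simp
  also have "fc_mu C one \<odot> \<dots> = (fc_mu C one \<odot> fc_ar C (TB A)) \<odot> (fc_ar C (p2 A) \<odot> p2 ?W)"
    using Gph.comp_assoc[OF y FTA m1] by simp
  also have "fc_mu C one \<odot> fc_ar C (TB A) = TB A \<odot> fc_mu C A"
    using fc_mu_natural[OF bang_vhom[OF A]] by simp
  also have "(TB A \<odot> fc_mu C A) \<odot> (fc_ar C (p2 A) \<odot> p2 ?W)
      = TB A \<odot> (fc_mu C A \<odot> (fc_ar C (p2 A) \<odot> p2 ?W))"
    by (rule Gph.comp_assoc[OF y mA TA])
  finally have c: "d \<odot> (m \<odot> J) = TB A \<odot> (fc_mu C A \<odot> (fc_ar C (p2 A) \<odot> p2 ?W))" .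
  note U = TW_tup[OF A Gph.comp_hom[OF J(1) m_hom] Gph.comp_hom[OF y mA] c, folded eq]
  show "TMu TR A \<in> hom Gph (TW (TW A)) (TW A)" "p1 A \<odot> TMu TR A = m \<odot> J"
    "p2 A \<odot> TMu TR A = fc_mu C A \<odot> (fc_ar C (p2 A) \<odot> p2 (TW A))"
    "J \<in> hom Gph (TW (TW A)) WS" "t1 d d \<odot> J = fc_ar C (p1 A) \<odot> p2 (TW A)"
    "t2 d d \<odot> J = p1 (TW A)"
    using U J by auto
qed

text \<open>Elements of the twofold application of the monad: \<open>p\<close> and, for each edge of the path \<open>ws\<close> in
  \<open>TW A\<close>, an operation \<open>qs ! i\<close> and a string \<open>xss ! i\<close> along the block \<open>bss ! i\<close>.\<close>

definition represents2 :: "('u, 'o) vgraph \<Rightarrow> 'o \<Rightarrow> 'u list \<Rightarrow> 'm \<Rightarrow> 'm list \<Rightarrow> 'u list list \<Rightarrow> 'm list \<Rightarrow> 'm list list \<Rightarrow>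
    'u \<times> 'u \<times> 'm \<Rightarrow> bool" where
  "represents2 A z ws p cs bss qs xss t \<longleftrightarrow> repr (TW A) z ws p cs t \<and>
     length bss = plen ws \<and> length qs = plen ws \<and> length xss = plen ws \<and>
     (\<forall>i < plen ws. repr A z (bss ! i) (qs ! i) (xss ! i) (ws ! i, ws ! Suc i, cs ! i))"

lemma covers_represents2:
  assumes A: "is_vgraph C A" and t: "t \<in> el (TW (TW A)) Z"
  shows "covers Z (\<lambda>c. \<exists>ws p cs bss qs xss. represents2 A (Dom C c) ws p cs bss qs xss (rs t c))"
proof -
  note W = TW_graph[OF A A]
  define R where "R z v u \<longleftrightarrow> repr A z (fst v) (fst (snd v)) (snd (snd v)) u" for z v u
  have cv: "covers Z (\<lambda>c. \<exists>v. R (Dom C c) v (rs t c))" if "t \<in> el (TW A) Z" for Z t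
    using covers_represents[OF A TW_pb[OF A] that] by (rule covers_mono) (auto simp: R_def)
  have st: "\<exists>v. R z' v (rs u c)" if u: "u \<in> el (TW A) z" "c \<in> hom C z' z" "R z v u" for z z' c u v
    using represents_rs[OF A TW_pb[OF A] u(1,2) u(3)[unfolded R_def]] unfolding R_def by fastforce
  show ?thesis
  proof (rule covers_mono[OF covers_represents2_gen[OF W TW_pb[OF W] t, of R, OF cv st]])
    fix c assume "\<exists>as p xs vs. repr (TW A) (Dom C c) as p xs (rs t c) \<and> length vs = plen as \<and>
         (\<forall>i<plen as. R (Dom C c) (vs ! i) (as ! i, as ! Suc i, xs ! i))"
    then obtain ws p cs vs where "repr (TW A) (Dom C c) ws p cs (rs t c)" "length vs = plen ws"
         "\<forall>i<plen ws. R (Dom C c) (vs ! i) (ws ! i, ws ! Suc i, cs ! i)" by blast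
    then have "represents2 A (Dom C c) ws p cs (map fst vs) (map (\<lambda>v. fst (snd v)) vs) (map (\<lambda>v. snd (snd v)) vs) (rs t c)"
      by (simp add: represents2_def R_def)
    then show "\<exists>ws p cs bss qs xss. represents2 A (Dom C c) ws p cs bss qs xss (rs t c)" by blast
  qed
qed

lemma represents2_blocks:
  assumes A: "is_vgraph C A" and q: "represents2 A z ws p cs bss qs xss t"
  shows "map_string C (p2 A) ws cs = fcels A z bss xss" "bss \<in> blocks A (map (Vmap (p2 A)) ws)"
    "okss A z bss xss" "qs \<in> elems C z (map (\<lambda>bs. OpOb P (plen bs)) bss)"
    "map_string C (p1 A) ws cs = sels (map plen bss) qs"
proof -
  note h = TW_hom[OF A A]
  have ws: "ws \<in> all_paths (TW A)" and cs: "cs \<in> elems C z (edges (TW A) ws)" using q by (auto simp: represents2_def represents_def)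
  have l: "length bss = plen ws" "length xss = plen ws" "length qs = plen ws" using q by (auto simp: represents2_def)
  have i: "\<forall>i < plen ws. bss ! i \<in> all_paths A"
    "\<forall>i < plen ws. ap (p2 A) (ws ! i, ws ! Suc i, cs ! i) = FE A z (bss ! i) (xss ! i)"
    using q by (auto simp: represents2_def represents_def)
  show "map_string C (p2 A) ws cs = fcels A z bss xss" "bss \<in> blocks A (map (Vmap (p2 A)) ws)"
    using map_string_FE[OF h(2) ws cs l(1,2) i] by auto
  show "okss A z bss xss" using q l by (auto simp: represents2_def represents_def list_all2_conv_all_nth)
  show "qs \<in> elems C z (map (\<lambda>bs. OpOb P (plen bs)) bss)" using q l by (auto simp: represents2_def represents_def elems_nth)
  show "map_string C (p1 A) ws cs = sels (map plen bss) qs"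
    by (rule map_string_S[OF h(1) ws cs]) (use q l in \<open>auto simp: represents2_def represents_def\<close>)
qed

text \<open>On the first component \<open>m\<close> composes the operations, on the second
  \<open>fc_mu\<close> joins the blocks; arity and length agree by \<open>plen_join\<close>.\<close>

lemma repr_mu:
  assumes A: "is_vgraph C A" and t: "t \<in> el (TW (TW A)) z" and q: "represents2 A z ws p cs bss qs xss t"
  shows "repr A z (join (map (Vmap (p2 A)) ws) bss) (opc z (map plen bss) p qs) (concat xss) (ap (TMu TR A) t)"
proof -
  let ?as = "map (Vmap (p2 A)) ws"
  note W = TW_graph[OF A A] and h = TW_hom[OF A A]
  note H = TW_hom[OF W W] and hS = tens_homs[OF d_hom d_hom] and M = TR_mu[OF A] and b = represents2_blocks[OF A q]
  let ?J = "tens_tup Gph (fc C) d d (fc_ar C (p1 A) \<odot> p2 (TW A)) (p1 (TW A))"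
  have z: "z \<in> Obj C" using el_obj[OF t] .
  have ws: "ws \<in> all_paths (TW A)" and cs: "cs \<in> elems C z (edges (TW A) ws)" and p: "p \<in> hom C z (OpOb P (plen ws))"
    and e1: "ap (p1 (TW A)) t = SE (plen ws) p" and e2: "ap (p2 (TW A)) t = FE (TW A) z ws cs"
    using q by (auto simp: represents2_def represents_def)
  have l: "length bss = plen ws" using q by (auto simp: represents2_def)
  have as: "?as \<in> all_paths A" using map_all_paths[OF h(2) ws] by simp
  note asp = all_paths_paths[OF as]
  have j1: "ap (t1 d d) (ap ?J t) = FE S z (loop ty C (plen ws)) (sels (map plen bss) qs)"
    using ap_comp[OF M(4) hS(1) t] M(5) ap_comp[OF H(2) fc_ar_hom[OF h(1)] t] e2
      ap_fc[OF h(1) ws z cs] map_S_path[OF h(1) ws] b(5) by simp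
  have j2: "ap (t2 d d) (ap ?J t) = SE (plen ws) p" using ap_comp[OF M(4) hS(2) t] M(6) e1 by simp
  have qs: "qs \<in> elems C z (map (OpOb P) (map plen bss))" using b(4) by (simp add: comp_def)
  have MJ: "mult_represents z (map plen bss) p qs (ap ?J t)" unfolding mult_represents_def using j1 j2 p qs l by simp
  have "ap (p1 A) (ap (TMu TR A) t) = ap m (ap ?J t)"
    using ap_comp[OF M(1) h(1) t] M(2) ap_comp[OF M(4) m_hom t] by simp
  also have "\<dots> = SE (sum_list (map plen bss)) (opc z (map plen bss) p qs)" by (rule ap_m[OF ap_el[OF M(4) t] MJ])
  finally have r1: "ap (p1 A) (ap (TMu TR A) t) = SE (plen (join ?as bss)) (opc z (map plen bss) p qs)"
    using plen_join[OF asp b(2)] by simp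
  have "ap (p2 A) (ap (TMu TR A) t) = ap (fc_mu C A) (ap (fc_ar C (p2 A)) (ap (p2 (TW A)) t))"
    using ap_comp[OF M(1) h(2) t] M(3) ap_comp[OF Gph.comp_hom[OF H(2) fc_ar_hom[OF h(2)]] fc_mu_hom[OF A] t]
      ap_comp[OF H(2) fc_ar_hom[OF h(2)] t] by simp
  also have "\<dots> = ap (fc_mu C A) (FE (fc_ob C A) z ?as (fcels A z bss xss))"
    using ap_fc[OF h(2) ws z cs] b(1) e2 by simp
  also have "\<dots> = FE A z (join ?as bss) (concat xss)" by (rule ap_mu[OF A as b(2) z b(3)])
  finally have r2: "ap (p2 A) (ap (TMu TR A) t) = FE A z (join ?as bss) (concat xss)" .
  have "opc z (map plen bss) p qs \<in> hom C z (OpOb P (plen (join ?as bss)))"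
    using opc_hom[of p z "map plen bss" qs] p qs l plen_join[OF asp b(2)] by simp
  then show ?thesis unfolding represents_def
    using r1 r2 paths_all_paths[OF join_paths[OF asp b(2)]] okss_join[OF A asp b(2,3)] by simp
qed

section \<open>Families of actions and structure maps\<close>

definition is_action_family :: "('u, 'o) vgraph \<Rightarrow> ('u list \<Rightarrow> 'm) \<Rightarrow> bool" where
  "is_action_family A \<gamma> \<longleftrightarrow> (\<forall>as. as \<notin> all_paths A \<longrightarrow> \<gamma> as = undefined) \<and>
     (\<forall>as \<in> all_paths A. \<gamma> as \<in> hom C (prd C (OpOb P (plen as) # rev (edges A as))) (Edge A (hd as) (last as)))"

definition act :: "('u list \<Rightarrow> 'm) \<Rightarrow> 'o \<Rightarrow> 'u list \<Rightarrow> 'm \<Rightarrow> 'm list \<Rightarrow> 'm" where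
  "act \<gamma> z as p xs = \<gamma> as \<cdot> tup C z (p # rev xs)"

text \<open>The vertex condition is not automatic for a mere morphism \<open>\<theta>\<close>; for algebras it follows from the
  unit law.\<close>

definition corresponds :: "('u, 'o) vgraph \<Rightarrow> ('u list \<Rightarrow> 'm) \<Rightarrow> ('u, 'o, 'm) vgmor \<Rightarrow> bool" where
  "corresponds A \<gamma> \<theta> \<longleftrightarrow> is_vgraph C A \<and> is_action_family A \<gamma> \<and> \<theta> \<in> hom Gph (TW A) A \<and> (\<forall>w \<in> Verts (TW A). Vmap \<theta> w = Vmap (p2 A) w) \<and>
     (\<forall>z t as p xs. t \<in> el (TW A) z \<longrightarrow> repr A z as p xs t \<longrightarrow> ap \<theta> t = (hd as, last as, act \<gamma> z as p xs))"

lemma act_elems: 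
  assumes "p \<in> hom C z (OpOb P (plen as))" "xs \<in> elems C z (edges A as)"
  shows "p # rev xs \<in> elems C z (OpOb P (plen as) # rev (edges A as))"
  using assms by simp

lemma act_hom:
  assumes "is_action_family A \<gamma>" "as \<in> all_paths A" "p \<in> hom C z (OpOb P (plen as))" "xs \<in> elems C z (edges A as)"
  shows "act \<gamma> z as p xs \<in> hom C z (Edge A (hd as) (last as))"
proof -
  have "z \<in> Obj C" using assms(3) by (auto simp: hom_iff)
  then show ?thesis using comp_hom[OF tup_hom[OF _ act_elems[OF assms(3,4)]]] assms(1,2) unfolding act_def is_action_family_def by blast
qed

lemma act_comp:
  assumes "is_action_family A \<gamma>" "as \<in> all_paths A" "p \<in> hom C z (OpOb P (plen as))" "xs \<in> elems C z (edges A as)" "c \<in> hom C z' z"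
  shows "act \<gamma> z as p xs \<cdot> c = act \<gamma> z' as (p \<cdot> c) (map (\<lambda>x. x \<cdot> c) xs)"
proof -
  have z: "z \<in> Obj C" using assms(3) by (auto simp: hom_iff)
  note e = act_elems[OF assms(3,4)]
  have "\<gamma> as \<in> hom C (prd C (OpOb P (plen as) # rev (edges A as))) (Edge A (hd as) (last as))"
    using assms(1,2) by (auto simp: is_action_family_def)
  then show ?thesis unfolding act_def using comp_assoc[OF assms(5) tup_hom[OF z e]] tup_comp[OF e assms(5)] by (simp add: rev_map)
qed

lemma represents_ends: "w2 \<in> hom Gph W (fc_ob C A) \<Longrightarrow> represents A w1 w2 z as p xs (a, b, x) \<Longrightarrow> hd as = Vmap w2 a \<and> last as = Vmap w2 b"
  by (auto simp: represents_def ap_def FE_def)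

text \<open>\<open>\<theta>\<close> is glued from the values of \<open>act\<close> on normal forms,
  which are single-valued outside void stages and restrict well by \<open>act_comp\<close>. This
  concerns the typing of \<open>\<gamma>\<close>; its laws are matched with those of
  \<open>\<theta>\<close> afterwards.\<close>

lemma corresponds_ex_theta:
  assumes A: "is_vgraph C A" and g: "is_action_family A \<gamma>"
  shows "\<exists>\<theta>. corresponds A \<gamma> \<theta>"
proof -
  let ?W = "TW A" and ?v = "Vmap (p2 A)"
  note W = TW_graph[OF A A] and h = TW_hom[OF A A] and pb = TW_pb[OF A]
  have ex1: "\<exists>!k. k \<in> hom C (Edge ?W w w') (Edge A (?v w) (?v w')) \<and> (\<forall>c v. c \<in> hom C (Dom C c) (Edge ?W w w') \<longrightarrow>
      (\<exists>as p xs. repr A (Dom C c) as p xs (w, w', c) \<and> v = act \<gamma> (Dom C c) as p xs) \<longrightarrow> k \<cdot> c = v)"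
    if w: "w \<in> Verts ?W" "w' \<in> Verts ?W" for w w'
  proof -
    let ?E = "Edge ?W w w'"
    have E: "?E \<in> Obj C" using is_vgraph_Edge[OF W w] .
    have cel: "(w, w', c) \<in> el ?W z" if "c \<in> hom C z ?E" for c z using that w by (simp add: el_def)
    show ?thesis
    proof (rule covers_glue[OF covers_represents[OF A pb cel[OF ident_hom[OF E]]]])
      show "Edge A (?v w) (?v w') \<in> Obj C" using vhomD(5)[OF h(2)] w by (intro is_vgraph_Edge[OF A]) auto
      fix c assume c: "c \<in> hom C (Dom C c) ?E"
      show "\<exists>v as p xs. repr A (Dom C c) as p xs (w, w', c) \<and> v = act \<gamma> (Dom C c) as p xs"
        if "\<exists>as p xs. repr A (Dom C c) as p xs (rs (w, w', Ident C ?E) c)"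
        using that ident_left[OF c] by (auto simp: rs_def)
      show ty: "v \<in> hom C (Dom C c) (Edge A (?v w) (?v w'))"
        if "\<exists>as p xs. repr A (Dom C c) as p xs (w, w', c) \<and> v = act \<gamma> (Dom C c) as p xs" for v
        using that represents_ends[OF h(2)] act_hom[OF g] unfolding represents_def by metis
      show "v = v'" if v: "\<exists>as p xs. repr A (Dom C c) as p xs (w, w', c) \<and> v = act \<gamma> (Dom C c) as p xs"
         "\<exists>as p xs. repr A (Dom C c) as p xs (w, w', c) \<and> v' = act \<gamma> (Dom C c) as p xs" for v v'
      proof (cases "void (Dom C c)")
        case True then show ?thesis using void_eq ty v by blast
      next
        case False then show ?thesis using v represents_eq[OF A pb] by blast
      qed
      show "\<exists>as p xs. repr A (Dom C (c \<cdot> t)) as p xs (w, w', c \<cdot> t) \<and> v \<cdot> t = act \<gamma> (Dom C (c \<cdot> t)) as p xs"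
        if v: "\<exists>as p xs. repr A (Dom C c) as p xs (w, w', c) \<and> v = act \<gamma> (Dom C c) as p xs"
          and t: "t \<in> hom C (Dom C t) (Dom C c)" for v t
      proof -
        obtain as p xs where q: "repr A (Dom C c) as p xs (w, w', c)" "v = act \<gamma> (Dom C c) as p xs" using v by blast
        have D: "Dom C (c \<cdot> t) = Dom C t" using c t by (simp add: hom_iff)
        have "repr A (Dom C t) as (p \<cdot> t) (map (\<lambda>x. x \<cdot> t) xs) (w, w', c \<cdot> t)"
          using represents_rs[OF A pb cel[OF c] t q(1)] by (simp add: rs_def)
        moreover have "v \<cdot> t = act \<gamma> (Dom C t) as (p \<cdot> t) (map (\<lambda>x. x \<cdot> t) xs)"
          unfolding q(2) by (rule act_comp[OF g _ _ _ t]) (use q(1) in \<open>auto simp: represents_def\<close>)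
        ultimately show ?thesis unfolding D by blast
      qed
    qed
  qed
  define k where "k w w' = (THE k. k \<in> hom C (Edge ?W w w') (Edge A (?v w) (?v w')) \<and> (\<forall>c v. c \<in> hom C (Dom C c) (Edge ?W w w') \<longrightarrow>
      (\<exists>as p xs. repr A (Dom C c) as p xs (w, w', c) \<and> v = act \<gamma> (Dom C c) as p xs) \<longrightarrow> k \<cdot> c = v))" for w w'
  have k: "k w w' \<in> hom C (Edge ?W w w') (Edge A (?v w) (?v w')) \<and> (\<forall>c v. c \<in> hom C (Dom C c) (Edge ?W w w') \<longrightarrow>
      (\<exists>as p xs. repr A (Dom C c) as p xs (w, w', c) \<and> v = act \<gamma> (Dom C c) as p xs) \<longrightarrow> k w w' \<cdot> c = v)"
    if "w \<in> Verts ?W" "w' \<in> Verts ?W" for w w'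
    unfolding k_def by (rule theI'[OF ex1[OF that]])
  define \<theta> where "\<theta> = mk_vgmor ?W A ?v k"
  have th: "\<theta> \<in> hom Gph ?W A" unfolding \<theta>_def
    by (rule vhomI[OF W A]) (use vhomD(5)[OF h(2)] k in auto)
  have "ap \<theta> t = (hd as, last as, act \<gamma> z as p xs)" if t: "t \<in> el ?W z" and q: "repr A z as p xs t" for z t as p xs
  proof -
    obtain w w' c where t': "t = (w, w', c)" "w \<in> Verts ?W" "w' \<in> Verts ?W" "c \<in> hom C z (Edge ?W w w')"
      using t by (auto simp: el_def)
    have D: "Dom C c = z" using t'(4) by (simp add: hom_iff)
    have "k w w' \<cdot> c = act \<gamma> z as p xs" using k[OF t'(2,3)] q t' D by blast
    then show ?thesis using t' represents_ends[OF h(2)] q by (simp add: ap_def \<theta>_def)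
  qed
  then have "corresponds A \<gamma> \<theta>" unfolding corresponds_def using A g th by (auto simp: \<theta>_def)
  then show ?thesis ..
qed

text \<open>Elements with a normal form cover, and there both maps have the same value.\<close>

lemma corresponds_theta_unique:
  assumes "corresponds A \<gamma> \<theta>" "corresponds A \<gamma> \<theta>'"
  shows "\<theta> = \<theta>'"
proof -
  have A: "is_vgraph C A" using assms by (simp add: corresponds_def)
  show ?thesis
  proof (rule vhom_el_eqI)
    show "\<theta> \<in> hom Gph (TW A) A" "\<theta>' \<in> hom Gph (TW A) A" using assms by (auto simp: corresponds_def)
    show "Vmap \<theta> a = Vmap \<theta>' a" if "a \<in> Verts (TW A)" for a using assms that by (simp add: corresponds_def)
    fix Z t assume t: "t \<in> el (TW A) Z"
    show "covers Z (\<lambda>c. ap \<theta> (rs t c) = ap \<theta>' (rs t c))"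
      by (rule covers_mono[OF covers_represents[OF A TW_pb[OF A] t]])
        (use assms rs_el[OF t] in \<open>unfold corresponds_def, metis\<close>)
  qed
qed

text \<open>\<open>\<gamma> as\<close> is the value of \<open>\<theta>\<close> at the generic pair
  of operation and string along \<open>as\<close>, which consists of the projections of the product;
  every other pair is a restriction of it.\<close>

lemma corresponds_ex_gamma:
  assumes A: "is_vgraph C A" and th: "\<theta> \<in> hom Gph (TW A) A" and v: "\<forall>w \<in> Verts (TW A). Vmap \<theta> w = Vmap (p2 A) w"
  shows "\<exists>\<gamma>. corresponds A \<gamma> \<theta>"
proof -
  note h = TW_hom[OF A A] and pb = TW_pb[OF A]
  let ?xs = "\<lambda>as. OpOb P (plen as) # rev (edges A as)"
  have s: "set (?xs as) \<subseteq> Obj C" if "as \<in> all_paths A" for as using edges_obj[OF A that] by simp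
  \<comment> \<open>The first projection is the operation; the others come in composition order and
    are reversed to follow the path.\<close>
  have ex: "\<exists>t. t \<in> el (TW A) (prd C (?xs as)) \<and>
      repr A (prd C (?xs as)) as (hd (prjs C (?xs as))) (rev (tl (prjs C (?xs as)))) t" if as: "as \<in> all_paths A" for as
  proof -
    obtain \<pi> \<pi>s where pi: "prjs C (?xs as) = \<pi> # \<pi>s" "\<pi> \<in> hom C (prd C (?xs as)) (OpOb P (plen as))"
      "\<pi>s \<in> elems C (prd C (?xs as)) (rev (edges A as))"
      using prjs_elems[OF s[OF as]] by (auto simp: elems_Cons)
    have "rev \<pi>s \<in> elems C (prd C (?xs as)) (edges A as)" using pi(3) by (metis elems_rev rev_rev_ident)
    from represents_ex[OF A pb as pi(2) this] show ?thesis using pi(1) by auto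
  qed
  define T where "T as = (SOME t. t \<in> el (TW A) (prd C (?xs as)) \<and>
      repr A (prd C (?xs as)) as (hd (prjs C (?xs as))) (rev (tl (prjs C (?xs as)))) t)" for as
  have T: "T as \<in> el (TW A) (prd C (?xs as))"
      "repr A (prd C (?xs as)) as (hd (prjs C (?xs as))) (rev (tl (prjs C (?xs as)))) (T as)" if "as \<in> all_paths A" for as
    using someI_ex[OF ex[OF that]] unfolding T_def by auto
  define \<gamma> where "\<gamma> as = (if as \<in> all_paths A then snd (snd (ap \<theta> (T as))) else undefined)" for as
  have apT: "ap \<theta> (T as) = (hd as, last as, \<gamma> as)" if as: "as \<in> all_paths A" for as
  proof -
    obtain w w' c where t': "T as = (w, w', c)" "w \<in> Verts (TW A)" "w' \<in> Verts (TW A)"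
      using T(1)[OF as] by (auto simp: el_def)
    have "hd as = Vmap (p2 A) w \<and> last as = Vmap (p2 A) w'" using represents_ends[OF h(2)] T(2)[OF as] t'(1) by metis
    then show ?thesis using t' v as by (simp add: ap_def \<gamma>_def)
  qed
  have g: "is_action_family A \<gamma>" unfolding is_action_family_def
  proof (intro conjI allI impI ballI)
    show "\<gamma> as = undefined" if "as \<notin> all_paths A" for as using that by (simp add: \<gamma>_def)
    show "\<gamma> as \<in> hom C (prd C (?xs as)) (Edge A (hd as) (last as))" if as: "as \<in> all_paths A" for as
      using ap_el[OF th T(1)[OF as]] apT[OF as] by (simp add: el_def)
  qed
  have "ap \<theta> t = (hd as, last as, act \<gamma> z as p xs)" if t: "t \<in> el (TW A) z" and q: "repr A z as p xs t" for z t as p xs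
  proof -
    have as: "as \<in> all_paths A" and p: "p \<in> hom C z (OpOb P (plen as))" and xs: "xs \<in> elems C z (edges A as)"
      using q by (auto simp: represents_def)
    have z: "z \<in> Obj C" using el_obj[OF t] .
    note e = act_elems[OF p xs]
    let ?c = "tup C z (p # rev xs)"
    note c = tup_hom[OF z e]
    have pr: "map (\<lambda>\<pi>. \<pi> \<cdot> ?c) (prjs C (?xs as)) = p # rev xs" by (rule prjs_tup[OF z e])
    have "prjs C (?xs as) \<noteq> []" using pr by auto
    then have "hd (prjs C (?xs as)) \<cdot> ?c = p" "map (\<lambda>\<pi>. \<pi> \<cdot> ?c) (tl (prjs C (?xs as))) = rev xs"
      using pr by (cases "prjs C (?xs as)"; simp)+
    then have "repr A z as p xs (rs (T as) ?c)"
      using represents_rs[OF A pb T(1)[OF as] c T(2)[OF as]] by (simp add: rev_map[symmetric])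
    \<comment> \<open>The given element and the restriction of the generic one have the same normal
      form, hence coincide.\<close>
    then have "t = rs (T as) ?c" using represents_inj[OF A pb t rs_el[OF T(1)[OF as] c] q] by blast
    then show ?thesis using ap_rs[OF th T(1)[OF as] c] apT[OF as] by (simp add: rs_def act_def)
  qed
  then have "corresponds A \<gamma> \<theta>" unfolding corresponds_def using A g th v by blast
  then show ?thesis by (rule exI[of _ \<gamma>])
qed

text \<open>Evaluate at the generic pair, whose \<open>tup\<close> is the identity. Off the paths of
  \<open>A\<close> both families are \<open>undefined\<close>.\<close>

lemma corresponds_gamma_unique:
  assumes "corresponds A \<gamma> \<theta>" "corresponds A \<gamma>' \<theta>"
  shows "\<gamma> = \<gamma>'"
proof
  fix as
  have A: "is_vgraph C A" and g: "is_action_family A \<gamma>" "is_action_family A \<gamma>'" using assms by (auto simp: corresponds_def)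
  show "\<gamma> as = \<gamma>' as"
  proof (cases "as \<in> all_paths A")
    case False then show ?thesis using g by (simp add: is_action_family_def)
  next
    case True
    let ?xs = "OpOb P (plen as) # rev (edges A as)"
    let ?z = "prd C ?xs"
    have s: "set ?xs \<subseteq> Obj C" using edges_obj[OF A True] by simp
    then have z: "?z \<in> Obj C" by simp
    obtain \<pi> \<pi>s where pi: "prjs C ?xs = \<pi> # \<pi>s" "\<pi> \<in> hom C ?z (OpOb P (plen as))"
      "\<pi>s \<in> elems C ?z (rev (edges A as))"
      using prjs_elems[OF s] by (auto simp: elems_Cons)
    have ps: "rev \<pi>s \<in> elems C ?z (edges A as)" using pi(3) by (metis elems_rev rev_rev_ident)
    obtain t where "t \<in> el (TW A) ?z" "repr A ?z as \<pi> (rev \<pi>s) t" using represents_ex[OF A TW_pb[OF A] True pi(2) ps] by blast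
    then have e: "act \<gamma> ?z as \<pi> (rev \<pi>s) = act \<gamma>' ?z as \<pi> (rev \<pi>s)" using assms unfolding corresponds_def by (metis Pair_inject)
    have "tup C ?z (\<pi> # \<pi>s) = Ident C ?z"
      using tup_prjs[OF s ident_hom[OF z]] map_comp_ident[OF prjs_elems[OF s]] pi(1) by simp
    moreover have "\<gamma> as \<in> hom C ?z (Edge A (hd as) (last as))" "\<gamma>' as \<in> hom C ?z (Edge A (hd as) (last as))"
      using g True by (auto simp: is_action_family_def)
    ultimately show ?thesis using e ident_right unfolding act_def by (metis rev_rev_ident)
  qed
qed

text \<open>By \<open>repr_eta\<close>, \<open>\<theta> \<odot> TEta TR A\<close> lets the operad
  unit act on \<open>x\<close> through \<open>\<gamma>\<close>. The converse also needs vertices,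
  where \<open>p2 A\<close> undoes \<open>TEta TR A\<close>.\<close>

lemma corresponds_unit:
  assumes ag: "corresponds A \<gamma> \<theta>"
  shows "\<theta> \<odot> TEta TR A = Ident Gph A \<longleftrightarrow>
     (\<forall>a \<in> Verts A. \<forall>b \<in> Verts A. \<forall>z \<in> Obj C. \<forall>x \<in> hom C z (Edge A a b).
        \<gamma> [a, b] \<cdot> tup C z [OpUnit P \<cdot> bang C z, x] = x)"
proof -
  have A: "is_vgraph C A" and th: "\<theta> \<in> hom Gph (TW A) A" and v: "\<And>w. w \<in> Verts (TW A) \<Longrightarrow> Vmap \<theta> w = Vmap (p2 A) w"
    using ag by (auto simp: corresponds_def)
  note E = TR_eta[OF A]
  note tE = Gph.comp_hom[OF E(1) th]
  have key: "ap (\<theta> \<odot> TEta TR A) (a, b, x) = (a, b, \<gamma> [a, b] \<cdot> tup C z [OpUnit P \<cdot> bang C z, x])"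
    if t: "(a, b, x) \<in> el A z" for a b x z
    using ap_comp[OF E(1) th t] ag ap_el[OF E(1) t] repr_eta[OF A t] unfolding corresponds_def by (auto simp: act_def)
  show ?thesis
  proof
    assume eq: "\<theta> \<odot> TEta TR A = Ident Gph A"
    show "\<forall>a \<in> Verts A. \<forall>b \<in> Verts A. \<forall>z \<in> Obj C. \<forall>x \<in> hom C z (Edge A a b).
        \<gamma> [a, b] \<cdot> tup C z [OpUnit P \<cdot> bang C z, x] = x"
    proof (intro ballI)
      fix a b z x assume "a \<in> Verts A" "b \<in> Verts A" "x \<in> hom C z (Edge A a b)"
      then have t: "(a, b, x) \<in> el A z" by (simp add: el_def)
      then show "\<gamma> [a, b] \<cdot> tup C z [OpUnit P \<cdot> bang C z, x] = x" using key[OF t] ap_ident[OF t] eq by simp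
    qed
  next
    assume R: "\<forall>a \<in> Verts A. \<forall>b \<in> Verts A. \<forall>z \<in> Obj C. \<forall>x \<in> hom C z (Edge A a b).
        \<gamma> [a, b] \<cdot> tup C z [OpUnit P \<cdot> bang C z, x] = x"
    show "\<theta> \<odot> TEta TR A = Ident Gph A"
    proof (rule vhom_el_eqI[OF tE])
      show "Ident Gph A \<in> hom Gph A A" using A by (simp add: Gph.ident_hom)
      show "Vmap (\<theta> \<odot> TEta TR A) a = Vmap (Ident Gph A) a" if a: "a \<in> Verts A" for a
      proof -
        have "Vmap (p2 A) (Vmap (TEta TR A) a) = Vmap (fc_eta C A) a" using Vmap_comp[OF E(1) a, of "p2 A"] E(3) by simp
        then show ?thesis using v[OF vhomD(5)[OF E(1) a]] Vmap_comp[OF E(1) a, of \<theta>] Vmap_fc_eta[OF A a] Ident_vg(1)[OF a, of C] by simp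
      qed
      fix Z t assume t: "t \<in> el A Z"
      obtain a b x where t': "t = (a, b, x)" by (cases t)
      have Z: "Z \<in> Obj C" using el_obj[OF t] .
      have "ap (\<theta> \<odot> TEta TR A) t = t" using key[of a b x Z] R t t' Z by (auto simp: el_def)
      moreover have "rs t (Ident C Z) = t" using t by (auto simp: rs_def el_def ident_right)
      ultimately show "covers Z (\<lambda>c. ap (\<theta> \<odot> TEta TR A) (rs t c) = ap (Ident Gph A) (rs t c))"
        using ap_ident[OF t] by (intro covers_triv[OF Z]) simp
    qed
  qed
qed

text \<open>\<open>repr_ar\<close> and \<open>repr_mu\<close> supply the normal forms to which
  \<open>\<theta>\<close> is applied; \<open>as\<close> is the path of cut points.\<close>

lemma corresponds_assoc_el:
  assumes ag: "corresponds A \<gamma> \<theta>" and t: "t \<in> el (TW (TW A)) z" and q: "represents2 A z ws p cs bss qs xss t"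
  defines "as \<equiv> map (Vmap (p2 A)) ws"
  shows "ap (\<theta> \<odot> TAr TR \<theta>) t = (hd as, last as, \<gamma> as \<cdot>
            tup C z (p # rev (map (\<lambda>i. \<gamma> (bss ! i) \<cdot> tup C z (qs ! i # rev (xss ! i))) [0..<length bss])))"
    "ap (\<theta> \<odot> TMu TR A) t = (hd as, last as, \<gamma> (join as bss) \<cdot>
            tup C z ((OpComp P (map plen bss) \<cdot> tup C z (p # qs)) # rev (concat xss)))"
proof -
  have A: "is_vgraph C A" and th: "\<theta> \<in> hom Gph (TW A) A" and v: "\<And>w. w \<in> Verts (TW A) \<Longrightarrow> Vmap \<theta> w = Vmap (p2 A) w"
    and el: "\<And>z t as p xs. t \<in> el (TW A) z \<Longrightarrow> repr A z as p xs t \<Longrightarrow> ap \<theta> t = (hd as, last as, act \<gamma> z as p xs)"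
    using ag by (auto simp: corresponds_def)
  note F = TR_ar[OF th] and M = TR_mu[OF A]
  have ws: "ws \<in> all_paths (TW A)" and cs: "cs \<in> elems C z (edges (TW A) ws)" and Qt: "repr (TW A) z ws p cs t" using q by (auto simp: represents2_def represents_def)
  have l: "length bss = plen ws" "length cs = plen ws" using q cs by (auto simp: represents2_def elems_nth)
  have m: "map (Vmap \<theta>) ws = as" using ws v by (auto simp: as_def all_paths_iff)
  have ms: "map_string C \<theta> ws cs = map (\<lambda>i. act \<gamma> z (bss ! i) (qs ! i) (xss ! i)) [0..<length bss]"
  proof (rule nth_equalityI)
    fix i assume "i < length (map_string C \<theta> ws cs)"
    then have i: "i < plen ws" by simp
    have "repr A z (bss ! i) (qs ! i) (xss ! i) (ws ! i, ws ! Suc i, cs ! i)" using q i by (simp add: represents2_def)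
    from el[OF nth_el[OF ws cs i] this]
    show "map_string C \<theta> ws cs ! i = map (\<lambda>i. act \<gamma> z (bss ! i) (qs ! i) (xss ! i)) [0..<length bss] ! i"
      using i l unfolding ap_nth[OF i l(2)] by simp
  qed (use l in simp)
  show "ap (\<theta> \<odot> TAr TR \<theta>) t = (hd as, last as, \<gamma> as \<cdot>
            tup C z (p # rev (map (\<lambda>i. \<gamma> (bss ! i) \<cdot> tup C z (qs ! i # rev (xss ! i))) [0..<length bss])))"
    using ap_comp[OF F(1) th t] el[OF ap_el[OF F(1) t] repr_ar[OF th t Qt]] unfolding m ms act_def by simp
  have as: "as \<in> all_paths A" using map_all_paths[OF TW_hom(2)[OF A A] ws] by (simp add: as_def)
  have "join as bss \<in> paths A (hd as) (last as)"
    using join_paths[OF all_paths_paths[OF as]] represents2_blocks(2)[OF A q] by (simp add: as_def)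
  then have "hd (join as bss) = hd as" "last (join as bss) = last as" by (auto simp: paths_iff)
  then show "ap (\<theta> \<odot> TMu TR A) t = (hd as, last as, \<gamma> (join as bss) \<cdot>
            tup C z ((OpComp P (map plen bss) \<cdot> tup C z (p # qs)) # rev (concat xss)))"
    using ap_comp[OF M(1) th t] el[OF ap_el[OF M(1) t] repr_mu[OF A t q]] by (simp add: as_def act_def opc_def)
qed

text \<open>Turns the data of the associativity axiom into an element of the iterated monad. The cut
  points must first be lifted to vertices of \<open>TW A\<close>.\<close>

lemma represents2_ex:
  assumes A: "is_vgraph C A" and as: "as \<in> all_paths A" and ps: "ps \<in> blocks A as" and p: "p \<in> hom C z (OpOb P (length ps))"
    and qs: "qs \<in> elems C z (map (\<lambda>bs. OpOb P (plen bs)) ps)" and xss: "okss A z ps xss"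
  shows "\<exists>t ws cs. t \<in> el (TW (TW A)) z \<and> represents2 A z ws p cs ps qs xss t \<and> map (Vmap (p2 A)) ws = as"
proof -
  note W = TW_graph[OF A A] and h = TW_hom[OF A A] and pb = TW_pb[OF A]
  \<comment> \<open>The projection \<open>p2 A\<close> is bijective on vertices, so the choice is
    forced.\<close>
  define lift where "lift a = (SOME w. w \<in> Verts (TW A) \<and> Vmap (p2 A) w = a)" for a
  have lift: "lift a \<in> Verts (TW A)" "Vmap (p2 A) (lift a) = a" if "a \<in> Verts A" for a
    using someI_ex[of "\<lambda>w. w \<in> Verts (TW A) \<and> Vmap (p2 A) w = a"] W_vertex[OF A pb that] unfolding lift_def by blast+
  let ?ws = "map lift as"
  have ws: "?ws \<in> all_paths (TW A)" and m: "map (Vmap (p2 A)) ?ws = as"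
    using as lift by (auto simp: all_paths_iff intro!: map_idI)
  have l: "length ps = plen as" "length qs = plen as" "length xss = plen as"
    using ps qs xss by (auto simp: blocks_iff elems_nth list_all2_conv_all_nth)
  have ex: "\<exists>c. c \<in> hom C z (Edge (TW A) (?ws ! i) (?ws ! Suc i)) \<and> repr A z (ps ! i) (qs ! i) (xss ! i) (?ws ! i, ?ws ! Suc i, c)"
    if i: "i < plen as" for i
  proof -
    have pi: "ps ! i \<in> paths A (as ! i) (as ! Suc i)" using ps i by (simp add: blocks_iff)
    obtain w w' c where t: "(w, w', c) \<in> el (TW A) z" "repr A z (ps ! i) (qs ! i) (xss ! i) (w, w', c)"
      using represents_ex[OF A pb paths_all_paths[OF pi], of "qs ! i" z "xss ! i"] qs xss i l
      by (auto simp: elems_nth list_all2_conv_all_nth)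
    have wv: "w \<in> Verts (TW A)" "w' \<in> Verts (TW A)" "c \<in> hom C z (Edge (TW A) w w')" using t(1) by (auto simp: el_def)
    have i': "i < length as" "Suc i < length as" using i by (auto simp: plen_def)
    have "Vmap (p2 A) w = as ! i" "Vmap (p2 A) w' = as ! Suc i"
      using represents_ends[OF h(2) t(2)] pi by (auto simp: paths_iff)
    \<comment> \<open>The element was found between some vertices over the endpoints; injectivity of
      \<open>p2 A\<close> on vertices identifies them with the lifted ones.\<close>
    then have "w = ?ws ! i" "w' = ?ws ! Suc i"
      using W_vertex_eq[OF A pb wv(1), of "?ws ! i"] W_vertex_eq[OF A pb wv(2), of "?ws ! Suc i"]
        lift path_nth[OF as i] i' by auto
    then show ?thesis using wv t(2) by auto
  qed
  then obtain cs where cs: "length cs = plen as" "\<And>i. i < plen as \<Longrightarrow> cs ! i \<in> hom C z (Edge (TW A) (?ws ! i) (?ws ! Suc i)) \<and>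
       repr A z (ps ! i) (qs ! i) (xss ! i) (?ws ! i, ?ws ! Suc i, cs ! i)"
    using Skolem_list_nth[of "plen as" "\<lambda>i c. c \<in> hom C z (Edge (TW A) (?ws ! i) (?ws ! Suc i)) \<and>
       repr A z (ps ! i) (qs ! i) (xss ! i) (?ws ! i, ?ws ! Suc i, c)"] by blast
  have ce: "cs \<in> elems C z (edges (TW A) ?ws)" using cs by (simp add: elems_nth edges_nth)
  have "p \<in> hom C z (OpOb P (plen ?ws))" using p l by simp
  from represents_ex[OF W TW_pb[OF W] ws this ce]
  obtain t where t: "t \<in> el (TW (TW A)) z" "repr (TW A) z ?ws p cs t" by blast
  have "represents2 A z ?ws p cs ps qs xss t" unfolding represents2_def using t(2) l cs(2) by simp
  then show ?thesis using t(1) m by blast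
qed

text \<open>Every instance of the axiom is an element of the iterated monad by
  \<open>represents2_ex\<close>, and elements of this form cover it by
  \<open>covers_represents2\<close>; each direction rests on one of these facts.\<close>

lemma corresponds_assoc:
  assumes ag: "corresponds A \<gamma> \<theta>"
  shows "\<theta> \<odot> TAr TR \<theta> = \<theta> \<odot> TMu TR A \<longleftrightarrow>
     (\<forall>as \<in> all_paths A. \<forall>ps \<in> blocks A as. \<forall>z \<in> Obj C.
        \<forall>p \<in> hom C z (OpOb P (length ps)).
        \<forall>qs \<in> elems C z (map (\<lambda>bs. OpOb P (plen bs)) ps).
        \<forall>xss. okss A z ps xss \<longrightarrow>
          \<gamma> as \<cdot> tup C z (p # rev (map (\<lambda>i. \<gamma> (ps ! i) \<cdot> tup C z (qs ! i # rev (xss ! i))) [0..<length ps]))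
          = \<gamma> (join as ps) \<cdot> tup C z ((OpComp P (map plen ps) \<cdot> tup C z (p # qs)) # rev (concat xss)))"
    (is "?L \<longleftrightarrow> ?R")
proof -
  have A: "is_vgraph C A" and th: "\<theta> \<in> hom Gph (TW A) A" and v: "\<And>w. w \<in> Verts (TW A) \<Longrightarrow> Vmap \<theta> w = Vmap (p2 A) w"
    using ag by (auto simp: corresponds_def)
  note W = TW_graph[OF A A] and h = TW_hom[OF A A] and F = TR_ar[OF th] and M = TR_mu[OF A]
  note H = TW_hom[OF W W]
  show ?thesis
  proof
    assume L: ?L
    show ?R
    proof (intro ballI allI impI)
      fix as ps z p qs xss
      assume a: "as \<in> all_paths A" "ps \<in> blocks A as" "p \<in> hom C z (OpOb P (length ps))"
        "qs \<in> elems C z (map (\<lambda>bs. OpOb P (plen bs)) ps)" "okss A z ps xss"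
      obtain t ws cs where t: "t \<in> el (TW (TW A)) z" "represents2 A z ws p cs ps qs xss t" "map (Vmap (p2 A)) ws = as"
        using represents2_ex[OF A a] by blast
      show "\<gamma> as \<cdot> tup C z (p # rev (map (\<lambda>i. \<gamma> (ps ! i) \<cdot> tup C z (qs ! i # rev (xss ! i))) [0..<length ps]))
          = \<gamma> (join as ps) \<cdot> tup C z ((OpComp P (map plen ps) \<cdot> tup C z (p # qs)) # rev (concat xss))"
        using corresponds_assoc_el[OF ag t(1,2)] L unfolding t(3) by simp
    qed
  next
    assume R: ?R
    show ?L
    proof (rule vhom_el_eqI[OF Gph.comp_hom[OF F(1) th] Gph.comp_hom[OF M(1) th]])
      \<comment> \<open>On vertices \<open>\<theta>\<close> is \<open>p2 A\<close>, and both
        composites become the iterated projection to \<open>A\<close>.\<close>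
      fix w assume w: "w \<in> Verts (TW (TW A))"
      note Hw = vhomD(5)[OF H(2) w, simplified]
      have "Vmap (\<theta> \<odot> TAr TR \<theta>) w = Vmap (p2 A) (Vmap (TAr TR \<theta>) w)"
        using Vmap_comp[OF F(1) w] v[OF vhomD(5)[OF F(1) w]] by simp
      also have "\<dots> = Vmap (fc_ar C \<theta> \<odot> p2 (TW A)) w" using Vmap_comp[OF F(1) w, of "p2 A"] F(3) by simp
      also have "\<dots> = Vmap (p2 A) (Vmap (p2 (TW A)) w)"
        using Vmap_comp[OF H(2) w] Vmap_fc_ar[OF th Hw] v[OF Hw] by simp
      also have "\<dots> = Vmap (fc_mu C A \<odot> (fc_ar C (p2 A) \<odot> p2 (TW A))) w"
        using Vmap_comp[OF Gph.comp_hom[OF H(2) fc_ar_hom[OF h(2)]] w] Vmap_comp[OF H(2) w] Vmap_fc_ar[OF h(2) Hw]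
          Vmap_fc_mu[OF A] vhomD(5)[OF h(2) Hw] by simp
      also have "\<dots> = Vmap (p2 A) (Vmap (TMu TR A) w)" using Vmap_comp[OF M(1) w, of "p2 A"] M(3) by simp
      also have "\<dots> = Vmap (\<theta> \<odot> TMu TR A) w" using Vmap_comp[OF M(1) w] v[OF vhomD(5)[OF M(1) w]] by simp
      finally show "Vmap (\<theta> \<odot> TAr TR \<theta>) w = Vmap (\<theta> \<odot> TMu TR A) w" .
    next
      fix Z t assume t: "t \<in> el (TW (TW A)) Z"
      show "covers Z (\<lambda>c. ap (\<theta> \<odot> TAr TR \<theta>) (rs t c) = ap (\<theta> \<odot> TMu TR A) (rs t c))"
      proof (rule covers_mono[OF covers_represents2[OF A t]])
        fix c assume c: "c \<in> hom C (Dom C c) Z" and "\<exists>ws p cs bss qs xss. represents2 A (Dom C c) ws p cs bss qs xss (rs t c)"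
        then obtain ws p cs bss qs xss where q: "represents2 A (Dom C c) ws p cs bss qs xss (rs t c)" by blast
        note tc = rs_el[OF t c] and b = represents2_blocks[OF A q]
        have "map (Vmap (p2 A)) ws \<in> all_paths A" using map_all_paths[OF h(2), of ws] q by (simp add: represents2_def represents_def)
        moreover have "p \<in> hom C (Dom C c) (OpOb P (length bss))" using q by (simp add: represents2_def represents_def)
        ultimately show "ap (\<theta> \<odot> TAr TR \<theta>) (rs t c) = ap (\<theta> \<odot> TMu TR A) (rs t c)"
          using corresponds_assoc_el[OF ag tc q] R b(2,3,4) el_obj[OF tc] by simp
      qed
    qed
  qed
qed

lemma corresponds_iff:
  assumes ag: "corresponds A \<gamma> \<theta>"
  shows "is_vpcat C P (A, \<gamma>) \<longleftrightarrow> is_algebra Gph TR (A, \<theta>)"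
proof -
  have "is_vgraph C A" "is_action_family A \<gamma>" "\<theta> \<in> hom Gph (TW A) A" using ag by (auto simp: corresponds_def)
  then show ?thesis
    unfolding is_vpcat_def is_algebra_def prod.case corresponds_unit[OF ag] corresponds_assoc[OF ag] TR_ob is_action_family_def
    by (auto simp only: VGph_simps mem_Collect_eq)
qed

lemma vpcat_corresponds: "is_vpcat C P (A, \<gamma>) \<Longrightarrow> \<exists>\<theta>. corresponds A \<gamma> \<theta>"
  by (rule corresponds_ex_theta) (simp_all add: is_vpcat_def is_action_family_def)

text \<open>The unit law gives the vertex condition: on vertices \<open>TEta TR A\<close> is inverse
  to \<open>p2 A\<close>, and \<open>\<theta>\<close> is a left inverse of
  \<open>TEta TR A\<close>.\<close>

lemma algebra_corresponds:
  assumes "is_algebra Gph TR (A, \<theta>)"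
  shows "\<exists>\<gamma>. corresponds A \<gamma> \<theta>"
proof -
  have A: "is_vgraph C A" and th: "\<theta> \<in> hom Gph (TW A) A" and u: "\<theta> \<odot> TEta TR A = Ident Gph A"
    using assms by (simp_all add: is_algebra_def)
  note E = TR_eta[OF A] and pb = TW_pb[OF A] and h = TW_hom[OF A A]
  show ?thesis
  proof (rule corresponds_ex_gamma[OF A th], rule ballI)
    fix w assume w: "w \<in> Verts (TW A)"
    let ?a = "Vmap (p2 A) w"
    have a: "?a \<in> Verts A" using vhomD(5)[OF h(2) w] by simp
    have "Vmap (p2 A) (Vmap (TEta TR A) ?a) = ?a" using Vmap_comp[OF E(1) a, of "p2 A"] E(3) Vmap_fc_eta[OF A a] by simp
    then have "Vmap (TEta TR A) ?a = w" using W_vertex_eq[OF A pb vhomD(5)[OF E(1) a] w] by simp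
    then show "Vmap \<theta> w = ?a" using Vmap_comp[OF E(1) a, of \<theta>] u Ident_vg(1)[OF a, of C] by simp
  qed
qed

text \<open>Both conditions compare values on normal forms: every pair of operation and string is an
  element of \<open>TW A\<close>, and such elements cover.\<close>

lemma corresponds_mor_iff:
  assumes a: "corresponds A \<gamma> \<theta>" and b: "corresponds B \<delta> \<xi>"
  shows "is_vpcat_mor C P (A, \<gamma>) (B, \<delta>) f \<longleftrightarrow> is_algebra_mor Gph TR (A, \<theta>) (B, \<xi>) f"
proof (cases "f \<in> hom Gph A B")
  case False
  then show ?thesis by (simp add: is_vpcat_mor_def is_algebra_mor_def)
next
  case f: True
  have A: "is_vgraph C A" and th: "\<theta> \<in> hom Gph (TW A) A" and v: "\<And>w. w \<in> Verts (TW A) \<Longrightarrow> Vmap \<theta> w = Vmap (p2 A) w"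
    and el: "\<And>z t as p xs. t \<in> el (TW A) z \<Longrightarrow> repr A z as p xs t \<Longrightarrow> ap \<theta> t = (hd as, last as, act \<gamma> z as p xs)"
    using a by (auto simp: corresponds_def)
  have B: "is_vgraph C B" and xi: "\<xi> \<in> hom Gph (TW B) B" and v': "\<And>w. w \<in> Verts (TW B) \<Longrightarrow> Vmap \<xi> w = Vmap (p2 B) w"
    and el': "\<And>z t as p xs. t \<in> el (TW B) z \<Longrightarrow> repr B z as p xs t \<Longrightarrow> ap \<xi> t = (hd as, last as, act \<delta> z as p xs)"
    using b by (auto simp: corresponds_def)
  note F = TR_ar[OF f] and h = TW_hom[OF A A]
  have L: "ap (f \<odot> \<theta>) t = (Vmap f (hd as), Vmap f (last as), Emap f (hd as) (last as) \<cdot> act \<gamma> z as p xs)"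
    if t: "t \<in> el (TW A) z" and q: "repr A z as p xs t" for t z as p xs
    using ap_comp[OF th f t] el[OF t q] by (simp add: ap_def)
  have R: "ap (\<xi> \<odot> TAr TR f) t = (Vmap f (hd as), Vmap f (last as), act \<delta> z (map (Vmap f) as) p (map_string C f as xs))"
    if t: "t \<in> el (TW A) z" and q: "repr A z as p xs t" for t z as p xs
  proof -
    have "as \<noteq> []" using q by (auto simp: represents_def all_paths_iff)
    then show ?thesis using ap_comp[OF F(1) xi t] el'[OF ap_el[OF F(1) t] repr_ar[OF f t q]] by (simp add: hd_map last_map)
  qed
  have "(f \<odot> \<theta> = \<xi> \<odot> TAr TR f) \<longleftrightarrow> (\<forall>as \<in> all_paths A. \<forall>z \<in> Obj C. \<forall>p \<in> hom C z (OpOb P (plen as)).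
        \<forall>xs \<in> elems C z (edges A as). Emap f (hd as) (last as) \<cdot> act \<gamma> z as p xs = act \<delta> z (map (Vmap f) as) p (map_string C f as xs))"
    (is "?l \<longleftrightarrow> ?r")
  proof
    assume ?l
    show ?r
    proof (intro ballI)
      fix as z p xs assume "as \<in> all_paths A" "p \<in> hom C z (OpOb P (plen as))" "xs \<in> elems C z (edges A as)"
      from represents_ex[OF A TW_pb[OF A] this] obtain t where "t \<in> el (TW A) z" "repr A z as p xs t" by blast
      from L[OF this] R[OF this] \<open>?l\<close>
      show "Emap f (hd as) (last as) \<cdot> act \<gamma> z as p xs = act \<delta> z (map (Vmap f) as) p (map_string C f as xs)" by simp
    qed
  next
    assume r: ?r
    show ?l
    proof (rule vhom_el_eqI[OF Gph.comp_hom[OF th f] Gph.comp_hom[OF F(1) xi]])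
      fix w assume w: "w \<in> Verts (TW A)"
      have "Vmap (\<xi> \<odot> TAr TR f) w = Vmap (fc_ar C f \<odot> p2 A) w"
        using Vmap_comp[OF F(1) w, of \<xi>] v'[OF vhomD(5)[OF F(1) w]] Vmap_comp[OF F(1) w, of "p2 B"] F(3) by simp
      also have "\<dots> = Vmap (f \<odot> \<theta>) w"
        using Vmap_comp[OF h(2) w] Vmap_fc_ar[OF f] vhomD(5)[OF h(2) w] Vmap_comp[OF th w] v[OF w] by simp
      finally show "Vmap (f \<odot> \<theta>) w = Vmap (\<xi> \<odot> TAr TR f) w" by simp
    next
      fix Z t assume t: "t \<in> el (TW A) Z"
      show "covers Z (\<lambda>c. ap (f \<odot> \<theta>) (rs t c) = ap (\<xi> \<odot> TAr TR f) (rs t c))"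
      proof (rule covers_mono[OF covers_represents[OF A TW_pb[OF A] t]])
        fix c assume c: "c \<in> hom C (Dom C c) Z" and "\<exists>as p xs. repr A (Dom C c) as p xs (rs t c)"
        then obtain as p xs where q: "repr A (Dom C c) as p xs (rs t c)" by blast
        note tc = rs_el[OF t c]
        show "ap (f \<odot> \<theta>) (rs t c) = ap (\<xi> \<odot> TAr TR f) (rs t c)"
          unfolding L[OF tc q] R[OF tc q] using r q el_obj[OF tc] by (simp add: represents_def)
      qed
    qed
  qed
  then show ?thesis using f by (simp add: is_vpcat_mor_def is_algebra_mor_def act_def)
qed

text \<open>The premises in \<open>action_agrees\<close> say that \<open>(x, y, c)\<close> has the
  normal form given by \<open>as\<close>, \<open>p\<close> and \<open>xs\<close>.\<close>

lemma corresponds_action_agrees: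
  assumes ag: "corresponds A \<gamma> \<theta>"
  shows "action_agrees C P A \<gamma> \<theta>"
proof -
  have A: "is_vgraph C A" and th: "\<theta> \<in> hom Gph (TW A) A"
    and el: "\<And>z t as p xs. t \<in> el (TW A) z \<Longrightarrow> repr A z as p xs t \<Longrightarrow> ap \<theta> t = (hd as, last as, act \<gamma> z as p xs)"
    using ag by (auto simp: corresponds_def)
  note h = TW_hom[OF A A]
  have Rd: "Rmap (susp ty C P) = d" by (simp add: susp_def)
  show ?thesis unfolding action_agrees_def Let_def Rd Tbang_eq
  proof (intro ballI impI)
    fix x y as z p xs c
    assume xy: "x \<in> Verts (TW A)" "y \<in> Verts (TW A)" and as: "as \<in> paths A (Vmap (p2 A) x) (Vmap (p2 A) y)"
      and p: "p \<in> hom C z (OpOb P (plen as))" and xs: "xs \<in> elems C z (edges A as)" and c: "c \<in> hom C z (Edge (TW A) x y)"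
      and e1: "Emap (p1 A) x y \<cdot> c = susp_inc C P (plen as) \<cdot> p"
      and e2: "Emap (p2 A) x y \<cdot> c = path_inc C A as \<cdot> tup C z (rev xs)"
    have t: "(x, y, c) \<in> el (TW A) z" using xy c by (simp add: el_def)
    have "Vmap (p1 A) x = pt" "Vmap (p1 A) y = pt" using vhomD(5)[OF h(1)] xy by auto
    then have "repr A z as p xs (x, y, c)"
      unfolding represents_def using paths_all_paths[OF as] p xs e1 e2 as by (auto simp: ap_def SE_def FE_def fcel_def paths_iff)
    from el[OF t this] show "Emap \<theta> x y \<cdot> c = \<gamma> as \<cdot> tup C z (p # rev xs)" by (simp add: ap_def act_def)
  qed
qed

section \<open>The equivalence of categories\<close>

lemma algebra_mor_comp:
  assumes X: "is_algebra Gph TR X" and Y: "is_algebra Gph TR Y" and Z: "is_algebra Gph TR Z"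
    and f: "is_algebra_mor Gph TR X Y f" and g: "is_algebra_mor Gph TR Y Z g"
  shows "is_algebra_mor Gph TR X Z (g \<odot> f)"
proof -
  obtain A \<theta> B \<xi> D \<zeta> where e: "X = (A, \<theta>)" "Y = (B, \<xi>)" "Z = (D, \<zeta>)" by (metis surj_pair)
  have th: "\<theta> \<in> hom Gph (TW A) A" "\<xi> \<in> hom Gph (TW B) B" "\<zeta> \<in> hom Gph (TW D) D"
    using X Y Z e by (auto simp: is_algebra_def)
  have fg: "f \<in> hom Gph A B" "g \<in> hom Gph B D" "f \<odot> \<theta> = \<xi> \<odot> TAr TR f" "g \<odot> \<xi> = \<zeta> \<odot> TAr TR g"
    using f g e by (auto simp: is_algebra_mor_def)
  note F = TR_ar(1)[OF fg(1)] and G = TR_ar(1)[OF fg(2)]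
  have "(g \<odot> f) \<odot> \<theta> = g \<odot> (\<xi> \<odot> TAr TR f)"
    using Gph.comp_assoc[OF th(1) fg(1,2)] fg(3) by simp
  also have "\<dots> = (\<zeta> \<odot> TAr TR g) \<odot> TAr TR f" using Gph.comp_assoc[OF F th(2) fg(2)] fg(4) by simp
  also have "\<dots> = \<zeta> \<odot> TAr TR (g \<odot> f)" using Gph.comp_assoc[OF F G th(3)] TR_ar_comp[OF fg(1,2)] by simp
  finally show ?thesis using Gph.comp_hom[OF fg(1,2)] e by (simp add: is_algebra_mor_def)
qed

lemma algebra_mor_ident:
  assumes X: "is_algebra Gph TR X"
  shows "is_algebra_mor Gph TR X X (Ident Gph (fst X))"
proof -
  obtain A \<theta> where e: "X = (A, \<theta>)" by (metis surj_pair)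
  have A: "is_vgraph C A" and th: "\<theta> \<in> hom Gph (TW A) A" using X e by (auto simp: is_algebra_def)
  have "Ident Gph A \<in> hom Gph A A" using A by (simp add: Gph.ident_hom)
  moreover have "Ident Gph A \<odot> \<theta> = \<theta> \<odot> TAr TR (Ident Gph A)"
    unfolding TR_ar_ident[OF A] Gph.ident_left[OF th] Gph.ident_right[OF th] ..
  ultimately show ?thesis using e by (simp add: is_algebra_mor_def)
qed

lemma vpcat_equivalence:
  "\<exists>F. is_equivalence (VPCat C P) (OperadAlg Gph (fc C) (susp ty C P)) F \<and>
         (\<forall>A \<gamma>. (A, \<gamma>) \<in> Obj (VPCat C P :: (('u, 'o, 'm) vpcat, _) cat) \<longrightarrow>
            (\<exists>\<theta>. FOb F (A, \<gamma>) = (A, \<theta>) \<and> action_agrees C P A \<gamma> \<theta>)) \<and>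
         (\<forall>X Y f. (X, Y, f) \<in> Arr (VPCat C P :: (('u, 'o, 'm) vpcat, _) cat) \<longrightarrow> FAr F (X, Y, f) = (FOb F X, FOb F Y, f))"
proof -
  let ?Q = "{X :: ('u, 'o, 'm) vpcat. is_vpcat C P X}" and ?Q' = "{X. is_algebra Gph TR X}"
  have V: "(VPCat C P :: (('u, 'o, 'm) vpcat, _) cat) = concrete_cat Gph ?Q (is_vpcat_mor C P)"
    by (simp add: VPCat_def concrete_cat_def)
  have A: "OperadAlg Gph (fc C) (susp ty C P) = concrete_cat Gph ?Q' (is_algebra_mor Gph TR)"
    by (simp add: OperadAlg_def Alg_def concrete_cat_def)
  \<comment> \<open>The partner on either side is unique by \<open>corresponds_theta_unique\<close>
    and \<open>corresponds_gamma_unique\<close>; this makes the two choices mutually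
    inverse.\<close>
  define \<Phi> where "\<Phi> X = (fst X, SOME \<theta>. corresponds (fst X) (snd X) \<theta>)" for X
  define \<Psi> where "\<Psi> Y = (fst Y, SOME \<gamma>. corresponds (fst Y) \<gamma> (snd Y))" for Y
  have P: "corresponds (fst X) (snd X) (snd (\<Phi> X))" if "X \<in> ?Q" for X
    using someI_ex[OF vpcat_corresponds[of "fst X" "snd X"]] that by (simp add: \<Phi>_def)
  have S: "corresponds (fst Y) (snd (\<Psi> Y)) (snd Y)" if "Y \<in> ?Q'" for Y
    using someI_ex[OF algebra_corresponds[of "fst Y" "snd Y"]] that by (simp add: \<Psi>_def)
  have fP: "fst (\<Phi> X) = fst X" "fst (\<Psi> Y) = fst Y" for X Y by (simp_all add: \<Phi>_def \<Psi>_def)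
  have Q1: "\<Phi> X \<in> ?Q' \<and> \<Psi> (\<Phi> X) = X" if X: "X \<in> ?Q" for X
  proof -
    have 1: "\<Phi> X \<in> ?Q'" using corresponds_iff[OF P[OF X]] X fP(1)[of X] by (metis mem_Collect_eq prod.collapse)
    have "snd (\<Psi> (\<Phi> X)) = snd X" using corresponds_gamma_unique[OF S[OF 1, unfolded fP(1)] P[OF X]] .
    then show ?thesis using 1 fP by (metis prod.expand)
  qed
  have Q2: "\<Psi> Y \<in> ?Q \<and> \<Phi> (\<Psi> Y) = Y" if Y: "Y \<in> ?Q'" for Y
  proof -
    have 1: "\<Psi> Y \<in> ?Q" using corresponds_iff[OF S[OF Y]] Y fP(2)[of Y] by (metis mem_Collect_eq prod.collapse)
    have "snd (\<Phi> (\<Psi> Y)) = snd Y" using corresponds_theta_unique[OF P[OF 1, unfolded fP(2)] S[OF Y]] .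
    then show ?thesis using 1 fP by (metis prod.expand)
  qed
  have MM: "is_vpcat_mor C P X Y f \<longleftrightarrow> is_algebra_mor Gph TR (\<Phi> X) (\<Phi> Y) f" if "X \<in> ?Q" "Y \<in> ?Q" for X Y f
    using corresponds_mor_iff[OF P[OF that(1)] P[OF that(2)], of f] fP(1)[of X] fP(1)[of Y] by (metis prod.collapse)
  let ?F = "\<lparr>FOb = \<Phi>, FAr = \<lambda>(X, Y, f). (\<Phi> X, \<Phi> Y, f)\<rparr>"
  have "is_equivalence (concrete_cat Gph ?Q (is_vpcat_mor C P)) (concrete_cat Gph ?Q' (is_algebra_mor Gph TR)) ?F"
  proof (rule concrete_cat_equivalence[where \<Psi> = \<Psi>])
    show "category Gph" by (rule VGph_category)
  qed (use Q1 Q2 MM fP algebra_mor_comp algebra_mor_ident in \<open>auto simp: is_algebra_mor_def is_vpcat_mor_def\<close>)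
  moreover have "\<exists>\<theta>. FOb ?F (A, \<gamma>) = (A, \<theta>) \<and> action_agrees C P A \<gamma> \<theta>" if "(A, \<gamma>) \<in> ?Q" for A \<gamma>
    using corresponds_action_agrees[OF P[OF that]] by (simp add: \<Phi>_def)
  ultimately show ?thesis unfolding V A by (intro exI[of _ ?F]) auto
qed

end

theorem proposition2p11:
  fixes V :: "('o, 'm) cat" and P :: "('o, 'm) ns_operad"
  assumes "infinite (UNIV :: 'u set)"
    and "category V"
    and "has_pullbacks V"
    and "has_terminal V"
    and "has_small_coproducts TYPE('u) V"
    and "small_coproducts_commute_with_pullbacks TYPE('u) V"
    and "is_ns_operad V P"
  shows "is_gen_operad (VGph V) (fc V) (\<Sigma> V P :: ('u, 'o, 'm) vgmor gen_operad) \<and>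
    (\<exists>F. is_equivalence (VPCat V P)
           (OperadAlg (VGph V) (fc V) (\<Sigma> V P :: ('u, 'o, 'm) vgmor gen_operad)) F \<and>
         (\<forall>A \<gamma>. (A, \<gamma>) \<in> Obj (VPCat V P) \<longrightarrow>
            (\<exists>\<theta>. FOb F (A, \<gamma>) = (A, \<theta>) \<and> action_agrees V P A \<gamma> \<theta>)) \<and>
         (\<forall>X Y f. (X, Y, f) \<in> Arr (VPCat V P) \<longrightarrow> FAr F (X, Y, f) = (FOb F X, FOb F Y, f)))"
proof -
  interpret operad_cat V "TYPE('u)" P
    using assms by (intro operad_cat.intro ext_cat.intro cart_cat.intro cart_cat_axioms.intro ext_cat_axioms.intro operad_cat_axioms.intro)
  show ?thesis using susp_gen_operad vpcat_equivalence by blast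
qed

end
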